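(* Let $(E,\phi)$ be an Anderson $A$-module over $L$, $\mathfrak{p}\subset A$ a maximal ideal with uniformizer $u_{\mathfrak{p}}\in A$, and $\mathfrak{P}$ a maximal ideal of $\overline{\mathbb{F}}\otimes A$ above $\mathfrak{p}$ with evaluative character $\chi_{\mathfrak{P}}$. Then for every $x\in\mathfrak{d}_{A/\mathbb{F}[u_{\mathfrak{p}}]}\cdot\Lambda_E$, \[(\chi_{\mathfrak{P}}\hat\otimes\mathrm{id})\big(\delta_{u_{\mathfrak{p}}}(x)\big)=g_{u_{\mathfrak{p}}}(x),\] i.e. $(\chi_{\mathfrak{P}}\hat\otimes\mathrm{id})\circ\delta_{u_{\mathfrak{p}}}=g_{u_{\mathfrak{p}}}$ as maps of $A$-modules $\mathfrak{d}_{A/\mathbb{F}[u_{\mathfrak{p}}]}\cdot\Lambda_E\to G(E,\chi_{\mathfrak{P}})$.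
   Context: Setting: $\mathbb{F}$ finite field with $q$ elements, $C$ smooth projective geometrically irreducible curve over $\mathbb{F}$, $\infty$ a closed point, $A=H^0(C\setminus\{\infty\},\mathcal{O}_C)$, $K=\operatorname{Frac}A$, $\mathbb{C}_\infty$ completion of an algebraic closure of $K$ above $\infty$, $K\subseteq L\subseteq\mathbb{C}_\infty$ with inclusion $\ell$; tensors over $\mathbb{F}$. Anderson $A$-module $(E,\phi)$ over $L$: $\mathbb{F}$-vector space scheme $E\cong\mathbb{G}_{a,L}^d$ with $\mathbb{F}$-algebra map $\phi:A\to\operatorname{End}_{\mathbb{F},L}(E)$, $\partial\phi_a-\ell(a)$ nilpotent on $\operatorname{Lie}_E(L)$; $\partial a:=\partial\phi_a$, extended to $\partial r=(\partial b)^{-1}\partial a$ for $r=a/b\in K^\times$. $\exp_E$: unique $\mathbb{F}$-linear map $\operatorname{Lie}_E(\mathbb{C}_\infty)\to E(\mathbb{C}_\infty)$ with $\exp_E\circ\partial a=\phi_a\circ\exp_E$, given in coordinates by a series $x+e_1\tau(x)+\cdots$; $\Lambda_E=\ker\exp_E$ ($A$-module via $\partial$). Completions: $B\hat\otimes V$ is the completion of $B\otimes V$ for $\|x\|=\inf\max|v_i|$ over representations $\sum b_i\otimes v_i$. $E(\mathbb{T})=A\hat\otimes E(\mathbb{C}_\infty)$, $\operatorname{Lie}_E(\mathbb{T})=A\hat\otimes\operatorname{Lie}_E(\mathbb{C}_\infty)$ (norms via any coordinates), $A\otimes A$-modules with $a\otimes1$ on the $A$-factor and $1\otimes a$ via $\phi_a$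 resp. $\partial a$; $\mathrm{id}\hat\otimes\exp_E$ is the continuous extension. $\mathfrak{sf}(E)=\{\omega\in E(\mathbb{T}):(a\otimes1)\omega=(1\otimes a)\omega\ \forall a\}$. $u_{\mathfrak{p}}$ is separating ($K/\mathbb{F}(u_{\mathfrak{p}})$ finite separable); $\mathfrak{d}_{A/\mathbb{F}[u_{\mathfrak{p}}]}$ is the different of $\mathbb{F}[u_{\mathfrak{p}}]\subset A$ and $\mathfrak{d}\cdot\Lambda_E$ the submodule generated by $\partial a(\lambda)$, $a\in\mathfrak{d}$. $\delta_{u}:\mathfrak{d}_{A/\mathbb{F}[u]}\cdot\Lambda_E\to\mathfrak{sf}(E)$ is the $A$-module isomorphism characterized by $\delta_u(\mu(y))=(\mathrm{id}\hat\otimes\exp_E)((1\otimes\partial u-u\otimes1)^{-1}y)$ for every $y\in A\otimes_{\mathbb{F}[u]}\Lambda_E$ with $(a\otimes1)y=(1\otimes a)y$ for all $a\in A$, where $\mu(a\otimes\lambda)=\partial a(\lambda)$ maps these $y$ bijectively onto $\mathfrak{d}_{A/\mathbb{F}[u]}\cdot\Lambda_E$ (in the tensor product $u$ acts on $\Lambda_E$ via $\partial u$). $\mathbb{F}_{\mathfrak{p}}=A/\mathfrak{p}$, $E[\mathfrak{p}]=\{e\in E(\mathbb{C}_\infty):\phi_a(e)=0\ \forall a\in\mathfrak{p}\}$. $\chi_{\mathfrak{P}}:A\to\mathbb{F}_{\mathfrak{p}}$ sends $a$ to the class of $1\otimes a$ in $(\overline{\mathbb{F}}\otimes A)/\mathfrak{P}$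 (its image identified with $\mathbb{F}_{\mathfrak{p}}$); $\chi_{\mathfrak{P}}\hat\otimes\mathrm{id}:E(\mathbb{T})\to\mathbb{F}_{\mathfrak{p}}\otimes E(\mathbb{C}_\infty)$ is the continuous extension of $a\otimes e\mapsto\chi_{\mathfrak{P}}(a)\otimes e$. For an $A$-module map $\psi:A/\mathfrak{p}\to E[\mathfrak{p}]$, $g(\chi,\psi)=-\sum_{x\in(A/\mathfrak{p})^\times}\chi(x)^{-1}\otimes\psi(x)$; $G(E,\chi)=\{g\in\mathbb{F}_{\mathfrak{p}}\otimes E(\mathbb{C}_\infty):(1\otimes\phi_a)g=(\chi(a)\otimes1)g\ \forall a\}$. Choose $z_{\mathfrak{p}}\in\mathfrak{p}^{-1}$ with $u_{\mathfrak{p}}z_{\mathfrak{p}}\equiv1\bmod\mathfrak{p}$; for $\lambda\in\Lambda_E$ let $\psi_\lambda:A/\mathfrak{p}\to E[\mathfrak{p}]$, $a\mapsto\exp_E(\partial(az_{\mathfrak{p}})\lambda)$ (independent of the choice of $z_{\mathfrak{p}}$), and $g_{u_{\mathfrak{p}}}(\lambda)=g(\chi_{\mathfrak{P}},\psi_\lambda)$. *)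

theory Defs
  imports
    "HOL-Analysis.Analysis"
    "HOL-Algebra.Free_Abelian_Groups"
    "HOL-Algebra.Generated_Groups"
    "HOL-Algebra.Module"
    "HOL-Algebra.QuotRing"
    "HOL-Computational_Algebra.Polynomial"
begin

section \<open>Subrings and subfields of an ambient field\<close>

definition ring_on :: "'c::field set \<Rightarrow> 'c ring" where
  "ring_on S = \<lparr>carrier = S, monoid.mult = (*), one = 1, ring.zero = 0, add = (+)\<rparr>"

definition add_group_on :: "'v::ab_group_add set \<Rightarrow> 'v monoid" where
  "add_group_on S = \<lparr>carrier = S, monoid.mult = (+), one = 0\<rparr>"

definition polys_over :: "'c::field set \<Rightarrow> 'c poly set" where
  "polys_over S = {f. \<forall>i. coeff f i \<in> S}"

definition adjoin_ring :: "'c::field set \<Rightarrow> 'c \<Rightarrow> 'c set" where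
  "adjoin_ring F t = {poly f t | f. f \<in> polys_over F}"

definition adjoin_field :: "'c::field set \<Rightarrow> 'c \<Rightarrow> 'c set" where
  "adjoin_field F t = {x / y | x y. x \<in> adjoin_ring F t \<and> y \<in> adjoin_ring F t \<and> y \<noteq> 0}"

definition algebraic_over :: "'c::field set \<Rightarrow> 'c \<Rightarrow> bool" where
  "algebraic_over F x \<longleftrightarrow> (\<exists>f\<in>polys_over F. f \<noteq> 0 \<and> poly f x = 0)"

definition alg_elements :: "'c::field set \<Rightarrow> 'c set" where
  "alg_elements F = {x. algebraic_over F x}"

definition is_basis :: "'c::field set \<Rightarrow> 'c set \<Rightarrow> 'c set \<Rightarrow> bool" where
  "is_basis F K B \<longleftrightarrow> finite B \<and> B \<subseteq> K \<and>
     (\<forall>x\<in>K. \<exists>c. (\<forall>b\<in>B. c b \<in> F) \<and> x = (\<Sum>b\<in>B. c b * b)) \<and>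
     (\<forall>c. (\<forall>b\<in>B. c b \<in> F) \<and> (\<Sum>b\<in>B. c b * b) = 0 \<longrightarrow> (\<forall>b\<in>B. c b = 0))"

definition finite_extension_of :: "'c::field set \<Rightarrow> 'c set \<Rightarrow> bool" where
  "finite_extension_of F K \<longleftrightarrow>
     field (ring_on F) \<and> field (ring_on K) \<and> F \<subseteq> K \<and> (\<exists>B. is_basis F K B)"

definition is_min_poly :: "'c::field set \<Rightarrow> 'c \<Rightarrow> 'c poly \<Rightarrow> bool" where
  "is_min_poly F x m \<longleftrightarrow> m \<in> polys_over F \<and> lead_coeff m = 1 \<and> poly m x = 0 \<and>
     (\<forall>f\<in>polys_over F. f \<noteq> 0 \<and> poly f x = 0 \<longrightarrow> degree m \<le> degree f)"

text \<open>To be used when the ambient field is algebraically closed, so that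
  \<^const>\<open>rsquarefree\<close> says that all roots of the minimal polynomial are simple.\<close>

definition finite_separable :: "'c::field set \<Rightarrow> 'c set \<Rightarrow> bool" where
  "finite_separable F K \<longleftrightarrow> finite_extension_of F K \<and>
     (\<forall>x\<in>K. \<exists>m. is_min_poly F x m \<and> rsquarefree m)"

text \<open>The trace of the \<open>F\<close>-linear endomorphism \<open>b \<mapsto> x b\<close> of \<open>K\<close>, from its matrix in any
  basis.\<close>

definition field_trace :: "'c::field set \<Rightarrow> 'c set \<Rightarrow> 'c \<Rightarrow> 'c" where
  "field_trace F K x = (THE t. \<exists>B M. is_basis F K B \<and> (\<forall>b\<in>B. \<forall>b'\<in>B. M b b' \<in> F) \<and>
     (\<forall>b\<in>B. x * b = (\<Sum>b'\<in>B. M b b' * b')) \<and> t = (\<Sum>b\<in>B. M b b))"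

definition codifferent :: "'c::field set \<Rightarrow> 'c set \<Rightarrow> 'c set \<Rightarrow> 'c \<Rightarrow> 'c set" where
  "codifferent F K A u =
     {x\<in>K. \<forall>a\<in>A. field_trace (adjoin_field F u) K (x * a) \<in> adjoin_ring F u}"

definition different :: "'c::field set \<Rightarrow> 'c set \<Rightarrow> 'c set \<Rightarrow> 'c \<Rightarrow> 'c set" where
  "different F K A u = {d\<in>A. \<forall>x\<in>codifferent F K A u. d * x \<in> A}"

definition uniformizer :: "'c::field set \<Rightarrow> 'c set \<Rightarrow> 'c \<Rightarrow> bool" where
  "uniformizer A p u \<longleftrightarrow> u \<in> p \<and> (\<forall>x\<in>p. \<exists>s\<in>A - p. \<exists>r\<in>A. s * x = r * u)"

definition inverse_ideal :: "'c::field set \<Rightarrow> 'c set \<Rightarrow> 'c set \<Rightarrow> 'c set" where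
  "inverse_ideal K A p = {z\<in>K. \<forall>x\<in>p. z * x \<in> A}"

section \<open>The curve\<close>

text \<open>A smooth projective curve \<open>C\<close> over a finite field \<open>F\<close> is given by its function field \<open>K\<close>;
  it is geometrically irreducible iff \<open>F\<close> is algebraically closed in \<open>K\<close>. Its closed points are
  the places of \<open>K/F\<close>, represented by their valuation rings, which are the local rings of \<open>C\<close>.\<close>

definition function_field :: "'c::field set \<Rightarrow> 'c set \<Rightarrow> bool" where
  "function_field F K \<longleftrightarrow> field (ring_on F) \<and> finite F \<and> field (ring_on K) \<and> F \<subseteq> K \<and>
     (\<exists>t\<in>K. \<not> algebraic_over F t \<and> finite_extension_of (adjoin_field F t) K) \<and>
     (\<forall>x\<in>K. algebraic_over F x \<longrightarrow> x \<in> F)"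

definition is_place :: "'c::field set \<Rightarrow> 'c set \<Rightarrow> 'c set \<Rightarrow> bool" where
  "is_place F K V \<longleftrightarrow> cring (ring_on V) \<and> F \<subseteq> V \<and> V \<subset> K \<and> (\<forall>x\<in>K. x \<in> V \<or> inverse x \<in> V)"

definition regular_away :: "'c::field set \<Rightarrow> 'c set \<Rightarrow> 'c set \<Rightarrow> 'c set" where
  "regular_away F K Oinf = {x\<in>K. \<forall>V. is_place F K V \<and> V \<noteq> Oinf \<longrightarrow> x \<in> V}"

text \<open>The library constrains \<^const>\<open>norm\<close> to real normed vector spaces, hence a new constant.\<close>

class complete_ultrametric_field = field + complete_space +
  fixes absval :: "'a \<Rightarrow> real"
  assumes dist_absval: "dist x y = absval (x - y)"
    and absval_mult: "absval (x * y) = absval x * absval y"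
    and absval_ultra: "absval (x + y) \<le> max (absval x) (absval y)"

text \<open>The type \<^typ>\<open>'c\<close> is a completion of an algebraic closure of \<open>K\<close> for an absolute value
  above the place \<open>Oinf\<close>.\<close>

definition completed_closure :: "'c::complete_ultrametric_field set \<Rightarrow> 'c set \<Rightarrow> bool" where
  "completed_closure K Oinf \<longleftrightarrow> {x\<in>K. absval x \<le> 1} = Oinf \<and>
     (\<forall>f\<in>polys_over (alg_elements K). degree f > 0 \<longrightarrow> (\<exists>x\<in>alg_elements K. poly f x = 0)) \<and>
     closure (alg_elements K) = UNIV"

section \<open>Tensor products\<close>

definition tensor_relators ::
  "'r ring \<Rightarrow> ('r, 'm) module \<Rightarrow> ('r, 'n) module \<Rightarrow> ('m \<times> 'n \<Rightarrow>\<^sub>0 int) set" where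
  "tensor_relators R M N =
     {frag_of (m \<oplus>\<^bsub>M\<^esub> m', n) - frag_of (m, n) - frag_of (m', n) | m m' n.
        m \<in> carrier M \<and> m' \<in> carrier M \<and> n \<in> carrier N} \<union>
     {frag_of (m, n \<oplus>\<^bsub>N\<^esub> n') - frag_of (m, n) - frag_of (m, n') | m n n'.
        m \<in> carrier M \<and> n \<in> carrier N \<and> n' \<in> carrier N} \<union>
     {frag_of (r \<odot>\<^bsub>M\<^esub> m, n) - frag_of (m, r \<odot>\<^bsub>N\<^esub> n) | r m n.
        r \<in> carrier R \<and> m \<in> carrier M \<and> n \<in> carrier N}"

definition tensor_free :: "('r, 'm) module \<Rightarrow> ('r, 'n) module \<Rightarrow> ('m \<times> 'n \<Rightarrow>\<^sub>0 int) monoid" where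
  "tensor_free M N = free_Abelian_group (carrier M \<times> carrier N)"

definition tensor_null ::
  "'r ring \<Rightarrow> ('r, 'm) module \<Rightarrow> ('r, 'n) module \<Rightarrow> ('m \<times> 'n \<Rightarrow>\<^sub>0 int) set" where
  "tensor_null R M N = generate (tensor_free M N) (tensor_relators R M N)"

text \<open>The additive group \<open>M \<otimes>\<^sub>R N\<close>, written multiplicatively; its elements are cosets of
  formal sums of pairs.\<close>

definition tensor ::
  "'r ring \<Rightarrow> ('r, 'm) module \<Rightarrow> ('r, 'n) module \<Rightarrow> ('m \<times> 'n \<Rightarrow>\<^sub>0 int) set monoid" where
  "tensor R M N = tensor_free M N Mod tensor_null R M N"

definition tensor_class ::
  "'r ring \<Rightarrow> ('r, 'm) module \<Rightarrow> ('r, 'n) module \<Rightarrow> ('m \<times> 'n \<Rightarrow>\<^sub>0 int) \<Rightarrow> ('m \<times> 'n \<Rightarrow>\<^sub>0 int) set"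
  where "tensor_class R M N x = tensor_null R M N #>\<^bsub>tensor_free M N\<^esub> x"

text \<open>The map \<open>f \<otimes> g\<close> into \<open>M \<otimes>\<^sub>R N\<close>.\<close>

definition tensor_map ::
  "'r ring \<Rightarrow> ('r, 'm) module \<Rightarrow> ('r, 'n) module \<Rightarrow> ('a \<Rightarrow> 'm) \<Rightarrow> ('b \<Rightarrow> 'n) \<Rightarrow>
     ('a \<times> 'b \<Rightarrow>\<^sub>0 int) set \<Rightarrow> ('m \<times> 'n \<Rightarrow>\<^sub>0 int) set" where
  "tensor_map R M N f g X = tensor_null R M N <#>\<^bsub>tensor_free M N\<^esub>
     frag_extend (\<lambda>(a, b). frag_of (f a, g b)) ` X"

text \<open>The tensor product of two algebras, i.e. modules whose record carries a multiplication.\<close>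

definition tensor_ring ::
  "'r ring \<Rightarrow> ('r, 'm) module \<Rightarrow> ('r, 'n) module \<Rightarrow> ('m \<times> 'n \<Rightarrow>\<^sub>0 int) set ring" where
  "tensor_ring R M N =
     \<lparr>carrier = carrier (tensor R M N),
      monoid.mult = (\<lambda>X Y. tensor_null R M N <#>\<^bsub>tensor_free M N\<^esub>
        {frag_extend (\<lambda>(a, b). frag_extend (\<lambda>(c, d). frag_of (a \<otimes>\<^bsub>M\<^esub> c, b \<otimes>\<^bsub>N\<^esub> d)) y) x | x y.
           x \<in> X \<and> y \<in> Y}),
      one = tensor_class R M N (frag_of (\<one>\<^bsub>M\<^esub>, \<one>\<^bsub>N\<^esub>)),
      ring.zero = \<one>\<^bsub>tensor R M N\<^esub>,
      add = monoid.mult (tensor R M N)\<rparr>"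

text \<open>\<open>\<parallel>X\<parallel> = inf max \<bar>v\<^sub>i\<bar>\<close> over all representations \<open>X = \<Sum> b\<^sub>i \<otimes> v\<^sub>i\<close>.\<close>

definition tensor_norm ::
  "('r, 'm) module \<Rightarrow> ('r, 'n) module \<Rightarrow> ('n \<Rightarrow> real) \<Rightarrow> ('m \<times> 'n \<Rightarrow>\<^sub>0 int) set \<Rightarrow> real" where
  "tensor_norm M N nrm X = Inf {Max (insert 0 (nrm ` snd ` set ps)) | ps.
     set ps \<subseteq> carrier M \<times> carrier N \<and> sum_list (map frag_of ps) \<in> X}"

section \<open>Completion of a normed abelian group\<close>

definition cauchy_seqs :: "'g monoid \<Rightarrow> ('g \<Rightarrow> real) \<Rightarrow> (nat \<Rightarrow> 'g) set" where
  "cauchy_seqs G nrm = {X. (\<forall>n. X n \<in> carrier G) \<and>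
     (\<forall>e>0. \<exists>N. \<forall>m\<ge>N. \<forall>n\<ge>N. nrm (X m \<otimes>\<^bsub>G\<^esub> inv\<^bsub>G\<^esub> X n) < e)}"

definition null_rel :: "'g monoid \<Rightarrow> ('g \<Rightarrow> real) \<Rightarrow> ((nat \<Rightarrow> 'g) \<times> (nat \<Rightarrow> 'g)) set" where
  "null_rel G nrm = {(X, Y). X \<in> cauchy_seqs G nrm \<and> Y \<in> cauchy_seqs G nrm \<and>
     (\<lambda>n. nrm (X n \<otimes>\<^bsub>G\<^esub> inv\<^bsub>G\<^esub> Y n)) \<longlonglongrightarrow> 0}"

definition completion :: "'g monoid \<Rightarrow> ('g \<Rightarrow> real) \<Rightarrow> (nat \<Rightarrow> 'g) set monoid" where
  "completion G nrm =
     \<lparr>carrier = cauchy_seqs G nrm // null_rel G nrm,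
      monoid.mult = (\<lambda>S T. \<Union>X\<in>S. \<Union>Y\<in>T. null_rel G nrm `` {\<lambda>n. X n \<otimes>\<^bsub>G\<^esub> Y n}),
      one = null_rel G nrm `` {\<lambda>n. \<one>\<^bsub>G\<^esub>}\<rparr>"

definition to_completion :: "'g monoid \<Rightarrow> ('g \<Rightarrow> real) \<Rightarrow> 'g \<Rightarrow> (nat \<Rightarrow> 'g) set" where
  "to_completion G nrm x = null_rel G nrm `` {\<lambda>n. x}"

text \<open>Continuous extension of a uniformly continuous map \<open>h\<close> into \<open>G\<close>: first to a map between
  completions, then, when \<open>G\<close> is itself complete, to a map into \<open>G\<close>.\<close>

definition completion_map ::
  "'g monoid \<Rightarrow> ('g \<Rightarrow> real) \<Rightarrow> ('h \<Rightarrow> 'g) \<Rightarrow> (nat \<Rightarrow> 'h) set \<Rightarrow> (nat \<Rightarrow> 'g) set" where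
  "completion_map G nrm h S = (\<Union>X\<in>S. null_rel G nrm `` {\<lambda>n. h (X n)})"

definition completion_lift ::
  "'g monoid \<Rightarrow> ('g \<Rightarrow> real) \<Rightarrow> ('h \<Rightarrow> 'g) \<Rightarrow> (nat \<Rightarrow> 'h) set \<Rightarrow> 'g" where
  "completion_lift G nrm h S = (THE g. g \<in> carrier G \<and>
     (\<forall>X\<in>S. (\<lambda>n. nrm (h (X n) \<otimes>\<^bsub>G\<^esub> inv\<^bsub>G\<^esub> g)) \<longlonglongrightarrow> 0))"

section \<open>Anderson modules\<close>

text \<open>In coordinates \<open>E \<cong> \<bbbG>\<^sub>a\<^sup>d\<close>, an \<open>F\<close>-linear endomorphism of \<open>E\<close> over \<open>L\<close> is
  a twisted polynomial \<open>\<Sum> f n \<tau>\<^sup>n\<close> with \<open>d \<times> d\<close> matrix coefficients over \<open>L\<close>, where \<open>\<tau>\<close> is the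
  \<open>q\<close>-Frobenius, \<open>q = card F\<close>. Both \<open>E(\<complex>\<^sub>\<infinity>)\<close> and \<open>Lie\<^sub>E(\<complex>\<^sub>\<infinity>)\<close> are then \<^typ>\<open>'c^'d\<close>.\<close>

type_synonym ('c, 'd) twisted = "nat \<Rightarrow> 'c^'d^'d"

definition frob_vec :: "nat \<Rightarrow> nat \<Rightarrow> 'c::field^'d \<Rightarrow> 'c^'d" where
  "frob_vec q n x = (\<chi> i. (x $ i) ^ (q ^ n))"

definition frob_mat :: "nat \<Rightarrow> nat \<Rightarrow> 'c::field^'d^'d \<Rightarrow> 'c^'d^'d" where
  "frob_mat q n M = (\<chi> i j. (M $ i $ j) ^ (q ^ n))"

definition twisted_polys :: "'c::field set \<Rightarrow> ('c, 'd::finite) twisted set" where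
  "twisted_polys L = {f. finite {n. f n \<noteq> 0} \<and> (\<forall>n i j. f n $ i $ j \<in> L)}"

definition twisted_const :: "'c::field \<Rightarrow> ('c, 'd::finite) twisted" where
  "twisted_const c n = (if n = 0 then mat c else 0)"

definition twisted_mult ::
  "nat \<Rightarrow> ('c::field, 'd::finite) twisted \<Rightarrow> ('c, 'd) twisted \<Rightarrow> ('c, 'd) twisted" where
  "twisted_mult q f g n = (\<Sum>i\<le>n. f i ** frob_mat q i (g (n - i)))"

definition twisted_app :: "nat \<Rightarrow> ('c::field, 'd::finite) twisted \<Rightarrow> 'c^'d \<Rightarrow> 'c^'d" where
  "twisted_app q f x = (\<Sum>n | f n \<noteq> 0. f n *v frob_vec q n x)"

definition nilpotent_mat :: "'c::field^'d::finite^'d \<Rightarrow> bool" where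
  "nilpotent_mat N \<longleftrightarrow> (\<exists>k. ((\<lambda>M. N ** M) ^^ k) (mat 1) = 0)"

text \<open>\<open>phi a 0\<close> is the action \<open>\<partial>a = \<partial>\<phi>\<^sub>a\<close> on the Lie algebra.\<close>

definition anderson_module ::
  "'c::field set \<Rightarrow> 'c set \<Rightarrow> 'c set \<Rightarrow> ('c \<Rightarrow> ('c, 'd::finite) twisted) \<Rightarrow> bool" where
  "anderson_module F A L phi \<longleftrightarrow>
     (\<forall>a\<in>A. phi a \<in> twisted_polys L) \<and>
     (\<forall>c\<in>F. phi c = twisted_const c) \<and>
     (\<forall>a\<in>A. \<forall>b\<in>A. phi (a + b) = (\<lambda>n. phi a n + phi b n)) \<and>
     (\<forall>a\<in>A. \<forall>b\<in>A. phi (a * b) = twisted_mult (card F) (phi a) (phi b)) \<and>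
     (\<forall>a\<in>A. nilpotent_mat (phi a 0 - mat a))"

text \<open>Extension of \<open>\<partial>\<close> to the fraction field of \<open>A\<close>.\<close>

definition lie_action ::
  "'c::field set \<Rightarrow> ('c \<Rightarrow> ('c, 'd::finite) twisted) \<Rightarrow> 'c \<Rightarrow> 'c^'d^'d" where
  "lie_action A phi r = (THE M. \<exists>a\<in>A. \<exists>b\<in>A. b \<noteq> 0 \<and> r = a / b \<and>
     M = matrix_inv (phi b 0) ** phi a 0)"

definition is_exponential ::
  "'c::complete_ultrametric_field set \<Rightarrow> 'c set \<Rightarrow> ('c \<Rightarrow> ('c, 'd::finite) twisted) \<Rightarrow>
     ('c^'d \<Rightarrow> 'c^'d) \<Rightarrow> bool" where
  "is_exponential F A phi ex \<longleftrightarrow>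
     (\<forall>x y. ex (x + y) = ex x + ex y) \<and> (\<forall>c\<in>F. \<forall>x. ex (c *s x) = c *s ex x) \<and>
     (\<forall>a\<in>A. \<forall>x. ex (phi a 0 *v x) = twisted_app (card F) (phi a) (ex x)) \<and>
     (\<exists>e. e 0 = mat 1 \<and> (\<forall>x. (\<lambda>n. e n *v frob_vec (card F) n x) sums ex x))"

definition period_lattice :: "('c::field^'d \<Rightarrow> 'c^'d) \<Rightarrow> ('c^'d) set" where
  "period_lattice ex = {x. ex x = 0}"

definition ideal_times_lattice ::
  "'c::field set \<Rightarrow> ('c \<Rightarrow> ('c, 'd::finite) twisted) \<Rightarrow> 'c set \<Rightarrow> ('c^'d) set \<Rightarrow> ('c^'d) set" where
  "ideal_times_lattice A phi I Lam =
     (\<lambda>N. subgroup N (add_group_on UNIV) \<and> (\<forall>a\<in>A. \<forall>x\<in>N. phi a 0 *v x \<in> N)) hull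
       {phi a 0 *v x | a x. a \<in> I \<and> x \<in> Lam}"

section \<open>The modules \<open>E(\<T>)\<close> and \<open>Lie\<^sub>E(\<T>)\<close>\<close>

definition alg_on :: "'c::field set \<Rightarrow> ('c, 'c) module" where
  "alg_on S = \<lparr>carrier = S, monoid.mult = (*), one = 1, ring.zero = 0, add = (+), smult = (*)\<rparr>"

text \<open>The ring multiplication and unit that the record type requires are irrelevant for modules.\<close>

definition module_on :: "('c \<Rightarrow> 'c^'d \<Rightarrow> 'c^'d) \<Rightarrow> ('c::field^'d) set \<Rightarrow> ('c, 'c^'d) module" where
  "module_on sm S = \<lparr>carrier = S, monoid.mult = undefined, one = undefined,
     ring.zero = 0, add = (+), smult = sm\<rparr>"

abbreviation coord_space :: "('c::field, 'c^'d) module" where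
  "coord_space \<equiv> module_on (*s) UNIV"

definition vec_sup_norm :: "'c::complete_ultrametric_field^'d::finite \<Rightarrow> real" where
  "vec_sup_norm v = Max (range (\<lambda>i. absval (v $ i)))"

definition tensor_AV :: "'c::complete_ultrametric_field set \<Rightarrow> 'c set \<Rightarrow>
    ('c \<times> ('c^'d::finite) \<Rightarrow>\<^sub>0 int) set monoid" where
  "tensor_AV F A = tensor (ring_on F) (alg_on A) coord_space"

definition norm_AV :: "'c::complete_ultrametric_field set \<Rightarrow>
    ('c \<times> ('c^'d::finite) \<Rightarrow>\<^sub>0 int) set \<Rightarrow> real" where
  "norm_AV A = tensor_norm (alg_on A) coord_space vec_sup_norm"

text \<open>The completion of \<open>A \<otimes> \<complex>\<^sub>\<infinity>\<^sup>d\<close>. It is the group underlying both \<open>E(\<T>)\<close> and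
  \<open>Lie\<^sub>E(\<T>)\<close>, which differ by the action of \<open>1 \<otimes> a\<close>.\<close>

type_synonym ('c, 'd) hat_elem = "(nat \<Rightarrow> ('c \<times> ('c^'d) \<Rightarrow>\<^sub>0 int) set) set"

definition hat_AV :: "'c::complete_ultrametric_field set \<Rightarrow> 'c set \<Rightarrow>
    ('c, 'd::finite) hat_elem monoid" where
  "hat_AV F A = completion (tensor_AV F A) (norm_AV A)"

definition hat_map :: "'c::complete_ultrametric_field set \<Rightarrow> 'c set \<Rightarrow> ('c \<Rightarrow> 'c) \<Rightarrow>
    ('c^'d \<Rightarrow> 'c^'d) \<Rightarrow> ('c, 'd::finite) hat_elem \<Rightarrow> ('c, 'd) hat_elem" where
  "hat_map F A f g = completion_map (tensor_AV F A) (norm_AV A)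
     (tensor_map (ring_on F) (alg_on A) coord_space f g)"

definition special_functions :: "'c::complete_ultrametric_field set \<Rightarrow> 'c set \<Rightarrow>
    ('c \<Rightarrow> ('c, 'd::finite) twisted) \<Rightarrow> ('c, 'd) hat_elem set" where
  "special_functions F A phi = {w \<in> carrier (hat_AV F A).
     \<forall>a\<in>A. hat_map F A ((*) a) id w = hat_map F A id (twisted_app (card F) (phi a)) w}"

section \<open>The isomorphism \<open>\<delta>\<^sub>u\<close>\<close>

text \<open>The operator \<open>1 \<otimes> \<partial>u - u \<otimes> 1\<close> on \<open>Lie\<^sub>E(\<T>)\<close>.\<close>

definition u_diff :: "'c::complete_ultrametric_field set \<Rightarrow> 'c set \<Rightarrow>
    ('c \<Rightarrow> ('c, 'd::finite) twisted) \<Rightarrow> 'c \<Rightarrow> ('c, 'd) hat_elem \<Rightarrow> ('c, 'd) hat_elem" where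
  "u_diff F A phi u w =
     hat_map F A id ((*v) (phi u 0)) w \<otimes>\<^bsub>hat_AV F A\<^esub>
       inv\<^bsub>hat_AV F A\<^esub> hat_map F A ((*) u) id w"

definition lattice_module :: "('c \<Rightarrow> ('c, 'd::finite) twisted) \<Rightarrow> ('c^'d \<Rightarrow> 'c^'d) \<Rightarrow>
    ('c::field, 'c^'d) module" where
  "lattice_module phi ex = module_on (\<lambda>r x. phi r 0 *v x) (period_lattice ex)"

text \<open>The elements \<open>y \<in> A \<otimes>\<^bsub>F[u]\<^esub> \<Lambda>\<^sub>E\<close> with \<open>(a \<otimes> 1) y = (1 \<otimes> a) y\<close> for all \<open>a\<close>.\<close>

definition diagonal_tensors :: "'c::field set \<Rightarrow> 'c set \<Rightarrow> ('c \<Rightarrow> ('c, 'd::finite) twisted) \<Rightarrow>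
    ('c^'d \<Rightarrow> 'c^'d) \<Rightarrow> 'c \<Rightarrow> ('c \<times> ('c^'d) \<Rightarrow>\<^sub>0 int) set set" where
  "diagonal_tensors F A phi ex u =
     (let R = ring_on (adjoin_ring F u); M = alg_on A; N = lattice_module phi ex in
      {y \<in> carrier (tensor R M N).
         \<forall>a\<in>A. tensor_map R M N ((*) a) id y = tensor_map R M N id ((*v) (phi a 0)) y})"

definition mult_map :: "('c::field \<Rightarrow> ('c, 'd::finite) twisted) \<Rightarrow>
    ('c \<times> ('c^'d) \<Rightarrow>\<^sub>0 int) set \<Rightarrow> 'c^'d" where
  "mult_map phi y = the_elem ((\<lambda>s. \<Sum>(a, x)\<in>Poly_Mapping.keys s.
     of_int (Poly_Mapping.lookup s (a, x)) *s (phi a 0 *v x)) ` y)"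

text \<open>Since \<open>u \<otimes> 1\<close> and \<open>1 \<otimes> \<partial>u\<close> agree on \<open>A \<otimes>\<^bsub>F[u]\<^esub> \<Lambda>\<^sub>E\<close>, the expression
  \<open>(1 \<otimes> \<partial>u - u \<otimes> 1)\<^sup>-\<^sup>1 y\<close> refers to a lift of \<open>y\<close> to \<open>A \<otimes>\<^bsub>F\<^esub> \<Lambda>\<^sub>E \<subseteq> Lie\<^sub>E(\<T>)\<close>. Two lifts differ by
  an element of \<open>(1 \<otimes> \<partial>u - u \<otimes> 1)(A \<otimes>\<^bsub>F\<^esub> \<Lambda>\<^sub>E)\<close>, which does not change the image under
  \<open>id \<otimes> exp\<close>. The formal sums \<open>s\<close> that belong to the coset \<open>y\<close> represent all lifts.\<close>

definition is_delta :: "'c::complete_ultrametric_field set \<Rightarrow> 'c set \<Rightarrow> 'c set \<Rightarrow>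
    ('c \<Rightarrow> ('c, 'd::finite) twisted) \<Rightarrow> ('c^'d \<Rightarrow> 'c^'d) \<Rightarrow> 'c \<Rightarrow>
    ('c^'d \<Rightarrow> ('c, 'd) hat_elem) \<Rightarrow> bool" where
  "is_delta F K A phi ex u delta \<longleftrightarrow>
     (let D = ideal_times_lattice A phi (different F K A u) (period_lattice ex) in
      delta \<in> iso (add_group_on D) ((hat_AV F A)\<lparr>carrier := special_functions F A phi\<rparr>) \<and>
      (\<forall>a\<in>A. \<forall>x\<in>D. delta (phi a 0 *v x) = hat_map F A ((*) a) id (delta x)) \<and>
      (\<forall>y\<in>diagonal_tensors F A phi ex u. \<forall>s\<in>y.
         delta (mult_map phi y) =
           hat_map F A id ex
             (the_inv_into (carrier (hat_AV F A)) (u_diff F A phi u)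
               (to_completion (tensor_AV F A) (norm_AV A)
                 (tensor_class (ring_on F) (alg_on A) coord_space s)))))"

section \<open>Evaluative characters and Gauss--Thakur sums\<close>

type_synonym 'c residue = "('c \<times> 'c \<Rightarrow>\<^sub>0 int) set set"

definition geom_ring :: "'c::field set \<Rightarrow> 'c set \<Rightarrow> ('c \<times> 'c \<Rightarrow>\<^sub>0 int) set ring" where
  "geom_ring F A = tensor_ring (ring_on F) (alg_on (alg_elements F)) (alg_on A)"

definition geom_const :: "'c::field set \<Rightarrow> 'c set \<Rightarrow> 'c \<Rightarrow> ('c \<times> 'c \<Rightarrow>\<^sub>0 int) set" where
  "geom_const F A a =
     tensor_class (ring_on F) (alg_on (alg_elements F)) (alg_on A) (frag_of (1, a))"

definition max_ideal_above :: "'c::field set \<Rightarrow> 'c set \<Rightarrow> 'c set \<Rightarrow> 'c residue \<Rightarrow> bool" where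
  "max_ideal_above F A p P \<longleftrightarrow>
     maximalideal P (geom_ring F A) \<and> {a\<in>A. geom_const F A a \<in> P} = p"

definition eval_char :: "'c::field set \<Rightarrow> 'c set \<Rightarrow> 'c residue \<Rightarrow> 'c \<Rightarrow> 'c residue" where
  "eval_char F A P a = P +>\<^bsub>geom_ring F A\<^esub> geom_const F A a"

text \<open>The residue field \<open>F\<^sub>p\<close>, as the image of the character.\<close>

definition residue_module :: "'c::field set \<Rightarrow> 'c set \<Rightarrow> 'c residue \<Rightarrow> ('c, 'c residue) module"
  where
  "residue_module F A P = (let Q = geom_ring F A Quot P in
     \<lparr>carrier = eval_char F A P ` A, monoid.mult = monoid.mult Q, one = one Q,
      ring.zero = ring.zero Q, add = add Q, smult = (\<lambda>c t. eval_char F A P c \<otimes>\<^bsub>Q\<^esub> t)\<rparr>)"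

definition tensor_FV :: "'c::complete_ultrametric_field set \<Rightarrow> 'c set \<Rightarrow> 'c residue \<Rightarrow>
    ('c residue \<times> ('c^'d::finite) \<Rightarrow>\<^sub>0 int) set monoid" where
  "tensor_FV F A P = tensor (ring_on F) (residue_module F A P) coord_space"

definition tensor_FV_map :: "'c::complete_ultrametric_field set \<Rightarrow> 'c set \<Rightarrow> 'c residue \<Rightarrow>
    ('a \<Rightarrow> 'c residue) \<Rightarrow> ('c^'d \<Rightarrow> 'c^'d::finite) \<Rightarrow>
    ('a \<times> ('c^'d) \<Rightarrow>\<^sub>0 int) set \<Rightarrow> ('c residue \<times> ('c^'d) \<Rightarrow>\<^sub>0 int) set" where
  "tensor_FV_map F A P = tensor_map (ring_on F) (residue_module F A P) coord_space"

definition char_hat :: "'c::complete_ultrametric_field set \<Rightarrow> 'c set \<Rightarrow> 'c residue \<Rightarrow>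
    ('c, 'd::finite) hat_elem \<Rightarrow> ('c residue \<times> ('c^'d) \<Rightarrow>\<^sub>0 int) set" where
  "char_hat F A P = completion_lift (tensor_FV F A P)
     (tensor_norm (residue_module F A P) coord_space vec_sup_norm)
     (tensor_FV_map F A P (eval_char F A P) id)"

definition gauss_module :: "'c::complete_ultrametric_field set \<Rightarrow> 'c set \<Rightarrow> 'c residue \<Rightarrow>
    ('c \<Rightarrow> ('c, 'd::finite) twisted) \<Rightarrow> ('c residue \<times> ('c^'d) \<Rightarrow>\<^sub>0 int) set set" where
  "gauss_module F A P phi = {g \<in> carrier (tensor_FV F A P). \<forall>a\<in>A.
     tensor_FV_map F A P id (twisted_app (card F) (phi a)) g =
     tensor_FV_map F A P (\<lambda>t. eval_char F A P a \<otimes>\<^bsub>geom_ring F A Quot P\<^esub> t) id g}"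

text \<open>The sum \<open>g(\<chi>, \<psi>)\<close>; the character and \<open>\<psi>\<close> are given on \<open>A\<close> and passed to the cosets
  \<open>x \<in> (A/p)\<^sup>\<times>\<close>.\<close>

definition gauss_sum :: "'c::complete_ultrametric_field set \<Rightarrow> 'c set \<Rightarrow> 'c set \<Rightarrow> 'c residue \<Rightarrow>
    ('c \<Rightarrow> 'c^'d::finite) \<Rightarrow> ('c residue \<times> ('c^'d) \<Rightarrow>\<^sub>0 int) set" where
  "gauss_sum F A p P psi =
     tensor_class (ring_on F) (residue_module F A P) coord_space
       (- (\<Sum>x\<in>Units (ring_on A Quot p).
            frag_of (inv\<^bsub>geom_ring F A Quot P\<^esub> the_elem (eval_char F A P ` x),
                     the_elem (psi ` x))))"

definition gauss_map :: "'c::complete_ultrametric_field set \<Rightarrow> 'c set \<Rightarrow> 'c set \<Rightarrow> 'c residue \<Rightarrow>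
    ('c \<Rightarrow> ('c, 'd::finite) twisted) \<Rightarrow> ('c^'d \<Rightarrow> 'c^'d) \<Rightarrow> 'c \<Rightarrow>
    'c^'d \<Rightarrow> ('c residue \<times> ('c^'d) \<Rightarrow>\<^sub>0 int) set" where
  "gauss_map F A p P phi ex z x =
     gauss_sum F A p P (\<lambda>a. ex (lie_action A phi (a * z) *v x))"

end

theory Submission
  imports Defs
begin

text \<open>
  The operator \<open>1 \<otimes> \<partial>u - u \<otimes> 1\<close> is inverted by a geometric series, so \<open>\<delta>\<^sub>u\<close> sends \<open>\<mu>(y)\<close>, for a diagonal
  \<open>y = \<Sum> a\<^sub>i \<otimes> \<lambda>\<^sub>i\<close>, to the sum of all \<open>u\<^sup>n a\<^sub>i \<otimes> exp (\<partial>u\<^sup>-\<^sup>n\<^sup>-\<^sup>1 \<lambda>\<^sub>i)\<close>. The character kills \<open>u\<close>, hence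
  only \<open>\<Theta> = \<Sum> \<chi>(a\<^sub>i) \<otimes> exp (\<partial>u\<^sup>-\<^sup>1 \<lambda>\<^sub>i)\<close> survives. As \<open>y\<close> is diagonal, \<open>1 \<otimes> \<phi>\<^sub>a\<close> acts on \<open>\<Theta>\<close> as
  \<open>\<chi>(a)\<close>. Acting with \<open>a = u z \<equiv> 1\<close> replaces \<open>\<partial>u\<^sup>-\<^sup>1\<close> by \<open>\<partial>z\<close>, and averaging over
  \<open>(A/p)\<^sup>\<times>\<close>, whose order is \<open>-1\<close> in \<open>F\<close>, turns \<open>\<Theta>\<close> into the Gauss sum of \<open>\<mu>(y)\<close>.

  It remains to find, for every period \<open>\<lambda>\<close>, a diagonal \<open>y\<close> with \<open>\<mu>(y) = \<partial>s \<lambda>\<close> and \<open>s \<equiv> 1\<close> modulo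
  \<open>p\<close>; both sides of the theorem take the same value at \<open>\<lambda>\<close> and at \<open>\<partial>s \<lambda>\<close>. The extension
  \<open>F[u] \<subseteq> A\<close> is unramified at \<open>p\<close>: with \<open>Q\<close> the order of \<open>A/p\<close>, the relation \<open>t (a\<^sup>Q - a) = r u\<close> with
  \<open>t\<close> outside \<open>p\<close> expresses \<open>t (a \<otimes> 1 - 1 \<otimes> a)\<close> through elements of the same kind with
  coefficients in \<open>p\<close>. As in Nakayama's lemma, an element outside \<open>p\<close> annihilates the kernel of
  \<open>A \<otimes> A \<rightarrow> A\<close>. This uses that \<open>A\<close> is a finite \<open>F[u]\<close>-module, which holds because only finitely many
  elements of \<open>A\<close> have bounded absolute value at infinity.
\<close>

section \<open>Tensor products of modules\<close>

text \<open>The characterization of \<open>delta\<close> speaks only about values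
  \<open>\<mu>(y)\<close> with \<open>y\<close> diagonal. Writing a given \<open>x\<close> of
  \<open>D\<close> itself as such a value would call for the trace duality behind the different.
  Allowing a factor \<open>s \<equiv> 1\<close> modulo \<open>p\<close> makes the question local at
  \<open>p\<close>, where explicit elimination suffices; linearity of \<open>delta\<close> and
  \<open>\<chi>(s) = 1\<close> then lead back from \<open>\<partial>s x\<close> to \<open>x\<close>.
  Several notions are definite descriptions, and each forces a uniqueness proof. The inverse of
  \<open>1 \<otimes> \<partial>u - u \<otimes> 1\<close> needs injectivity on the completion, which
  comes from the contraction \<open>u \<otimes> \<partial>u^(-1)\<close>. The limit in
  \<open>char_hat\<close> needs a definite norm on \<open>F_p \<otimes> E\<close>, which comes from
  an \<open>F\<close>-basis of \<open>A/p\<close>. Because of the nilpotent part of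
  \<open>\<partial>u\<close>, a single \<open>\<partial>u^(-1)\<close> need not shrink vectors. In
  positive characteristic some power of \<open>\<partial>u\<close> is scalar, and this yields the
  decay. Tensors are handled as formal sums, and equality of tensors as membership of a difference
  in a null subgroup.\<close>

definition diff_closed :: "'a::ab_group_add set \<Rightarrow> bool" where
  "diff_closed S \<longleftrightarrow> 0 \<in> S \<and> (\<forall>x\<in>S. \<forall>y\<in>S. x - y \<in> S)"

lemma diff_closedD:
  assumes "diff_closed S"
  shows "0 \<in> S" "x \<in> S \<Longrightarrow> y \<in> S \<Longrightarrow> x - y \<in> S" "x \<in> S \<Longrightarrow> - x \<in> S"
    "x \<in> S \<Longrightarrow> y \<in> S \<Longrightarrow> x + y \<in> S"
proof -
  show *: "0 \<in> S" "\<And>x y. x \<in> S \<Longrightarrow> y \<in> S \<Longrightarrow> x - y \<in> S"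
    using assms by (auto simp: diff_closed_def)
  show neg: "x \<in> S \<Longrightarrow> - x \<in> S" for x using *(2)[of 0 x] *(1) by simp
  show "x \<in> S \<Longrightarrow> y \<in> S \<Longrightarrow> x + y \<in> S" using *(2)[of x "- y"] neg by simp
qed

lemma diff_closed_sum:
  assumes "diff_closed S" "\<And>i. i \<in> I \<Longrightarrow> f i \<in> S"
  shows "sum f I \<in> S"
  using assms(2)
  by (induction I rule: infinite_finite_induct) (auto intro: diff_closedD[OF assms(1)])

lemma diff_closed_zero: "diff_closed {0}"
  by (simp add: diff_closed_def)

text \<open>The map \<open>f \<otimes> g\<close> before passage to cosets. Composition and
  additivity hold here exactly and not only modulo \<open>null\<close>.\<close>

definition fmap2 :: "('a \<Rightarrow> 'm) \<Rightarrow> ('b \<Rightarrow> 'n) \<Rightarrow> ('a \<times> 'b \<Rightarrow>\<^sub>0 int) \<Rightarrow> ('m \<times> 'n \<Rightarrow>\<^sub>0 int)" where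
  "fmap2 f g = frag_extend (\<lambda>(a, b). frag_of (f a, g b))"

lemma fmap2_simps [simp]:
  "fmap2 f g 0 = 0" "fmap2 f g (frag_of (a, b)) = frag_of (f a, g b)"
  "fmap2 f g (x + y) = fmap2 f g x + fmap2 f g y"
  "fmap2 f g (x - y) = fmap2 f g x - fmap2 f g y"
  "fmap2 f g (- x) = - fmap2 f g x"
  by (auto simp: fmap2_def frag_extend_add frag_extend_diff frag_extend_minus)

lemma fmap2_sum: "fmap2 f g (sum h I) = (\<Sum>i\<in>I. fmap2 f g (h i))"
  by (induction I rule: infinite_finite_induct) auto

lemma frag_induct_UNIV [case_names zero one diff]:
  assumes "P 0" "\<And>a b. P (frag_of (a, b))" "\<And>x y. P x \<Longrightarrow> P y \<Longrightarrow> P (x - y)"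
  shows "P (x :: 'a \<times> 'b \<Rightarrow>\<^sub>0 int)"
  by (rule free_Abelian_group_induct[of x UNIV]) (use assms in auto)

lemma fmap2_fmap2: "fmap2 f g (fmap2 f' g' x) = fmap2 (\<lambda>a. f (f' a)) (\<lambda>b. g (g' b)) x"
  by (induction x rule: frag_induct_UNIV) auto

lemma fmap2_id [simp]: "fmap2 (\<lambda>a. a) (\<lambda>b. b) x = x" "fmap2 id id x = x"
  by (induction x rule: frag_induct_UNIV, auto)+

lemma keys_fmap2:
  fixes x :: "'a \<times> 'b \<Rightarrow>\<^sub>0 int"
  assumes "Poly_Mapping.keys x \<subseteq> A \<times> B" "\<And>a. a \<in> A \<Longrightarrow> f a \<in> A'" "\<And>b. b \<in> B \<Longrightarrow> g b \<in> B'"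
  shows "Poly_Mapping.keys (fmap2 f g x) \<subseteq> A' \<times> B'"
  using assms(1)
proof (rule free_Abelian_group_induct)
  fix x y :: "'a \<times> 'b \<Rightarrow>\<^sub>0 int"
  assume "Poly_Mapping.keys (fmap2 f g x) \<subseteq> A' \<times> B'" "Poly_Mapping.keys (fmap2 f g y) \<subseteq> A' \<times> B'"
  then show "Poly_Mapping.keys (fmap2 f g (x - y)) \<subseteq> A' \<times> B'"
    using keys_diff[of "fmap2 f g x" "fmap2 f g y"] by auto
qed (use assms in auto)

lemma fmap2_cong:
  assumes "Poly_Mapping.keys x \<subseteq> A \<times> B" "\<And>a. a \<in> A \<Longrightarrow> f a = f' a" "\<And>b. b \<in> B \<Longrightarrow> g b = g' b"
  shows "fmap2 f g x = fmap2 f' g' x"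
  using assms(1) by (rule free_Abelian_group_induct) (use assms in auto)

lemma keys_add_subset: "Poly_Mapping.keys x \<subseteq> S \<Longrightarrow> Poly_Mapping.keys y \<subseteq> S \<Longrightarrow> Poly_Mapping.keys (x + y) \<subseteq> S"
  using keys_add[of x y] by auto

lemma keys_diff_subset: "Poly_Mapping.keys x \<subseteq> S \<Longrightarrow> Poly_Mapping.keys y \<subseteq> S \<Longrightarrow> Poly_Mapping.keys (x - y) \<subseteq> S"
  using keys_diff[of x y] by auto

lemma diff_closed_keys: "diff_closed {x :: 'a \<Rightarrow>\<^sub>0 int. Poly_Mapping.keys x \<subseteq> S}"
  by (auto simp: diff_closed_def intro!: keys_diff_subset del: subsetI)

text \<open>The additive extension of \<open>h\<close> with values in a vector space, where
  \<open>frag_extend\<close> has values in formal sums; integer coefficients act as scalars.\<close>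

definition fext :: "('k \<Rightarrow> 'c::field^'d) \<Rightarrow> ('k \<Rightarrow>\<^sub>0 int) \<Rightarrow> 'c^'d" where
  "fext h s = (\<Sum>k\<in>Poly_Mapping.keys s. of_int (Poly_Mapping.lookup s k) *s h k)"

lemma fext_superset:
  assumes "finite S" "Poly_Mapping.keys s \<subseteq> S"
  shows "fext h s = (\<Sum>k\<in>S. of_int (Poly_Mapping.lookup s k) *s h k)"
  unfolding fext_def by (rule sum.mono_neutral_left) (use assms in \<open>auto simp: in_keys_iff\<close>)

lemma fext_diff: "fext h (s - t) = fext h s - fext h t"
proof -
  let ?S = "Poly_Mapping.keys s \<union> Poly_Mapping.keys t"
  have S: "finite ?S" by simp
  show ?thesis
    unfolding fext_superset[OF S keys_diff] fext_superset[OF S Un_upper1] fext_superset[OF S Un_upper2]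
      sum_subtractf[symmetric]
    by (rule sum.cong) (auto simp: lookup_minus vec.scale_left_diff_distrib)
qed

lemma fext_simps [simp]: "fext h 0 = 0" "fext h (frag_of k) = h k"
  by (simp_all add: fext_def)

text \<open>One setting for the four tensor products that occur: \<open>LT\<close> over
  \<open>F[u]\<close> with the period lattice, \<open>GT\<close> for the geometric ring,
  \<open>AT\<close> and \<open>FT\<close> over \<open>F\<close> with the coordinate space. Closure
  under the scalars keeps the relators inside the free group.\<close>

locale tensor_pair =
  fixes R :: "'r ring" and M :: "('r, 'm) module" and N :: "('r, 'n) module"
  assumes abM: "abelian_group M" and abN: "abelian_group N"
    and smM: "\<And>r m. r \<in> carrier R \<Longrightarrow> m \<in> carrier M \<Longrightarrow> r \<odot>\<^bsub>M\<^esub> m \<in> carrier M"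
    and smN: "\<And>r n. r \<in> carrier R \<Longrightarrow> n \<in> carrier N \<Longrightarrow> r \<odot>\<^bsub>N\<^esub> n \<in> carrier N"
begin

sublocale MM: abelian_group M by (rule abM)
sublocale NN: abelian_group N by (rule abN)

abbreviation "pairs \<equiv> carrier M \<times> carrier N"
abbreviation "null \<equiv> tensor_null R M N"
abbreviation "cls \<equiv> tensor_class R M N"

lemma carrier_free: "x \<in> carrier (tensor_free M N) \<longleftrightarrow> Poly_Mapping.keys x \<subseteq> pairs"
  by (simp add: tensor_free_def)

lemma relators_carrier: "tensor_relators R M N \<subseteq> carrier (tensor_free M N)"
proof
  fix x assume "x \<in> tensor_relators R M N"
  then show "x \<in> carrier (tensor_free M N)"
    unfolding tensor_relators_def carrier_free
    by (elim UnE CollectE exE conjE) (simp_all add: keys_diff_subset smM smN)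
qed

lemma null_subgroup: "subgroup null (tensor_free M N)"
  unfolding tensor_null_def
  by (rule group.generate_is_subgroup[OF _ relators_carrier]) (simp add: tensor_free_def)

lemma null_keys: "x \<in> null \<Longrightarrow> Poly_Mapping.keys x \<subseteq> pairs"
  using subgroup.mem_carrier[OF null_subgroup] carrier_free by blast

lemma null_diff_closed: "diff_closed null"
proof -
  have "x - y \<in> null" if "x \<in> null" "y \<in> null" for x y
  proof -
    have "inv\<^bsub>tensor_free M N\<^esub> y = - y" using null_keys[OF that(2)] by (simp add: tensor_free_def)
    then have "- y \<in> null" using subgroup.m_inv_closed[OF null_subgroup that(2)] by simp
    then show ?thesis using subgroup.m_closed[OF null_subgroup that(1), of "- y"]
      by (simp add: tensor_free_def)
  qed
  then show ?thesis using subgroup.one_closed[OF null_subgroup]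
    by (auto simp: diff_closed_def tensor_free_def)
qed

lemmas null_0 [simp, intro] = diff_closedD(1)[OF null_diff_closed]
lemmas null_diff = diff_closedD(2)[OF null_diff_closed]
lemmas null_minus = diff_closedD(3)[OF null_diff_closed]
lemmas null_add = diff_closedD(4)[OF null_diff_closed]
lemmas null_sum = diff_closed_sum[OF null_diff_closed]

lemma null_trans: "x - y \<in> null \<Longrightarrow> y - w \<in> null \<Longrightarrow> x - w \<in> null"
  using null_add[of "x - y" "y - w"] by simp

lemma null_sym: "x - y \<in> null \<Longrightarrow> y - x \<in> null"
  using null_minus[of "x - y"] by simp

lemma null_add2: "x - y \<in> null \<Longrightarrow> x' - y' \<in> null \<Longrightarrow> (x + x') - (y + y') \<in> null"
  using null_add[of "x - y" "x' - y'"] by (simp add: algebra_simps)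

lemma null_diff2: "x - y \<in> null \<Longrightarrow> x' - y' \<in> null \<Longrightarrow> (x - x') - (y - y') \<in> null"
  using null_diff[of "x - y" "x' - y'"] by (simp add: algebra_simps)

lemma null_sum2: "(\<And>i. i \<in> I \<Longrightarrow> f i - g i \<in> null) \<Longrightarrow> sum f I - sum g I \<in> null"
  using null_sum[of I "\<lambda>i. f i - g i"] by (simp add: sum_subtractf)

lemma rel_left: "m \<in> carrier M \<Longrightarrow> m' \<in> carrier M \<Longrightarrow> n \<in> carrier N \<Longrightarrow>
    frag_of (m \<oplus>\<^bsub>M\<^esub> m', n) - frag_of (m, n) - frag_of (m', n) \<in> null"
  unfolding tensor_null_def by (rule generate.incl) (auto simp: tensor_relators_def)

lemma rel_right: "m \<in> carrier M \<Longrightarrow> n \<in> carrier N \<Longrightarrow> n' \<in> carrier N \<Longrightarrow>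
    frag_of (m, n \<oplus>\<^bsub>N\<^esub> n') - frag_of (m, n) - frag_of (m, n') \<in> null"
  unfolding tensor_null_def by (rule generate.incl) (auto simp: tensor_relators_def)

lemma rel_smult: "r \<in> carrier R \<Longrightarrow> m \<in> carrier M \<Longrightarrow> n \<in> carrier N \<Longrightarrow>
    frag_of (r \<odot>\<^bsub>M\<^esub> m, n) - frag_of (m, r \<odot>\<^bsub>N\<^esub> n) \<in> null"
  unfolding tensor_null_def by (rule generate.incl) (auto simp: tensor_relators_def)

lemma zero_left: "n \<in> carrier N \<Longrightarrow> frag_of (\<zero>\<^bsub>M\<^esub>, n) \<in> null"
  using null_minus[OF rel_left[of "\<zero>\<^bsub>M\<^esub>" "\<zero>\<^bsub>M\<^esub>" n]] by simp

lemma zero_right: "m \<in> carrier M \<Longrightarrow> frag_of (m, \<zero>\<^bsub>N\<^esub>) \<in> null"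
  using null_minus[OF rel_right[of m "\<zero>\<^bsub>N\<^esub>" "\<zero>\<^bsub>N\<^esub>"]] by simp

lemma neg_right: "m \<in> carrier M \<Longrightarrow> n \<in> carrier N \<Longrightarrow> frag_of (m, \<ominus>\<^bsub>N\<^esub> n) + frag_of (m, n) \<in> null"
  using null_diff[OF zero_right[of m] rel_right[of m "\<ominus>\<^bsub>N\<^esub> n" n]]
  by (simp add: NN.l_neg add.commute)

text \<open>The source of all well-definedness proofs: \<open>S\<close> is \<open>{0}\<close> for a
  map into vectors and the null subgroup of the target for a map between tensor products.\<close>

lemma null_induct:
  assumes h: "\<And>x y. h (x - y) = h x - h y"
    and S: "diff_closed S"
    and rels: "\<And>x. x \<in> tensor_relators R M N \<Longrightarrow> h x \<in> S"
    and x: "x \<in> null"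
  shows "h x \<in> S"
proof -
  have h0: "h 0 = 0" using h[of 0 0] by simp
  have neg: "h (- y) = - h y" for y using h[of 0 y] h0 by simp
  have hadd: "h (x + y) = h x + h y" for x y using h[of x "- y"] neg[of y] by simp
  from x show ?thesis unfolding tensor_null_def
  proof (induction rule: generate.induct)
    case one then show ?case using h0 diff_closedD(1)[OF S] by (simp add: tensor_free_def)
  next
    case (incl x) then show ?case by (rule rels)
  next
    case (inv x)
    then have "Poly_Mapping.keys x \<subseteq> pairs" using relators_carrier carrier_free by blast
    then show ?case using inv rels[of x] neg diff_closedD(3)[OF S] by (simp add: tensor_free_def)
  next
    case (eng x y) then show ?case using hadd diff_closedD(4)[OF S] by (simp add: tensor_free_def)
  qed
qed

lemma null_induct_balanced:
  assumes h: "\<And>x y. h (x - y) = h x - h y"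
    and S: "diff_closed S"
    and left: "\<And>m m' n. m \<in> carrier M \<Longrightarrow> m' \<in> carrier M \<Longrightarrow> n \<in> carrier N \<Longrightarrow>
       h (frag_of (m \<oplus>\<^bsub>M\<^esub> m', n)) - h (frag_of (m, n)) - h (frag_of (m', n)) \<in> S"
    and right: "\<And>m n n'. m \<in> carrier M \<Longrightarrow> n \<in> carrier N \<Longrightarrow> n' \<in> carrier N \<Longrightarrow>
       h (frag_of (m, n \<oplus>\<^bsub>N\<^esub> n')) - h (frag_of (m, n)) - h (frag_of (m, n')) \<in> S"
    and smult: "\<And>r m n. r \<in> carrier R \<Longrightarrow> m \<in> carrier M \<Longrightarrow> n \<in> carrier N \<Longrightarrow>
       h (frag_of (r \<odot>\<^bsub>M\<^esub> m, n)) - h (frag_of (m, r \<odot>\<^bsub>N\<^esub> n)) \<in> S"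
    and x: "x \<in> null"
  shows "h x \<in> S"
  using h S _ x
proof (rule null_induct)
  fix x assume "x \<in> tensor_relators R M N"
  then show "h x \<in> S" unfolding tensor_relators_def
    using left right smult by (auto simp: h)
qed

lemma cls_mem: "s \<in> cls x \<longleftrightarrow> s - x \<in> null"
  unfolding tensor_class_def r_coset_def tensor_free_def
  by (auto simp: algebra_simps) (metis add_diff_cancel_left' diff_add_cancel)

lemma cls_self [simp]: "x \<in> cls x"
  by (simp add: cls_mem)

lemma cls_eq_iff: "cls x = cls y \<longleftrightarrow> x - y \<in> null"
proof
  assume "cls x = cls y" then show "x - y \<in> null" using cls_self[of x] cls_mem by blast
next
  assume *: "x - y \<in> null"
  show "cls x = cls y"
    using null_trans[OF _ *] null_trans[OF _ null_sym[OF *]] by (auto simp: cls_mem)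
qed

lemma cls_eqI: "x - y \<in> null \<Longrightarrow> cls x = cls y"
  by (simp add: cls_eq_iff)

lemma cls_keys:
  assumes "s \<in> cls x" "Poly_Mapping.keys x \<subseteq> pairs"
  shows "Poly_Mapping.keys s \<subseteq> pairs"
  using assms null_keys[of "s - x"] keys_add_subset[of "s - x" pairs x] by (simp add: cls_mem)

lemma tensor_carrier: "X \<in> carrier (tensor R M N) \<longleftrightarrow> (\<exists>x. Poly_Mapping.keys x \<subseteq> pairs \<and> X = cls x)"
  unfolding tensor_def FactGroup_def RCOSETS_def tensor_class_def by (simp add: Bex_def carrier_free)

lemma cls_carrier: "Poly_Mapping.keys x \<subseteq> pairs \<Longrightarrow> cls x \<in> carrier (tensor R M N)"
  by (auto simp: tensor_carrier)

lemma tensor_carrierE: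
  assumes "X \<in> carrier (tensor R M N)"
  obtains x where "Poly_Mapping.keys x \<subseteq> pairs" "X = cls x"
  using assms by (auto simp: tensor_carrier)

lemma tensor_carrier_cls:
  assumes "X \<in> carrier (tensor R M N)" "x \<in> X" shows "X = cls x" "Poly_Mapping.keys x \<subseteq> pairs"
proof -
  obtain y where y: "Poly_Mapping.keys y \<subseteq> pairs" "X = cls y" using assms(1) by (rule tensor_carrierE)
  then show "X = cls x" using assms(2) by (simp add: cls_mem cls_eq_iff null_sym)
  show "Poly_Mapping.keys x \<subseteq> pairs" using cls_keys y assms(2) by blast
qed

lemma null_normal: "null \<lhd> tensor_free M N"
  by (rule comm_group.subgroup_imp_normal[OF _ null_subgroup])
     (simp add: tensor_free_def abelian_free_Abelian_group)

lemma tensor_comm_group: "comm_group (tensor R M N)"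
  unfolding tensor_def
  by (rule comm_group.abelian_FactGroup[OF _ null_subgroup])
     (simp add: tensor_free_def abelian_free_Abelian_group)

lemma tensor_mult:
  assumes "Poly_Mapping.keys x \<subseteq> pairs" "Poly_Mapping.keys y \<subseteq> pairs"
  shows "cls x \<otimes>\<^bsub>tensor R M N\<^esub> cls y = cls (x + y)"
  using normal.rcos_sum[OF null_normal, of x y] assms
  unfolding tensor_def tensor_class_def by (simp add: carrier_free tensor_free_def)

lemma tensor_one: "\<one>\<^bsub>tensor R M N\<^esub> = cls 0"
proof -
  have "cls 0 = null" using cls_mem[of _ 0] by auto
  then show ?thesis by (simp add: tensor_def)
qed

lemma tensor_inv:
  assumes "Poly_Mapping.keys x \<subseteq> pairs"
  shows "inv\<^bsub>tensor R M N\<^esub> (cls x) = cls (- x)"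
proof -
  interpret T: comm_group "tensor R M N" by (rule tensor_comm_group)
  show ?thesis
    by (rule T.inv_equality) (use assms in \<open>auto simp: tensor_mult cls_carrier tensor_one\<close>)
qed

lemma tensor_diff:
  assumes "Poly_Mapping.keys x \<subseteq> pairs" "Poly_Mapping.keys y \<subseteq> pairs"
  shows "cls x \<otimes>\<^bsub>tensor R M N\<^esub> inv\<^bsub>tensor R M N\<^esub> (cls y) = cls (x - y)"
  using assms by (simp add: tensor_inv tensor_mult)

end

lemma fmap2_null:
  assumes "tensor_pair R M N" "tensor_pair R' M' N'"
    and f: "\<And>m. m \<in> carrier M \<Longrightarrow> f m \<in> carrier M'"
      "\<And>m m'. m \<in> carrier M \<Longrightarrow> m' \<in> carrier M \<Longrightarrow> f (m \<oplus>\<^bsub>M\<^esub> m') = f m \<oplus>\<^bsub>M'\<^esub> f m'"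
    and g: "\<And>n. n \<in> carrier N \<Longrightarrow> g n \<in> carrier N'"
      "\<And>n n'. n \<in> carrier N \<Longrightarrow> n' \<in> carrier N \<Longrightarrow> g (n \<oplus>\<^bsub>N\<^esub> n') = g n \<oplus>\<^bsub>N'\<^esub> g n'"
    and bal: "\<And>r m n. r \<in> carrier R \<Longrightarrow> m \<in> carrier M \<Longrightarrow> n \<in> carrier N \<Longrightarrow>
       frag_of (f (r \<odot>\<^bsub>M\<^esub> m), g n) - frag_of (f m, g (r \<odot>\<^bsub>N\<^esub> n)) \<in> tensor_null R' M' N'"
    and x: "x \<in> tensor_null R M N"
  shows "fmap2 f g x \<in> tensor_null R' M' N'"
proof -
  interpret A: tensor_pair R M N by fact
  interpret B: tensor_pair R' M' N' by fact
  show ?thesis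
    by (rule A.null_induct_balanced[OF _ B.null_diff_closed _ _ _ x])
       (use f g bal in \<open>auto intro!: B.rel_left B.rel_right\<close>)
qed

text \<open>\<open>tensor_map\<close> collects the cosets of the images of all representatives; they
  agree because \<open>fmap2 f g\<close> respects the null subgroups. Afterwards one representative
  is enough.\<close>

lemma tensor_map_cls:
  assumes "tensor_pair R M N" "tensor_pair R' M' N'"
    and keys: "Poly_Mapping.keys x \<subseteq> carrier M \<times> carrier N"
    and null: "\<And>x. x \<in> tensor_null R M N \<Longrightarrow> fmap2 f g x \<in> tensor_null R' M' N'"
  shows "tensor_map R' M' N' f g (tensor_class R M N x) = tensor_class R' M' N' (fmap2 f g x)"
proof -
  interpret A: tensor_pair R M N by fact
  interpret B: tensor_pair R' M' N' by fact
  show ?thesis (is "?l = ?r")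
  proof (intro equalityI subsetI)
    fix s assume "s \<in> ?l"
    then obtain n t where nt: "n \<in> tensor_null R' M' N'" "t \<in> A.cls x" "s = n + fmap2 f g t"
      unfolding tensor_map_def set_mult_def fmap2_def[symmetric] by (auto simp: tensor_free_def)
    have "fmap2 f g t - fmap2 f g x \<in> tensor_null R' M' N'"
      using null[of "t - x"] nt(2) by (simp add: A.cls_mem)
    then show "s \<in> ?r" using B.null_add[OF nt(1)] unfolding nt(3) B.cls_mem
      by (metis add_diff_eq)
  next
    fix s assume "s \<in> ?r"
    then have "s - fmap2 f g x \<in> tensor_null R' M' N'" by (simp add: B.cls_mem)
    then show "s \<in> ?l"
      unfolding tensor_map_def set_mult_def fmap2_def[symmetric]
      using A.cls_self[of x] by (auto simp: tensor_free_def intro!: bexI[of _ "s - fmap2 f g x"] bexI[of _ x])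
  qed
qed

section \<open>Completion of ultrametric groups\<close>

text \<open>A seminorm, so distinct elements may be at distance 0. Definiteness is asked for
  separately in \<open>completion_lift_eq\<close>, where a limit has to be unique.\<close>

locale ultra_group = comm_group G for G :: "'a monoid" (structure) +
  fixes nrm :: "'a \<Rightarrow> real"
  assumes nrm_nonneg: "x \<in> carrier G \<Longrightarrow> 0 \<le> nrm x"
    and nrm_one: "nrm \<one> = 0"
    and nrm_diff: "x \<in> carrier G \<Longrightarrow> y \<in> carrier G \<Longrightarrow> nrm (x \<otimes> inv y) \<le> max (nrm x) (nrm y)"
begin

abbreviation "seqcls X \<equiv> null_rel G nrm `` {X}"

lemma nrm_inv: "y \<in> carrier G \<Longrightarrow> nrm (inv y) = nrm y"
  using nrm_diff[of \<one> y] nrm_diff[of \<one> "inv y"] nrm_nonneg[of y] nrm_nonneg[of "inv y"]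
  by (simp add: nrm_one max_def split: if_splits)

lemma nrm_mult: "x \<in> carrier G \<Longrightarrow> y \<in> carrier G \<Longrightarrow> nrm (x \<otimes> y) \<le> max (nrm x) (nrm y)"
  using nrm_diff[of x "inv y"] by (simp add: nrm_inv)

lemma null_seq_mult:
  assumes "\<And>n. X n \<in> carrier G" "\<And>n. Y n \<in> carrier G"
    "(\<lambda>n. nrm (X n)) \<longlonglongrightarrow> 0" "(\<lambda>n. nrm (Y n)) \<longlonglongrightarrow> 0"
  shows "(\<lambda>n. nrm (X n \<otimes> Y n)) \<longlonglongrightarrow> 0"
proof (rule tendsto_sandwich[of "\<lambda>_. 0" _ _ "\<lambda>n. nrm (X n) + nrm (Y n)"])
  show "\<forall>\<^sub>F n in sequentially. nrm (X n \<otimes> Y n) \<le> nrm (X n) + nrm (Y n)"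
  proof (rule always_eventually, rule allI)
    fix n
    show "nrm (X n \<otimes> Y n) \<le> nrm (X n) + nrm (Y n)"
      using nrm_mult[OF assms(1,2), of n n] nrm_nonneg[OF assms(1), of n] nrm_nonneg[OF assms(2), of n]
      by linarith
  qed
  show "(\<lambda>n. nrm (X n) + nrm (Y n)) \<longlonglongrightarrow> 0"
    using tendsto_add[OF assms(3,4)] by simp
qed (use assms nrm_nonneg in auto)

lemma cauchy_mem:
  "X \<in> cauchy_seqs G nrm \<longleftrightarrow> (\<forall>n. X n \<in> carrier G) \<and>
     (\<forall>e>0. \<exists>N. \<forall>m\<ge>N. \<forall>n\<ge>N. nrm (X m \<otimes> inv X n) < e)"
  by (simp add: cauchy_seqs_def)

lemma cauchy_carrier: "X \<in> cauchy_seqs G nrm \<Longrightarrow> X n \<in> carrier G"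
  by (simp add: cauchy_mem)

lemma cauchy_diff:
  assumes "X \<in> cauchy_seqs G nrm" "Y \<in> cauchy_seqs G nrm"
  shows "(\<lambda>n. X n \<otimes> inv Y n) \<in> cauchy_seqs G nrm"
proof -
  have "\<exists>N. \<forall>m\<ge>N. \<forall>n\<ge>N. nrm ((X m \<otimes> inv Y m) \<otimes> inv (X n \<otimes> inv Y n)) < e" if e: "e > 0" for e
  proof -
    obtain N1 where N1: "\<And>m n. m \<ge> N1 \<Longrightarrow> n \<ge> N1 \<Longrightarrow> nrm (X m \<otimes> inv X n) < e"
      using assms(1) e unfolding cauchy_mem by blast
    obtain N2 where N2: "\<And>m n. m \<ge> N2 \<Longrightarrow> n \<ge> N2 \<Longrightarrow> nrm (Y m \<otimes> inv Y n) < e"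
      using assms(2) e unfolding cauchy_mem by blast
    have "nrm ((X m \<otimes> inv Y m) \<otimes> inv (X n \<otimes> inv Y n)) < e" if "m \<ge> max N1 N2" "n \<ge> max N1 N2" for m n
    proof -
      have "(X m \<otimes> inv Y m) \<otimes> inv (X n \<otimes> inv Y n) = (X m \<otimes> inv X n) \<otimes> inv (Y m \<otimes> inv Y n)"
        using assms by (simp add: cauchy_carrier inv_mult m_ac)
      then show ?thesis
        using nrm_diff[of "X m \<otimes> inv X n" "Y m \<otimes> inv Y n"] N1[of m n] N2[of m n] that
          assms by (simp add: cauchy_carrier)
    qed
    then show ?thesis by blast
  qed
  then show ?thesis using assms by (simp add: cauchy_mem)
qed

lemma cauchy_const: "x \<in> carrier G \<Longrightarrow> (\<lambda>n. x) \<in> cauchy_seqs G nrm"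
  by (simp add: cauchy_mem nrm_one)

lemma cauchy_inv: "X \<in> cauchy_seqs G nrm \<Longrightarrow> (\<lambda>n. inv X n) \<in> cauchy_seqs G nrm"
  using cauchy_diff[OF cauchy_const[OF one_closed]] by (auto simp: cauchy_carrier)

lemma cauchy_mult:
  assumes "X \<in> cauchy_seqs G nrm" "Y \<in> cauchy_seqs G nrm"
  shows "(\<lambda>n. X n \<otimes> Y n) \<in> cauchy_seqs G nrm"
  using cauchy_diff[OF assms(1) cauchy_inv[OF assms(2)]] assms by (simp add: cauchy_carrier)

lemma null_rel_iff:
  "(X, Y) \<in> null_rel G nrm \<longleftrightarrow> X \<in> cauchy_seqs G nrm \<and> Y \<in> cauchy_seqs G nrm \<and>
     (\<lambda>n. nrm (X n \<otimes> inv Y n)) \<longlonglongrightarrow> 0"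
  by (simp add: null_rel_def)

lemma null_rel_equiv: "equiv (cauchy_seqs G nrm) (null_rel G nrm)"
proof (rule equivI)
  show "refl_on (cauchy_seqs G nrm) (null_rel G nrm)"
    by (auto simp: refl_on_def null_rel_iff cauchy_carrier nrm_one)
  show "null_rel G nrm \<subseteq> cauchy_seqs G nrm \<times> cauchy_seqs G nrm"
    by (auto simp: null_rel_iff)
  show "sym (null_rel G nrm)"
  proof (rule symI)
    fix X Y assume *: "(X, Y) \<in> null_rel G nrm"
    have "nrm (Y n \<otimes> inv X n) = nrm (X n \<otimes> inv Y n)" for n
      using nrm_inv[of "X n \<otimes> inv Y n"] * by (simp add: null_rel_iff cauchy_carrier inv_mult m_comm)
    then show "(Y, X) \<in> null_rel G nrm" using * by (simp add: null_rel_iff)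
  qed
  show "trans (null_rel G nrm)"
  proof (rule transI)
    fix X Y Z assume *: "(X, Y) \<in> null_rel G nrm" "(Y, Z) \<in> null_rel G nrm"
    have "(X n \<otimes> inv Y n) \<otimes> (Y n \<otimes> inv Z n) = X n \<otimes> inv Z n" for n
    proof -
      have "X n \<in> carrier G" "Y n \<in> carrier G" "Z n \<in> carrier G"
        using * by (auto simp: null_rel_iff cauchy_carrier)
      then show ?thesis by (metis inv_closed inv_solve_left m_assoc m_closed)
    qed
    then show "(X, Z) \<in> null_rel G nrm"
      using null_seq_mult[of "\<lambda>n. X n \<otimes> inv Y n" "\<lambda>n. Y n \<otimes> inv Z n"] *
      by (simp add: null_rel_iff cauchy_carrier)
  qed
qed

lemma seqcls_eq_iff:
  assumes "X \<in> cauchy_seqs G nrm" "Y \<in> cauchy_seqs G nrm"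
  shows "seqcls X = seqcls Y \<longleftrightarrow> (\<lambda>n. nrm (X n \<otimes> inv Y n)) \<longlonglongrightarrow> 0"
  using eq_equiv_class_iff[OF null_rel_equiv assms] assms by (simp add: null_rel_iff)

lemma seqcls_memD:
  assumes "Y \<in> seqcls X" shows "X \<in> cauchy_seqs G nrm" "Y \<in> cauchy_seqs G nrm"
    "seqcls Y = seqcls X" "(\<lambda>n. nrm (X n \<otimes> inv Y n)) \<longlonglongrightarrow> 0"
proof -
  show *: "X \<in> cauchy_seqs G nrm" "Y \<in> cauchy_seqs G nrm" "(\<lambda>n. nrm (X n \<otimes> inv Y n)) \<longlonglongrightarrow> 0"
    using assms by (auto simp: null_rel_iff)
  show "seqcls Y = seqcls X" using seqcls_eq_iff[OF *(1,2)] *(3) by simp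
qed

lemma seqcls_self: "X \<in> cauchy_seqs G nrm \<Longrightarrow> X \<in> seqcls X"
  by (simp add: null_rel_iff cauchy_carrier nrm_one)

lemma completion_carrier: "W \<in> carrier (completion G nrm) \<longleftrightarrow> (\<exists>X\<in>cauchy_seqs G nrm. W = seqcls X)"
  by (auto simp: completion_def quotient_def)

lemma completion_mult:
  assumes "X \<in> cauchy_seqs G nrm" "Y \<in> cauchy_seqs G nrm"
  shows "seqcls X \<otimes>\<^bsub>completion G nrm\<^esub> seqcls Y = seqcls (\<lambda>n. X n \<otimes> Y n)"
proof -
  have eq: "seqcls (\<lambda>n. X' n \<otimes> Y' n) = seqcls (\<lambda>n. X n \<otimes> Y n)"
    if "X' \<in> seqcls X" "Y' \<in> seqcls Y" for X' Y'
  proof -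
    note X' = seqcls_memD[OF that(1)] and Y' = seqcls_memD[OF that(2)]
    have "(X n \<otimes> inv X' n) \<otimes> (Y n \<otimes> inv Y' n) = (X n \<otimes> Y n) \<otimes> inv (X' n \<otimes> Y' n)" for n
      using X' Y' by (simp add: cauchy_carrier inv_mult m_ac)
    then have "seqcls (\<lambda>n. X n \<otimes> Y n) = seqcls (\<lambda>n. X' n \<otimes> Y' n)"
      using null_seq_mult[OF _ _ X'(4) Y'(4)] X' Y'
      by (simp add: seqcls_eq_iff cauchy_mult cauchy_carrier)
    then show ?thesis by simp
  qed
  have "seqcls X \<otimes>\<^bsub>completion G nrm\<^esub> seqcls Y = (\<Union>X'\<in>seqcls X. \<Union>Y'\<in>seqcls Y. seqcls (\<lambda>n. X n \<otimes> Y n))"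
    unfolding completion_def using eq by simp
  also have "\<dots> = seqcls (\<lambda>n. X n \<otimes> Y n)"
  proof -
    have ne: "seqcls X \<noteq> {}" "seqcls Y \<noteq> {}"
      using seqcls_self[OF assms(1)] seqcls_self[OF assms(2)] by blast+
    show ?thesis by (simp only: UN_constant ne if_False)
  qed
  finally show ?thesis .
qed

lemma completion_one: "\<one>\<^bsub>completion G nrm\<^esub> = seqcls (\<lambda>n. \<one>)"
  by (simp add: completion_def)

lemma completion_comm_group: "comm_group (completion G nrm)"
proof (rule comm_groupI)
  show "x \<otimes>\<^bsub>completion G nrm\<^esub> y \<in> carrier (completion G nrm)"
    if "x \<in> carrier (completion G nrm)" "y \<in> carrier (completion G nrm)" for x y
  proof -
    obtain X Y where "X \<in> cauchy_seqs G nrm" "x = seqcls X" "Y \<in> cauchy_seqs G nrm" "y = seqcls Y"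
      using \<open>x \<in> _\<close> \<open>y \<in> _\<close> unfolding completion_carrier by blast
    then show ?thesis unfolding completion_carrier by (auto simp: completion_mult intro: cauchy_mult)
  qed
  show "\<one>\<^bsub>completion G nrm\<^esub> \<in> carrier (completion G nrm)"
    unfolding completion_carrier completion_one using cauchy_const[OF one_closed] by blast
  fix x assume "x \<in> carrier (completion G nrm)"
  then obtain X where X: "X \<in> cauchy_seqs G nrm" "x = seqcls X" by (auto simp: completion_carrier)
  show "\<exists>y\<in>carrier (completion G nrm). y \<otimes>\<^bsub>completion G nrm\<^esub> x = \<one>\<^bsub>completion G nrm\<^esub>"
  proof
    show "seqcls (\<lambda>n. inv X n) \<in> carrier (completion G nrm)"
      using X cauchy_inv completion_carrier by blast
  qed (use X in \<open>simp add: completion_mult cauchy_inv completion_one cauchy_carrier\<close>)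
  show "\<one>\<^bsub>completion G nrm\<^esub> \<otimes>\<^bsub>completion G nrm\<^esub> x = x"
    using X by (simp add: completion_one completion_mult cauchy_const cauchy_carrier)
  fix y assume "y \<in> carrier (completion G nrm)"
  then obtain Y where Y: "Y \<in> cauchy_seqs G nrm" "y = seqcls Y" by (auto simp: completion_carrier)
  show "x \<otimes>\<^bsub>completion G nrm\<^esub> y = y \<otimes>\<^bsub>completion G nrm\<^esub> x"
    using X Y by (simp add: completion_mult cauchy_carrier m_comm)
  fix w assume "w \<in> carrier (completion G nrm)"
  then obtain W where W: "W \<in> cauchy_seqs G nrm" "w = seqcls W" by (auto simp: completion_carrier)
  show "x \<otimes>\<^bsub>completion G nrm\<^esub> y \<otimes>\<^bsub>completion G nrm\<^esub> w = x \<otimes>\<^bsub>completion G nrm\<^esub> (y \<otimes>\<^bsub>completion G nrm\<^esub> w)"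
    using X Y W by (simp add: completion_mult cauchy_carrier cauchy_mult m_assoc)
qed

lemma completion_inv:
  assumes "X \<in> cauchy_seqs G nrm"
  shows "inv\<^bsub>completion G nrm\<^esub> (seqcls X) = seqcls (\<lambda>n. inv X n)"
proof -
  interpret C: comm_group "completion G nrm" by (rule completion_comm_group)
  show ?thesis
  proof (rule C.inv_equality)
    show "seqcls (\<lambda>n. inv X n) \<in> carrier (completion G nrm)" "seqcls X \<in> carrier (completion G nrm)"
      using assms cauchy_inv completion_carrier by blast+
  qed (use assms in \<open>simp add: completion_mult completion_one cauchy_inv cauchy_carrier\<close>)
qed

end

text \<open>For a homomorphism, continuity at the identity is uniform continuity, since differences
  are mapped to differences.\<close>

lemma ultra_uniform:
  assumes "ultra_group G nrm" "ultra_group G' nrm'" and h: "h \<in> hom G G'"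
    and cont: "\<forall>e>0. \<exists>d>0. \<forall>x\<in>carrier G. nrm x < d \<longrightarrow> nrm' (h x) < e"
    and X: "X \<in> cauchy_seqs G nrm"
  shows "(\<lambda>n. h (X n)) \<in> cauchy_seqs G' nrm'"
    and "Y \<in> null_rel G nrm `` {X} \<Longrightarrow> (\<lambda>n. nrm' (h (X n) \<otimes>\<^bsub>G'\<^esub> inv\<^bsub>G'\<^esub> h (Y n))) \<longlonglongrightarrow> 0"
proof -
  interpret A: ultra_group G nrm by fact
  interpret B: ultra_group G' nrm' by fact
  interpret h: group_hom G G' h by unfold_locales (rule h)
  have hd: "h (x \<otimes>\<^bsub>G\<^esub> inv\<^bsub>G\<^esub> y) = h x \<otimes>\<^bsub>G'\<^esub> inv\<^bsub>G'\<^esub> h y" if "x \<in> carrier G" "y \<in> carrier G" for x y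
    using that by simp
  have *: "\<exists>N. \<forall>m\<ge>N. \<forall>n\<ge>N. nrm' (h (X m) \<otimes>\<^bsub>G'\<^esub> inv\<^bsub>G'\<^esub> h (X n)) < e" if e: "e > 0" for e
  proof -
    obtain d where d: "d > 0" "\<And>x. x \<in> carrier G \<Longrightarrow> nrm x < d \<Longrightarrow> nrm' (h x) < e" using cont[rule_format, OF e] by blast
    obtain N where N: "\<And>m n. m \<ge> N \<Longrightarrow> n \<ge> N \<Longrightarrow> nrm (X m \<otimes>\<^bsub>G\<^esub> inv\<^bsub>G\<^esub> X n) < d"
      using X d(1) unfolding A.cauchy_mem by blast
    have "nrm' (h (X m) \<otimes>\<^bsub>G'\<^esub> inv\<^bsub>G'\<^esub> h (X n)) < e" if "m \<ge> N" "n \<ge> N" for m n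
      using d(2)[OF _ N[OF that]] hd[of "X m" "X n"] A.cauchy_carrier[OF X] by simp
    then show ?thesis by blast
  qed
  then show "(\<lambda>n. h (X n)) \<in> cauchy_seqs G' nrm'" using X by (auto simp: B.cauchy_mem A.cauchy_carrier)
  assume "Y \<in> null_rel G nrm `` {X}"
  note Y = A.seqcls_memD[OF this]
  show "(\<lambda>n. nrm' (h (X n) \<otimes>\<^bsub>G'\<^esub> inv\<^bsub>G'\<^esub> h (Y n))) \<longlonglongrightarrow> 0"
  proof (rule LIMSEQ_I)
    fix e :: real assume e: "e > 0"
    obtain d where d: "d > 0" "\<And>x. x \<in> carrier G \<Longrightarrow> nrm x < d \<Longrightarrow> nrm' (h x) < e"
      using cont[rule_format, OF e] by blast
    obtain N where N: "\<And>n. n \<ge> N \<Longrightarrow> nrm (X n \<otimes>\<^bsub>G\<^esub> inv\<^bsub>G\<^esub> Y n) < d"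
      using LIMSEQ_D[OF Y(4) d(1)] by (force simp: abs_less_iff)
    have "norm (nrm' (h (X n) \<otimes>\<^bsub>G'\<^esub> inv\<^bsub>G'\<^esub> h (Y n)) - 0) < e" if "n \<ge> N" for n
      using d(2)[OF _ N[OF that]] B.nrm_nonneg hd[of "X n" "Y n"] X Y(2)
      by (simp add: A.cauchy_carrier)
    then show "\<exists>N. \<forall>n\<ge>N. norm (nrm' (h (X n) \<otimes>\<^bsub>G'\<^esub> inv\<^bsub>G'\<^esub> h (Y n)) - 0) < e" by blast
  qed
qed

lemma completion_map_seqcls:
  assumes "ultra_group G nrm" "ultra_group G' nrm'" and h: "h \<in> hom G G'"
    and cont: "\<forall>e>0. \<exists>d>0. \<forall>x\<in>carrier G. nrm x < d \<longrightarrow> nrm' (h x) < e"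
    and X: "X \<in> cauchy_seqs G nrm"
  shows "completion_map G' nrm' h (null_rel G nrm `` {X}) = null_rel G' nrm' `` {\<lambda>n. h (X n)}"
proof -
  interpret A: ultra_group G nrm by fact
  interpret B: ultra_group G' nrm' by fact
  note uni = ultra_uniform[of G nrm G' nrm' h, OF assms(1,2) h cont]
  have "null_rel G' nrm' `` {\<lambda>n. h (Y n)} = null_rel G' nrm' `` {\<lambda>n. h (X n)}"
    if "Y \<in> A.seqcls X" for Y
    using B.seqcls_eq_iff[OF uni(1)[OF X] uni(1)[OF A.seqcls_memD(2)[OF that]]] uni(2)[OF X that] by simp
  then have "completion_map G' nrm' h (A.seqcls X) = (\<Union>Y\<in>A.seqcls X. B.seqcls (\<lambda>n. h (X n)))"
    unfolding completion_map_def by (rule SUP_cong[OF refl])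
  moreover have "A.seqcls X \<noteq> {}" using A.seqcls_self[OF X] by blast
  ultimately show ?thesis by (simp only: UN_constant if_False)
qed

text \<open>The limit \<open>g\<close> is exhibited by the caller, so completeness of the target
  does not have to be proved; definiteness makes \<open>g\<close> the only candidate, as the
  definite description requires.\<close>

lemma completion_lift_eq:
  fixes G (structure)
  assumes "ultra_group G nrm" and definite: "\<And>x. x \<in> carrier G \<Longrightarrow> nrm x = 0 \<Longrightarrow> x = \<one>\<^bsub>G\<^esub>"
    and g: "g \<in> carrier G" and h: "\<And>X n. X \<in> S \<Longrightarrow> h (X n) \<in> carrier G"
    and lim: "\<And>X. X \<in> S \<Longrightarrow> (\<lambda>n. nrm (h (X n) \<otimes>\<^bsub>G\<^esub> inv\<^bsub>G\<^esub> g)) \<longlonglongrightarrow> 0" and ne: "S \<noteq> {}"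
  shows "completion_lift G nrm h S = g"
  unfolding completion_lift_def
proof (rule the_equality)
  interpret ultra_group G nrm by fact
  show "g \<in> carrier G \<and> (\<forall>X\<in>S. (\<lambda>n. nrm (h (X n) \<otimes>\<^bsub>G\<^esub> inv\<^bsub>G\<^esub> g)) \<longlonglongrightarrow> 0)" using g lim by blast
  fix g' assume g': "g' \<in> carrier G \<and> (\<forall>X\<in>S. (\<lambda>n. nrm (h (X n) \<otimes>\<^bsub>G\<^esub> inv\<^bsub>G\<^esub> g')) \<longlonglongrightarrow> 0)"
  obtain X where X: "X \<in> S" using ne by blast
  have "(\<lambda>n. nrm (h (X n) \<otimes>\<^bsub>G\<^esub> inv\<^bsub>G\<^esub> g \<otimes>\<^bsub>G\<^esub> inv\<^bsub>G\<^esub> (h (X n) \<otimes>\<^bsub>G\<^esub> inv\<^bsub>G\<^esub> g'))) \<longlonglongrightarrow> 0"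
    by (rule null_seq_mult) (use X h g g' lim[OF X] in \<open>auto simp: nrm_inv\<close>)
  moreover have "h (X n) \<otimes>\<^bsub>G\<^esub> inv\<^bsub>G\<^esub> g \<otimes>\<^bsub>G\<^esub> inv\<^bsub>G\<^esub> (h (X n) \<otimes>\<^bsub>G\<^esub> inv\<^bsub>G\<^esub> g') = g' \<otimes>\<^bsub>G\<^esub> inv\<^bsub>G\<^esub> g" for n
  proof -
    let ?a = "h (X n)"
    have a: "?a \<in> carrier G" using h X by blast
    have "?a \<otimes> inv g \<otimes> inv (?a \<otimes> inv g') = (?a \<otimes> inv ?a) \<otimes> (g' \<otimes> inv g)"
      using a g g' by (simp add: inv_mult m_ac del: r_inv)
    then show ?thesis using a g g' by simp
  qed
  ultimately have "nrm (g' \<otimes> inv g) = 0" by (simp add: LIMSEQ_const_iff)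
  then have "g' \<otimes> inv g = \<one>" using definite g g' by simp
  then show "g' = g" using g g' by (metis inv_closed inv_equality inv_inv)
qed

section \<open>Ultrametric norms\<close>

lemma absval_0 [simp]: "absval (0 :: 'c::complete_ultrametric_field) = 0"
  using dist_absval[of 0 0] by simp

lemma absval_nonneg [simp]: "absval (x :: 'c::complete_ultrametric_field) \<ge> 0"
  using dist_absval[of x 0] zero_le_dist[of x 0] by simp

lemma absval_eq_0 [simp]: "absval (x :: 'c::complete_ultrametric_field) = 0 \<longleftrightarrow> x = 0"
  using dist_absval[of x 0] dist_eq_0_iff[of x 0] by simp

lemma absval_pos_iff [simp]: "absval (x :: 'c::complete_ultrametric_field) > 0 \<longleftrightarrow> x \<noteq> 0"
  using absval_nonneg[of x] absval_eq_0[of x] by linarith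

lemma absval_1 [simp]: "absval (1 :: 'c::complete_ultrametric_field) = 1"
  using absval_mult[of 1 1] absval_eq_0[of 1] by simp

lemma absval_minus [simp]: "absval (- x :: 'c::complete_ultrametric_field) = absval x"
  using dist_absval[of x 0] dist_absval[of 0 x] dist_commute[of x 0] by simp

lemma absval_power: "absval (x ^ n :: 'c::complete_ultrametric_field) = absval x ^ n"
  by (induction n) (simp_all add: absval_mult)

lemma absval_diff: "absval (x - y :: 'c::complete_ultrametric_field) \<le> max (absval x) (absval y)"
  using absval_ultra[of x "- y"] by simp

lemma absval_inverse: "absval (inverse x :: 'c::complete_ultrametric_field) = inverse (absval x)"
proof (cases "x = 0")
  case False
  then have "absval x * absval (inverse x) = 1" using absval_mult[of x "inverse x"] by simp
  then show ?thesis by (metis inverse_unique)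
qed simp

lemma absval_divide: "absval (x / y :: 'c::complete_ultrametric_field) = absval x / absval y"
  by (simp add: divide_inverse absval_mult absval_inverse)

lemma absval_sum_le:
  fixes f :: "'i \<Rightarrow> 'c::complete_ultrametric_field"
  assumes "\<And>i. i \<in> I \<Longrightarrow> absval (f i) \<le> B" "B \<ge> 0"
  shows "absval (sum f I) \<le> B"
  using assms(1)
proof (induction I rule: infinite_finite_induct)
  case (insert i I)
  have "absval (f i) \<le> B" "absval (sum f I) \<le> B" using insert by auto
  then show ?case using absval_ultra[of "f i" "sum f I"] insert(1,2) by simp
qed (use assms in auto)

abbreviation vsn :: "'c::complete_ultrametric_field^'d::finite \<Rightarrow> real" where
  "vsn \<equiv> vec_sup_norm"

lemma vsn_le_iff: "vsn v \<le> B \<longleftrightarrow> (\<forall>i. absval (v $ i) \<le> B)"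
  unfolding vec_sup_norm_def by (subst Max_le_iff) auto

lemma vsn_comp: "absval (v $ i) \<le> vsn v"
  using vsn_le_iff[of v "vsn v"] by simp

lemma vsn_nonneg [simp]: "vsn v \<ge> 0"
  using vsn_comp[of v undefined] absval_nonneg order_trans by blast

lemma vsn_0 [simp]: "vsn 0 = 0"
  by (rule order_antisym) (simp_all add: vsn_le_iff)

lemma vsn_minus [simp]: "vsn (- v) = vsn v"
  by (simp add: vec_sup_norm_def)

lemma vsn_add: "vsn (v + w) \<le> max (vsn v) (vsn w)"
  unfolding vsn_le_iff
proof
  fix i
  have "absval ((v + w) $ i) \<le> max (absval (v $ i)) (absval (w $ i))" by (simp add: absval_ultra)
  also have "\<dots> \<le> max (vsn v) (vsn w)" by (intro max.mono vsn_comp)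
  finally show "absval ((v + w) $ i) \<le> max (vsn v) (vsn w)" .
qed

lemma vsn_smult: "vsn (c *s v) \<le> absval c * vsn v"
  unfolding vsn_le_iff by (simp add: absval_mult mult_left_mono vsn_comp)

lemma vsn_eq_0: "vsn v = 0 \<Longrightarrow> v = 0"
  using vsn_comp[of v] by (metis absval_nonneg absval_eq_0 order_antisym vec_eq_iff zero_index)

lemma vsn_matrix_le:
  assumes "\<And>i j. absval (M $ i $ j) \<le> C"
  shows "vsn (M *v x) \<le> C * vsn x"
proof -
  have C: "C \<ge> 0" using assms[of undefined undefined] absval_nonneg order_trans by blast
  have "absval ((M *v x) $ i) \<le> C * vsn x" for i
    unfolding matrix_vector_mult_def vec_lambda_beta
    by (rule absval_sum_le) (auto simp: absval_mult C intro!: mult_mono assms vsn_comp)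
  then show ?thesis by (simp add: vsn_le_iff)
qed

lemma vsn_matrix_bound: "\<exists>C>0. \<forall>x. vsn (M *v x) \<le> C * vsn x"
proof -
  let ?S = "range (\<lambda>(i, j). absval (M $ i $ j))"
  have "absval (M $ i $ j) \<le> Max ?S" for i j by (rule Max_ge) auto
  \<comment> \<open>The maximum with 1 keeps the constant positive, because radii are later divided
    by it.\<close>
  then have "absval (M $ i $ j) \<le> max 1 (Max ?S)" for i j
    by (meson le_max_iff_disj)
  then show ?thesis using vsn_matrix_le[of M] by (intro exI[of _ "max 1 (Max ?S)"]) auto
qed

lemma module_on_simps [simp]:
  "carrier (module_on sm S) = S" "add (module_on sm S) = (+)" "ring.zero (module_on sm S) = 0"
  "module.smult (module_on sm S) = sm"
  by (simp_all add: module_on_def)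

lemma alg_on_simps [simp]:
  "carrier (alg_on S) = S" "add (alg_on S) = (+)" "ring.zero (alg_on S) = 0"
  "module.smult (alg_on S) = (*)" "monoid.mult (alg_on S) = (*)" "one (alg_on S) = 1"
  by (simp_all add: alg_on_def)

lemma ring_on_simps [simp]:
  "carrier (ring_on S) = S" "add (ring_on S) = (+)" "ring.zero (ring_on S) = 0"
  "monoid.mult (ring_on S) = (*)" "one (ring_on S) = 1"
  by (simp_all add: ring_on_def)

lemma abelian_group_on:
  assumes "diff_closed S" "carrier M = S" "add M = (+)" "ring.zero M = 0"
  shows "abelian_group M"
proof (rule abelian_groupI)
  fix x assume "x \<in> carrier M"
  then show "\<exists>y\<in>carrier M. y \<oplus>\<^bsub>M\<^esub> x = \<zero>\<^bsub>M\<^esub>"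
    using diff_closedD(3)[OF assms(1)] by (intro bexI[of _ "- x"]) (simp_all add: assms(2-4))
qed (use diff_closedD[OF assms(1)] in \<open>simp_all add: assms(2-4) algebra_simps\<close>)

lemma a_inv_on:
  assumes "diff_closed S" "carrier M = S" "add M = (+)" "ring.zero M = 0" "x \<in> S"
  shows "\<ominus>\<^bsub>M\<^esub> x = - x"
  by (rule abelian_group.minus_equality[OF abelian_group_on[OF assms(1-4)]])
     (use assms diff_closedD[OF assms(1)] in auto)

lemma diff_closed_UNIV: "diff_closed UNIV"
  by (simp add: diff_closed_def)

section \<open>The tensor norm described by its balls\<close>

locale tensor_V = tensor_pair R M N
  for R :: "'c::complete_ultrametric_field ring" and M :: "('c, 'm) module"
    and N :: "('c, 'c^'d::finite) module" +
  assumes N_def: "N = coord_space"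
begin

lemma N_simps [simp]: "carrier N = UNIV" "add N = (+)" "ring.zero N = 0" "module.smult N = (*s)"
  by (simp_all add: N_def)

abbreviation "tnorm \<equiv> tensor_norm M N vsn"

text \<open>The ball of radius \<open>e\<close> of the tensor norm, on the level of formal sums.
  Balls are additive subgroups, so estimates reduce to single tensors (\<open>small_induct\<close>)
  and the infimum is never computed.\<close>

definition small :: "real \<Rightarrow> ('m \<times> ('c^'d) \<Rightarrow>\<^sub>0 int) set" where
  "small e = {x. \<exists>ps. set ps \<subseteq> pairs \<and> (\<forall>p\<in>set ps. vsn (snd p) < e) \<and>
     sum_list (map frag_of ps) - x \<in> null}"

lemma neg_frag: "m \<in> carrier M \<Longrightarrow> - frag_of (m, v) - frag_of (m, - v) \<in> null"
  using null_minus[OF neg_right[of m v]]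
  by (simp add: a_inv_on[OF diff_closed_UNIV N_simps(1-3)] algebra_simps)

lemma keys_sum_list:
  assumes "set ps \<subseteq> S" shows "Poly_Mapping.keys (sum_list (map frag_of ps)) \<subseteq> S"
  using assms by (induction ps) (auto intro!: keys_add_subset del: subsetI)

lemma small_keys: "x \<in> small e \<Longrightarrow> Poly_Mapping.keys x \<subseteq> pairs"
proof -
  assume "x \<in> small e"
  then obtain ps where ps: "set ps \<subseteq> pairs" "sum_list (map frag_of ps) - x \<in> null"
    by (auto simp: small_def)
  show ?thesis
    using keys_diff_subset[OF keys_sum_list[OF ps(1)] null_keys[OF ps(2)]] by simp
qed

lemma small_null: "x \<in> null \<Longrightarrow> x \<in> small e"
  unfolding small_def by (auto intro!: exI[of _ "[]"] null_minus)

lemma small_frag: "m \<in> carrier M \<Longrightarrow> vsn v < e \<Longrightarrow> frag_of (m, v) \<in> small e"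
  unfolding small_def by (auto intro!: exI[of _ "[(m, v)]"])

lemma small_mono: "x \<in> small e \<Longrightarrow> e \<le> e' \<Longrightarrow> x \<in> small e'"
  unfolding small_def by fastforce

lemma small_add:
  assumes "x \<in> small e" "y \<in> small e" shows "x + y \<in> small e"
proof -
  obtain ps qs where "set ps \<subseteq> pairs" "\<forall>p\<in>set ps. vsn (snd p) < e" "sum_list (map frag_of ps) - x \<in> null"
    "set qs \<subseteq> pairs" "\<forall>p\<in>set qs. vsn (snd p) < e" "sum_list (map frag_of qs) - y \<in> null"
    using assms unfolding small_def by blast
  then show ?thesis unfolding small_def
    using null_add2[of "sum_list (map frag_of ps)" x "sum_list (map frag_of qs)" y]
    by (intro CollectI exI[of _ "ps @ qs"]) auto
qed

lemma small_minus:
  assumes "x \<in> small e" shows "- x \<in> small e"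
proof -
  obtain ps where ps: "set ps \<subseteq> pairs" "\<forall>p\<in>set ps. vsn (snd p) < e" "sum_list (map frag_of ps) - x \<in> null"
    using assms unfolding small_def by blast
  have neg: "- sum_list (map frag_of qs) - sum_list (map frag_of (map (\<lambda>(m, v). (m, - v)) qs)) \<in> null"
    if "set qs \<subseteq> pairs" for qs
    using that
  proof (induction qs)
    case (Cons p qs)
    obtain m v where p: "p = (m, v)" by (cases p)
    have "- frag_of (m, v) - frag_of (m, - v) \<in> null" using Cons.prems p by (intro neg_frag) auto
    from null_add2[OF this Cons.IH] show ?case using Cons.prems p by (simp add: algebra_simps)
  qed simp
  have "- x - (- sum_list (map frag_of ps)) \<in> null" using ps(3) by (simp add: algebra_simps)
  from null_sym[OF null_trans[OF this neg[OF ps(1)]]]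
  show ?thesis unfolding small_def using ps(1,2)
    by (intro CollectI exI[of _ "map (\<lambda>(m, v). (m, - v)) ps"]) auto
qed

lemma small_diff_closed: "diff_closed (small e)"
  unfolding diff_closed_def
proof (intro conjI ballI)
  show "0 \<in> small e" by (rule small_null[OF null_0])
  show "x - y \<in> small e" if "x \<in> small e" "y \<in> small e" for x y
    using small_add[OF that(1) small_minus[OF that(2)]] by simp
qed

lemma small_exists:
  assumes "Poly_Mapping.keys x \<subseteq> pairs" shows "\<exists>e>0. x \<in> small e"
  using assms
proof (rule free_Abelian_group_induct)
  show "\<exists>e>0. 0 \<in> small e" using small_null[OF null_0] zero_less_one by blast
next
  fix x y assume "\<exists>e>0. x \<in> small e" "\<exists>e>0. y \<in> small e"
  then obtain e e' where "e > 0" "x \<in> small e" "e' > 0" "y \<in> small e'" by blast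
  then show "\<exists>e>0. x - y \<in> small e" using diff_closedD(2)[OF small_diff_closed, of x "max e e'" y] small_mono
    by (intro exI[of _ "max e e'"]) auto
next
  fix a assume "a \<in> pairs"
  then show "\<exists>e>0. frag_of a \<in> small e" using small_frag[of "fst a" "snd a" "vsn (snd a) + 1"]
    by (intro exI[of _ "vsn (snd a) + 1"]) (auto simp: add_nonneg_pos)
qed

lemma small_induct:
  assumes h: "\<And>x y. h (x - y) = h x - h y" and S: "diff_closed S"
    and null: "\<And>x. x \<in> null \<Longrightarrow> h x \<in> S"
    and frag: "\<And>m v. m \<in> carrier M \<Longrightarrow> vsn v < e \<Longrightarrow> h (frag_of (m, v)) \<in> S"
    and x: "x \<in> small e"
  shows "h x \<in> S"
proof -
  obtain ps where ps: "set ps \<subseteq> pairs" "\<forall>p\<in>set ps. vsn (snd p) < e" "sum_list (map frag_of ps) - x \<in> null"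
    using x unfolding small_def by blast
  have h0: "h 0 = 0" using h[of 0 0] by simp
  have neg: "h (- y) = - h y" for y using h[of 0 y] h0 by simp
  have hadd: "h (x + y) = h x + h y" for x y using h[of x "- y"] neg[of y] by simp
  have "h (sum_list (map frag_of ps)) \<in> S" using ps(1,2)
  proof (induction ps)
    case (Cons p ps)
    then show ?case using frag[of "fst p" "snd p"] by (auto simp: hadd intro!: diff_closedD[OF S])
  qed (simp add: h0 diff_closedD[OF S])
  moreover have "h (sum_list (map frag_of ps)) - h x \<in> S" using null[OF ps(3)] by (simp add: h)
  ultimately show ?thesis using diff_closedD(2)[OF S, of "h (sum_list (map frag_of ps))"] by fastforce
qed

lemma tnorm_set:
  fixes x
  defines "S \<equiv> {Max (insert 0 (vsn ` snd ` set ps)) |ps. set ps \<subseteq> pairs \<and> sum_list (map frag_of ps) \<in> cls x}"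
  assumes "Poly_Mapping.keys x \<subseteq> pairs"
  shows "tnorm (cls x) = Inf S" "S \<noteq> {}" "\<And>s. s \<in> S \<Longrightarrow> s \<ge> 0" "bdd_below S"
proof -
  show "tnorm (cls x) = Inf S" by (simp add: tensor_norm_def S_def)
  obtain e ps where "set ps \<subseteq> pairs" "sum_list (map frag_of ps) - x \<in> null"
    using small_exists[OF assms(2)] unfolding small_def by blast
  then show "S \<noteq> {}" unfolding S_def by (auto simp: cls_mem)
  show *: "\<And>s. s \<in> S \<Longrightarrow> s \<ge> 0" unfolding S_def by auto
  show "bdd_below S" by (rule bdd_belowI[of _ 0]) (rule *)
qed

lemma tnorm_nonneg: "Poly_Mapping.keys x \<subseteq> pairs \<Longrightarrow> tnorm (cls x) \<ge> 0"
  unfolding tnorm_set(1) by (rule cInf_greatest) (use tnorm_set(2,3)[of x] in blast)+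

text \<open>For \<open>e \<le> 0\<close> the null sums lie in \<open>small e\<close> through their
  empty representation, although their norm is 0; hence the positive radius.\<close>

lemma tnorm_less_iff:
  assumes "Poly_Mapping.keys x \<subseteq> pairs" "e > 0"
  shows "tnorm (cls x) < e \<longleftrightarrow> x \<in> small e"
proof -
  note S = tnorm_set[OF assms(1)]
  have "Max (insert 0 (vsn ` snd ` set ps)) < e \<longleftrightarrow> (\<forall>p\<in>set ps. vsn (snd p) < e)"
    for ps :: "('m \<times> ('c^'d)) list"
    using assms(2) by (subst Max_less_iff) auto
  note max = this
  have "tnorm (cls x) < e \<longleftrightarrow> (\<exists>s\<in>{Max (insert 0 (vsn ` snd ` set ps)) |ps.
      set ps \<subseteq> pairs \<and> sum_list (map frag_of ps) \<in> cls x}. s < e)"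
    unfolding S(1) by (rule cInf_less_iff[OF S(2,4)])
  also have "\<dots> \<longleftrightarrow> (\<exists>ps. set ps \<subseteq> pairs \<and> Max (insert 0 (vsn ` snd ` set ps)) < e \<and>
      sum_list (map frag_of ps) \<in> cls x)" by blast
  finally show ?thesis unfolding small_def max cls_mem by simp
qed

lemma ultra: "ultra_group (tensor R M N) tnorm"
proof -
  interpret T: comm_group "tensor R M N" by (rule tensor_comm_group)
  show ?thesis
  proof
    fix X assume "X \<in> carrier (tensor R M N)"
    then obtain x where x: "Poly_Mapping.keys x \<subseteq> pairs" "X = cls x" by (rule tensor_carrierE)
    then show "0 \<le> tnorm X" by (simp add: tnorm_nonneg)
    fix Y assume "Y \<in> carrier (tensor R M N)"
    then obtain y where y: "Poly_Mapping.keys y \<subseteq> pairs" "Y = cls y" by (rule tensor_carrierE)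
    show "tnorm (X \<otimes>\<^bsub>tensor R M N\<^esub> inv\<^bsub>tensor R M N\<^esub> Y) \<le> max (tnorm X) (tnorm Y)"
    proof (rule dense_ge)
      fix e assume e: "max (tnorm X) (tnorm Y) < e"
      then have e0: "e > 0" using tnorm_nonneg[OF x(1)] x(2) by simp
      then have "x \<in> small e" "y \<in> small e" using e x y by (auto simp: tnorm_less_iff)
      then have "x - y \<in> small e" by (rule diff_closedD(2)[OF small_diff_closed])
      then have "tnorm (cls (x - y)) < e" using e0 x y by (simp add: tnorm_less_iff keys_diff_subset)
      then show "tnorm (X \<otimes>\<^bsub>tensor R M N\<^esub> inv\<^bsub>tensor R M N\<^esub> Y) \<le> e" using x y by (simp add: tensor_diff)
    qed
  next
    have "tnorm (cls 0) \<le> 0"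
      by (rule dense_ge) (use tnorm_less_iff[of 0] small_null[OF null_0] in \<open>auto simp: less_imp_le\<close>)
    then show "tnorm \<one>\<^bsub>tensor R M N\<^esub> = 0" using tnorm_nonneg[of 0] by (simp add: tensor_one)
  qed
qed

lemma tnorm_tendsto_0:
  assumes "\<And>n. Poly_Mapping.keys (x n) \<subseteq> pairs"
  shows "(\<lambda>n. tnorm (cls (x n))) \<longlonglongrightarrow> 0 \<longleftrightarrow> (\<forall>e>0. \<exists>N. \<forall>n\<ge>N. x n \<in> small e)"
  unfolding LIMSEQ_iff using assms by (simp add: tnorm_nonneg tnorm_less_iff)

lemma cauchy_cls:
  assumes "\<And>n. Poly_Mapping.keys (x n) \<subseteq> pairs"
  shows "(\<lambda>n. cls (x n)) \<in> cauchy_seqs (tensor R M N) tnorm \<longleftrightarrow>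
     (\<forall>e>0. \<exists>N. \<forall>m\<ge>N. \<forall>n\<ge>N. x m - x n \<in> small e)"
  unfolding ultra_group.cauchy_mem[OF ultra]
  using assms by (simp add: cls_carrier tensor_diff tnorm_less_iff keys_diff_subset)

lemma cauchy_lift:
  assumes "X \<in> cauchy_seqs (tensor R M N) tnorm"
  obtains x where "\<And>n. Poly_Mapping.keys (x n) \<subseteq> pairs" "X = (\<lambda>n. cls (x n))"
proof -
  have "\<exists>x. \<forall>n. Poly_Mapping.keys (x n) \<subseteq> pairs \<and> X n = cls (x n)"
    using ultra_group.cauchy_carrier[OF ultra assms] by (intro choice) (auto simp: tensor_carrier)
  then show ?thesis using that by blast
qed

end

lemma tensor_map_hom:
  assumes "tensor_pair R M N" "tensor_pair R' M' N'"
    and f: "\<And>m. m \<in> carrier M \<Longrightarrow> f m \<in> carrier M'" and g: "\<And>n. n \<in> carrier N \<Longrightarrow> g n \<in> carrier N'"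
    and null: "\<And>x. x \<in> tensor_null R M N \<Longrightarrow> fmap2 f g x \<in> tensor_null R' M' N'"
  shows "tensor_map R' M' N' f g \<in> hom (tensor R M N) (tensor R' M' N')"
proof -
  interpret A: tensor_pair R M N by fact
  interpret B: tensor_pair R' M' N' by fact
  note map = tensor_map_cls[OF assms(1,2) _ null]
  have keys: "Poly_Mapping.keys (fmap2 f g x) \<subseteq> B.pairs" if "Poly_Mapping.keys x \<subseteq> A.pairs" for x
    using that by (rule keys_fmap2) (use f g in auto)
  show ?thesis
  proof (rule homI)
    fix X assume "X \<in> carrier (tensor R M N)"
    then obtain x where x: "Poly_Mapping.keys x \<subseteq> A.pairs" "X = A.cls x" by (rule A.tensor_carrierE)
    then show "tensor_map R' M' N' f g X \<in> carrier (tensor R' M' N')"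
      using map[OF x(1)] keys by (simp add: B.cls_carrier)
    fix Y assume "Y \<in> carrier (tensor R M N)"
    then obtain y where y: "Poly_Mapping.keys y \<subseteq> A.pairs" "Y = A.cls y" by (rule A.tensor_carrierE)
    show "tensor_map R' M' N' f g (X \<otimes>\<^bsub>tensor R M N\<^esub> Y) =
        tensor_map R' M' N' f g X \<otimes>\<^bsub>tensor R' M' N'\<^esub> tensor_map R' M' N' f g Y"
      using x y keys by (simp add: A.tensor_mult B.tensor_mult map keys_add_subset)
  qed
qed

lemma small_map:
  fixes V :: "('c::complete_ultrametric_field, 'c^'d::finite) module"
  assumes "tensor_V R M V" "tensor_V R' M' V"
    and f: "\<And>m. m \<in> carrier M \<Longrightarrow> f m \<in> carrier M'"
    and null: "\<And>x. x \<in> tensor_null R M V \<Longrightarrow> fmap2 f g x \<in> tensor_null R' M' V"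
    and g: "\<And>v. vsn v < e \<Longrightarrow> vsn (g v) < e'"
    and x: "x \<in> tensor_V.small R M V e"
  shows "fmap2 f g x \<in> tensor_V.small R' M' V e'"
proof -
  interpret A: tensor_V R M V by fact
  interpret B: tensor_V R' M' V by fact
  show ?thesis
    by (rule A.small_induct[OF _ B.small_diff_closed _ _ x])
       (use null f g in \<open>auto intro: B.small_null B.small_frag\<close>)
qed

lemma tensor_map_cont:
  fixes V :: "('c::complete_ultrametric_field, 'c^'d::finite) module"
  assumes "tensor_V R M V" "tensor_V R' M' V"
    and f: "\<And>m. m \<in> carrier M \<Longrightarrow> f m \<in> carrier M'"
    and null: "\<And>x. x \<in> tensor_null R M V \<Longrightarrow> fmap2 f g x \<in> tensor_null R' M' V"
    and g: "\<And>e. e > 0 \<Longrightarrow> \<exists>d>0. \<forall>v. vsn v < d \<longrightarrow> vsn (g v) < e"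
  shows "\<forall>e>0. \<exists>d>0. \<forall>X\<in>carrier (tensor R M V). tensor_norm M V vsn X < d \<longrightarrow>
     tensor_norm M' V vsn (tensor_map R' M' V f g X) < e"
proof (intro allI impI)
  fix e :: real assume e: "e > 0"
  interpret A: tensor_V R M V by fact
  interpret B: tensor_V R' M' V by fact
  obtain d where d: "d > 0" "\<And>v. vsn v < d \<Longrightarrow> vsn (g v) < e" using g[OF e] by blast
  have "tensor_norm M' V vsn (tensor_map R' M' V f g X) < e"
    if X: "X \<in> carrier (tensor R M V)" "tensor_norm M V vsn X < d" for X
  proof -
    obtain x where x: "Poly_Mapping.keys x \<subseteq> A.pairs" "X = A.cls x" using X(1) by (rule A.tensor_carrierE)
    have "fmap2 f g x \<in> B.small e"
      by (rule small_map[OF assms(1,2) f null d(2)]) (use X x d in \<open>simp_all add: A.tnorm_less_iff\<close>)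
    moreover have "tensor_map R' M' V f g X = B.cls (fmap2 f g x)"
      unfolding x(2) by (rule tensor_map_cls[OF A.tensor_pair_axioms B.tensor_pair_axioms x(1) null])
    ultimately show ?thesis using e B.small_keys by (simp add: B.tnorm_less_iff)
  qed
  then show "\<exists>d>0. \<forall>X\<in>carrier (tensor R M V). tensor_norm M V vsn X < d \<longrightarrow>
     tensor_norm M' V vsn (tensor_map R' M' V f g X) < e" using d(1) by blast
qed

section \<open>Subrings, subfields and places\<close>

text \<open>The form without records of \<open>cring (ring_on S)\<close>; the hypotheses are
  converted once, by \<open>subring_of_cring\<close> and \<open>subfield_of_field\<close>.\<close>

definition is_subring :: "'c::field set \<Rightarrow> bool" where
  "is_subring S \<longleftrightarrow> diff_closed S \<and> 1 \<in> S \<and> (\<forall>x\<in>S. \<forall>y\<in>S. x * y \<in> S)"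

definition is_subfield :: "'c::field set \<Rightarrow> bool" where
  "is_subfield S \<longleftrightarrow> is_subring S \<and> (\<forall>x\<in>S. inverse x \<in> S)"

lemma subringD:
  assumes "is_subring S"
  shows "0 \<in> S" "1 \<in> S" "x \<in> S \<Longrightarrow> - x \<in> S" "x \<in> S \<Longrightarrow> y \<in> S \<Longrightarrow> x + y \<in> S"
    "x \<in> S \<Longrightarrow> y \<in> S \<Longrightarrow> x - y \<in> S" "x \<in> S \<Longrightarrow> y \<in> S \<Longrightarrow> x * y \<in> S" "x \<in> S \<Longrightarrow> x ^ n \<in> S"
    "(\<And>i. i \<in> I \<Longrightarrow> f i \<in> S) \<Longrightarrow> sum f I \<in> S" "(\<And>i. i \<in> I \<Longrightarrow> f i \<in> S) \<Longrightarrow> prod f I \<in> S"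
proof -
  have d: "diff_closed S" and 1: "1 \<in> S" and m: "\<And>x y. x \<in> S \<Longrightarrow> y \<in> S \<Longrightarrow> x * y \<in> S"
    using assms by (auto simp: is_subring_def)
  note D = diff_closedD[OF d]
  show "0 \<in> S" "1 \<in> S" "x \<in> S \<Longrightarrow> - x \<in> S" "x \<in> S \<Longrightarrow> y \<in> S \<Longrightarrow> x + y \<in> S"
    "x \<in> S \<Longrightarrow> y \<in> S \<Longrightarrow> x - y \<in> S" "x \<in> S \<Longrightarrow> y \<in> S \<Longrightarrow> x * y \<in> S"
    by (fact D(1) 1 D(3) D(4) D(2) m)+
  show "x \<in> S \<Longrightarrow> x ^ n \<in> S" by (induction n) (use 1 m in auto)
  show "(\<And>i. i \<in> I \<Longrightarrow> f i \<in> S) \<Longrightarrow> sum f I \<in> S" by (rule diff_closed_sum[OF d])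
  show "(\<And>i. i \<in> I \<Longrightarrow> f i \<in> S) \<Longrightarrow> prod f I \<in> S"
    by (induction I rule: infinite_finite_induct) (use 1 m in auto)
qed

lemma subfieldD:
  assumes "is_subfield S"
  shows "is_subring S" "x \<in> S \<Longrightarrow> inverse x \<in> S" "x \<in> S \<Longrightarrow> y \<in> S \<Longrightarrow> x / y \<in> S"
  using assms subringD(6) by (auto simp: is_subfield_def divide_inverse)

lemma subring_of_cring:
  assumes "cring (ring_on S)" shows "is_subring S"
proof -
  interpret cring "ring_on S" by fact
  have neg: "- x \<in> S" if "x \<in> S" for x
  proof -
    have "x + \<ominus>\<^bsub>ring_on S\<^esub> x = 0" using r_neg[of x] that by simp
    then have "\<ominus>\<^bsub>ring_on S\<^esub> x = - x" by (simp add: eq_neg_iff_add_eq_0 add.commute)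
    then show ?thesis using a_inv_closed[of x] that by simp
  qed
  have "x - y \<in> S" if "x \<in> S" "y \<in> S" for x y using a_closed[of x "- y"] neg that by simp
  then show ?thesis using zero_closed one_closed m_closed
    by (auto simp: is_subring_def diff_closed_def)
qed

lemma cring_of_subring:
  assumes "is_subring S" shows "cring (ring_on S)"
proof (rule cringI)
  show "abelian_group (ring_on S)"
    by (rule abelian_group_on[of S]) (use assms in \<open>auto simp: is_subring_def\<close>)
  show "comm_monoid (ring_on S)"
    by (rule comm_monoidI) (use assms in \<open>auto simp: is_subring_def\<close>)
qed (simp add: distrib_right)

lemma subfield_of_field:
  assumes "field (ring_on S)" shows "is_subfield S"
proof -
  interpret field "ring_on S" by fact
  have sr: "is_subring S" by (rule subring_of_cring) (rule is_cring)
  have "inverse x \<in> S" if "x \<in> S" for x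
  proof (cases "x = 0")
    case True then show ?thesis using subringD(1)[OF sr] by simp
  next
    case False
    then have "x \<in> Units (ring_on S)" using that field_Units by simp
    then obtain y where "y \<in> S" "y * x = 1" by (auto simp: Units_def)
    then show ?thesis by (metis inverse_unique mult.commute)
  qed
  with sr show ?thesis by (simp add: is_subfield_def)
qed

lemma polys_over_add: "is_subring S \<Longrightarrow> f \<in> polys_over S \<Longrightarrow> g \<in> polys_over S \<Longrightarrow> f + g \<in> polys_over S"
  by (simp add: polys_over_def subringD)

lemma polys_over_diff: "is_subring S \<Longrightarrow> f \<in> polys_over S \<Longrightarrow> g \<in> polys_over S \<Longrightarrow> f - g \<in> polys_over S"
  by (simp add: polys_over_def subringD)

lemma polys_over_mult: "is_subring S \<Longrightarrow> f \<in> polys_over S \<Longrightarrow> g \<in> polys_over S \<Longrightarrow> f * g \<in> polys_over S"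
  by (simp add: polys_over_def coeff_mult subringD)

lemma polys_over_monom: "is_subring S \<Longrightarrow> c \<in> S \<Longrightarrow> monom c n \<in> polys_over S"
  by (simp add: polys_over_def subringD)

lemma polys_over_smult: "is_subring S \<Longrightarrow> c \<in> S \<Longrightarrow> f \<in> polys_over S \<Longrightarrow> Polynomial.smult c f \<in> polys_over S"
  by (simp add: polys_over_def subringD)

lemma polys_over_sum: "is_subring S \<Longrightarrow> (\<And>i. i \<in> I \<Longrightarrow> f i \<in> polys_over S) \<Longrightarrow> sum f I \<in> polys_over S"
  by (simp add: polys_over_def coeff_sum subringD)

lemma poly_mem_subring:
  assumes "is_subring S" "f \<in> polys_over S" "x \<in> S" shows "poly f x \<in> S"
  unfolding poly_altdef using assms by (auto simp: polys_over_def intro!: subringD)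

lemma adjoin_ring_base: assumes "is_subring S" shows "S \<subseteq> adjoin_ring S t"
proof
  fix c assume "c \<in> S"
  then have "monom c 0 \<in> polys_over S" by (rule polys_over_monom[OF assms])
  moreover have "c = poly (monom c 0) t" by (simp add: poly_monom)
  ultimately show "c \<in> adjoin_ring S t" unfolding adjoin_ring_def by blast
qed

lemma adjoin_ring_subring: assumes "is_subring S" shows "is_subring (adjoin_ring S t)"
  unfolding is_subring_def diff_closed_def
proof (intro conjI ballI)
  show "0 \<in> adjoin_ring S t" "1 \<in> adjoin_ring S t"
    using adjoin_ring_base[OF assms] subringD(1,2)[OF assms] by auto
  fix x y assume "x \<in> adjoin_ring S t" "y \<in> adjoin_ring S t"
  then obtain f g where fg: "f \<in> polys_over S" "g \<in> polys_over S" "x = poly f t" "y = poly g t"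
    by (auto simp: adjoin_ring_def)
  show "x - y \<in> adjoin_ring S t" unfolding adjoin_ring_def using fg polys_over_diff[OF assms fg(1,2)]
    by (auto intro!: exI[of _ "f - g"])
  show "x * y \<in> adjoin_ring S t" unfolding adjoin_ring_def using fg polys_over_mult[OF assms fg(1,2)]
    by (auto intro!: exI[of _ "f * g"])
qed

lemma adjoin_ring_gen: "is_subring S \<Longrightarrow> t \<in> adjoin_ring S t"
  unfolding adjoin_ring_def using polys_over_monom[of S 1 1] subringD(2)[of S]
  by (auto intro!: exI[of _ "monom 1 1"] simp: poly_monom)

lemma adjoin_ring_least: "is_subring T \<Longrightarrow> S \<subseteq> T \<Longrightarrow> t \<in> T \<Longrightarrow> adjoin_ring S t \<subseteq> T"
  unfolding adjoin_ring_def
  by (force intro: poly_mem_subring simp: polys_over_def)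

section \<open>Valuation rings: Chevalley's argument and integral closedness\<close>

lemma poly_expand:
  fixes f :: "'c::comm_ring_1 poly"
  assumes "degree f \<le> n" shows "poly f x = (\<Sum>i\<le>n. coeff f i * x ^ i)"
  unfolding poly_altdef by (rule sum.mono_neutral_left) (use assms in \<open>auto simp: coeff_eq_0\<close>)

lemma algebraic_if_mem_adjoin_inverse:
  assumes S: "is_subring S" and x: "x \<noteq> 0" "x \<in> adjoin_ring S (inverse x)"
  shows "algebraic_over S x"
proof -
  obtain f where f: "f \<in> polys_over S" "x = poly f (inverse x)" using x(2) by (auto simp: adjoin_ring_def)
  let ?n = "degree f"
  \<comment> \<open>Multiplying \<open>x = f (1/x)\<close> by \<open>x ^ ?n\<close> turns it into
    \<open>x ^ Suc ?n = reflect_poly f x\<close>. The reflected polynomial has degree at most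
    \<open>?n\<close>, so \<open>g\<close> is monic.\<close>
  define g where "g = monom 1 (Suc ?n) - reflect_poly f"
  have "g \<in> polys_over S"
    unfolding g_def using f(1) S
    by (intro polys_over_diff polys_over_monom) (auto simp: polys_over_def coeff_reflect_poly subringD)
  moreover have "coeff g (Suc ?n) = 1" by (simp add: g_def coeff_reflect_poly)
  then have "g \<noteq> 0" by auto
  moreover have "poly g x = 0"
    using f(2) x(1) by (simp add: g_def poly_monom poly_reflect_poly_nz)
  ultimately show ?thesis by (auto simp: algebraic_over_def)
qed

text \<open>The degree-lowering step of Chevalley's theorem. With \<open>t0\<close> the constant
  term of \<open>g\<close>, multiplying \<open>x - t0\<close> by \<open>w ^ n\<close> gives a
  polynomial \<open>r\<close> in \<open>w\<close> of degree below \<open>n\<close>. Since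
  \<open>y\<close> is the inverse of \<open>x\<close>, \<open>(1 - y t0) x = x - t0\<close> and
  \<open>(1 - y t0) w^n = y w^n (x - t0) = y r(w)\<close>. Hence multiplying \<open>f\<close> by
  \<open>1 - y t0\<close> replaces its top term by \<open>s y r(w)\<close>.\<close>

lemma valuation_step:
  assumes S: "is_subring S" and y: "y \<in> S" "y * x = 1" and w: "w \<noteq> 0"
    and f: "f \<in> polys_over S" "degree f \<le> n" "poly f w = x"
    and g: "g \<in> polys_over S" "degree g \<le> m" "poly g (inverse w) = x"
    and mn: "m \<le> n" "0 < n"
  shows "\<exists>h\<in>polys_over S. degree h \<le> n - 1 \<and> poly h w = x"
proof -
  define t0 where "t0 = coeff g 0"
  define r where "r = (\<Sum>j<m. monom (coeff g (Suc j)) (n - 1 - j))"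
  define s where "s = coeff f n"
  define fl where "fl = f - monom s n"
  have S0: "t0 \<in> S" "s \<in> S" using f g by (auto simp: t0_def s_def polys_over_def)
  have r: "r \<in> polys_over S" unfolding r_def using g(1) S
    by (intro polys_over_sum polys_over_monom) (auto simp: polys_over_def)
  have fl: "fl \<in> polys_over S" unfolding fl_def using f(1) S S0 by (intro polys_over_diff polys_over_monom)
  have degr: "degree r \<le> n - 1" unfolding r_def
    by (intro degree_sum_le) (auto intro: order_trans[OF degree_monom_le])
  have "degree fl \<le> n" unfolding fl_def using f(2) degree_monom_le[of s n] by (intro degree_diff_le) auto
  moreover have "coeff fl n = 0" by (simp add: fl_def s_def)
  ultimately have degfl: "degree fl \<le> n - 1" using mn(2)
    by (metis One_nat_def Suc_pred degree_0 eq_zero_or_degree_less le_0_eq le_Suc_eq less_Suc_eq_le)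
  have xg: "x = t0 + (\<Sum>j<m. coeff g (Suc j) * inverse w ^ Suc j)"
  proof -
    have "x = (\<Sum>i\<le>m. coeff g i * inverse w ^ i)"
      using poly_expand[OF g(2), of "inverse w"] g(3) by simp
    then show ?thesis by (simp add: sum.atMost_shift t0_def)
  qed
  have rw: "w ^ n * (x - t0) = poly r w"
  proof -
    have "w ^ n * (coeff g (Suc j) * inverse w ^ Suc j) = coeff g (Suc j) * w ^ (n - 1 - j)" if "j < m" for j
    proof -
      have "n = (n - 1 - j) + Suc j" using that mn by simp
      then have "w ^ n = w ^ (n - 1 - j) * w ^ Suc j" by (metis power_add)
      then show ?thesis using w by (simp add: power_inverse field_simps)
    qed
    note * = this
    have "w ^ n * (x - t0) = (\<Sum>j<m. w ^ n * (coeff g (Suc j) * inverse w ^ Suc j))"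
      by (subst xg) (simp add: sum_distrib_left)
    also have "\<dots> = (\<Sum>j<m. coeff g (Suc j) * w ^ (n - 1 - j))" using * by (intro sum.cong) auto
    also have "\<dots> = poly r w" by (simp add: r_def poly_sum poly_monom)
    finally show ?thesis .
  qed
  have xf: "x = poly fl w + s * w ^ n" using f(3) by (simp add: fl_def poly_monom)
  define h where "h = [:t0:] + Polynomial.smult (1 - y * t0) fl + Polynomial.smult (s * y) r"
  have "h \<in> polys_over S" unfolding h_def
    using S S0 y r fl polys_over_monom[OF S S0(1), of 0]
    by (intro polys_over_add polys_over_smult) (auto simp: monom_0 subringD)
  moreover have "degree h \<le> n - 1" unfolding h_def using degr degfl
    by (intro degree_add_le) (auto intro: order_trans[OF degree_smult_le])
  moreover have "poly h w = x"
  proof -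
    have "(1 - y * t0) * x = x - t0" using y(2) by (simp add: algebra_simps)
    then have "x - t0 = (1 - y * t0) * poly fl w + s * (w ^ n * (1 - y * t0))"
      by (subst (asm) xf) (simp add: algebra_simps)
    moreover have "w ^ n * (1 - y * t0) = y * (w ^ n * (x - t0))"
      using y(2) by (simp add: algebra_simps)
    ultimately have "x - t0 = (1 - y * t0) * poly fl w + s * (y * poly r w)" by (simp only: rw)
    then show ?thesis by (simp add: h_def algebra_simps)
  qed
  ultimately show ?thesis by blast
qed

text \<open>Chevalley's extension theorem: a subring of \<open>K\<close> that is maximal among those containing
  \<open>x\<^sup>-\<^sup>1\<close> but not \<open>x\<close> is a valuation ring.\<close>

lemma place_avoiding:
  assumes F: "is_subfield F" and K: "is_subfield K" and FK: "F \<subseteq> K"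
    and x: "x \<in> K" "\<not> algebraic_over F x"
  shows "\<exists>V. is_place F K V \<and> x \<notin> V"
proof -
  have x0: "x \<noteq> 0"
  proof
    assume "x = 0"
    moreover have "monom 1 1 \<in> polys_over F" by (intro polys_over_monom subfieldD subringD F)
    ultimately have "algebraic_over F x"
      unfolding algebraic_over_def by (intro bexI[of _ "monom 1 1"]) (auto simp: poly_monom)
    with x show False by blast
  qed
  define y where "y = inverse x"
  note sF = subfieldD(1)[OF F] and sK = subfieldD(1)[OF K]
  have y: "y \<in> K" "y * x = 1" using x x0 subfieldD(2)[OF K] by (auto simp: y_def)
  define SS where "SS = {S. is_subring S \<and> F \<subseteq> S \<and> S \<subseteq> K \<and> y \<in> S \<and> x \<notin> S}"
  \<comment> \<open>A starting point for Zorn's lemma: if \<open>x\<close> were in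
    \<open>F[1/x]\<close>, it would be algebraic over \<open>F\<close>.\<close>
  have "adjoin_ring F y \<in> SS"
    unfolding SS_def using adjoin_ring_subring[OF sF] adjoin_ring_base[OF sF] adjoin_ring_gen[OF sF]
      adjoin_ring_least[OF sK FK y(1)] algebraic_if_mem_adjoin_inverse[OF sF x0] x(2) y_def by auto
  then have ne: "SS \<noteq> {}" by blast
  have "\<Union>C \<in> SS" if C: "C \<noteq> {}" "subset.chain SS C" for C
  proof -
    have CS: "\<And>S. S \<in> C \<Longrightarrow> S \<in> SS" using C(2) unfolding subset.chain_def by blast
    have two: "\<exists>S\<in>C. a \<in> S \<and> b \<in> S" if ab: "a \<in> \<Union>C" "b \<in> \<Union>C" for a b
    proof -
      obtain S T where ST: "S \<in> C" "T \<in> C" "a \<in> S" "b \<in> T" using ab by blast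
      then have "S \<subseteq> T \<or> T \<subseteq> S" using C(2) unfolding subset.chain_def by blast
      then show ?thesis using ST by blast
    qed
    have sub: "is_subring S" if "S \<in> C" for S using CS[OF that] by (simp add: SS_def)
    obtain S0 where S0: "S0 \<in> C" using C(1) by blast
    have "is_subring (\<Union>C)"
      unfolding is_subring_def diff_closed_def
    proof (intro conjI ballI)
      show "0 \<in> \<Union>C" "1 \<in> \<Union>C" using S0 subringD[OF sub[OF S0]] by blast+
      fix a b assume ab: "a \<in> \<Union>C" "b \<in> \<Union>C"
      obtain S where S: "S \<in> C" "a \<in> S" "b \<in> S" using two[OF ab] by blast
      show "a - b \<in> \<Union>C" "a * b \<in> \<Union>C" using S subringD(5,6)[OF sub[OF S(1)], of a b] by blast+
    qed
    moreover have "F \<subseteq> \<Union>C" "y \<in> \<Union>C" using CS[OF S0] S0 by (auto simp: SS_def)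
    moreover have "\<Union>C \<subseteq> K" "x \<notin> \<Union>C" using CS by (auto simp: SS_def)
    ultimately show ?thesis by (simp add: SS_def)
  qed
  from subset_Zorn_nonempty[OF ne this] obtain S where
    S: "S \<in> SS" and max: "\<And>X. X \<in> SS \<Longrightarrow> S \<subseteq> X \<Longrightarrow> X = S" by blast
  have sS: "is_subring S" "F \<subseteq> S" "S \<subseteq> K" "y \<in> S" "x \<notin> S" using S by (auto simp: SS_def)
  \<comment> \<open>By maximality, adjoining any further element of \<open>K\<close> brings in
    \<open>x\<close>.\<close>
  have full: "x \<in> adjoin_ring S w" if "w \<in> K" "w \<notin> S" for w
  proof (rule ccontr)
    assume "x \<notin> adjoin_ring S w"
    then have "adjoin_ring S w \<in> SS"
      unfolding SS_def using adjoin_ring_subring[OF sS(1)] adjoin_ring_base[OF sS(1), of w] sS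
        adjoin_ring_least[OF sK sS(3) that(1)] by auto
    then have "adjoin_ring S w = S" using max adjoin_ring_base[OF sS(1)] by blast
    then show False using adjoin_ring_gen[OF sS(1), of w] that(2) by simp
  qed
  \<comment> \<open>Descent on the sum of the two degree bounds: the larger one can always be
    lowered, and bound 0 would place \<open>x\<close> in \<open>S\<close>. If \<open>w\<close> and
    \<open>1/w\<close> were both outside \<open>S\<close>, \<open>full\<close> would provide both
    representations.\<close>
  have no: False if "w \<noteq> 0" "f \<in> polys_over S" "degree f \<le> n" "poly f w = x"
    "g \<in> polys_over S" "degree g \<le> m" "poly g (inverse w) = x" for w f g n m
    using that
  proof (induction "n + m" arbitrary: w f g n m rule: less_induct)
    case less
    have const: "0 < k" if "h \<in> polys_over S" "degree h \<le> k" "poly h v = x" for h k v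
    proof (rule ccontr)
      assume "\<not> 0 < k"
      then have "degree h = 0" using that(2) by simp
      then have "x = coeff h 0" using that(3) by (simp add: poly_altdef)
      then show False using that(1) sS(5) by (simp add: polys_over_def)
    qed
    have nm: "0 < n" "0 < m" using const less.prems by blast+
    show False
    proof (cases "m \<le> n")
      case True
      obtain h where "h \<in> polys_over S" "degree h \<le> n - 1" "poly h w = x"
        using valuation_step[OF sS(1,4) y(2) less.prems True nm(1)] by blast
      then show False using less.hyps[of "n - 1" m w h g] less.prems nm by simp
    next
      case False
      obtain h where "h \<in> polys_over S" "degree h \<le> m - 1" "poly h (inverse w) = x"
        using valuation_step[OF sS(1,4) y(2) _ less.prems(5,6,7) less.prems(2,3)] False nm less.prems by auto
      then show False using less.hyps[of n "m - 1" w f h] less.prems nm by simp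
    qed
  qed
  have val: "w \<in> S \<or> inverse w \<in> S" if w: "w \<in> K" for w
  proof (rule ccontr)
    assume *: "\<not> (w \<in> S \<or> inverse w \<in> S)"
    then have "w \<noteq> 0" using subringD(1)[OF sS(1)] by auto
    moreover obtain f where "f \<in> polys_over S" "poly f w = x"
      using full[OF w] * unfolding adjoin_ring_def by auto
    moreover obtain g where "g \<in> polys_over S" "poly g (inverse w) = x"
      using full[OF subfieldD(2)[OF K w]] * unfolding adjoin_ring_def by auto
    ultimately show False using no[of w f "degree f" g "degree g"] by simp
  qed
  have "is_place F K S" unfolding is_place_def using cring_of_subring[OF sS(1)] sS x(1) val by auto
  then show ?thesis using sS(5) by blast
qed

text \<open>Integral closedness of a valuation ring, adapted to a leading coefficient
  \<open>c\<close>. If \<open>c x\<close> is outside \<open>V\<close>, its inverse \<open>v\<close>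
  is inside and so is \<open>1/x = c v\<close>; dividing \<open>f(x) = 0\<close> by
  \<open>x^(m-1)\<close> then writes \<open>c x\<close> as a polynomial in \<open>1/x\<close> over
  \<open>V\<close>.\<close>

lemma place_integral:
  assumes V: "is_place F K V" and x: "x \<in> K" and f: "f \<in> polys_over V" "poly f x = 0" "f \<noteq> 0"
    and K: "is_subfield K"
  shows "lead_coeff f * x \<in> V"
proof (rule ccontr)
  assume nV: "lead_coeff f * x \<notin> V"
  have sV: "is_subring V" and VK: "V \<subseteq> K" and val: "\<And>x. x \<in> K \<Longrightarrow> x \<in> V \<or> inverse x \<in> V"
    using V subring_of_cring by (auto simp: is_place_def)
  let ?c = "lead_coeff f" and ?m = "degree f"
  have c: "?c \<in> V" "?c \<noteq> 0" using f by (auto simp: polys_over_def)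
  have x0: "x \<noteq> 0" using nV subringD(1)[OF sV] by auto
  have m: "?m > 0"
  proof (rule ccontr)
    assume "\<not> ?m > 0"
    then have "poly f x = ?c" by (simp add: poly_altdef)
    then show False using f c by simp
  qed
  define v where "v = inverse (?c * x)"
  have "?c * x \<in> K" using c VK x subringD(6)[OF subfieldD(1)[OF K]] by blast
  then have v: "v \<in> V" unfolding v_def using val nV by blast
  have xi: "inverse x = ?c * v" using c x0 by (simp add: v_def field_simps)
  have "0 = (\<Sum>i<?m. coeff f i * x ^ i) + ?c * x ^ ?m"
    using f(2) by (simp add: poly_altdef flip: lessThan_Suc_atMost)
  then have "?c * x ^ ?m = - (\<Sum>i<?m. coeff f i * x ^ i)" by (simp add: eq_neg_iff_add_eq_0 add.commute)
  then have "?c * x ^ ?m * inverse x ^ (?m - 1) = - (\<Sum>i<?m. coeff f i * x ^ i * inverse x ^ (?m - 1))"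
    by (simp add: sum_distrib_right)
  moreover have "x ^ ?m * inverse x ^ (?m - 1) = x"
    using m x0 by (cases ?m) (auto simp: power_inverse)
  moreover have "x ^ i * inverse x ^ (?m - 1) = inverse x ^ (?m - 1 - i)" if "i < ?m" for i
  proof -
    have "inverse x ^ (?m - 1) = inverse x ^ i * inverse x ^ (?m - 1 - i)"
      using that by (simp flip: power_add)
    then show ?thesis using x0 by (simp add: power_inverse)
  qed
  ultimately have "?c * x = - (\<Sum>i<?m. coeff f i * inverse x ^ (?m - 1 - i))"
    by (simp add: mult.assoc)
  also have "\<dots> \<in> V"
    unfolding xi using f(1) c v by (intro subringD[OF sV]) (auto simp: polys_over_def)
  finally show False using nV by simp
qed

section \<open>The coordinate ring as a finite module\<close>

text \<open>Gaussian elimination with more unknowns than equations: equation \<open>b\<close> is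
  solved for the unknown \<open>i0\<close>, and induction treats the remaining ones.\<close>

lemma homogeneous_system:
  fixes c :: "'i \<Rightarrow> 'b \<Rightarrow> 'c::field"
  assumes E: "is_subfield E" and "finite B" "finite I" "card B < card I"
    and "\<And>i b. i \<in> I \<Longrightarrow> b \<in> B \<Longrightarrow> c i b \<in> E"
  shows "\<exists>d. (\<forall>i\<in>I. d i \<in> E) \<and> (\<exists>i\<in>I. d i \<noteq> 0) \<and> (\<forall>b\<in>B. (\<Sum>i\<in>I. d i * c i b) = 0)"
  using assms(2-)
proof (induction B arbitrary: I c rule: finite_induct)
  case empty
  then obtain i where "i \<in> I" by fastforce
  then show ?case using subringD(2)[OF subfieldD(1)[OF E]] by (intro exI[of _ "\<lambda>_. 1"]) auto
next
  case (insert b B)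
  note sE = subringD[OF subfieldD(1)[OF E]]
  have cE: "\<And>i b'. i \<in> I \<Longrightarrow> b' \<in> insert b B \<Longrightarrow> c i b' \<in> E" using insert.prems by blast
  show ?case
  proof (cases "\<forall>i\<in>I. c i b = 0")
    case True
    have "card B < card I" using insert by simp
    then obtain d where "\<forall>i\<in>I. d i \<in> E" "\<exists>i\<in>I. d i \<noteq> 0" "\<forall>b\<in>B. (\<Sum>i\<in>I. d i * c i b) = 0"
      using insert.IH[of I c] insert.prems cE by auto
    then show ?thesis using True by (intro exI[of _ d]) auto
  next
    case False
    then obtain i0 where i0: "i0 \<in> I" "c i0 b \<noteq> 0" by blast
    define J where "J = I - {i0}"
    have J: "finite J" "card B < card J" "I = insert i0 J" "i0 \<notin> J"
      using insert i0 by (auto simp: J_def)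
    define r where "r i = c i b / c i0 b" for i
    have rE: "r i \<in> E" if "i \<in> I" for i unfolding r_def using cE that i0 by (intro subfieldD[OF E]) auto
    have "c i b' - r i * c i0 b' \<in> E" if "i \<in> J" "b' \<in> B" for i b'
      using that cE rE i0 J by (intro sE) auto
    then obtain d where d: "\<forall>i\<in>J. d i \<in> E" "\<exists>i\<in>J. d i \<noteq> 0"
      "\<forall>b'\<in>B. (\<Sum>i\<in>J. d i * (c i b' - r i * c i0 b')) = 0"
      using insert.IH[of J "\<lambda>i b'. c i b' - r i * c i0 b'"] J by auto
    define d' where "d' i = (if i = i0 then - (\<Sum>i\<in>J. d i * r i) else d i)" for i
    have dJ: "(\<Sum>i\<in>J. d' i * f i) = (\<Sum>i\<in>J. d i * f i)" for f :: "'i \<Rightarrow> 'c"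
      by (rule sum.cong) (use J in \<open>auto simp: d'_def\<close>)
    have tot: "(\<Sum>i\<in>I. d' i * f i) = (\<Sum>i\<in>J. d i * (f i - r i * f i0))" for f
    proof -
      have "(\<Sum>i\<in>I. d' i * f i) = d' i0 * f i0 + (\<Sum>i\<in>J. d i * f i)"
        using J by (simp add: dJ)
      also have "\<dots> = (\<Sum>i\<in>J. d i * f i) - (\<Sum>i\<in>J. d i * r i) * f i0" by (simp add: d'_def)
      also have "\<dots> = (\<Sum>i\<in>J. d i * (f i - r i * f i0))"
        unfolding sum_distrib_right sum_subtractf[symmetric]
        by (rule sum.cong) (auto simp: algebra_simps)
      finally show ?thesis .
    qed
    have "(\<Sum>i\<in>I. d' i * c i b') = 0" if "b' \<in> insert b B" for b'
    proof (cases "b' = b")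
      case True
      then show ?thesis unfolding tot using i0 by (simp add: r_def)
    next
      case False
      then show ?thesis unfolding tot using d(3) that by auto
    qed
    moreover have "d' i \<in> E" if "i \<in> I" for i
    proof (cases "i = i0")
      case True
      then show ?thesis unfolding d'_def using d(1) rE J by (auto intro!: sE)
    next
      case False
      then show ?thesis unfolding d'_def using d(1) J that by auto
    qed
    moreover have "\<exists>i\<in>I. d' i \<noteq> 0" using d(2) J unfolding d'_def by (metis insertI2)
    ultimately show ?thesis by blast
  qed
qed

lemma dependent_over:
  assumes E: "is_subfield E" and B: "finite B" "\<And>x. x \<in> K \<Longrightarrow> \<exists>c. (\<forall>b\<in>B. c b \<in> E) \<and> x = (\<Sum>b\<in>B. c b * b)"
    and I: "finite I" "card B < card I" "I \<subseteq> K"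
  shows "\<exists>d. (\<forall>i\<in>I. d i \<in> E) \<and> (\<exists>i\<in>I. d i \<noteq> 0) \<and> (\<Sum>i\<in>I. d i * i) = 0"
proof -
  obtain c where c: "\<And>x b. x \<in> K \<Longrightarrow> b \<in> B \<Longrightarrow> c x b \<in> E" "\<And>x. x \<in> K \<Longrightarrow> x = (\<Sum>b\<in>B. c x b * b)"
    using B(2) by metis
  obtain d where d: "\<forall>i\<in>I. d i \<in> E" "\<exists>i\<in>I. d i \<noteq> 0" "\<forall>b\<in>B. (\<Sum>i\<in>I. d i * c i b) = 0"
  proof -
    have "c i b \<in> E" if "i \<in> I" "b \<in> B" for i b using c(1) I(3) that by blast
    then have "\<exists>d. (\<forall>i\<in>I. d i \<in> E) \<and> (\<exists>i\<in>I. d i \<noteq> 0) \<and> (\<forall>b\<in>B. (\<Sum>i\<in>I. d i * c i b) = 0)"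
      by (rule homogeneous_system[OF E B(1) I(1,2)])
    then show ?thesis using that by blast
  qed
  have "(\<Sum>i\<in>I. d i * i) = (\<Sum>i\<in>I. d i * (\<Sum>b\<in>B. c i b * b))"
    using c(2) I(3) by (intro sum.cong) auto
  also have "\<dots> = (\<Sum>b\<in>B. (\<Sum>i\<in>I. d i * c i b) * b)"
    by (simp add: sum_distrib_left sum_distrib_right mult.assoc) (rule sum.swap)
  also have "\<dots> = 0" using d(3) by simp
  finally show ?thesis using d by blast
qed

lemma adjoin_field_subfield:
  assumes F: "is_subring F" shows "is_subfield (adjoin_field F u)"
proof -
  note R = subringD[OF adjoin_ring_subring[OF F, of u]]
  have mem: "a / b \<in> adjoin_field F u" if "a \<in> adjoin_ring F u" "b \<in> adjoin_ring F u" "b \<noteq> 0" for a b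
    using that by (auto simp: adjoin_field_def)
  show ?thesis unfolding is_subfield_def is_subring_def diff_closed_def
  proof (intro conjI ballI)
    show "0 \<in> adjoin_field F u" "1 \<in> adjoin_field F u" using mem[of 0 1] mem[of 1 1] R by auto
    fix x assume x: "x \<in> adjoin_field F u"
    then obtain a b where ab: "a \<in> adjoin_ring F u" "b \<in> adjoin_ring F u" "b \<noteq> 0" "x = a / b"
      by (auto simp: adjoin_field_def)
    show "inverse x \<in> adjoin_field F u"
      using ab mem[of b a] mem[of 0 1] R by (cases "a = 0") auto
    fix y assume "y \<in> adjoin_field F u"
    then obtain c d where cd: "c \<in> adjoin_ring F u" "d \<in> adjoin_ring F u" "d \<noteq> 0" "y = c / d"
      by (auto simp: adjoin_field_def)
    have "x - y = (a * d - c * b) / (b * d)" "x * y = (a * c) / (b * d)" using ab cd by (auto simp: field_simps)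
    then show "x - y \<in> adjoin_field F u" "x * y \<in> adjoin_field F u"
      using ab cd R mem by auto
  qed
qed

lemma clear_denominators:
  assumes F: "is_subring F" and "finite I" "\<And>i. i \<in> I \<Longrightarrow> c i \<in> adjoin_field F u"
  shows "\<exists>d\<in>adjoin_ring F u. d \<noteq> 0 \<and> (\<forall>i\<in>I. d * c i \<in> adjoin_ring F u)"
  using assms(2,3)
proof (induction I rule: finite_induct)
  case empty
  show ?case using subringD(2)[OF adjoin_ring_subring[OF F]] by (intro bexI[of _ 1]) auto
next
  case (insert i I)
  note R = subringD[OF adjoin_ring_subring[OF F, of u]]
  obtain d where d: "d \<in> adjoin_ring F u" "d \<noteq> 0" "\<forall>i\<in>I. d * c i \<in> adjoin_ring F u" using insert by auto
  obtain a b where ab: "a \<in> adjoin_ring F u" "b \<in> adjoin_ring F u" "b \<noteq> 0" "c i = a / b"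
    using insert.prems by (force simp: adjoin_field_def)
  have "d * b * c i = d * a" using ab by simp
  moreover have "d * b * c j \<in> adjoin_ring F u" if "j \<in> I" for j
  proof -
    have "d * b * c j = b * (d * c j)" by (simp add: mult_ac)
    then show ?thesis using R(6)[OF ab(2), of "d * c j"] d(3) that by metis
  qed
  ultimately have "\<forall>j\<in>insert i I. d * b * c j \<in> adjoin_ring F u" using d ab R(6) by simp
  then show ?case using d ab R(6) by (intro bexI[of _ "d * b"]) auto
qed

section \<open>Absolute values at infinity on \<open>F[u]\<close> and \<open>F(u)\<close>\<close>

lemma absval_const:
  fixes F :: "'c::complete_ultrametric_field set"
  assumes "is_subfield F" "\<And>c. c \<in> F \<Longrightarrow> absval c \<le> 1" "c \<in> F" "c \<noteq> 0"
  shows "absval c = 1"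
proof -
  have "absval (inverse c) \<le> 1" using assms subfieldD(2) by blast
  then have "absval c \<ge> 1" using assms(4) by (simp add: absval_inverse one_le_inverse_iff inverse_le_1_iff)
      (metis absval_pos_iff inverse_le_1_iff linorder_not_le)
  then show ?thesis using assms(2,3) by force
qed

text \<open>Every power of \<open>u\<close> below \<open>m\<close> is smaller than
  \<open>u ^ m\<close> by at least one factor \<open>absval u\<close>. The exponent \<open>m\<close>
  may exceed the degree, since \<open>dependent_mod_smaller\<close> uses one \<open>m\<close> for a
  whole family of polynomials.\<close>

lemma absval_poly_minus_lead:
  fixes u :: "'c::complete_ultrametric_field"
  assumes F: "\<And>c. c \<in> F \<Longrightarrow> absval c \<le> 1" and u: "absval u > 1"
    and f: "f \<in> polys_over F" "degree f \<le> m"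
  shows "absval (poly f u - coeff f m * u ^ m) \<le> absval u ^ m / absval u"
proof -
  have "poly f u - coeff f m * u ^ m = (\<Sum>i<m. coeff f i * u ^ i)"
    using poly_expand[OF f(2), of u] by (simp flip: lessThan_Suc_atMost)
  also have "absval \<dots> \<le> absval u ^ m / absval u"
  proof (rule absval_sum_le)
    fix i assume i: "i \<in> {..<m}"
    have "absval (coeff f i * u ^ i) \<le> 1 * absval u ^ i"
      unfolding absval_mult absval_power using F f(1) u by (intro mult_right_mono) (auto simp: polys_over_def)
    also have "\<dots> \<le> absval u ^ (m - 1)" using i u by (simp add: power_increasing)
    also have "\<dots> = absval u ^ m / absval u" using i u by (cases m) auto
    finally show "absval (coeff f i * u ^ i) \<le> absval u ^ m / absval u" .
  qed (use u in auto)
  finally show ?thesis .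
qed

lemma absval_poly:
  fixes u :: "'c::complete_ultrametric_field"
  assumes F: "is_subfield F" "\<And>c. c \<in> F \<Longrightarrow> absval c \<le> 1" and u: "absval u > 1"
    and f: "f \<in> polys_over F" "f \<noteq> 0"
  shows "absval (poly f u) = absval u ^ degree f"
proof -
  let ?l = "lead_coeff f * u ^ degree f"
  have l: "absval ?l = absval u ^ degree f"
    unfolding absval_mult absval_power using absval_const[OF F, of "lead_coeff f"] f by (auto simp: polys_over_def)
  have "absval (poly f u - ?l) \<le> absval u ^ degree f / absval u"
    by (rule absval_poly_minus_lead[OF F(2) u f(1)]) auto
  also have "\<dots> < absval u ^ degree f" using u by (auto simp: divide_less_eq)
  finally have less: "absval (poly f u - ?l) < absval ?l" using l by simp
  have "absval (poly f u) \<le> absval ?l" using absval_ultra[of "poly f u - ?l" ?l] less by simp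
  moreover have "absval ?l \<le> absval (poly f u)" using absval_diff[of "poly f u" "poly f u - ?l"] less by auto
  ultimately show ?thesis using l by simp
qed

text \<open>Division with remainder: \<open>absval u > 1\<close> turns degrees into absolute values,
  so the remainder divided by the denominator has absolute value at most 1.\<close>

lemma adjoin_field_approx:
  fixes u :: "'c::complete_ultrametric_field"
  assumes F: "is_subfield F" "\<And>c. c \<in> F \<Longrightarrow> absval c \<le> 1" and u: "absval u > 1"
    and c: "c \<in> adjoin_field F u"
  shows "\<exists>f\<in>adjoin_ring F u. absval (c - f) \<le> 1"
proof -
  note sF = subfieldD(1)[OF F(1)]
  obtain g h where gh: "g \<in> polys_over F" "h \<in> polys_over F" "poly h u \<noteq> 0" "c = poly g u / poly h u"
    using c by (auto simp: adjoin_field_def adjoin_ring_def)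
  have h0: "h \<noteq> 0" using gh by auto
  have "\<exists>f\<in>adjoin_ring F u. absval (poly g u / poly h u - f) \<le> 1"
    using gh(1)
  proof (induction "degree g" arbitrary: g rule: less_induct)
    case less
    have R: "is_subring (adjoin_ring F u)" by (rule adjoin_ring_subring[OF sF])
    show ?case
    proof (cases "g = 0 \<or> degree g \<le> degree h")
      case True
      have "absval (poly g u / poly h u) \<le> 1"
      proof (cases "g = 0")
        case False
        then have "absval (poly g u) \<le> absval (poly h u)"
          using absval_poly[OF F u less.prems] absval_poly[OF F u gh(2) h0] True u
          by (simp add: power_increasing)
        then show ?thesis using gh(3) by (simp add: absval_divide)
      qed simp
      then show ?thesis using subringD(1)[OF R] by (intro bexI[of _ 0]) auto
    next
      case False
      define t where "t = monom (lead_coeff g / lead_coeff h) (degree g - degree h)"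
      define g' where "g' = g - t * h"
      have lF: "lead_coeff g / lead_coeff h \<in> F"
        using less.prems gh(2) by (intro subfieldD[OF F(1)]) (auto simp: polys_over_def)
      have tP: "t \<in> polys_over F" unfolding t_def by (rule polys_over_monom[OF sF lF])
      have g'P: "g' \<in> polys_over F" unfolding g'_def
        by (intro polys_over_diff polys_over_mult sF tP gh less.prems)
      have t0: "t \<noteq> 0" using False h0 by (simp add: t_def)
      have dt: "degree (t * h) = degree g"
        using False h0 t0 by (simp add: degree_mult_eq) (simp add: t_def degree_monom_eq)
      have lt: "coeff (t * h) (degree g) = lead_coeff g"
        using False h0 lead_coeff_mult[of t h] unfolding dt by (simp add: t_def degree_monom_eq)
      have "degree g' < degree g"
      proof -
        have "degree g' \<le> degree g" unfolding g'_def using dt by (intro degree_diff_le) auto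
        moreover have "coeff g' (degree g) = 0" by (simp add: g'_def lt)
        ultimately show ?thesis using False
          by (metis degree_0 eq_zero_or_degree_less less_nat_zero_code linorder_not_le nat_less_le zero_le)
      qed
      then obtain f where f: "f \<in> adjoin_ring F u" "absval (poly g' u / poly h u - f) \<le> 1"
        using less.hyps g'P by blast
      have "poly g u / poly h u - (f + poly t u) = poly g' u / poly h u - f"
        using gh(3) by (simp add: g'_def field_simps)
      moreover have "poly t u \<in> adjoin_ring F u" using tP by (auto simp: adjoin_ring_def)
      ultimately show ?thesis using f subringD(4)[OF R] by (metis (no_types, lifting))
    qed
  qed
  then show ?thesis using gh by simp
qed

text \<open>More than \<open>card B\<close> elements satisfy a linear relation over
  \<open>F(u)\<close>. After clearing denominators, let \<open>m\<close> be the largest degree of a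
  coefficient. All lower powers of \<open>u\<close> contribute less by a factor
  \<open>absval u\<close>, so the combination with the coefficients of \<open>u ^ m\<close>, which
  lie in \<open>F\<close>, must be small as well.\<close>

lemma dependent_mod_smaller:
  fixes u :: "'c::complete_ultrametric_field"
  assumes F: "is_subfield F" "\<And>c. c \<in> F \<Longrightarrow> absval c \<le> 1" and u: "absval u > 1"
    and B: "finite B" "\<And>x. x \<in> K \<Longrightarrow> \<exists>c. (\<forall>b\<in>B. c b \<in> adjoin_field F u) \<and> x = (\<Sum>b\<in>B. c b * b)"
    and I: "finite I" "card B < card I" "I \<subseteq> K" "\<And>i. i \<in> I \<Longrightarrow> absval i \<le> R"
  shows "\<exists>g. (\<forall>i\<in>I. g i \<in> F) \<and> (\<exists>i\<in>I. g i \<noteq> 0) \<and> absval (\<Sum>i\<in>I. g i * i) \<le> R / absval u"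
proof -
  note sF = subfieldD(1)[OF F(1)]
  obtain d where d: "\<And>i. i \<in> I \<Longrightarrow> d i \<in> adjoin_field F u" "\<exists>i\<in>I. d i \<noteq> 0" "(\<Sum>i\<in>I. d i * i) = 0"
  proof -
    have "\<exists>d. (\<forall>i\<in>I. d i \<in> adjoin_field F u) \<and> (\<exists>i\<in>I. d i \<noteq> 0) \<and> (\<Sum>i\<in>I. d i * i) = 0"
      by (rule dependent_over[OF adjoin_field_subfield[OF sF] B(1) _ I(1-3)]) (rule B(2))
    then show ?thesis using that by blast
  qed
  obtain D where D: "D \<noteq> 0" "\<And>i. i \<in> I \<Longrightarrow> D * d i \<in> adjoin_ring F u"
    using clear_denominators[where c = d and u = u, OF sF I(1)] d(1) by blast
  have "\<exists>f. f \<in> polys_over F \<and> D * d i = poly f u" if "i \<in> I" for i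
    using D(2)[OF that] unfolding adjoin_ring_def by blast
  then obtain f where f: "\<And>i. i \<in> I \<Longrightarrow> f i \<in> polys_over F" "\<And>i. i \<in> I \<Longrightarrow> D * d i = poly (f i) u"
    by metis
  obtain i0 where i0: "i0 \<in> I" "d i0 \<noteq> 0" using d(2) by blast
  then have f0: "f i0 \<noteq> 0" using f(2)[of i0] D(1) by auto
  define J where "J = {i\<in>I. f i \<noteq> 0}"
  define m where "m = Max ((\<lambda>i. degree (f i)) ` J)"
  have J: "finite J" "i0 \<in> J" using I(1) i0 f0 by (auto simp: J_def)
  have dm: "degree (f i) \<le> m" if "i \<in> I" for i
  proof (cases "f i = 0")
    case False
    then have "i \<in> J" using that by (simp add: J_def)
    then show ?thesis unfolding m_def using J(1) by (intro Max_ge) auto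
  qed simp
  \<comment> \<open>The maximum is attained, so the coefficients of \<open>u ^ m\<close> are not all
    zero.\<close>
  have "m \<in> (\<lambda>i. degree (f i)) ` J" unfolding m_def using J by (intro Max_in) auto
  then obtain i1 where i1: "i1 \<in> I" "f i1 \<noteq> 0" "degree (f i1) = m" by (auto simp: J_def)
  have zero: "(\<Sum>i\<in>I. poly (f i) u * i) = 0"
  proof -
    have "(\<Sum>i\<in>I. poly (f i) u * i) = D * (\<Sum>i\<in>I. d i * i)"
      unfolding sum_distrib_left by (rule sum.cong) (use f(2) in \<open>auto simp: mult.assoc[symmetric]\<close>)
    then show ?thesis using d(3) by simp
  qed
  have u0: "u \<noteq> 0" using u by auto
  have R0: "R \<ge> 0" using I(4)[OF i0(1)] absval_nonneg order_trans by blast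
  have "u ^ m * (\<Sum>i\<in>I. coeff (f i) m * i) = - (\<Sum>i\<in>I. (poly (f i) u - coeff (f i) m * u ^ m) * i)"
  proof -
    have "(\<Sum>i\<in>I. (poly (f i) u - coeff (f i) m * u ^ m) * i) =
        (\<Sum>i\<in>I. poly (f i) u * i) - (\<Sum>i\<in>I. u ^ m * (coeff (f i) m * i))"
      unfolding sum_subtractf[symmetric] by (rule sum.cong) (auto simp: algebra_simps)
    then show ?thesis by (simp add: zero sum_distrib_left)
  qed
  then have "absval u ^ m * absval (\<Sum>i\<in>I. coeff (f i) m * i) =
      absval (\<Sum>i\<in>I. (poly (f i) u - coeff (f i) m * u ^ m) * i)"
    by (simp only: absval_minus flip: absval_mult absval_power)
  also have "\<dots> \<le> absval u ^ m / absval u * R"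
  proof (rule absval_sum_le)
    fix i assume "i \<in> I"
    then show "absval ((poly (f i) u - coeff (f i) m * u ^ m) * i) \<le> absval u ^ m / absval u * R"
      unfolding absval_mult using absval_poly_minus_lead[OF F(2) u f(1) dm] I(4) u
      by (intro mult_mono) auto
  qed (use u R0 in auto)
  finally have "absval u ^ m * absval (\<Sum>i\<in>I. coeff (f i) m * i) \<le> absval u ^ m * (R / absval u)"
    by (simp add: mult.commute)
  then have "absval (\<Sum>i\<in>I. coeff (f i) m * i) \<le> R / absval u"
    by (rule mult_left_le_imp_le) (rule zero_less_power, use u in linarith)
  moreover have "coeff (f i1) m \<noteq> 0" using i1 by auto
  moreover have "coeff (f i) m \<in> F" if "i \<in> I" for i using f(1)[OF that] by (simp add: polys_over_def)
  ultimately show ?thesis using i1(1) by (intro exI[of _ "\<lambda>i. coeff (f i) m"]) blast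
qed

text \<open>Modulo the elements of size at most \<open>R / absval u\<close>, those of size at most
  \<open>R\<close> form a vector space over the finite field \<open>F\<close> of dimension at most
  \<open>card B\<close>. This takes the place of the Riemann inequality for multiples of the point
  at infinity.\<close>

lemma finite_bounded_step:
  fixes u :: "'c::complete_ultrametric_field"
  assumes F: "is_subfield F" "\<And>c. c \<in> F \<Longrightarrow> absval c \<le> 1" "finite F" and u: "absval u > 1"
    and B: "finite B" "\<And>x. x \<in> K \<Longrightarrow> \<exists>c. (\<forall>b\<in>B. c b \<in> adjoin_field F u) \<and> x = (\<Sum>b\<in>B. c b * b)"
    and A: "is_subring A" "F \<subseteq> A" "A \<subseteq> K"
    and fin: "finite {a\<in>A. absval a \<le> R / absval u}"
  shows "finite {a\<in>A. absval a \<le> R}"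
proof -
  let ?H = "{a\<in>A. absval a \<le> R / absval u}"
  define indep where "indep I \<longleftrightarrow> finite I \<and> I \<subseteq> {a\<in>A. absval a \<le> R} \<and>
    (\<forall>g. (\<forall>i\<in>I. g i \<in> F) \<and> absval (\<Sum>i\<in>I. g i * i) \<le> R / absval u \<longrightarrow> (\<forall>i\<in>I. g i = 0))" for I
  have bound: "card I \<le> card B" if I: "indep I" for I
  proof (rule ccontr)
    assume "\<not> card I \<le> card B"
    moreover have "finite I" "I \<subseteq> K" "\<And>i. i \<in> I \<Longrightarrow> absval i \<le> R" using I A(3) unfolding indep_def by auto
    ultimately obtain g where "\<forall>i\<in>I. g i \<in> F" "\<exists>i\<in>I. g i \<noteq> 0" "absval (\<Sum>i\<in>I. g i * i) \<le> R / absval u"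
      using dependent_mod_smaller[where K = K and I = I and R = R, OF F(1,2) u B] by auto
    then show False using I unfolding indep_def by blast
  qed
  \<comment> \<open>The bound on sizes provides an independent set of largest size; adding any
    \<open>x\<close> to it creates a relation in which \<open>x\<close> has a nonzero
    coefficient.\<close>
  have "indep {}" by (simp add: indep_def)
  then obtain I where I: "indep I" and max: "\<And>J. indep J \<Longrightarrow> card J \<le> card I"
    using ex_has_greatest_nat[of indep "{}" card "Suc (card B)"] bound by (auto simp: less_Suc_eq_le)
  have finI: "finite I" and IA: "I \<subseteq> A" "\<And>i. i \<in> I \<Longrightarrow> absval i \<le> R" using I unfolding indep_def by auto
  have "x \<in> (\<lambda>(g, h). (\<Sum>i\<in>I. g i * i) + h) ` ((I \<rightarrow>\<^sub>E F) \<times> insert 0 ?H)"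
    if x: "x \<in> A" "absval x \<le> R" for x
  proof (cases "x \<in> I")
    case True
    let ?g = "\<lambda>i\<in>I. if i = x then 1 else 0"
    have "?g \<in> I \<rightarrow>\<^sub>E F" using subringD(1,2)[OF subfieldD(1)[OF F(1)]] by auto
    moreover have "(\<Sum>i\<in>I. ?g i * i) = (\<Sum>i\<in>I. if i = x then x else 0)" by (rule sum.cong) auto
    then have "x = (\<Sum>i\<in>I. ?g i * i) + 0" using True finI by simp
    ultimately show ?thesis by (intro image_eqI[of _ _ "(?g, 0)"]) auto
  next
    case False
    then have "\<not> indep (insert x I)" using max[of "insert x I"] finI by auto
    then obtain g where g: "\<forall>i\<in>insert x I. g i \<in> F" "absval (\<Sum>i\<in>insert x I. g i * i) \<le> R / absval u"
      "\<not> (\<forall>i\<in>insert x I. g i = 0)"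
      using finI IA x unfolding indep_def by auto
    have s: "(\<Sum>i\<in>insert x I. g i * i) = g x * x + (\<Sum>i\<in>I. g i * i)" using False finI by simp
    have gx: "g x \<noteq> 0"
    proof
      assume "g x = 0"
      then have "absval (\<Sum>i\<in>I. g i * i) \<le> R / absval u" using g(2) s by simp
      then have "\<forall>i\<in>I. g i = 0" using I g(1) unfolding indep_def by blast
      then show False using g(3) \<open>g x = 0\<close> by simp
    qed
    define h where "h = inverse (g x) * (\<Sum>i\<in>insert x I. g i * i)"
    let ?g = "\<lambda>i\<in>I. - (inverse (g x) * g i)"
    have gF: "inverse (g x) \<in> F" using g(1) subfieldD(2)[OF F(1)] by blast
    have "absval (inverse (g x)) = 1" using absval_const[OF F(1,2) gF] gx by simp
    then have "absval h \<le> R / absval u" using g(2) by (simp add: h_def absval_mult)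
    moreover have "h \<in> A" unfolding h_def using gF g(1) A IA x
      by (intro subringD[OF A(1)]) auto
    ultimately have "h \<in> ?H" by simp
    moreover have "?g \<in> I \<rightarrow>\<^sub>E F" using g(1) gF subringD(3,6)[OF subfieldD(1)[OF F(1)]] by auto
    moreover have "x = (\<Sum>i\<in>I. ?g i * i) + h"
    proof -
      have "(\<Sum>i\<in>I. ?g i * i) = - (inverse (g x) * (\<Sum>i\<in>I. g i * i))"
        unfolding sum_distrib_left sum_negf[symmetric] by (rule sum.cong) (auto simp: mult.assoc)
      then show ?thesis unfolding h_def s using gx by (simp add: distrib_left)
    qed
    ultimately show ?thesis by (intro image_eqI[of _ _ "(?g, h)"]) auto
  qed
  then have "{a\<in>A. absval a \<le> R} \<subseteq> (\<lambda>(g, h). (\<Sum>i\<in>I. g i * i) + h) ` ((I \<rightarrow>\<^sub>E F) \<times> insert 0 ?H)" by blast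
  moreover have "finite ((I \<rightarrow>\<^sub>E F) \<times> insert 0 ?H)" using fin F(3) finI by (simp add: finite_PiE)
  ultimately show ?thesis using finite_subset by blast
qed

section \<open>Generators of the coordinate ring over \<open>F[u]\<close>\<close>

lemma function_fieldD:
  assumes "function_field F K"
  shows "is_subfield F" "finite F" "is_subfield K" "F \<subseteq> K" "\<And>x. x \<in> K \<Longrightarrow> algebraic_over F x \<Longrightarrow> x \<in> F"
    "\<exists>t\<in>K. \<not> algebraic_over F t"
  using assms subfield_of_field by (auto simp: function_field_def)

lemma finite_extension_spanE:
  assumes "finite_extension_of E K"
  obtains B where "finite B" "B \<subseteq> K" "\<And>x. x \<in> K \<Longrightarrow> \<exists>c. (\<forall>b\<in>B. c b \<in> E) \<and> x = (\<Sum>b\<in>B. c b * b)"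
proof -
  obtain B where "is_basis E K B" using assms unfolding finite_extension_of_def by (elim conjE exE)
  then show ?thesis using that[of B] by (simp add: is_basis_def)
qed

text \<open>An algebraic \<open>u\<close> would lie in \<open>F\<close>, so \<open>K\<close> would
  be finite over a finite field. Then two powers of a transcendental \<open>t\<close> would
  coincide.\<close>

lemma transcendental_if_finite_extension:
  assumes ff: "function_field F K" and u: "u \<in> K" "finite_extension_of (adjoin_field F u) K"
  shows "\<not> algebraic_over F u"
proof
  assume "algebraic_over F u"
  note FK = function_fieldD[OF ff]
  have uF: "u \<in> F" using FK(5) u(1) \<open>algebraic_over F u\<close> by blast
  have "adjoin_ring F u \<subseteq> F" by (rule adjoin_ring_least) (use uF subfieldD(1)[OF FK(1)] in auto)
  then have EF: "adjoin_field F u \<subseteq> F" unfolding adjoin_field_def using subfieldD(3)[OF FK(1)] by auto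
  obtain B where B: "finite B" "\<And>x. x \<in> K \<Longrightarrow> \<exists>c. (\<forall>b\<in>B. c b \<in> adjoin_field F u) \<and> x = (\<Sum>b\<in>B. c b * b)"
    using finite_extension_spanE[OF u(2)] by metis
  have "K \<subseteq> (\<lambda>c. \<Sum>b\<in>B. c b * b) ` (B \<rightarrow>\<^sub>E F)"
  proof
    fix x assume "x \<in> K"
    then obtain c where c: "\<forall>b\<in>B. c b \<in> F" "x = (\<Sum>b\<in>B. c b * b)" using B(2) EF by blast
    have "x = (\<Sum>b\<in>B. restrict c B b * b)" unfolding c(2) by (rule sum.cong) auto
    moreover have "restrict c B \<in> B \<rightarrow>\<^sub>E F" using c(1) by auto
    ultimately show "x \<in> (\<lambda>c. \<Sum>b\<in>B. c b * b) ` (B \<rightarrow>\<^sub>E F)" by (rule image_eqI)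
  qed
  then have finK: "finite K" using FK(2) B(1) by (meson finite_PiE finite_imageI finite_subset)
  obtain t where t: "t \<in> K" "\<not> algebraic_over F t" using FK(6) by blast
  have "range (\<lambda>i::nat. t ^ i) \<subseteq> K" using t(1) subringD(7)[OF subfieldD(1)[OF FK(3)]] by auto
  then have "\<not> inj (\<lambda>i::nat. t ^ i)" using finK finite_subset range_inj_infinite by blast
  then obtain i j :: nat where ij: "i < j" "t ^ i = t ^ j" by (metis linorder_inj_onI' linorder_neqE_nat injI)
  have "monom 1 j - monom 1 i \<in> polys_over F"
    using subfieldD(1)[OF FK(1)] by (intro polys_over_diff polys_over_monom subringD)
  moreover have "coeff (monom 1 j - monom (1 :: 'a) i) j = 1" using ij(1) by simp
  then have "monom 1 j - monom (1 :: 'a) i \<noteq> 0" by (metis coeff_0 zero_neq_one)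
  moreover have "poly (monom 1 j - monom 1 i) t = 0" using ij(2) by (simp add: poly_monom)
  ultimately show False using t(2) unfolding algebraic_over_def by blast
qed

lemma regular_away_subring:
  assumes "is_subfield F" "is_subfield K" "F \<subseteq> K" "A = regular_away F K Oinf"
  shows "is_subring A" "F \<subseteq> A" "A \<subseteq> K"
proof -
  have V: "is_subring V" "F \<subseteq> V" if "is_place F K V" for V
    using that subring_of_cring by (auto simp: is_place_def)
  note K = subringD[OF subfieldD(1)[OF assms(2)]]
  show "is_subring A"
    unfolding assms(4) regular_away_def is_subring_def diff_closed_def
    using V(1) by (auto simp: K subringD)
  show "F \<subseteq> A" "A \<subseteq> K" using assms V(2) by (auto simp: regular_away_def)
qed

text \<open>Such an element lies in every place, whereas \<open>place_avoiding\<close> gives each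
  transcendental element a place that omits it.\<close>

lemma regular_bounded_const:
  assumes ff: "function_field F K" and "A = regular_away F K Oinf" "x \<in> A" "x \<in> Oinf"
  shows "x \<in> F"
proof (rule ccontr)
  note FK = function_fieldD[OF ff]
  assume "x \<notin> F"
  moreover have xK: "x \<in> K" using assms by (auto simp: regular_away_def)
  ultimately obtain V where "is_place F K V" "x \<notin> V"
    using place_avoiding[OF FK(1,3,4) xK] FK(5) by blast
  then show False using assms by (cases "V = Oinf") (auto simp: regular_away_def)
qed

text \<open>Scale an \<open>F(u)\<close>-basis of \<open>K\<close> into \<open>A\<close>. Removing
  the polynomial parts of the coordinates of \<open>a\<close> leaves an element of \<open>A\<close>
  of bounded absolute value, and there are only finitely many of these. Both families serve as
  generators; the disjoint sum as index type lets them overlap.\<close>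

lemma coordinate_ring_finite:
  fixes u :: "'c::complete_ultrametric_field"
  assumes ff: "function_field F K" and A_def: "A = regular_away F K Oinf"
    and inf: "is_place F K Oinf" "{x\<in>K. absval x \<le> 1} = Oinf"
    and u: "u \<in> A" "finite_separable (adjoin_field F u) K"
  shows "absval u > 1"
    and "\<exists>(I :: ('c + 'c) set) g. finite I \<and> (\<forall>i\<in>I. g i \<in> A) \<and>
      (\<forall>a\<in>A. \<exists>c. (\<forall>i\<in>I. c i \<in> adjoin_ring F u) \<and> a = (\<Sum>i\<in>I. c i * g i))"
proof -
  note FK = function_fieldD[OF ff]
  note A = regular_away_subring[OF FK(1,3,4) A_def]
  note sF = subfieldD(1)[OF FK(1)]
  have ext: "finite_extension_of (adjoin_field F u) K" using u(2) by (simp add: finite_separable_def)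
  have uK: "u \<in> K" using A u by blast
  have "u \<notin> F"
  proof
    assume "u \<in> F"
    then have "[:- u, 1:] \<in> polys_over F"
      using subringD[OF sF] by (auto simp: polys_over_def coeff_pCons split: nat.split)
    then have "algebraic_over F u" unfolding algebraic_over_def by (intro bexI[of _ "[:- u, 1:]"]) auto
    then show False using transcendental_if_finite_extension[OF ff uK ext] by blast
  qed
  then have "u \<notin> Oinf" using regular_bounded_const[OF ff A_def u(1)] by blast
  then show u1: "absval u > 1" using inf(2) uK by auto
  have F1: "absval c \<le> 1" if "c \<in> F" for c using that inf by (auto simp: is_place_def)
  obtain B where B: "finite B" "B \<subseteq> K"
    "\<And>x. x \<in> K \<Longrightarrow> \<exists>c. (\<forall>b\<in>B. c b \<in> adjoin_field F u) \<and> x = (\<Sum>b\<in>B. c b * b)"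
    using finite_extension_spanE[OF ext] by metis
  \<comment> \<open>At radius 1 only constants remain; each step enlarges the radius by a factor
    \<open>absval u\<close>.\<close>
  have fin: "finite {a\<in>A. absval a \<le> absval u ^ m}" for m
  proof (induction m)
    case 0
    have "{a\<in>A. absval a \<le> absval u ^ 0} \<subseteq> F"
      using regular_bounded_const[OF ff A_def] inf(2) A(3) by auto
    then show ?case using FK(2) finite_subset by blast
  next
    case (Suc m)
    have "absval u ^ Suc m / absval u = absval u ^ m" using u1 by auto
    then show ?case
      using finite_bounded_step[OF FK(1) F1 FK(2) u1 B(1,3) A, of "absval u ^ Suc m"] Suc.IH by simp
  qed
  have sR: "is_subring (adjoin_ring F u)" by (rule adjoin_ring_subring[OF sF])
  \<comment> \<open>The minimal polynomial is monic, so a common denominator \<open>D\<close> of its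
    coefficients becomes the leading coefficient of an equation over \<open>F[u]\<close>.
    \<open>place_integral\<close> then puts \<open>D x\<close> into every place other than
    infinity.\<close>
  have "\<exists>d. d \<in> adjoin_ring F u \<and> d \<noteq> 0 \<and> d * x \<in> A" if x: "x \<in> K" for x
  proof -
    obtain m where m: "m \<in> polys_over (adjoin_field F u)" "lead_coeff m = 1" "poly m x = 0"
      using u(2) x by (auto simp: finite_separable_def is_min_poly_def)
    obtain D where D: "D \<in> adjoin_ring F u" "D \<noteq> 0"
      "\<And>i. i \<in> {..degree m} \<Longrightarrow> D * coeff m i \<in> adjoin_ring F u"
      using clear_denominators[OF sF, of "{..degree m}" "coeff m" u] m(1) by (auto simp: polys_over_def)
    have all: "D * coeff m i \<in> adjoin_ring F u" for i
    proof (cases "i \<le> degree m")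
      case False
      then show ?thesis using subringD(1)[OF sR] by (simp add: coeff_eq_0)
    qed (use D in auto)
    define f where "f = Polynomial.smult D m"
    have "D * x \<in> V" if V: "is_place F K V" "V \<noteq> Oinf" for V
    proof -
      have sV: "is_subring V" "F \<subseteq> V" using V(1) subring_of_cring by (auto simp: is_place_def)
      have "u \<in> V" using u(1) V by (auto simp: A_def regular_away_def)
      then have "adjoin_ring F u \<subseteq> V" using adjoin_ring_least sV by blast
      then have "f \<in> polys_over V" using all by (auto simp: f_def polys_over_def)
      moreover have "poly f x = 0" "f \<noteq> 0" "lead_coeff f = D" using m D(2) by (auto simp: f_def)
      ultimately show ?thesis using place_integral[OF V(1) x _ _ _ FK(3), of f] by simp
    qed
    moreover have "D * x \<in> K"
    proof -
      have "adjoin_ring F u \<subseteq> K" by (rule adjoin_ring_least[OF subfieldD(1)[OF FK(3)] FK(4) uK])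
      then show ?thesis using D(1) x subringD(6)[OF subfieldD(1)[OF FK(3)]] by blast
    qed
    ultimately have "D * x \<in> A" by (auto simp: A_def regular_away_def)
    then show ?thesis using D by blast
  qed
  then obtain d where d: "\<And>b. b \<in> B \<Longrightarrow> d b \<in> adjoin_ring F u" "\<And>b. b \<in> B \<Longrightarrow> d b \<noteq> 0"
    "\<And>b. b \<in> B \<Longrightarrow> d b * b \<in> A" using B(2) by (metis subsetD)
  define R where "R = Max (insert 1 ((\<lambda>b. absval (d b * b)) ` B))"
  have R: "absval (d b * b) \<le> R" if "b \<in> B" for b
    unfolding R_def using B(1) that by (intro Max_ge) auto
  have R1: "R \<ge> 1" unfolding R_def using B(1) by (intro Max_ge) auto
  obtain m where m: "R < absval u ^ m" using real_arch_pow[OF u1] by blast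
  define H where "H = {a\<in>A. absval a \<le> R}"
  have finH: "finite H" unfolding H_def using m by (intro finite_subset[OF _ fin[of m]]) auto
  define g where "g = case_sum (\<lambda>b. d b * b) (\<lambda>a. a)"
  have Ru: "adjoin_ring F u \<subseteq> A" by (rule adjoin_ring_least[OF A(1,2) u(1)])
  have "\<exists>c. (\<forall>i\<in>B <+> H. c i \<in> adjoin_ring F u) \<and> a = (\<Sum>i\<in>B <+> H. c i * g i)" if a: "a \<in> A" for a
  proof -
    obtain c where c: "\<And>b. b \<in> B \<Longrightarrow> c b \<in> adjoin_field F u" "a = (\<Sum>b\<in>B. c b * b)" using B(3) a A(3) by blast
    have Rin: "adjoin_ring F u \<subseteq> adjoin_field F u"
    proof
      fix x assume "x \<in> adjoin_ring F u"
      then show "x \<in> adjoin_field F u"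
        unfolding adjoin_field_def using subringD(2)[OF sR] by (intro CollectI exI[of _ x] exI[of _ 1]) auto
    qed
    have "\<exists>f. f \<in> adjoin_ring F u \<and> absval (c b / d b - f) \<le> 1" if b: "b \<in> B" for b
      using adjoin_field_approx[OF FK(1) F1 u1, of "c b / d b"]
        subfieldD(3)[OF adjoin_field_subfield[OF sF], of "c b" u "d b"] c(1)[OF b] d(1)[OF b] Rin by blast
    then obtain f where f: "\<And>b. b \<in> B \<Longrightarrow> f b \<in> adjoin_ring F u" "\<And>b. b \<in> B \<Longrightarrow> absval (c b / d b - f b) \<le> 1"
      by metis
    \<comment> \<open>The remainder is bounded by \<open>R\<close>, because each coordinate is
      within 1 of a polynomial, and it lies in \<open>A\<close>; so it is itself one of the
      generators in \<open>H\<close>.\<close>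
    define a' where "a' = a - (\<Sum>b\<in>B. f b * (d b * b))"
    have "a' = (\<Sum>b\<in>B. (c b / d b - f b) * (d b * b))"
      unfolding a'_def c(2) sum_subtractf[symmetric]
      by (rule sum.cong) (use d(2) in \<open>auto simp: field_simps\<close>)
    also have "absval \<dots> \<le> 1 * R"
    proof (rule absval_sum_le)
      fix b assume "b \<in> B"
      then show "absval ((c b / d b - f b) * (d b * b)) \<le> 1 * R"
        unfolding absval_mult[of "c b / d b - f b"] using f R by (intro mult_mono) auto
    qed (use R1 in auto)
    finally have "absval a' \<le> R" by simp
    moreover have "a' \<in> A"
    proof -
      have "f b * (d b * b) \<in> A" if "b \<in> B" for b
        using subringD(6)[OF A(1), of "f b" "d b * b"] f(1)[OF that] d(3)[OF that] Ru by blast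
      then show ?thesis unfolding a'_def by (intro subringD(5,8)[OF A(1)] a)
    qed
    ultimately have a'H: "a' \<in> H" by (simp add: H_def)
    define e where "e = case_sum f (\<lambda>x. if x = a' then 1 else 0)"
    have "(\<Sum>i\<in>B <+> H. e i * g i) = (\<Sum>b\<in>B. f b * (d b * b)) + (\<Sum>x\<in>H. if x = a' then a' else 0)"
      by (subst sum.Plus[OF B(1) finH]) (auto simp: e_def g_def intro!: arg_cong2[of _ _ _ _ "(+)"] sum.cong)
    also have "\<dots> = a" using finH a'H by (simp add: a'_def)
    finally have "a = (\<Sum>i\<in>B <+> H. e i * g i)" by simp
    moreover have "\<forall>i\<in>B <+> H. e i \<in> adjoin_ring F u"
      using f(1) subringD(1,2)[OF sR] by (auto simp: e_def)
    ultimately show ?thesis by blast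
  qed
  moreover have "\<forall>i\<in>B <+> H. g i \<in> A" using d(3) by (auto simp: g_def H_def)
  moreover have "finite (B <+> H)" using B(1) finH by simp
  ultimately show "\<exists>(I :: ('c + 'c) set) g. finite I \<and> (\<forall>i\<in>I. g i \<in> A) \<and>
      (\<forall>a\<in>A. \<exists>c. (\<forall>i\<in>I. c i \<in> adjoin_ring F u) \<and> a = (\<Sum>i\<in>I. c i * g i))" by blast
qed

section \<open>Frobenius\<close>

lemma power_card_subfield:
  assumes F: "is_subfield F" "finite F" and c: "c \<in> F"
  shows "c ^ card F = c"
proof (cases "c = 0")
  case True
  have "card F > 0" using F(2) c by (auto simp: card_gt_0_iff)
  with True show ?thesis by simp
next
  case False
  let ?S = "F - {0}"
  note sF = subringD[OF subfieldD(1)[OF F(1)]]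
  have "bij_betw ((*) c) ?S ?S"
    unfolding bij_betw_def
  proof
    show inj: "inj_on ((*) c) ?S" using False by (auto simp: inj_on_def)
    have "(*) c ` ?S \<subseteq> ?S" using False c sF(6) by auto
    then show "(*) c ` ?S = ?S" using inj F(2) by (simp add: endo_inj_surj)
  qed
  then have "(\<Prod>x\<in>?S. c * x) = (\<Prod>x\<in>?S. x)" by (rule prod.reindex_bij_betw)
  then have "c ^ card ?S * (\<Prod>x\<in>?S. x) = (\<Prod>x\<in>?S. x)" by (simp add: prod.distrib)
  moreover have "(\<Prod>x\<in>?S. x) \<noteq> 0" using F(2) by simp
  ultimately have "c ^ card ?S = 1" by simp
  moreover have "card F = Suc (card ?S)" using card.remove[OF F(2) sF(1)] by simp
  ultimately show ?thesis by simp
qed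

text \<open>The polynomial \<open>(1 + X)^q - X^q - 1\<close> has degree below \<open>q\<close> and
  vanishes on all \<open>q\<close> elements of \<open>F\<close>, hence is zero. This avoids writing
  \<open>q\<close> as a power of the characteristic.\<close>

lemma frobenius_add:
  fixes x y :: "'c::field" and F :: "'c set"
  assumes F: "is_subfield F" "finite F"
  shows "(x + y) ^ card F = x ^ card F + y ^ card F"
proof -
  let ?q = "card F"
  note sF = subringD[OF subfieldD(1)[OF F(1)]]
  have q: "?q > 0" using F(2) sF(1) by (auto simp: card_gt_0_iff)
  define g :: "'c poly" where "g = [:1, 1:] ^ ?q - (monom 1 ?q + 1)"
  have root: "poly g c = 0" if "c \<in> F" for c
  proof -
    have "1 + c \<in> F" using that sF by blast
    then show ?thesis using power_card_subfield[OF F] that by (simp add: g_def poly_monom)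
  qed
  have "g = 0"
  proof (rule ccontr)
    assume g0: "g \<noteq> 0"
    have d1: "degree ([:1, 1:] ^ ?q :: 'c poly) = ?q" by (simp add: degree_power_eq)
    have d2: "degree (monom 1 ?q + 1 :: 'c poly) \<le> ?q"
      by (intro degree_add_le) (auto simp: degree_monom_eq)
    have "degree g \<le> ?q" unfolding g_def using d1 d2 by (intro degree_diff_le) auto
    moreover have "coeff g ?q = 0"
    proof -
      have "coeff ([:1, 1:] ^ ?q :: 'c poly) ?q = 1"
        using lead_coeff_power[of "[:1, 1:] :: 'c poly" ?q] d1 by simp
      then show ?thesis using q by (simp add: g_def)
    qed
    ultimately have dg: "degree g < ?q"
      using g0 by (metis leading_coeff_0_iff le_neq_implies_less)
    have "card F \<le> card {x. poly g x = 0}"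
      using root poly_roots_finite[OF g0] by (intro card_mono) auto
    also have "\<dots> \<le> degree g" by (rule card_poly_roots_bound[OF g0])
    finally show False using dg by simp
  qed
  have one: "(1 + w) ^ ?q = 1 + w ^ ?q" for w :: 'c
  proof -
    have "poly g w = 0" using \<open>g = 0\<close> by simp
    then show ?thesis by (simp add: g_def poly_monom)
  qed
  show ?thesis
  proof (cases "y = 0")
    case True
    then show ?thesis using q by simp
  next
    case False
    have "x + y = y * (1 + x / y)" using False by (simp add: field_simps)
    then have "(x + y) ^ ?q = (y * (1 + x / y)) ^ ?q" by (simp only:)
    also have "\<dots> = y ^ ?q * (1 + (x / y) ^ ?q)" by (simp only: power_mult_distrib one)
    also have "\<dots> = x ^ ?q + y ^ ?q" using False by (simp add: power_divide field_simps)
    finally show ?thesis .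
  qed
qed

lemma frobenius_pow_add:
  fixes x y :: "'c::field" and F :: "'c set"
  assumes F: "is_subfield F" "finite F"
  shows "(x + y) ^ (card F ^ n) = x ^ (card F ^ n) + y ^ (card F ^ n)"
proof (induction n)
  case (Suc n)
  have "(x + y) ^ (card F ^ Suc n) = ((x + y) ^ (card F ^ n)) ^ card F" by (simp add: power_mult[symmetric] mult.commute)
  also have "\<dots> = (x ^ (card F ^ n)) ^ card F + (y ^ (card F ^ n)) ^ card F"
    by (simp only: Suc.IH frobenius_add[OF F])
  finally show ?case by (simp add: power_mult[symmetric] mult.commute)
qed simp

lemma frobenius_pow_fixed:
  assumes F: "is_subfield F" "finite F" and c: "c \<in> F"
  shows "c ^ (card F ^ n) = c"
proof (induction n)
  case (Suc n)
  have "c ^ (card F ^ Suc n) = (c ^ (card F ^ n)) ^ card F" by (simp add: power_mult[symmetric] mult.commute)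
  then show ?case using Suc.IH power_card_subfield[OF F c] by simp
qed simp

lemma card_subfield_pos:
  assumes "is_subfield F" "finite F" shows "card F > 0"
  using assms subringD(1)[OF subfieldD(1)] by (auto simp: card_gt_0_iff)

lemma frob_vec_add:
  fixes F :: "'c::field set" and x y :: "'c^'d"
  assumes F: "is_subfield F" "finite F"
  shows "frob_vec (card F) n (x + y) = frob_vec (card F) n x + frob_vec (card F) n y"
  by (simp add: frob_vec_def vec_eq_iff frobenius_pow_add[OF F])

lemma frob_vec_smult:
  assumes F: "is_subfield F" "finite F" "c \<in> F"
  shows "frob_vec (card F) n (c *s x) = c *s frob_vec (card F) n x"
  by (simp add: frob_vec_def vec_eq_iff power_mult_distrib frobenius_pow_fixed[OF F])

lemma frob_vec_0:
  assumes F: "is_subfield F" "finite F" shows "frob_vec (card F) n 0 = 0"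
  using card_subfield_pos[OF F] by (simp add: frob_vec_def vec_eq_iff)

lemma twisted_app_add:
  fixes F :: "'c::field set" and f :: "('c, 'd::finite) twisted"
  assumes F: "is_subfield F" "finite F"
  shows "twisted_app (card F) f (x + y) = twisted_app (card F) f x + twisted_app (card F) f y"
  by (simp add: twisted_app_def frob_vec_add[OF F] matrix_vector_right_distrib sum.distrib)

lemma twisted_app_smult:
  assumes F: "is_subfield F" "finite F" "c \<in> F"
  shows "twisted_app (card F) f (c *s x) = c *s twisted_app (card F) f x"
proof -
  have "f n *v frob_vec (card F) n (c *s x) = c *s (f n *v frob_vec (card F) n x)" for n
    by (simp add: frob_vec_smult[OF F] vector_scalar_commute)
  then show ?thesis by (simp add: twisted_app_def vec.scale_sum_right)
qed

lemma twisted_app_0: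
  assumes F: "is_subfield F" "finite F" shows "twisted_app (card F) f 0 = 0"
  by (simp add: twisted_app_def frob_vec_0[OF F])

text \<open>The multiples of 1 stay in the finite set \<open>F\<close>, so two of them
  coincide.\<close>

lemma char_pos:
  assumes F: "is_subfield F" "finite (F :: 'c::field set)" shows "prime CHAR('c)"
proof -
  have "of_nat i \<in> F" for i
    using subringD(1,2,4)[OF subfieldD(1)[OF F(1)]] by (induction i) auto
  then have "range (of_nat :: nat \<Rightarrow> 'c) \<subseteq> F" by auto
  then have "\<not> inj (of_nat :: nat \<Rightarrow> 'c)" using F(2) finite_subset range_inj_infinite by blast
  then obtain i j :: nat where "i < j" "of_nat i = (of_nat j :: 'c)"
    by (metis injI linorder_neqE_nat)
  then have "of_nat (j - i) = (0 :: 'c)" by (simp add: of_nat_diff)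
  then have "CHAR('c) > 0" using \<open>i < j\<close> CHAR_pos_iff zero_less_diff by blast
  then show ?thesis by (rule prime_CHAR_semidom)
qed

section \<open>Anderson modules\<close>

locale anderson =
  fixes F A L :: "'c::complete_ultrametric_field set"
    and phi :: "'c \<Rightarrow> ('c, 'd::finite) twisted" and ex :: "'c^'d \<Rightarrow> 'c^'d"
  assumes F: "is_subfield F" and finF: "finite F" and F1: "\<And>c. c \<in> F \<Longrightarrow> absval c \<le> 1"
    and A: "is_subring A" and FA: "F \<subseteq> A"
    and E: "anderson_module F A L phi" and exp_E: "is_exponential F A phi ex"
begin

abbreviation dd :: "'c \<Rightarrow> 'c^'d \<Rightarrow> 'c^'d" where "dd a x \<equiv> phi a 0 *v x"
abbreviation tw :: "'c \<Rightarrow> 'c^'d \<Rightarrow> 'c^'d" where "tw a \<equiv> twisted_app (card F) (phi a)"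

lemmas sF = subfieldD(1)[OF F]
lemmas tw_add = twisted_app_add[OF F finF]
lemmas tw_smult = twisted_app_smult[OF F finF]
lemmas tw_0 = twisted_app_0[OF F finF]

lemma phi_add: "a \<in> A \<Longrightarrow> b \<in> A \<Longrightarrow> phi (a + b) 0 = phi a 0 + phi b 0"
  using E by (simp add: anderson_module_def)

lemma phi_mult: "a \<in> A \<Longrightarrow> b \<in> A \<Longrightarrow> phi (a * b) 0 = phi a 0 ** phi b 0"
proof -
  have "frob_mat (card F) 0 M = M" for M :: "'c^'d^'d" by (simp add: frob_mat_def vec_eq_iff)
  then show "a \<in> A \<Longrightarrow> b \<in> A \<Longrightarrow> phi (a * b) 0 = phi a 0 ** phi b 0"
    using E by (simp add: anderson_module_def twisted_mult_def)
qed

lemma phi_const: "c \<in> F \<Longrightarrow> phi c 0 = mat c"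
  using E by (simp add: anderson_module_def twisted_const_def)

lemma mat_vec: "mat c *v x = c *s (x :: 'c^'d)"
  by (simp add: vec_eq_iff matrix_vector_mult_def mat_def if_distrib[of "\<lambda>y. y * _"] cong: if_cong)

lemma dd_add_left: "a \<in> A \<Longrightarrow> b \<in> A \<Longrightarrow> dd (a + b) x = dd a x + dd b x"
  by (simp add: phi_add matrix_vector_mult_add_rdistrib)

lemma dd_mult: "a \<in> A \<Longrightarrow> b \<in> A \<Longrightarrow> dd (a * b) x = dd a (dd b x)"
  by (simp add: phi_mult matrix_vector_mul_assoc)

lemma dd_commute: "a \<in> A \<Longrightarrow> b \<in> A \<Longrightarrow> dd a (dd b x) = dd b (dd a x)"
  by (metis dd_mult mult.commute)

lemma dd_const: "c \<in> F \<Longrightarrow> dd c x = c *s x"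
  by (simp add: phi_const mat_vec)

lemma dd_1: "dd 1 x = x"
  using dd_const[OF subringD(2)[OF sF]] by simp

lemma dd_0: "dd 0 x = 0"
  using dd_const[OF subringD(1)[OF sF]] by simp

lemma dd_minus_left: "a \<in> A \<Longrightarrow> dd (- a) x = - dd a x"
  using dd_add_left[of a "- a" x] subringD(3)[OF A] by (simp add: dd_0 eq_neg_iff_add_eq_0 add.commute)

lemma dd_diff_left: "a \<in> A \<Longrightarrow> b \<in> A \<Longrightarrow> dd (a - b) x = dd a x - dd b x"
  using dd_add_left[of a "- b" x] dd_minus_left[of b x] subringD(3)[OF A] by simp

lemma dd_smult: "dd a (c *s x) = c *s dd a x"
  by (simp add: vector_scalar_commute)

lemma dd_add: "dd a (x + y) = dd a x + dd a y"
  by (simp add: matrix_vector_right_distrib)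

text \<open>In characteristic \<open>p\<close> a nilpotent perturbation of a scalar becomes scalar after raising to a
  large power of \<open>p\<close>.\<close>

lemma power_scalar:
  assumes a: "a \<in> A"
  shows "\<exists>Q>0. \<forall>x. dd (a ^ Q) x = a ^ Q *s x"
proof -
  let ?p = "CHAR('c)"
  have p: "prime ?p" by (rule char_pos[OF F finF])
  define N where "N = phi a 0 - mat a"
  have Nx: "N *v x = dd a x - a *s x" for x
    by (simp add: N_def matrix_vector_mult_diff_rdistrib mat_vec)
  obtain k where k: "((\<lambda>M. N ** M) ^^ k) (mat 1) = 0"
    using E a by (auto simp: anderson_module_def nilpotent_mat_def N_def)
  have Npow: "((\<lambda>M. N ** M) ^^ n) (mat 1) *v x = ((\<lambda>x. N *v x) ^^ n) x" for n x
    by (induction n arbitrary: x) (simp_all add: matrix_vector_mul_assoc[symmetric])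
  have Nk: "((\<lambda>x. N *v x) ^^ n) x = 0" if "k \<le> n" for n x
  proof -
    have "((\<lambda>x. N *v x) ^^ (m + k)) x = 0" for m
    proof (induction m)
      case 0
      show ?case using Npow[of k x] k by simp
    qed simp
    then show ?thesis using that by (metis le_add_diff_inverse2)
  qed
  \<comment> \<open>Evaluation of polynomials at the operator \<open>dd a\<close>. It transports the
    identity \<open>X^Q = (X - a)^Q + a^Q\<close> to operators, with \<open>X - a\<close> acting as
    the nilpotent \<open>N\<close>.\<close>
  define PE where "PE f x = fold_coeffs (\<lambda>c w. c *s x + dd a w) f 0" for f x
  have PE0: "PE 0 x = 0" for x by (simp add: PE_def)
  have PEC: "PE (pCons c f) x = c *s x + dd a (PE f x)" for c f x
    by (cases "c = 0 \<and> f = 0") (auto simp: PE_def)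
  have PEadd: "PE (f + g) x = PE f x + PE g x" for f g x
    by (induction f g rule: poly_induct2) (simp_all add: PE0 PEC dd_add vector_sadd_rdistrib algebra_simps)
  have PEsm: "PE (Polynomial.smult c f) x = c *s PE f x" for c f x
    by (induction f) (simp_all add: PE0 PEC dd_smult vector_add_ldistrib vector_smult_assoc)
  have PEN: "PE ([:- a, 1:] * f) x = N *v PE f x" for f x
  proof -
    have "[:- a, 1:] * f = pCons 0 f + Polynomial.smult (- a) f" by simp
    then have "PE ([:- a, 1:] * f) x = dd a (PE f x) + (- a) *s PE f x" by (simp only: PEadd PEsm PEC) simp
    then show ?thesis by (simp add: Nx)
  qed
  have PEpow: "PE ([:- a, 1:] ^ n) x = ((\<lambda>x. N *v x) ^^ n) x" for n x
    by (induction n) (simp_all add: PEN PEC PE0 one_pCons del: mult_pCons_left)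
  have PEmon: "PE (monom 1 n) x = dd (a ^ n) x" for n x
    by (induction n) (simp_all add: monom_0 monom_Suc PEC PE0 dd_1 dd_mult a subringD(7)[OF A])
  \<comment> \<open>A power of the characteristic, for the additivity of \<open>Q\<close>-th powers,
    and at least the nilpotency index \<open>k\<close>, because
    \<open>k \<le> 2 ^ k\<close>.\<close>
  define Q where "Q = ?p ^ k"
  have "k \<le> 2 ^ k" by (simp add: less_imp_le)
  also have "\<dots> \<le> Q" unfolding Q_def using prime_ge_2_nat[OF p] by (rule power_mono) simp
  finally have Qk: "k \<le> Q" .
  have "monom 1 Q = ([:0, 1:] :: 'c poly) ^ Q" by (simp add: monom_altdef)
  also have "\<dots> = ([:- a, 1:] + [:a:]) ^ Q" by simp
  also have "\<dots> = [:- a, 1:] ^ Q + [:a:] ^ Q"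
    by (rule freshmans_dream'[where n = k]) (use p in \<open>simp_all add: Q_def\<close>)
  also have "[:a:] ^ Q = [:a ^ Q:]" by (induction Q) (simp_all add: one_pCons)
  finally have "dd (a ^ Q) x = PE ([:- a, 1:] ^ Q) x + PE [:a ^ Q:] x" for x
    using PEmon[of Q x] PEadd by simp
  then have "dd (a ^ Q) x = a ^ Q *s x" for x by (simp add: PEpow Nk[OF Qk] PEC PE0)
  moreover have "Q > 0" unfolding Q_def using prime_gt_0_nat[OF p] by simp
  ultimately show ?thesis by blast
qed

text \<open>Since \<open>\<partial>(a^Q)\<close> is the scalar \<open>a^Q\<close>, the operator
  \<open>a^(-Q) \<partial>(a^(Q-1))\<close> is a two-sided inverse of
  \<open>\<partial>a\<close>.\<close>

lemma phi_invertible: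
  assumes a: "a \<in> A" "a \<noteq> 0"
  shows "phi a 0 ** matrix_inv (phi a 0) = mat 1" "matrix_inv (phi a 0) ** phi a 0 = mat 1"
proof -
  obtain Q where Q: "Q > 0" "\<And>x. dd (a ^ Q) x = a ^ Q *s x" using power_scalar[OF a(1)] by blast
  have b: "a ^ (Q - 1) \<in> A" using a(1) by (rule subringD(7)[OF A])
  define M where "M = mat (inverse (a ^ Q)) ** phi (a ^ (Q - 1)) 0"
  have Mx: "M *v x = inverse (a ^ Q) *s dd (a ^ (Q - 1)) x" for x
    by (simp add: M_def matrix_vector_mul_assoc[symmetric] mat_vec)
  have "a * a ^ (Q - 1) = a ^ Q" "a ^ (Q - 1) * a = a ^ Q" using Q(1) by (cases Q; simp)+
  then have "dd a (dd (a ^ (Q - 1)) x) = a ^ Q *s x" "dd (a ^ (Q - 1)) (dd a x) = a ^ Q *s x" for x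
    using dd_mult[OF a(1) b, of x] dd_mult[OF b a(1), of x] Q(2) by simp_all
  then have "dd a (M *v x) = x" "M *v dd a x = x" for x
    using a(2) by (simp_all add: Mx dd_smult vector_smult_assoc)
  then have "phi a 0 ** M = mat 1 \<and> M ** phi a 0 = mat 1"
    by (auto simp: matrix_eq matrix_vector_mul_assoc[symmetric])
  then have "phi a 0 ** matrix_inv (phi a 0) = mat 1 \<and> matrix_inv (phi a 0) ** phi a 0 = mat 1"
    unfolding matrix_inv_def by (rule someI)
  then show "phi a 0 ** matrix_inv (phi a 0) = mat 1" "matrix_inv (phi a 0) ** phi a 0 = mat 1" by auto
qed

text \<open>Independence of the chosen fraction: cross-multiply, then cancel the invertible
  operators of both denominators.\<close>

lemma lie_action_eq:
  assumes "a \<in> A" "b \<in> A" "b \<noteq> 0"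
  shows "lie_action A phi (a / b) = matrix_inv (phi b 0) ** phi a 0"
  unfolding lie_action_def
proof (rule the_equality)
  show "\<exists>a'\<in>A. \<exists>b'\<in>A. b' \<noteq> 0 \<and> a / b = a' / b' \<and> matrix_inv (phi b 0) ** phi a 0 = matrix_inv (phi b' 0) ** phi a' 0"
    using assms by blast
next
  fix M assume "\<exists>a'\<in>A. \<exists>b'\<in>A. b' \<noteq> 0 \<and> a / b = a' / b' \<and> M = matrix_inv (phi b' 0) ** phi a' 0"
  then obtain a' b' where ab': "a' \<in> A" "b' \<in> A" "b' \<noteq> 0" "a / b = a' / b'" "M = matrix_inv (phi b' 0) ** phi a' 0"
    by blast
  have eq: "a * b' = a' * b" using ab' assms by (simp add: field_simps)
  let ?Mb = "matrix_inv (phi b 0)" and ?Mb' = "matrix_inv (phi b' 0)"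
  note ib = phi_invertible[OF assms(2,3)] and ib' = phi_invertible[OF ab'(2,3)]
  have can: "dd b (?Mb *v x) = x" "?Mb *v dd b x = x" "dd b' (?Mb' *v x) = x" "?Mb' *v dd b' x = x" for x
    using ib ib' by (simp_all add: matrix_vector_mul_assoc)
  have "?Mb' *v dd a' x = ?Mb *v dd a x" for x
  proof -
    have "dd b' (dd b (?Mb' *v dd a' x)) = dd b' (dd b (?Mb *v dd a x))"
    proof -
      have "dd b' (dd b (?Mb' *v dd a' x)) = dd b (dd a' x)" by (simp only: dd_commute[OF ab'(2) assms(2)] can)
      also have "\<dots> = dd (a' * b) x" by (simp only: mult.commute[of a'] dd_mult[OF assms(2) ab'(1)])
      also have "\<dots> = dd b' (dd a x)" by (simp only: eq[symmetric] mult.commute[of a] dd_mult[OF ab'(2) assms(1)])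
      finally show ?thesis by (simp only: can)
    qed
    then show ?thesis by (metis can(2,4))
  qed
  then show "M = ?Mb ** phi a 0" unfolding ab'(5) by (auto simp: matrix_eq matrix_vector_mul_assoc[symmetric])
qed

lemma ex_add: "ex (x + y) = ex x + ex y" and ex_smult: "c \<in> F \<Longrightarrow> ex (c *s x) = c *s ex x"
  and ex_dd: "a \<in> A \<Longrightarrow> ex (dd a x) = tw a (ex x)"
  using exp_E by (auto simp: is_exponential_def)

lemma ex_0: "ex 0 = 0"
  using ex_add[of 0 0] by simp

lemma ex_minus: "ex (- x) = - ex x"
  using ex_add[of x "- x"] by (simp add: ex_0 eq_neg_iff_add_eq_0 add.commute)

text \<open>Convergence at the unit vectors bounds the coefficient matrices of the series. Frobenius
  powers do not enlarge vectors of the unit ball, so the exponential is Lipschitz there.\<close>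

lemma ex_continuous:
  assumes "e > 0" shows "\<exists>d>0. \<forall>v. vsn v < d \<longrightarrow> vsn (ex v) < e"
proof -
  let ?q = "card F"
  have q: "?q > 0" by (rule card_subfield_pos[OF F finF])
  obtain M where M: "\<And>x. (\<lambda>n. M n *v frob_vec ?q n x) sums ex x"
    using exp_E unfolding is_exponential_def by blast
  have comp: "(\<lambda>n. \<Sum>k<n. (M k *v frob_vec ?q k x) $ i) \<longlonglongrightarrow> ex x $ i" for x i
    using tendsto_vec_nth[OF M[of x, unfolded sums_def], of i] by (simp add: sum_component)
  have "\<exists>C. \<forall>n. absval (M n $ i $ j) \<le> C" for i j
  proof -
    let ?s = "\<lambda>n. \<Sum>k<n. (M k *v frob_vec ?q k (axis j 1)) $ i"
    \<comment> \<open>Unit vectors are fixed by Frobenius, so at them the terms of the series are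
      the matrix entries themselves.\<close>
    have "frob_vec ?q k (axis j 1) = axis j (1 :: 'c)" for k
      using q by (simp add: frob_vec_def vec_eq_iff axis_def)
    then have trm: "(M k *v frob_vec ?q k (axis j 1)) $ i = M k $ i $ j" for k
      by (simp add: matrix_vector_mult_def axis_def if_distrib cong: if_cong)
    have "Cauchy ?s" using comp LIMSEQ_imp_Cauchy by blast
    from metric_CauchyD[OF this zero_less_one] obtain N where
      N: "\<forall>m\<ge>N. \<forall>n\<ge>N. dist (?s m) (?s n) < 1" ..
    have late: "absval (M n $ i $ j) \<le> 1" if "n \<ge> N" for n
      using N[rule_format, of "Suc n" n] that by (simp add: dist_absval trm)
    let ?C = "Max (insert 1 ((\<lambda>n. absval (M n $ i $ j)) ` {..<N}))"
    have "absval (M n $ i $ j) \<le> ?C" for n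
    proof (cases "n < N")
      case False
      then have "absval (M n $ i $ j) \<le> 1" using late by simp
      also have "1 \<le> ?C" by (rule Max_ge) auto
      finally show ?thesis .
    qed (rule Max_ge; auto)
    then show ?thesis by blast
  qed
  then obtain C where C: "\<And>i j n. absval (M n $ i $ j) \<le> C i j" by metis
  define C' where "C' = Max (insert 1 (range (\<lambda>(i, j). C i j)))"
  have C': "absval (M n $ i $ j) \<le> C'" for i j n
  proof -
    have "C i j \<le> C'" unfolding C'_def by (rule Max_ge) auto
    then show ?thesis using C order_trans by blast
  qed
  have C'1: "C' \<ge> 1" unfolding C'_def by (rule Max_ge) auto
  have lip: "vsn (ex v) \<le> C' * vsn v" if v: "vsn v \<le> 1" for v
    unfolding vsn_le_iff
  proof
    fix i
    have frob: "vsn (frob_vec ?q n v) \<le> vsn v" for n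
      unfolding vsn_le_iff
    proof
      fix j
      have "absval (v $ j) \<le> 1" using vsn_comp v order_trans by blast
      then have "absval (v $ j) ^ (?q ^ n) \<le> absval (v $ j) ^ 1"
        using q by (intro power_decreasing) (auto simp: Suc_le_eq)
      also have "\<dots> \<le> vsn v" using vsn_comp by simp
      finally show "absval (frob_vec ?q n v $ j) \<le> vsn v" by (simp add: frob_vec_def absval_power)
    qed
    have "absval ((M k *v frob_vec ?q k v) $ i) \<le> C' * vsn v" for k
    proof -
      have "absval ((M k *v frob_vec ?q k v) $ i) \<le> vsn (M k *v frob_vec ?q k v)" by (rule vsn_comp)
      also have "\<dots> \<le> C' * vsn (frob_vec ?q k v)" by (rule vsn_matrix_le[OF C'])
      also have "\<dots> \<le> C' * vsn v" using frob C'1 by (intro mult_left_mono) auto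
      finally show ?thesis .
    qed
    then have part: "absval (\<Sum>k<n. (M k *v frob_vec ?q k v) $ i) \<le> C' * vsn v" for n
      using C'1 by (intro absval_sum_le) auto
    \<comment> \<open>Otherwise a partial sum closer to the limit than the size of the limit would,
      by the ultrametric inequality, have to be as large as the limit.\<close>
    show "absval (ex v $ i) \<le> C' * vsn v"
    proof (rule ccontr)
      assume "\<not> ?thesis"
      then have less: "C' * vsn v < absval (ex v $ i)" by simp
      then have "absval (ex v $ i) > 0" using C'1 by (meson le_less_trans mult_nonneg_nonneg order_trans vsn_nonneg zero_le_one)
      from metric_LIMSEQ_D[OF comp this] obtain n where
        "dist (\<Sum>k<n. (M k *v frob_vec ?q k v) $ i) (ex v $ i) < absval (ex v $ i)" by blast
      then have "absval ((\<Sum>k<n. (M k *v frob_vec ?q k v) $ i) - ex v $ i) < absval (ex v $ i)" by (simp add: dist_absval)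
      then show False
        using absval_diff[of "\<Sum>k<n. (M k *v frob_vec ?q k v) $ i" "(\<Sum>k<n. (M k *v frob_vec ?q k v) $ i) - ex v $ i"]
          part[of n] less by simp
    qed
  qed
  show ?thesis
  proof (intro exI[of _ "min 1 (e / C')"] conjI allI impI)
    show "0 < min 1 (e / C')" using assms C'1 by simp
    fix v :: "'c^'d" assume "vsn v < min 1 (e / C')"
    then have "vsn v \<le> 1" "C' * vsn v < e" using C'1 by (auto simp: field_simps)
    then show "vsn (ex v) < e" using lip[of v] by linarith
  qed
qed

end

section \<open>The residue field\<close>

text \<open>Translation by \<open>x\<close> permutes the group, so it does not change the product of
  all elements.\<close>

lemma (in comm_group) finite_pow_card:
  assumes fin: "finite (carrier G)" and x: "x \<in> carrier G"
  shows "x [^] card (carrier G) = \<one>"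
proof -
  let ?C = "carrier G"
  have inj: "inj_on (\<lambda>y. x \<otimes> y) ?C" using x by (auto simp: inj_on_def)
  moreover have "(\<lambda>y. x \<otimes> y) ` ?C \<subseteq> ?C" using x by auto
  ultimately have img: "(\<lambda>y. x \<otimes> y) ` ?C = ?C" by (metis endo_inj_surj[OF fin])
  let ?P = "finprod G (\<lambda>y. y) ?C"
  have P: "?P \<in> ?C" by (rule finprod_closed) auto
  have "?P = finprod G (\<lambda>y. x \<otimes> y) ?C"
    using finprod_reindex[of "\<lambda>y. y" "\<lambda>y. x \<otimes> y" ?C] inj x unfolding img by (simp add: Pi_def)
  also have "\<dots> = finprod G (\<lambda>_. x) ?C \<otimes> ?P"
    by (rule finprod_multf) (use x in auto)
  also have "finprod G (\<lambda>_. x) ?C = x [^] card ?C" by (rule finprod_const[OF x])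
  finally have "x [^] card ?C \<otimes> ?P = \<one> \<otimes> ?P" using P by simp
  then show ?thesis using P x by (simp only: right_cancel one_closed nat_pow_closed)
qed

text \<open>Of the curve, this locale adds only \<open>u1\<close> and \<open>gens\<close>, both
  supplied by \<open>coordinate_ring_finite\<close>.\<close>

locale anderson_prime = anderson F A L phi ex
  for F A L :: "'c::complete_ultrametric_field set" and phi :: "'c \<Rightarrow> ('c, 'd::finite) twisted" and ex +
  fixes p :: "'c set" and u :: 'c
  assumes p: "maximalideal p (ring_on A)" and unif: "uniformizer A p u"
    and uA: "u \<in> A" and u1: "absval u > 1"
    and gens: "\<exists>(I :: ('c + 'c) set) g. finite I \<and> (\<forall>i\<in>I. g i \<in> A) \<and>
      (\<forall>a\<in>A. \<exists>c. (\<forall>i\<in>I. c i \<in> adjoin_ring F u) \<and> a = (\<Sum>i\<in>I. c i * g i))"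
begin

lemmas sA = subringD[OF A]

lemma p_ideal: "ideal p (ring_on A)"
  using p by (simp add: maximalideal_def)

lemma pA: "p \<subseteq> A"
  using additive_subgroup.a_subset[OF ideal.axioms(1)[OF p_ideal]] by simp

lemma p_mult: "a \<in> A \<Longrightarrow> x \<in> p \<Longrightarrow> a * x \<in> p" "a \<in> A \<Longrightarrow> x \<in> p \<Longrightarrow> x * a \<in> p"
  using ideal.I_l_closed[OF p_ideal, of x a] ideal.I_r_closed[OF p_ideal, of x a] by auto

lemma p_diff_closed: "diff_closed p"
proof -
  have 0: "0 \<in> p" using additive_subgroup.zero_closed[OF ideal.axioms(1)[OF p_ideal]] by simp
  have add: "x + y \<in> p" if "x \<in> p" "y \<in> p" for x y
    using additive_subgroup.a_closed[OF ideal.axioms(1)[OF p_ideal] that] by simp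
  have "- x \<in> p" if "x \<in> p" for x using p_mult(1)[OF _ that, of "- 1"] sA(2,3) by simp
  then have "x - y \<in> p" if "x \<in> p" "y \<in> p" for x y using add[of x "- y"] that by simp
  then show ?thesis using 0 by (simp add: diff_closed_def)
qed

lemmas pD = diff_closedD[OF p_diff_closed]
lemmas p_sum = diff_closed_sum[OF p_diff_closed]

lemma one_notin_p: "1 \<notin> p"
proof
  assume "1 \<in> p"
  then have "A \<subseteq> p" using p_mult(1)[of _ 1] by auto
  then show False using pA maximalideal.I_notcarr[OF p] by simp
qed

abbreviation kap :: "'c \<Rightarrow> 'c set" where "kap a \<equiv> p +>\<^bsub>ring_on A\<^esub> a"
abbreviation "kk \<equiv> ring_on A Quot p"

lemma kap_mem: "x \<in> kap a \<longleftrightarrow> x - a \<in> p"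
  unfolding a_r_coset_def r_coset_def by (auto simp: algebra_simps) (metis diff_add_cancel)

lemma kap_eq: "kap a = kap b \<longleftrightarrow> a - b \<in> p"
proof
  assume "kap a = kap b"
  then show "a - b \<in> p" using kap_mem[of a a] kap_mem[of a b] pD(1) by simp
next
  assume ab: "a - b \<in> p"
  have "x - a \<in> p \<longleftrightarrow> x - b \<in> p" for x
    using pD(4)[OF _ ab, of "x - a"] pD(2)[OF _ ab, of "x - b"] by auto
  then show "kap a = kap b" by (auto simp: kap_mem)
qed

lemma kk_field: "field kk"
  using maximalideal.quotient_is_field[OF p cring_of_subring[OF A]] .

lemma kk_carrier: "carrier kk = kap ` A"
  by (auto simp: FactRing_def A_RCOSETS_def' )

lemma kk_zero: "\<zero>\<^bsub>kk\<^esub> = kap 0"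
  using kap_mem[of _ 0] by (auto simp: FactRing_def)

lemma kk_one: "\<one>\<^bsub>kk\<^esub> = kap 1"
  by (simp add: FactRing_def)

lemma kk_mult: "a \<in> A \<Longrightarrow> b \<in> A \<Longrightarrow> kap a \<otimes>\<^bsub>kk\<^esub> kap b = kap (a * b)"
  using ideal.rcoset_mult_add[OF p_ideal, of a b] by (simp add: FactRing_def)

lemma kk_add: "a \<in> A \<Longrightarrow> b \<in> A \<Longrightarrow> kap a \<oplus>\<^bsub>kk\<^esub> kap b = kap (a + b)"
proof -
  interpret ideal p "ring_on A" by (rule p_ideal)
  interpret abelian_subgroup p "ring_on A"
    by (rule abelian_subgroupI3) (unfold_locales)
  show "a \<in> A \<Longrightarrow> b \<in> A \<Longrightarrow> kap a \<oplus>\<^bsub>kk\<^esub> kap b = kap (a + b)"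
    using a_rcos_sum[of a b] by (simp add: FactRing_def)
qed

lemma Units_kk: "Units kk = kap ` (A - p)"
proof -
  interpret K: field kk by (rule kk_field)
  have "Units kk = kap ` A - {kap 0}" using K.field_Units by (simp add: kk_carrier kk_zero)
  moreover have "kap a = kap 0 \<longleftrightarrow> a \<in> p" for a by (simp add: kap_eq)
  ultimately show ?thesis by blast
qed

lemma inv_mod_p: assumes "a \<in> A" "a \<notin> p" shows "\<exists>b\<in>A - p. a * b - 1 \<in> p"
proof -
  have "kap a \<in> Units kk" using assms by (simp add: Units_kk)
  then obtain X where X: "X \<in> carrier kk" "kap a \<otimes>\<^bsub>kk\<^esub> X = \<one>\<^bsub>kk\<^esub>" by (auto simp: Units_def)
  then obtain b where b: "b \<in> A" "X = kap b" by (auto simp: kk_carrier)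
  then have ab: "a * b - 1 \<in> p" using X assms by (simp add: kk_mult kk_one kap_eq)
  have "b \<notin> p"
  proof
    assume "b \<in> p"
    then have "a * b - (a * b - 1) \<in> p" by (intro pD(2)[OF p_mult(1)[OF assms(1)] ab])
    then show False using one_notin_p by simp
  qed
  then show ?thesis using b ab by blast
qed

lemma p_prime: assumes "a \<in> A" "b \<in> A" "a \<notin> p" "b \<notin> p" shows "a * b \<notin> p"
proof
  assume ab: "a * b \<in> p"
  obtain a' where a': "a' \<in> A" "a * a' - 1 \<in> p" using inv_mod_p assms by blast
  have "a' * (a * b) - b * (a * a' - 1) = b" by (simp add: algebra_simps)
  moreover have "a' * (a * b) - b * (a * a' - 1) \<in> p"
    by (intro pD(2) p_mult(1) a' ab assms(2))
  ultimately show False using assms(4) by simp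
qed

lemma up: "u \<in> p"
  using unif by (simp add: uniformizer_def)

lemma u0: "u \<noteq> 0"
  using u1 by auto

lemma adjoin_decomp: assumes "c \<in> adjoin_ring F u" shows "\<exists>c0\<in>F. \<exists>r\<in>A. c = c0 + u * r"
proof -
  obtain f where f: "f \<in> polys_over F" "c = poly f u" using assms by (auto simp: adjoin_ring_def)
  obtain c0 g where fg: "f = pCons c0 g" by (cases f)
  have cf: "\<And>i. coeff f i \<in> F" using f(1) by (simp add: polys_over_def)
  have "c0 \<in> F" using cf[of 0] fg by simp
  moreover have "coeff g i \<in> F" for i using cf[of "Suc i"] fg by simp
  then have "g \<in> polys_over A" using FA by (auto simp: polys_over_def)
  then have "poly g u \<in> A" by (rule poly_mem_subring[OF A _ uA])
  ultimately show ?thesis using f(2) fg by auto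
qed

lemma adjoin_mod_p: assumes "c \<in> adjoin_ring F u" shows "\<exists>c0\<in>F. c - c0 \<in> p"
proof -
  obtain c0 r where c: "c0 \<in> F" "r \<in> A" "c = c0 + u * r" using adjoin_decomp[OF assms] by blast
  then have "c - c0 \<in> p" using p_mult(2)[OF c(2) up] by simp
  then show ?thesis using c(1) by blast
qed

text \<open>As \<open>u\<close> lies in \<open>p\<close>, coefficients in \<open>F[u]\<close> reduce
  to their constant terms.\<close>

lemma span_mod_p:
  "\<exists>(I :: ('c + 'c) set) g. finite I \<and> (\<forall>i\<in>I. g i \<in> A) \<and>
      (\<forall>a\<in>A. \<exists>c. (\<forall>i\<in>I. c i \<in> F) \<and> a - (\<Sum>i\<in>I. c i * g i) \<in> p)"
proof -
  obtain I :: "('c + 'c) set" and g where I: "finite I" "\<forall>i\<in>I. g i \<in> A"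
    "\<forall>a\<in>A. \<exists>c. (\<forall>i\<in>I. c i \<in> adjoin_ring F u) \<and> a = (\<Sum>i\<in>I. c i * g i)"
    using gens by blast
  have "\<exists>c. (\<forall>i\<in>I. c i \<in> F) \<and> a - (\<Sum>i\<in>I. c i * g i) \<in> p" if a: "a \<in> A" for a
  proof -
    obtain c where c: "\<forall>i\<in>I. c i \<in> adjoin_ring F u" "a = (\<Sum>i\<in>I. c i * g i)" using I(3) a by blast
    obtain c0 where c0: "\<And>i. i \<in> I \<Longrightarrow> c0 i \<in> F" "\<And>i. i \<in> I \<Longrightarrow> c i - c0 i \<in> p"
    proof -
      have "\<forall>i\<in>I. \<exists>c0. c0 \<in> F \<and> c i - c0 \<in> p" using adjoin_mod_p c(1) by blast
      then show ?thesis using that by metis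
    qed
    have "a - (\<Sum>i\<in>I. c0 i * g i) = (\<Sum>i\<in>I. (c i - c0 i) * g i)"
      by (simp add: c(2) left_diff_distrib sum_subtractf)
    also have "\<dots> \<in> p" using c0(2) I(2) by (intro p_sum p_mult(2)) auto
    finally show ?thesis using c0(1) by blast
  qed
  then show ?thesis using I(1,2) by blast
qed

lemma finite_kk: "finite (carrier kk)"
proof -
  obtain I :: "('c + 'c) set" and g where I: "finite I"
    "\<forall>a\<in>A. \<exists>c. (\<forall>i\<in>I. c i \<in> F) \<and> a - (\<Sum>i\<in>I. c i * g i) \<in> p"
    using span_mod_p by blast
  have "carrier kk \<subseteq> (\<lambda>c. kap (\<Sum>i\<in>I. c i * g i)) ` (I \<rightarrow>\<^sub>E F)"
  proof
    fix X assume "X \<in> carrier kk"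
    then obtain a where a: "a \<in> A" "X = kap a" by (auto simp: kk_carrier)
    obtain c where c: "\<forall>i\<in>I. c i \<in> F" "a - (\<Sum>i\<in>I. c i * g i) \<in> p" using I(2) a by blast
    have "(\<Sum>i\<in>I. c i * g i) = (\<Sum>i\<in>I. restrict c I i * g i)" by (rule sum.cong) auto
    then have "X = kap (\<Sum>i\<in>I. restrict c I i * g i)" using a c(2) by (simp add: kap_eq)
    moreover have "restrict c I \<in> I \<rightarrow>\<^sub>E F" using c(1) by auto
    ultimately show "X \<in> (\<lambda>c. kap (\<Sum>i\<in>I. c i * g i)) ` (I \<rightarrow>\<^sub>E F)" by (rule image_eqI)
  qed
  then show ?thesis using I(1) finF by (meson finite_PiE finite_imageI finite_subset)
qed

definition Q :: nat where "Q = card (carrier kk)"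

text \<open>The additive group of \<open>A/p\<close> has order \<open>Q\<close>, so \<open>Q\<close>
  lies in \<open>p\<close>. It also lies in \<open>F\<close>, and a nonzero constant would be a unit
  inside \<open>p\<close>.\<close>

lemma Q_char: "of_nat Q = (0 :: 'c)"
proof -
  interpret K: field kk by (rule kk_field)
  have nF: "of_nat n \<in> F" for n using subringD(1,2,4)[OF sF] by (induction n) auto
  have nA: "of_nat n \<in> A" for n using nF FA by blast
  have "add_pow kk n \<one>\<^bsub>kk\<^esub> = kap (of_nat n)" for n :: nat
  proof (induction n)
    case (Suc n)
    then show ?case using kk_add[OF nA sA(2)] by (simp add: kk_one add.commute)
  qed (simp add: kk_zero)
  moreover have "add_pow kk Q \<one>\<^bsub>kk\<^esub> = \<zero>\<^bsub>kk\<^esub>"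
    unfolding Q_def using comm_group.finite_pow_card[OF K.a_comm_group, of "\<one>\<^bsub>kk\<^esub>"] finite_kk
    by (simp add: add_pow_def)
  ultimately have "of_nat Q \<in> p" by (simp add: kk_zero kap_eq)
  then have "inverse (of_nat Q) * of_nat Q \<in> p" using subfieldD(2)[OF F nF[of Q]] FA by (intro p_mult(1)) auto
  then show ?thesis using one_notin_p by (metis left_inverse)
qed

lemma Q_pos: "Q > 0"
  unfolding Q_def using finite_kk kk_carrier sA(1) by (auto simp: card_gt_0_iff)

lemma Q_power: assumes a: "a \<in> A" shows "a ^ Q - a \<in> p"
proof (cases "a \<in> p")
  case True
  have "a ^ Q = a ^ (Q - 1) * a" using Q_pos by (metis power_minus_mult)
  then show ?thesis using p_mult(1)[OF sA(7)[OF a] True, of "Q - 1"] True pD(2) by simp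
next
  case False
  interpret K: field kk by (rule kk_field)
  interpret U: comm_group "units_of kk" by (rule K.units_comm_group)
  have aU: "kap a \<in> carrier (units_of kk)" using a False by (simp add: units_of_def Units_kk)
  have pow: "kap a [^]\<^bsub>units_of kk\<^esub> n = kap (a ^ n)" for n :: nat
  proof (induction n)
    case (Suc n)
    then show ?case using kk_mult[OF sA(7)[OF a] a] by (simp add: units_of_mult mult.commute)
  qed (simp add: units_of_one kk_one)
  have fin: "finite (carrier (units_of kk))" using finite_kk by (simp add: units_of_def K.field_Units)
  have "kap (a ^ card (carrier (units_of kk))) = kap 1"
    using U.finite_pow_card[OF fin aU] pow by (simp add: units_of_one kk_one)
  moreover have "Q = Suc (card (carrier (units_of kk)))"
    unfolding Q_def using card.remove[OF finite_kk K.zero_closed] by (simp add: units_of_def K.field_Units)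
  ultimately have "a ^ Q - a = a * (a ^ card (carrier (units_of kk)) - 1)" "a ^ card (carrier (units_of kk)) - 1 \<in> p"
    by (simp_all add: kap_eq algebra_simps)
  then show ?thesis using p_mult(1)[OF a] by simp
qed

section \<open>Diagonal tensors\<close>

abbreviation "Lam \<equiv> period_lattice ex"
abbreviation "RR \<equiv> ring_on (adjoin_ring F u)"
abbreviation "LM \<equiv> lattice_module phi ex"

lemma Lam_iff: "x \<in> Lam \<longleftrightarrow> ex x = 0"
  by (simp add: period_lattice_def)

lemma Lam_diff_closed: "diff_closed Lam"
  using ex_add[of _ "- _"] by (auto simp: diff_closed_def Lam_iff ex_0 ex_minus simp flip: add_uminus_conv_diff)

lemma Lam_dd: "a \<in> A \<Longrightarrow> x \<in> Lam \<Longrightarrow> dd a x \<in> Lam"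
  by (simp add: Lam_iff ex_dd tw_0)

lemma Ru_A: "adjoin_ring F u \<subseteq> A"
  by (rule adjoin_ring_least[OF A FA uA])

lemma LM_simps [simp]: "carrier LM = Lam" "add LM = (+)" "ring.zero LM = 0" "module.smult LM = (\<lambda>a x. dd a x)"
  by (simp_all add: lattice_module_def)

lemma AM_abelian: "abelian_group (alg_on A)"
  by (rule abelian_group_on[of A]) (use A in \<open>simp_all add: is_subring_def\<close>)

sublocale LT: tensor_pair RR "alg_on A" LM
proof (rule tensor_pair.intro)
  show "abelian_group (alg_on A)" by (rule AM_abelian)
  show "abelian_group LM" by (rule abelian_group_on[of Lam]) (simp_all add: Lam_diff_closed)
qed (use Ru_A sA(6) Lam_dd in auto)

definition mu :: "('c \<times> ('c^'d) \<Rightarrow>\<^sub>0 int) \<Rightarrow> 'c^'d" where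
  "mu = fext (\<lambda>(a, x). dd a x)"

lemma mu_diff: "mu (s - t) = mu s - mu t"
  by (simp add: mu_def fext_diff)

lemma mu_0 [simp]: "mu 0 = 0"
  by (simp add: mu_def)

lemma mu_frag [simp]: "mu (frag_of (a, x)) = dd a x"
  by (simp add: mu_def)

lemma mu_null: "x \<in> LT.null \<Longrightarrow> mu x = 0"
proof -
  assume x: "x \<in> LT.null"
  have "mu x \<in> {0}"
    by (rule LT.null_induct_balanced[OF mu_diff diff_closed_zero _ _ _ x])
       (use Ru_A in \<open>auto simp: dd_add_left dd_add algebra_simps dd_mult dd_commute subset_iff\<close>)
  then show ?thesis by simp
qed

section \<open>The action of \<open>A \<otimes> A\<close> on the tensor product with the
  lattice\<close>

definition Lop :: "'c \<Rightarrow> ('c \<times> ('c^'d) \<Rightarrow>\<^sub>0 int) \<Rightarrow> ('c \<times> ('c^'d) \<Rightarrow>\<^sub>0 int)" where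
  "Lop a = fmap2 ((*) a) (\<lambda>x. x)"
definition Rop :: "'c \<Rightarrow> ('c \<times> ('c^'d) \<Rightarrow>\<^sub>0 int) \<Rightarrow> ('c \<times> ('c^'d) \<Rightarrow>\<^sub>0 int)" where
  "Rop a = fmap2 (\<lambda>x. x) (\<lambda>x. dd a x)"

text \<open>The image of \<open>A \<otimes> A\<close> in the endomorphisms of the tensor product, every element together with
  its image under the multiplication \<open>A \<otimes> A \<rightarrow> A\<close>.\<close>

inductive BB :: "(('c \<times> ('c^'d) \<Rightarrow>\<^sub>0 int) \<Rightarrow> ('c \<times> ('c^'d) \<Rightarrow>\<^sub>0 int)) \<Rightarrow> 'c \<Rightarrow> bool" where
  BB_L: "a \<in> A \<Longrightarrow> BB (Lop a) a"
| BB_R: "a \<in> A \<Longrightarrow> BB (Rop a) a"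
| BB_diff: "BB S s \<Longrightarrow> BB T t \<Longrightarrow> BB (\<lambda>x. S x - T x) (s - t)"
| BB_comp: "BB S s \<Longrightarrow> BB T t \<Longrightarrow> BB (\<lambda>x. S (T x)) (s * t)"

lemma BB_val: "BB T t \<Longrightarrow> t \<in> A"
  by (induction rule: BB.induct) (auto intro: sA)

lemma BB_add: "BB T t \<Longrightarrow> T (x - y) = T x - T y"
  by (induction arbitrary: x y rule: BB.induct) (simp_all add: Lop_def Rop_def)

lemma BB_zero: "BB T t \<Longrightarrow> T 0 = 0"
  using BB_add[of T t 0 0] by simp

lemma BB_plus: "BB T t \<Longrightarrow> T (x + y) = T x + T y"
  using BB_add[of T t x "0 - y"] BB_add[of T t 0 y] BB_zero[of T t] by simp

lemma BB_sum: "BB T t \<Longrightarrow> T (sum f I) = (\<Sum>i\<in>I. T (f i))"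
  by (induction I rule: infinite_finite_induct) (simp_all add: BB_zero BB_plus)

lemma BB_keys: "BB T t \<Longrightarrow> Poly_Mapping.keys x \<subseteq> A \<times> Lam \<Longrightarrow> Poly_Mapping.keys (T x) \<subseteq> A \<times> Lam"
  by (induction arbitrary: x rule: BB.induct)
     (auto simp: Lop_def Rop_def intro!: keys_fmap2 keys_diff_subset Lam_dd sA(6) del: subsetI)

lemma Lop_null: "a \<in> A \<Longrightarrow> x \<in> LT.null \<Longrightarrow> Lop a x \<in> LT.null"
  unfolding Lop_def
  by (rule fmap2_null[OF LT.tensor_pair_axioms LT.tensor_pair_axioms])
     (use sA(6) LT.rel_smult in \<open>auto simp: distrib_left mult.left_commute\<close>)

lemma Rop_null: "a \<in> A \<Longrightarrow> x \<in> LT.null \<Longrightarrow> Rop a x \<in> LT.null"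
proof -
  assume a: "a \<in> A"
  have "frag_of (r * m, dd a n) - frag_of (m, dd a (dd r n)) \<in> LT.null"
    if "r \<in> adjoin_ring F u" "m \<in> A" "n \<in> Lam" for r m n
    using LT.rel_smult[of r m "dd a n"] that Lam_dd[OF a] Ru_A dd_commute[OF a, of r n] by auto
  then show "x \<in> LT.null \<Longrightarrow> Rop a x \<in> LT.null"
    unfolding Rop_def
    by (intro fmap2_null[OF LT.tensor_pair_axioms LT.tensor_pair_axioms])
       (use Lam_dd a in \<open>auto simp: dd_add\<close>)
qed

lemma BB_null: "BB T t \<Longrightarrow> x \<in> LT.null \<Longrightarrow> T x \<in> LT.null"
  by (induction arbitrary: x rule: BB.induct)
     (auto intro: Lop_null Rop_null LT.null_diff)

lemma mu_BB:
  assumes "BB T t" "Poly_Mapping.keys x \<subseteq> A \<times> Lam" shows "mu (T x) = dd t (mu x)"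
  using assms
proof (induction arbitrary: x rule: BB.induct)
  case (BB_L a)
  from BB_L(2) show ?case
    by (rule free_Abelian_group_induct) (use BB_L(1) in \<open>auto simp: Lop_def mu_diff matrix_vector_mult_diff_distrib dd_mult\<close>)
next
  case (BB_R a)
  from BB_R(2) show ?case
    by (rule free_Abelian_group_induct) (use BB_R(1) in \<open>auto simp: Rop_def mu_diff matrix_vector_mult_diff_distrib dd_commute\<close>)
next
  case (BB_diff S s T t)
  then show ?case using BB_val by (simp add: mu_diff dd_diff_left)
next
  case (BB_comp S s T t)
  then show ?case using BB_val by (simp add: dd_mult BB_keys)
qed

lemma Lop_commute: "BB T t \<Longrightarrow> a \<in> A \<Longrightarrow> Lop a (T x) = T (Lop a x)"
  by (induction arbitrary: x rule: BB.induct)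
     (simp_all add: Lop_def Rop_def fmap2_fmap2 mult.left_commute)

lemma Rop_commute: "BB T t \<Longrightarrow> a \<in> A \<Longrightarrow> Rop a (T x) = T (Rop a x)"
  by (induction arbitrary: x rule: BB.induct)
     (simp_all add: Lop_def Rop_def fmap2_fmap2 dd_commute)

text \<open>Commutativity of \<open>A \<otimes> A\<close>, on which the elimination below
  rests.\<close>

lemma BB_commute: "BB S s \<Longrightarrow> BB T t \<Longrightarrow> S (T x) = T (S x)"
  by (induction arbitrary: x rule: BB.induct)
     (simp_all add: Lop_commute Rop_commute BB_add)

lemma BB_0: "BB (\<lambda>x. 0) 0"
  using BB_diff[OF BB_L BB_L, OF sA(1) sA(1)] by simp

lemma BB_sumop: "BB S s \<Longrightarrow> BB T t \<Longrightarrow> BB (\<lambda>x. S x + T x) (s + t)"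
  using BB_diff[OF _ BB_diff[OF BB_0], of S s T t] by simp

text \<open>The elements \<open>a \<otimes> 1 - 1 \<otimes> a\<close> generate the kernel of
  \<open>A \<otimes> A \<rightarrow> A\<close> and behave like differentials:
  \<open>Iop_mult\<close> is the Leibniz rule, and \<open>Iop_base\<close> says that
  \<open>F[u]\<close> consists of constants.\<close>

definition Iop :: "'c \<Rightarrow> ('c \<times> ('c^'d) \<Rightarrow>\<^sub>0 int) \<Rightarrow> ('c \<times> ('c^'d) \<Rightarrow>\<^sub>0 int)" where
  "Iop a x = Lop a x - Rop a x"

lemma BB_I: "a \<in> A \<Longrightarrow> BB (Iop a) 0"
  using BB_diff[OF BB_L BB_R, of a a] by (simp add: Iop_def[abs_def])

lemma Iop_mult:
  assumes "a \<in> A" "b \<in> A" shows "Iop (a * b) x = Lop a (Iop b x) + Rop b (Iop a x)"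
proof -
  have "(*) (a * b) = (\<lambda>c. a * (b * c))" by (simp add: fun_eq_iff mult.assoc)
  then have "Lop (a * b) x = Lop a (Lop b x)" by (simp add: Lop_def fmap2_fmap2)
  moreover have "Rop (a * b) x = Rop b (Rop a x)" using assms by (simp add: Rop_def fmap2_fmap2 mult.commute[of a] dd_mult)
  moreover have "Lop a (Rop b x) = Rop b (Lop a x)" by (simp add: Lop_def Rop_def fmap2_fmap2)
  ultimately show ?thesis
    unfolding Iop_def BB_add[OF BB_L[OF assms(1)]] BB_add[OF BB_R[OF assms(2)]] by simp
qed

lemma Lop_1: "Lop 1 x = x"
proof -
  have "(*) (1 :: 'c) = (\<lambda>c. c)" by (simp add: fun_eq_iff)
  then show ?thesis by (simp add: Lop_def)
qed

lemma frags_null: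
  assumes "\<And>x y. h (x - y) = h x - h y" "\<And>a x. a \<in> A \<Longrightarrow> x \<in> Lam \<Longrightarrow> h (frag_of (a, x)) \<in> LT.null"
    and "Poly_Mapping.keys x \<subseteq> A \<times> Lam"
  shows "h x \<in> LT.null"
proof -
  have "h 0 = 0" using assms(1)[of 0 0] by simp
  then show ?thesis using assms(3)
    by (induction x rule: free_Abelian_group_induct) (use assms in \<open>auto intro: LT.null_diff\<close>)
qed

lemma Iop_add:
  assumes "a \<in> A" "b \<in> A" "Poly_Mapping.keys x \<subseteq> A \<times> Lam"
  shows "Iop (a + b) x - (Iop a x + Iop b x) \<in> LT.null"
proof -
  have "Lop (a + b) x - (Lop a x + Lop b x) \<in> LT.null"
    by (rule frags_null[OF _ _ assms(3)])
       (use assms sA(6) LT.rel_left in \<open>auto simp: Lop_def algebra_simps\<close>)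
  moreover have "Rop (a + b) x - (Rop a x + Rop b x) \<in> LT.null"
    by (rule frags_null[OF _ _ assms(3)])
       (use assms Lam_dd LT.rel_right in \<open>auto simp: Rop_def dd_add_left diff_diff_eq[symmetric]\<close>)
  ultimately show ?thesis using LT.null_diff by (force simp: Iop_def algebra_simps)
qed

lemma Iop_base:
  assumes "c \<in> adjoin_ring F u" "Poly_Mapping.keys x \<subseteq> A \<times> Lam"
  shows "Iop c x \<in> LT.null"
  by (rule frags_null[OF _ _ assms(2)])
     (use assms(1) LT.rel_smult in \<open>auto simp: Iop_def Lop_def Rop_def\<close>)

lemma Iop_sum:
  assumes "finite I" "\<And>i. i \<in> I \<Longrightarrow> g i \<in> A" "Poly_Mapping.keys x \<subseteq> A \<times> Lam"
  shows "Iop (\<Sum>i\<in>I. g i) x - (\<Sum>i\<in>I. Iop (g i) x) \<in> LT.null"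
  using assms(1,2)
proof (induction I rule: finite_induct)
  case empty
  show ?case using Iop_base[OF subringD(1)[OF adjoin_ring_subring[OF sF]] assms(3)] by simp
next
  case (insert i I)
  have "Iop (g i + (\<Sum>i\<in>I. g i)) x - (Iop (g i) x + Iop (\<Sum>i\<in>I. g i) x) \<in> LT.null"
    using insert by (intro Iop_add assms(3)) (auto intro: sA(8))
  moreover have "(Iop (g i) x + Iop (\<Sum>i\<in>I. g i) x) - (Iop (g i) x + (\<Sum>i\<in>I. Iop (g i) x)) \<in> LT.null"
    using insert by simp
  ultimately show ?case using insert(1,2) LT.null_trans by simp
qed

lemma Iop_span:
  assumes "finite I" "\<And>i. i \<in> I \<Longrightarrow> g i \<in> A" "\<And>i. i \<in> I \<Longrightarrow> c i \<in> adjoin_ring F u"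
    "Poly_Mapping.keys x \<subseteq> A \<times> Lam"
  shows "Iop (\<Sum>i\<in>I. c i * g i) x - (\<Sum>i\<in>I. Lop (c i) (Iop (g i) x)) \<in> LT.null"
proof -
  have cA: "c i \<in> A" if "i \<in> I" for i using assms(3) Ru_A that by blast
  have "Iop (\<Sum>i\<in>I. c i * g i) x - (\<Sum>i\<in>I. Iop (c i * g i) x) \<in> LT.null"
    by (rule Iop_sum) (use assms cA sA(6) in auto)
  moreover have "(\<Sum>i\<in>I. Iop (c i * g i) x) - (\<Sum>i\<in>I. Lop (c i) (Iop (g i) x)) \<in> LT.null"
  proof (rule LT.null_sum2)
    fix i assume i: "i \<in> I"
    show "Iop (c i * g i) x - Lop (c i) (Iop (g i) x) \<in> LT.null"
      using Iop_mult[OF cA assms(2), OF i i, of x] Rop_null[OF assms(2)[OF i] Iop_base[OF assms(3)[OF i] assms(4)]]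
      by simp
  qed
  ultimately show ?thesis by (rule LT.null_trans)
qed

text \<open>\<open>H\<close> is the sum of all \<open>a^i \<otimes> a^(n-i)\<close>; its value under
  multiplication is the derivative of \<open>a^(n+1)\<close>. For exponent \<open>Q\<close> this
  value is 0.\<close>

lemma Iop_power:
  assumes a: "a \<in> A"
  shows "\<exists>H. BB H (of_nat (Suc n) * a ^ n) \<and> (\<forall>x. Iop (a ^ Suc n) x = H (Iop a x))"
proof (induction n)
  case 0
  have "BB (Lop 1) (of_nat (Suc 0) * a ^ 0)" using BB_L[OF sA(2)] by simp
  moreover have "Iop (a ^ Suc 0) x = Lop 1 (Iop a x)" for x by (simp add: Lop_1)
  ultimately show ?case by blast
next
  case (Suc n)
  then obtain H where H: "BB H (of_nat (Suc n) * a ^ n)" "\<And>x. Iop (a ^ Suc n) x = H (Iop a x)" by blast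
  have an: "a ^ Suc n \<in> A" using a by (rule sA(7))
  let ?H = "\<lambda>y. Lop a (H y) + Rop (a ^ Suc n) y"
  have "BB (?H) (a * (of_nat (Suc n) * a ^ n) + a ^ Suc n)"
    by (rule BB_sumop[OF BB_comp[OF BB_L[OF a] H(1)] BB_R[OF an]])
  moreover have "a * (of_nat (Suc n) * a ^ n) + a ^ Suc n = of_nat (Suc (Suc n)) * a ^ Suc n"
    by (simp add: algebra_simps)
  moreover have "Iop (a ^ Suc (Suc n)) x = ?H (Iop a x)" for x
    using Iop_mult[OF a an, of x] by (simp add: H(2)[symmetric])
  ultimately show ?case by (intro exI[of _ ?H]) auto
qed

text \<open>With \<open>a = g k\<close> and \<open>b = a^Q - a\<close> in \<open>p\<close>, the
  uniformizer gives \<open>s b = r u\<close> with \<open>s\<close> outside \<open>p\<close>. Apply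
  the Leibniz rule to it: \<open>Iop u\<close> vanishes, and \<open>Iop b\<close> equals
  \<open>H (Iop a) - Iop a\<close> with \<open>H\<close> of value \<open>Q a^(Q-1) = 0\<close>. The
  terms \<open>b (Iop s)\<close> and \<open>u (Iop r)\<close>, expanded in the generators, have
  coefficients in \<open>p\<close>. What remains outside \<open>p\<close> is the coefficient at
  \<open>k\<close>, congruent to \<open>s\<close>.\<close>

lemma generator_relation:
  assumes I: "finite I" "\<And>i. i \<in> I \<Longrightarrow> g i \<in> A"
      "\<And>a. a \<in> A \<Longrightarrow> \<exists>c. (\<forall>i\<in>I. c i \<in> adjoin_ring F u) \<and> a = (\<Sum>i\<in>I. c i * g i)"
    and k: "k \<in> I"
  shows "\<exists>D v. (\<forall>j\<in>I. BB (D j) (v j)) \<and> v k \<notin> p \<and> (\<forall>j\<in>I. j \<noteq> k \<longrightarrow> v j \<in> p) \<and>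
     (\<forall>x. Poly_Mapping.keys x \<subseteq> A \<times> Lam \<longrightarrow> (\<Sum>j\<in>I. D j (Iop (g j) x)) \<in> LT.null)"
proof -
  let ?a = "g k"
  have a: "?a \<in> A" using I k by blast
  define b where "b = ?a ^ Q - ?a"
  have b: "b \<in> A" "b \<in> p" unfolding b_def using a Q_power by (auto intro: sA)
  obtain s r where sr: "s \<in> A" "s \<notin> p" "r \<in> A" "s * b = r * u"
    using unif b(2) unfolding uniformizer_def by blast
  obtain c c' where c: "\<And>i. i \<in> I \<Longrightarrow> c i \<in> adjoin_ring F u" "s = (\<Sum>i\<in>I. c i * g i)"
    and c': "\<And>i. i \<in> I \<Longrightarrow> c' i \<in> adjoin_ring F u" "r = (\<Sum>i\<in>I. c' i * g i)"
    using I(3)[OF sr(1)] I(3)[OF sr(3)] by blast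
  have cA: "c i \<in> A" "c' i \<in> A" if "i \<in> I" for i using c(1) c'(1) Ru_A that by blast+
  obtain m where m: "Q = Suc m" using Q_pos gr0_implies_Suc by blast
  obtain H where H: "BB H (of_nat Q * ?a ^ m)" "\<And>x. Iop (?a ^ Q) x = H (Iop ?a x)"
    using Iop_power[OF a, of m] m by auto
  have H0: "BB H 0" using H(1) by (simp add: Q_char)
  define G where "G j = (if j = k then (\<lambda>y. Lop s y - Lop s (H y)) else (\<lambda>y. 0))" for j
  have G: "BB (G j) (if j = k then s else 0)" for j
    using BB_diff[OF BB_L[OF sr(1)] BB_comp[OF BB_L[OF sr(1)] H0]] BB_0 by (auto simp: G_def)
  define D where "D j = (\<lambda>y. G j y - (Rop b (Lop (c j) y) - Rop u (Lop (c' j) y)))" for j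
  define v where "v j = (if j = k then s else 0) - (b * c j - u * c' j)" for j
  have D: "BB (D j) (v j)" if "j \<in> I" for j
    unfolding D_def v_def
    by (intro BB_diff G BB_comp BB_R BB_L b uA cA that)
  have vp: "b * c j - u * c' j \<in> p" if "j \<in> I" for j
    using cA[OF that] by (intro pD(2) p_mult(2) b up)
  have vk: "v k \<notin> p"
  proof
    assume "v k \<in> p"
    then have "v k + (b * c k - u * c' k) \<in> p" using vp[OF k] by (rule pD(4))
    then show False using sr(2) by (simp add: v_def)
  qed
  have vj: "v j \<in> p" if "j \<in> I" "j \<noteq> k" for j using pD(3)[OF vp[OF that(1)]] that by (simp add: v_def)
  have "(\<Sum>j\<in>I. D j (Iop (g j) x)) \<in> LT.null" if x: "Poly_Mapping.keys x \<subseteq> A \<times> Lam" for x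
  proof -
    let ?y = "\<lambda>j. Iop (g j) x"
    have e1: "Iop b x - (H (?y k) - ?y k) \<in> LT.null"
    proof -
      have "b + ?a = ?a ^ Q" by (simp add: b_def)
      then have "H (?y k) - (Iop b x + ?y k) \<in> LT.null" using Iop_add[OF b(1) a x] by (simp add: H(2))
      then have "- (H (?y k) - (Iop b x + ?y k)) \<in> LT.null" by (rule LT.null_minus)
      then show ?thesis by (simp add: algebra_simps)
    qed
    have e2: "Iop s x - (\<Sum>j\<in>I. Lop (c j) (?y j)) \<in> LT.null"
      unfolding c(2) by (rule Iop_span[OF I(1,2) c(1) x])
    have e3: "Iop r x - (\<Sum>j\<in>I. Lop (c' j) (?y j)) \<in> LT.null"
      unfolding c'(2) by (rule Iop_span[OF I(1,2) c'(1) x])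
    have e4: "Iop u x \<in> LT.null" by (rule Iop_base[OF adjoin_ring_gen[OF sF] x])
    have eq: "Lop s (Iop b x) + Rop b (Iop s x) = Lop r (Iop u x) + Rop u (Iop r x)"
      using Iop_mult[OF sr(1) b(1), of x] Iop_mult[OF sr(3) uA, of x] sr(4) by simp
    have f1: "Lop s (Iop b x) - (Lop s (H (?y k)) - Lop s (?y k)) \<in> LT.null"
      using Lop_null[OF sr(1) e1] by (simp add: BB_add[OF BB_L[OF sr(1)]])
    have f2: "Rop b (Iop s x) - (\<Sum>j\<in>I. Rop b (Lop (c j) (?y j))) \<in> LT.null"
      using Rop_null[OF b(1) e2] by (simp add: BB_add[OF BB_R[OF b(1)]] BB_sum[OF BB_R[OF b(1)]])
    have f3: "Rop u (Iop r x) - (\<Sum>j\<in>I. Rop u (Lop (c' j) (?y j))) \<in> LT.null"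
      using Rop_null[OF uA e3] by (simp add: BB_add[OF BB_R[OF uA]] BB_sum[OF BB_R[OF uA]])
    have f4: "Lop r (Iop u x) \<in> LT.null" by (rule Lop_null[OF sr(3) e4])
    have "(\<Sum>j\<in>I. G j (?y j)) = (\<Sum>j\<in>I. if j = k then Lop s (?y k) - Lop s (H (?y k)) else 0)"
      by (rule sum.cong) (auto simp: G_def)
    then have G1: "(\<Sum>j\<in>I. G j (?y j)) = Lop s (?y k) - Lop s (H (?y k))" using I(1) k by simp
    have "(\<Sum>j\<in>I. D j (?y j)) = (\<Sum>j\<in>I. G j (?y j)) - ((\<Sum>j\<in>I. Rop b (Lop (c j) (?y j))) - (\<Sum>j\<in>I. Rop u (Lop (c' j) (?y j))))"
      by (simp add: D_def sum_subtractf)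
    also have "\<dots> = (Lop s (Iop b x) - (Lop s (H (?y k)) - Lop s (?y k))) +
       (Rop b (Iop s x) - (\<Sum>j\<in>I. Rop b (Lop (c j) (?y j)))) -
       (Rop u (Iop r x) - (\<Sum>j\<in>I. Rop u (Lop (c' j) (?y j)))) - Lop r (Iop u x)"
      using eq unfolding G1 by (simp add: algebra_simps)
    also have "\<dots> \<in> LT.null" by (intro LT.null_diff LT.null_add f1 f2 f3 f4)
    finally show ?thesis .
  qed
  then show ?thesis using D vk vj by (intro exI[of _ D] exI[of _ v]) blast
qed

text \<open>Gaussian elimination in place of Cramer's rule: a system whose matrix is invertible modulo the
  prime kills its unknowns after multiplication by an element outside the prime.\<close>

lemma elimination:
  assumes "finite J" "\<And>j. j \<in> J \<Longrightarrow> BB (Y j) 0"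
    and "\<And>i j. i \<in> J \<Longrightarrow> j \<in> J \<Longrightarrow> BB (D i j) (v i j)"
    and "\<And>i. i \<in> J \<Longrightarrow> v i i \<notin> p" "\<And>i j. i \<in> J \<Longrightarrow> j \<in> J \<Longrightarrow> i \<noteq> j \<Longrightarrow> v i j \<in> p"
    and "\<And>i x. i \<in> J \<Longrightarrow> Poly_Mapping.keys x \<subseteq> A \<times> Lam \<Longrightarrow> (\<Sum>j\<in>J. D i j (Y j x)) \<in> LT.null"
  shows "\<exists>e w. BB e w \<and> w \<notin> p \<and>
     (\<forall>j\<in>J. \<forall>x. Poly_Mapping.keys x \<subseteq> A \<times> Lam \<longrightarrow> e (Y j x) \<in> LT.null)"
  using assms
proof (induction J arbitrary: D v rule: finite_induct)
  case empty
  show ?case using BB_L[OF sA(2)] one_notin_p by blast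
next
  case (insert k J)
  let ?Dk = "D k k"
  have Dk: "BB (?Dk) (v k k)" "v k k \<notin> p" using insert.prems by blast+
  have BD: "BB (D i j) (v i j)" if "i \<in> insert k J" "j \<in> insert k J" for i j using insert.prems(2) that by blast
  have row: "(\<Sum>j\<in>insert k J. D i j (Y j x)) = D i k (Y k x) + (\<Sum>j\<in>J. D i j (Y j x))" for i x
    using insert(1,2) by simp
  \<comment> \<open>Elimination of \<open>Y k\<close> without division: row \<open>i\<close> times
    the pivot minus row \<open>k\<close> times \<open>D i k\<close>. Off-diagonal values lie in
    \<open>p\<close> and \<open>p\<close> is prime, so the new diagonal stays outside
    \<open>p\<close>.\<close>
  define D' where "D' i j = (\<lambda>y. ?Dk (D i j y) - D i k (D k j y))" for i j
  define v' where "v' i j = v k k * v i j - v i k * v k j" for i j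
  have "\<exists>e w. BB e w \<and> w \<notin> p \<and>
     (\<forall>j\<in>J. \<forall>x. Poly_Mapping.keys x \<subseteq> A \<times> Lam \<longrightarrow> e (Y j x) \<in> LT.null)"
  proof (rule insert.IH[of D' v'])
    show "BB (Y j) 0" if "j \<in> J" for j using insert.prems(1) that by blast
    show "BB (D' i j) (v' i j)" if "i \<in> J" "j \<in> J" for i j
      unfolding D'_def v'_def using that by (intro BB_diff BB_comp BD) auto
    have off: "v i k * v k j \<in> p" if "i \<in> J" "j \<in> J" for i j
    proof -
      have "v i k \<in> p" using insert.prems(4)[of i k] insert(2) that by auto
      then show ?thesis using BB_val[OF BD[of k j]] that by (intro p_mult(2)) auto
    qed
    show "v' i i \<notin> p" if i: "i \<in> J" for i
    proof
      assume "v' i i \<in> p"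
      then have "v' i i + v i k * v k i \<in> p" using off[OF i i] by (rule pD(4))
      then have "v k k * v i i \<in> p" by (simp add: v'_def)
      moreover have "v k k * v i i \<notin> p"
        using BB_val[OF BD[of i i]] i insert.prems(3)[of i] by (intro p_prime BB_val[OF Dk(1)] Dk(2)) auto
      ultimately show False by blast
    qed
    show "v' i j \<in> p" if "i \<in> J" "j \<in> J" "i \<noteq> j" for i j
      unfolding v'_def using insert.prems(4)[of i j] that
      by (intro pD(2) off p_mult(1)[OF BB_val[OF Dk(1)]]) auto
    fix i and x :: "'c \<times> ('c^'d) \<Rightarrow>\<^sub>0 int" assume i: "i \<in> J" and x: "Poly_Mapping.keys x \<subseteq> A \<times> Lam"
    have Di: "BB (D i k) (v i k)" using BD i by blast
    have "?Dk (\<Sum>j\<in>insert k J. D i j (Y j x)) \<in> LT.null" "D i k (\<Sum>j\<in>insert k J. D k j (Y j x)) \<in> LT.null"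
      using insert.prems(5) i x by (intro BB_null[OF Dk(1)] BB_null[OF Di]; blast)+
    then have "?Dk (\<Sum>j\<in>insert k J. D i j (Y j x)) - D i k (\<Sum>j\<in>insert k J. D k j (Y j x)) \<in> LT.null"
      by (rule LT.null_diff)
    moreover have "?Dk (\<Sum>j\<in>insert k J. D i j (Y j x)) - D i k (\<Sum>j\<in>insert k J. D k j (Y j x)) =
       (\<Sum>j\<in>J. D' i j (Y j x))"
      unfolding row BB_plus[OF Dk(1)] BB_plus[OF Di] BB_sum[OF Dk(1)] BB_sum[OF Di]
      using BB_commute[OF Dk(1) Di, of "Y k x"] by (simp add: D'_def sum_subtractf)
    ultimately show "(\<Sum>j\<in>J. D' i j (Y j x)) \<in> LT.null" by simp
  qed
  then obtain e w where e: "BB e w" "w \<notin> p"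
    "\<And>j x. j \<in> J \<Longrightarrow> Poly_Mapping.keys x \<subseteq> A \<times> Lam \<Longrightarrow> e (Y j x) \<in> LT.null" by blast
  \<comment> \<open>The pivot is kept as a factor for the sake of \<open>Y k\<close>: row
    \<open>k\<close> expresses the pivot times \<open>Y k\<close> through the other unknowns, which
    \<open>e\<close> kills.\<close>
  have "BB (\<lambda>y. e (?Dk y)) (w * v k k)" by (rule BB_comp[OF e(1) Dk(1)])
  moreover have "w * v k k \<notin> p" by (intro p_prime BB_val[OF e(1)] BB_val[OF Dk(1)] e(2) Dk(2))
  moreover have "e (?Dk (Y j x)) \<in> LT.null" if j: "j \<in> insert k J" and x: "Poly_Mapping.keys x \<subseteq> A \<times> Lam" for j x
  proof (cases "j = k")
    case False
    then show ?thesis using BB_commute[OF e(1) Dk(1), of "Y j x"] BB_null[OF Dk(1) e(3)[of j x]] j x by auto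
  next
    case True
    have "e (\<Sum>j\<in>insert k J. D k j (Y j x)) \<in> LT.null"
      using insert.prems(5)[of k x] x by (intro BB_null[OF e(1)]) auto
    moreover have "(\<Sum>j\<in>J. e (D k j (Y j x))) \<in> LT.null"
    proof (rule LT.null_sum)
      fix j assume j: "j \<in> J"
      have Dj: "BB (D k j) (v k j)" using BD j by blast
      show "e (D k j (Y j x)) \<in> LT.null"
        using BB_commute[OF e(1) Dj, of "Y j x"] BB_null[OF Dj e(3)[OF j x]] by simp
    qed
    ultimately have "e (\<Sum>j\<in>insert k J. D k j (Y j x)) - (\<Sum>j\<in>J. e (D k j (Y j x))) \<in> LT.null" by (rule LT.null_diff)
    then show ?thesis using True by (simp add: row BB_plus[OF e(1)] BB_sum[OF e(1)])
  qed
  ultimately show ?case by blast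
qed

text \<open>The operator \<open>e\<close> kills every \<open>Iop (g j)\<close>, hence by
  \<open>Iop_span\<close> every \<open>Iop a\<close>, so whatever it produces is diagonal. Its value
  \<open>w\<close> is invertible modulo \<open>p\<close>; applying \<open>e\<close> to
  \<open>w' \<otimes> x\<close> instead of \<open>1 \<otimes> x\<close> gives
  \<open>s = w w'\<close>, congruent to 1.\<close>

lemma diagonal_exists:
  assumes x: "x \<in> Lam"
  shows "\<exists>y s. Poly_Mapping.keys y \<subseteq> A \<times> Lam \<and> s \<in> A \<and> s - 1 \<in> p \<and> mu y = dd s x \<and>
     (\<forall>a\<in>A. Lop a y - Rop a y \<in> LT.null)"
proof -
  obtain I :: "('c + 'c) set" and g where I: "finite I" "\<And>i. i \<in> I \<Longrightarrow> g i \<in> A"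
    "\<And>a. a \<in> A \<Longrightarrow> \<exists>c. (\<forall>i\<in>I. c i \<in> adjoin_ring F u) \<and> a = (\<Sum>i\<in>I. c i * g i)"
    using gens by blast
  have "\<forall>k\<in>I. \<exists>D v. (\<forall>j\<in>I. BB (D j) (v j)) \<and> v k \<notin> p \<and> (\<forall>j\<in>I. j \<noteq> k \<longrightarrow> v j \<in> p) \<and>
     (\<forall>x. Poly_Mapping.keys x \<subseteq> A \<times> Lam \<longrightarrow> (\<Sum>j\<in>I. D j (Iop (g j) x)) \<in> LT.null)"
    using generator_relation[OF I] by blast
  from bchoice[OF this] obtain D where "\<forall>k\<in>I. \<exists>v. (\<forall>j\<in>I. BB (D k j) (v j)) \<and> v k \<notin> p \<and> (\<forall>j\<in>I. j \<noteq> k \<longrightarrow> v j \<in> p) \<and>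
     (\<forall>x. Poly_Mapping.keys x \<subseteq> A \<times> Lam \<longrightarrow> (\<Sum>j\<in>I. D k j (Iop (g j) x)) \<in> LT.null)" ..
  from bchoice[OF this] obtain v where Dv: "\<forall>k\<in>I. (\<forall>j\<in>I. BB (D k j) (v k j)) \<and> v k k \<notin> p \<and> (\<forall>j\<in>I. j \<noteq> k \<longrightarrow> v k j \<in> p) \<and>
     (\<forall>x. Poly_Mapping.keys x \<subseteq> A \<times> Lam \<longrightarrow> (\<Sum>j\<in>I. D k j (Iop (g j) x)) \<in> LT.null)" ..
  have "\<exists>e w. BB e w \<and> w \<notin> p \<and>
     (\<forall>j\<in>I. \<forall>x. Poly_Mapping.keys x \<subseteq> A \<times> Lam \<longrightarrow> e (Iop (g j) x) \<in> LT.null)"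
  proof (rule elimination[OF I(1), where D = D and v = v])
    show "BB (Iop (g j)) 0" if "j \<in> I" for j using I(2)[OF that] by (rule BB_I)
    fix i assume "i \<in> I"
    note D1 = Dv[THEN bspec, OF this]
    show "v i i \<notin> p" using D1 by (elim conjE)
    show "BB (D i j) (v i j)" if "j \<in> I" for j using D1[THEN conjunct1] that by (rule bspec)
    show "v i j \<in> p" if "j \<in> I" "i \<noteq> j" for j
      using D1[THEN conjunct2, THEN conjunct2, THEN conjunct1] that by simp
    show "(\<Sum>j\<in>I. D i j (Iop (g j) x)) \<in> LT.null" if "Poly_Mapping.keys x \<subseteq> A \<times> Lam" for x
      using D1[THEN conjunct2, THEN conjunct2, THEN conjunct2] that by simp
  qed
  then obtain e w where e: "BB e w" "w \<notin> p"
    "\<And>j x. j \<in> I \<Longrightarrow> Poly_Mapping.keys x \<subseteq> A \<times> Lam \<Longrightarrow> e (Iop (g j) x) \<in> LT.null" by blast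
  obtain w' where w': "w' \<in> A" "w * w' - 1 \<in> p" using inv_mod_p[OF BB_val[OF e(1)] e(2)] by blast
  define t where "t = frag_of (1 :: 'c, x)"
  have t: "Poly_Mapping.keys t \<subseteq> A \<times> Lam" using sA(2) x by (simp add: t_def)
  have e': "BB (\<lambda>y. e (Lop w' y)) (w * w')" by (rule BB_comp[OF e(1) BB_L[OF w'(1)]])
  define y where "y = e (Lop w' t)"
  have "Lop a y - Rop a y \<in> LT.null" if a: "a \<in> A" for a
  proof -
    obtain c where c: "\<And>i. i \<in> I \<Longrightarrow> c i \<in> adjoin_ring F u" "a = (\<Sum>i\<in>I. c i * g i)" using I(3)[OF a] by blast
    let ?t = "Lop w' t"
    have kt: "Poly_Mapping.keys ?t \<subseteq> A \<times> Lam" by (rule BB_keys[OF BB_L[OF w'(1)] t])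
    have "Lop a y - Rop a y = e (Iop a ?t)"
      using BB_commute[OF BB_I[OF a] e(1), of ?t] by (simp add: y_def Iop_def)
    moreover have "e (Iop a ?t) \<in> LT.null"
    proof -
      have "Iop a ?t - (\<Sum>i\<in>I. Lop (c i) (Iop (g i) ?t)) \<in> LT.null"
        unfolding c(2) by (rule Iop_span[OF I(1,2) c(1) kt])
      from BB_null[OF e(1) this]
      have "e (Iop a ?t) - (\<Sum>i\<in>I. e (Lop (c i) (Iop (g i) ?t))) \<in> LT.null"
        by (simp add: BB_add[OF e(1)] BB_sum[OF e(1)])
      moreover have "(\<Sum>i\<in>I. e (Lop (c i) (Iop (g i) ?t))) \<in> LT.null"
      proof (rule LT.null_sum)
        fix i assume i: "i \<in> I"
        have ci: "c i \<in> A" using c(1)[OF i] Ru_A by blast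
        show "e (Lop (c i) (Iop (g i) ?t)) \<in> LT.null"
          using Lop_commute[OF e(1) ci, of "Iop (g i) ?t"] Lop_null[OF ci e(3)[OF i kt]] by simp
      qed
      ultimately show ?thesis using LT.null_add by fastforce
    qed
    ultimately show ?thesis by simp
  qed
  moreover have "Poly_Mapping.keys y \<subseteq> A \<times> Lam" unfolding y_def by (rule BB_keys[OF e' t])
  moreover have "mu y = dd (w * w') x" unfolding y_def using mu_BB[OF e' t] by (simp add: t_def dd_1)
  moreover have "w * w' \<in> A" by (rule BB_val[OF e'])
  ultimately show ?thesis using w'(2) by blast
qed

end

section \<open>Elements algebraic over a finite field\<close>

text \<open>All powers of \<open>x\<close> stay among the combinations of
  \<open>1, x, ..., x^(d-1)\<close> over \<open>F\<close>, a finite set.\<close>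

lemma algebraic_power_repeats:
  fixes F :: "'c::field set"
  assumes F: "is_subfield F" "finite F" and x: "algebraic_over F x"
  shows "finite (range (\<lambda>i::nat. x ^ i))"
proof -
  note sF = subringD[OF subfieldD(1)[OF F(1)]]
  obtain f where f: "f \<in> polys_over F" "f \<noteq> 0" "poly f x = 0" using x by (auto simp: algebraic_over_def)
  define d where "d = degree f"
  have d: "d > 0"
  proof (rule ccontr)
    assume "\<not> d > 0"
    then have "poly f x = coeff f 0" "coeff f 0 = lead_coeff f" by (simp_all add: poly_altdef d_def)
    then show False using f by simp
  qed
  define W where "W = (\<lambda>c. \<Sum>i<d. c i * x ^ i) ` ({..<d} \<rightarrow>\<^sub>E F)"
  have Wfin: "finite W" unfolding W_def using F(2) by (intro finite_imageI finite_PiE) auto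
  have WI: "(\<Sum>i<d. c i * x ^ i) \<in> W" if "\<And>i. c i \<in> F" for c
  proof -
    have "(\<Sum>i<d. c i * x ^ i) = (\<Sum>i<d. restrict c {..<d} i * x ^ i)" by (rule sum.cong) auto
    moreover have "restrict c {..<d} \<in> {..<d} \<rightarrow>\<^sub>E F" using that by auto
    ultimately show ?thesis unfolding W_def by (rule image_eqI)
  qed
  have fF: "coeff f i \<in> F" for i using f(1) by (simp add: polys_over_def)
  have "x ^ n \<in> W" for n
  proof (induction n)
    case 0
    have "(\<Sum>i<d. (if i = 0 then 1 else 0) * x ^ i) = (\<Sum>i<d. if i = 0 then 1 else 0)"
      by (rule sum.cong) auto
    also have "\<dots> = 1" using d by simp
    finally show ?case using WI[of "\<lambda>i. if i = 0 then 1 else 0"] sF(1,2) by simp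
  next
    case (Suc n)
    then obtain c where c: "c \<in> {..<d} \<rightarrow>\<^sub>E F" "x ^ n = (\<Sum>i<d. c i * x ^ i)" by (auto simp: W_def)
    obtain e where e: "d = Suc e" using d gr0_implies_Suc by blast
    define r where "r = c e / lead_coeff f"
    have cF: "c i \<in> F" if "i < d" for i using c(1) that by auto
    have rF: "r \<in> F" unfolding r_def using cF e fF by (intro subfieldD[OF F(1)]) auto
    \<comment> \<open>Coordinates of \<open>x\<close> times the combination \<open>c\<close>: a
      shift, after which the overflowing term \<open>c e * x ^ d\<close> is rewritten by
      \<open>f(x) = 0\<close>. The value 0 beyond \<open>d\<close> makes \<open>c'\<close> a
      function into \<open>F\<close> on all indices, as \<open>WI\<close> expects.\<close>
    define c' where "c' i = (if i < d then (if i = 0 then 0 else c (i - 1)) - r * coeff f i else 0)" for i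
    have c'F: "c' i \<in> F" for i unfolding c'_def using cF rF fF sF by auto
    have fx: "(\<Sum>i<d. coeff f i * x ^ i) + lead_coeff f * x ^ d = 0"
      using f(3) by (simp add: poly_altdef d_def flip: lessThan_Suc_atMost)
    have "x ^ Suc n = (\<Sum>i<d. c i * x ^ Suc i)" by (simp add: c(2) sum_distrib_left mult_ac)
    also have "\<dots> = (\<Sum>i<e. c i * x ^ Suc i) + c e * x ^ d" by (simp add: e)
    also have "(\<Sum>i<e. c i * x ^ Suc i) = (\<Sum>i<d. (if i = 0 then 0 else c (i - 1)) * x ^ i)"
      unfolding e by (subst sum.lessThan_Suc_shift) simp
    also have "c e * x ^ d = - (r * (\<Sum>i<d. coeff f i * x ^ i))"
    proof -
      have "c e * x ^ d = r * (lead_coeff f * x ^ d)" using f(2) by (simp add: r_def)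
      also have "lead_coeff f * x ^ d = - (\<Sum>i<d. coeff f i * x ^ i)"
        using fx by (simp add: eq_neg_iff_add_eq_0 add.commute)
      finally show ?thesis by simp
    qed
    finally have "x ^ Suc n = (\<Sum>i<d. (if i = 0 then 0 else c (i - 1)) * x ^ i) - (\<Sum>i<d. r * coeff f i * x ^ i)"
      by (simp add: sum_distrib_left mult.assoc)
    also have "\<dots> = (\<Sum>i<d. c' i * x ^ i)"
      unfolding sum_subtractf[symmetric] by (rule sum.cong) (auto simp: c'_def left_diff_distrib)
    finally show ?case using WI[OF c'F] by simp
  qed
  then have "range (\<lambda>i::nat. x ^ i) \<subseteq> W" by auto
  then show ?thesis using Wfin by (rule finite_subset)
qed

lemma card_subfield_gt_1:
  fixes F :: "'c::field set"
  assumes "is_subfield F" "finite F" shows "card F > 1"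
proof -
  have "{0, 1} \<subseteq> F" using subringD(1,2)[OF subfieldD(1)[OF assms(1)]] by simp
  then have "card {0 :: 'c, 1} \<le> card F" using assms(2) by (rule card_mono[rotated])
  then show ?thesis by simp
qed

text \<open>By finiteness two Frobenius powers of \<open>x\<close> coincide, and additivity makes
  Frobenius injective, so the smaller exponent cancels. The fixed-point form is compatible with
  differences, which gives \<open>alg_elements_closed\<close>.\<close>

lemma algebraic_iff_frobenius_fixed:
  fixes F :: "'c::field set"
  assumes F: "is_subfield F" "finite F"
  shows "algebraic_over F x \<longleftrightarrow> (\<exists>n>0. x ^ (card F ^ n) = x)"
proof
  let ?q = "card F"
  note q2 = card_subfield_gt_1[OF F]
  assume "algebraic_over F x"
  then have fin: "finite (range (\<lambda>i. x ^ (?q ^ i)))"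
    by (intro finite_subset[OF _ algebraic_power_repeats[OF F, of x]]) auto
  then have "\<not> inj (\<lambda>i. x ^ (?q ^ i))" using finite_imageD infinite_UNIV_nat by blast
  then obtain i j :: nat where ij: "i < j" "x ^ (?q ^ i) = x ^ (?q ^ j)" by (metis injI linorder_neqE_nat)
  define y where "y = x ^ (?q ^ (j - i))"
  have "?q ^ j = ?q ^ (j - i) * ?q ^ i" using ij(1) by (simp flip: power_add)
  then have "y ^ (?q ^ i) = x ^ (?q ^ i)" using ij(2) by (simp add: y_def power_mult)
  moreover have "(y - x) ^ (?q ^ i) + x ^ (?q ^ i) = y ^ (?q ^ i)"
    using frobenius_pow_add[OF F, of "y - x" x i] by simp
  ultimately have "y = x" using q2 by (simp add: power_eq_0_iff)
  then show "\<exists>n>0. x ^ (?q ^ n) = x" using ij(1) unfolding y_def by (intro exI[of _ "j - i"]) auto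
next
  let ?q = "card F"
  note q2 = card_subfield_gt_1[OF F]
  assume "\<exists>n>0. x ^ (?q ^ n) = x"
  then obtain n where n: "n > 0" "x ^ (?q ^ n) = x" by blast
  have qn: "?q ^ n > 1" using one_less_power[OF q2 n(1)] .
  define f where "f = monom 1 (?q ^ n) - monom (1 :: 'c) 1"
  have "f \<in> polys_over F" unfolding f_def
    using subfieldD(1)[OF F(1)] by (intro polys_over_diff polys_over_monom subringD)
  moreover have "coeff f (?q ^ n) = 1" using qn by (simp add: f_def)
  then have "f \<noteq> 0" by auto
  moreover have "poly f x = 0" using n(2) by (simp add: f_def poly_monom)
  ultimately show "algebraic_over F x" by (auto simp: algebraic_over_def)
qed

lemma alg_elements_closed:
  fixes F :: "'c::field set"
  assumes F: "is_subfield F" "finite F"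
  shows "diff_closed (alg_elements F)" "1 \<in> alg_elements F"
    "c \<in> F \<Longrightarrow> x \<in> alg_elements F \<Longrightarrow> c * x \<in> alg_elements F"
proof -
  let ?q = "card F"
  note iff = algebraic_iff_frobenius_fixed[OF F]
  \<comment> \<open>Passing to multiples of the exponent gives two elements a common one.\<close>
  have mult: "x ^ (?q ^ (n * m)) = x" if "x ^ (?q ^ n) = x" for x :: 'c and n m
  proof (induction m)
    case (Suc m)
    have "x ^ (?q ^ (n * Suc m)) = (x ^ (?q ^ n)) ^ (?q ^ (n * m))" by (simp add: power_add power_mult)
    then show ?case using Suc that by simp
  qed simp
  have "x - y \<in> alg_elements F" if xy: "x \<in> alg_elements F" "y \<in> alg_elements F" for x y
  proof -
    obtain n m where nm: "n > 0" "x ^ (?q ^ n) = x" "m > 0" "y ^ (?q ^ m) = y"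
      using xy by (auto simp: alg_elements_def iff)
    have x': "x ^ (?q ^ (n * m)) = x" and y': "y ^ (?q ^ (n * m)) = y"
      using mult[OF nm(2), of m] mult[OF nm(4), of n] by (simp_all add: mult.commute)
    have "(x - y) ^ (?q ^ (n * m)) = x - y"
      using frobenius_pow_add[OF F, of "x - y" y "n * m"] x' y' by (simp add: algebra_simps)
    then show ?thesis using nm by (auto simp: alg_elements_def iff intro!: exI[of _ "n * m"])
  qed
  moreover have "0 ^ (?q ^ 1) = (0 :: 'c)" using card_subfield_pos[OF F] by simp
  then have "0 \<in> alg_elements F" unfolding alg_elements_def iff mem_Collect_eq by (intro exI[of _ 1]) simp
  ultimately show "diff_closed (alg_elements F)" by (simp add: diff_closed_def)
  show "1 \<in> alg_elements F" by (auto simp: alg_elements_def iff intro!: exI[of _ 1])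
  assume c: "c \<in> F" and "x \<in> alg_elements F"
  then obtain n where "n > 0" "x ^ (?q ^ n) = x" by (auto simp: alg_elements_def iff)
  then show "c * x \<in> alg_elements F"
    by (auto simp: alg_elements_def iff power_mult_distrib frobenius_pow_fixed[OF F c] intro!: exI[of _ n])
qed

section \<open>The evaluative character\<close>

locale anderson_char = anderson_prime F A L phi ex p u
  for F A L :: "'c::complete_ultrametric_field set" and phi :: "'c \<Rightarrow> ('c, 'd::finite) twisted" and ex p u +
  fixes P :: "'c residue" and z :: 'c
  assumes P: "max_ideal_above F A p P" and zp: "\<And>x. x \<in> p \<Longrightarrow> z * x \<in> A" and uz: "u * z - 1 \<in> p"
begin

sublocale GT: tensor_pair "ring_on F" "alg_on (alg_elements F)" "alg_on A"
proof (rule tensor_pair.intro)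
  show "abelian_group (alg_on (alg_elements F))"
    by (rule abelian_group_on[of "alg_elements F"]) (simp_all add: alg_elements_closed[OF F finF])
  show "abelian_group (alg_on A)" by (rule AM_abelian)
qed (use sA(6) FA alg_elements_closed[OF F finF] in auto)

abbreviation "GG \<equiv> geom_ring F A"
abbreviation "gc \<equiv> geom_const F A"
abbreviation "QQ \<equiv> GG Quot P"
abbreviation "chi \<equiv> eval_char F A P"
abbreviation "KM \<equiv> residue_module F A P"

lemma P_ideal: "ideal P GG"
  using P by (simp add: max_ideal_above_def maximalideal_def)

lemma GG_ring: "ring GG"
  using P_ideal by (simp add: ideal_def)

lemma gc_def': "gc a = GT.cls (frag_of (1, a))"
  by (simp add: geom_const_def)

lemma gc_keys: "a \<in> A \<Longrightarrow> Poly_Mapping.keys (frag_of (1 :: 'c, a)) \<subseteq> GT.pairs"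
  by (simp add: alg_elements_closed[OF F finF])

lemma gc_carrier: "a \<in> A \<Longrightarrow> gc a \<in> carrier GG"
  using GT.cls_carrier[OF gc_keys] by (simp add: gc_def' geom_ring_def tensor_ring_def)

lemma gc_add: "a \<in> A \<Longrightarrow> b \<in> A \<Longrightarrow> gc a \<oplus>\<^bsub>GG\<^esub> gc b = gc (a + b)"
proof -
  assume ab: "a \<in> A" "b \<in> A"
  have "frag_of (1, a) + frag_of (1, b) - frag_of (1 :: 'c, a + b) \<in> GT.null"
    using GT.null_minus[OF GT.rel_right[of 1 a b]] ab alg_elements_closed(2)[OF F finF] by (simp add: algebra_simps)
  then show ?thesis
    using ab GT.tensor_mult[OF gc_keys gc_keys, of a b] GT.cls_eqI
    by (simp add: gc_def' geom_ring_def tensor_ring_def)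
qed

text \<open>That the geometric ring is a ring is part of \<open>P\<close> being an ideal in it. So
  the product is known to be a single coset, and it suffices to find the representative
  \<open>(1, a * b)\<close> in it.\<close>

lemma gc_mult: "a \<in> A \<Longrightarrow> b \<in> A \<Longrightarrow> gc a \<otimes>\<^bsub>GG\<^esub> gc b = gc (a * b)"
proof -
  assume ab: "a \<in> A" "b \<in> A"
  interpret ring GG by (rule GG_ring)
  have "gc a \<otimes>\<^bsub>GG\<^esub> gc b \<in> carrier GG" using ab by (intro m_closed gc_carrier)
  then have "gc a \<otimes>\<^bsub>GG\<^esub> gc b \<in> carrier (tensor (ring_on F) (alg_on (alg_elements F)) (alg_on A))"
    by (simp add: geom_ring_def tensor_ring_def)
  moreover have "frag_of (1, a * b) \<in> gc a \<otimes>\<^bsub>GG\<^esub> gc b"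
  proof -
    let ?pr = "\<lambda>x y. frag_extend (\<lambda>(a', b'). frag_extend (\<lambda>(c, d). frag_of (a' * c, b' * d)) y) x"
    let ?S = "{?pr x y |x y. x \<in> gc a \<and> y \<in> gc b}"
    have "?pr (frag_of (1, a)) (frag_of (1, b)) \<in> ?S"
      by (rule CollectI, intro exI[of _ "frag_of (1, a)"] exI[of _ "frag_of (1, b)"])
         (simp only: gc_def' GT.cls_self simp_thms)
    then have mem: "frag_of (1, a * b) \<in> ?S" by simp
    have "gc a \<otimes>\<^bsub>GG\<^esub> gc b = (\<Union>n\<in>GT.null. \<Union>s\<in>?S. {n + s})"
      by (simp add: geom_ring_def tensor_ring_def set_mult_def tensor_free_def)
    moreover have "frag_of (1, a * b) \<in> (\<Union>n\<in>GT.null. \<Union>s\<in>?S. {n + s})"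
      by (rule UN_I[OF GT.null_0], rule UN_I[OF mem]) simp
    ultimately show ?thesis by simp
  qed
  ultimately show ?thesis unfolding gc_def'[of "a * b"] by (rule GT.tensor_carrier_cls(1))
qed

lemma gc_one: "\<one>\<^bsub>GG\<^esub> = gc 1"
  by (simp add: geom_ring_def tensor_ring_def geom_const_def)

lemma QQ_ring: "ring QQ"
  by (rule ideal.quotient_is_ring[OF P_ideal])

lemma chi_carrier: "a \<in> A \<Longrightarrow> chi a \<in> carrier QQ"
  using gc_carrier[of a] by (auto simp: eval_char_def FactRing_def A_RCOSETS_def')

lemma chi_mult: "a \<in> A \<Longrightarrow> b \<in> A \<Longrightarrow> chi a \<otimes>\<^bsub>QQ\<^esub> chi b = chi (a * b)"
  using ideal.rcoset_mult_add[OF P_ideal gc_carrier gc_carrier, of a b]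
  by (simp add: FactRing_def eval_char_def gc_mult)

lemma chi_add: "a \<in> A \<Longrightarrow> b \<in> A \<Longrightarrow> chi a \<oplus>\<^bsub>QQ\<^esub> chi b = chi (a + b)"
proof -
  interpret ideal P GG by (rule P_ideal)
  interpret abelian_subgroup P GG
    by (rule abelian_subgroupI3) (unfold_locales)
  show "a \<in> A \<Longrightarrow> b \<in> A \<Longrightarrow> chi a \<oplus>\<^bsub>QQ\<^esub> chi b = chi (a + b)"
    using a_rcos_sum[OF gc_carrier gc_carrier, of a b] by (simp add: FactRing_def eval_char_def gc_add)
qed

lemma chi_one: "\<one>\<^bsub>QQ\<^esub> = chi 1"
  by (simp add: FactRing_def eval_char_def gc_one)

lemma chi_zero_iff: "a \<in> A \<Longrightarrow> chi a = \<zero>\<^bsub>QQ\<^esub> \<longleftrightarrow> a \<in> p"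
proof -
  assume a: "a \<in> A"
  interpret ideal P GG by (rule P_ideal)
  interpret abelian_subgroup P GG
    by (rule abelian_subgroupI3) (unfold_locales)
  have "chi a = \<zero>\<^bsub>QQ\<^esub> \<longleftrightarrow> gc a \<in> P"
  proof
    assume "chi a = \<zero>\<^bsub>QQ\<^esub>"
    then show "gc a \<in> P" using a_rcos_self[OF gc_carrier[OF a]] by (simp add: FactRing_def eval_char_def)
  next
    assume "gc a \<in> P"
    then show "chi a = \<zero>\<^bsub>QQ\<^esub>" using a_rcos_const by (simp add: FactRing_def eval_char_def)
  qed
  also have "\<dots> \<longleftrightarrow> a \<in> p" using P a by (auto simp: max_ideal_above_def)
  finally show ?thesis .
qed

lemma chi_zero: "\<zero>\<^bsub>QQ\<^esub> = chi 0"
  using chi_zero_iff[OF sA(1)] pD(1) by simp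

lemma chi_eq: "a \<in> A \<Longrightarrow> b \<in> A \<Longrightarrow> chi a = chi b \<longleftrightarrow> a - b \<in> p"
proof -
  assume ab: "a \<in> A" "b \<in> A"
  interpret Q: ring QQ by (rule QQ_ring)
  have d: "a - b \<in> A" using ab by (rule sA(5))
  have "chi a = chi (a - b) \<oplus>\<^bsub>QQ\<^esub> chi b" using chi_add[OF d ab(2)] by simp
  then have "chi a = chi b \<longleftrightarrow> chi (a - b) = \<zero>\<^bsub>QQ\<^esub>"
    using Q.add.right_cancel[OF chi_carrier[OF ab(2)] chi_carrier[OF d] Q.zero_closed]
    by (simp add: chi_carrier ab)
  then show ?thesis using chi_zero_iff[OF d] by simp
qed

lemma chi_inv: assumes "a \<in> A" "b \<in> A" "a * b - 1 \<in> p" shows "inv\<^bsub>QQ\<^esub> (chi a) = chi b"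
proof -
  interpret Q: ring QQ by (rule QQ_ring)
  have "chi (a * b) = chi 1" using assms sA by (simp add: chi_eq)
  then show ?thesis
    using assms chi_mult[of a b] chi_mult[of b a]
    by (intro Q.inv_char) (simp_all add: chi_carrier chi_one mult.commute)
qed

lemma KM_simps [simp]: "carrier KM = chi ` A" "add KM = add QQ" "ring.zero KM = \<zero>\<^bsub>QQ\<^esub>"
  "module.smult KM = (\<lambda>c t. chi c \<otimes>\<^bsub>QQ\<^esub> t)"
  by (simp_all add: residue_module_def Let_def)

lemma KM_abelian: "abelian_group KM"
proof (rule abelian_groupI)
  show "\<exists>y\<in>carrier KM. y \<oplus>\<^bsub>KM\<^esub> x = \<zero>\<^bsub>KM\<^esub>" if "x \<in> carrier KM" for x
  proof -
    obtain a where a: "a \<in> A" "x = chi a" using \<open>x \<in> _\<close> by auto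
    then show ?thesis using sA(3)[OF a(1)] chi_add[of "- a" a]
      by (intro bexI[of _ "chi (- a)"]) (simp_all add: chi_zero)
  qed
qed (auto simp: chi_add chi_zero sA add_ac)

abbreviation "VV \<equiv> (coord_space :: ('c, 'c^'d) module)"

sublocale FT: tensor_V "ring_on F" KM VV
proof (intro tensor_V.intro tensor_pair.intro tensor_V_axioms.intro)
  show "abelian_group KM" by (rule KM_abelian)
  show "abelian_group VV" by (rule abelian_group_on[OF diff_closed_UNIV]) simp_all
qed (use FA chi_mult sA(6) in auto)

sublocale AT: tensor_V "ring_on F" "alg_on A" VV
proof (intro tensor_V.intro tensor_pair.intro tensor_V_axioms.intro)
  show "abelian_group (alg_on A)" by (rule AM_abelian)
  show "abelian_group VV" by (rule abelian_group_on[OF diff_closed_UNIV]) simp_all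
qed (use FA sA(6) in auto)

abbreviation fr :: "'c \<Rightarrow> 'c^'d \<Rightarrow> _" where "fr a v \<equiv> frag_of (chi a, v)"

lemma fr_left: "a \<in> A \<Longrightarrow> b \<in> A \<Longrightarrow> fr (a + b) v - (fr a v + fr b v) \<in> FT.null"
  using FT.rel_left[of "chi a" "chi b" v] by (simp add: chi_add diff_diff_eq)

lemma fr_right: "a \<in> A \<Longrightarrow> fr a (v + w) - (fr a v + fr a w) \<in> FT.null"
  using FT.rel_right[of "chi a" v w] by (simp add: diff_diff_eq)

lemma fr_smult: "a \<in> A \<Longrightarrow> c \<in> F \<Longrightarrow> fr (c * a) v - fr a (c *s v) \<in> FT.null"
  using FT.rel_smult[of c "chi a" v] FA by (auto simp: chi_mult)

lemma fr_p: "a \<in> p \<Longrightarrow> fr a v \<in> FT.null"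
  using FT.zero_left[of v] chi_zero_iff[of a] pA by auto

lemma fr_0: "a \<in> A \<Longrightarrow> fr a 0 \<in> FT.null"
  using FT.zero_right[of "chi a"] by simp

lemma fr_diff: "a \<in> A \<Longrightarrow> fr a (v - w) - (fr a v - fr a w) \<in> FT.null"
  using FT.null_minus[OF fr_right[of a "v - w" w]] by (simp add: algebra_simps)

lemma fr_sum: "finite I \<Longrightarrow> a \<in> A \<Longrightarrow> fr a (sum f I) - (\<Sum>i\<in>I. fr a (f i)) \<in> FT.null"
proof (induction I rule: finite_induct)
  case (insert i I)
  then have "fr a (f i + sum f I) - (fr a (f i) + fr a (sum f I)) \<in> FT.null" by (intro fr_right)
  moreover have "fr a (f i) + fr a (sum f I) - (fr a (f i) + (\<Sum>i\<in>I. fr a (f i))) \<in> FT.null" using insert by simp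
  ultimately show ?case using insert(1,2) FT.null_trans by simp
qed (simp add: fr_0)

text \<open>A spanning family of least size is independent, so these are lifts of an
  \<open>F\<close>-basis of \<open>A/p\<close>.\<close>

lemma span_minimal:
  "\<exists>(I :: ('c + 'c) set) g. finite I \<and> (\<forall>i\<in>I. g i \<in> A) \<and>
      (\<forall>a\<in>A. \<exists>c. (\<forall>i\<in>I. c i \<in> F) \<and> a - (\<Sum>i\<in>I. c i * g i) \<in> p) \<and>
      (\<forall>c. (\<forall>i\<in>I. c i \<in> F) \<and> (\<Sum>i\<in>I. c i * g i) \<in> p \<longrightarrow> (\<forall>i\<in>I. c i = 0))"
proof -
  define sp where "sp I g \<longleftrightarrow> finite I \<and> (\<forall>i\<in>I. g i \<in> A) \<and>
      (\<forall>a\<in>A. \<exists>c. (\<forall>i\<in>I. c i \<in> F) \<and> a - (\<Sum>i\<in>I. c i * g i) \<in> p)" for I :: "('c + 'c) set" and g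
  obtain I0 g where "sp I0 g" using span_mod_p unfolding sp_def by blast
  then obtain I where I: "sp I g" and min: "\<And>J. sp J g \<Longrightarrow> card I \<le> card J"
    using ex_has_least_nat[of "\<lambda>I. sp I g" I0 card] by blast
  have finI: "finite I" and gA: "\<And>i. i \<in> I \<Longrightarrow> g i \<in> A"
    and span: "\<And>a. a \<in> A \<Longrightarrow> \<exists>c. (\<forall>i\<in>I. c i \<in> F) \<and> a - (\<Sum>i\<in>I. c i * g i) \<in> p"
    using I unfolding sp_def by blast+
  have ind: "c k = 0" if c: "\<forall>i\<in>I. c i \<in> F" "(\<Sum>i\<in>I. c i * g i) \<in> p" and k: "k \<in> I" for c k
  proof (rule ccontr)
    assume ck: "c k \<noteq> 0"
    let ?J = "I - {k}"
    have "\<exists>d. (\<forall>i\<in>?J. d i \<in> F) \<and> a - (\<Sum>i\<in>?J. d i * g i) \<in> p" if a: "a \<in> A" for a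
    proof -
      obtain b where b: "\<forall>i\<in>I. b i \<in> F" "a - (\<Sum>i\<in>I. b i * g i) \<in> p" using span[OF a] by blast
      define r where "r = b k / c k"
      have rF: "r \<in> F" unfolding r_def using b c k by (intro subfieldD(3)[OF F]) auto
      define d where "d i = b i - r * c i" for i
      have "(\<Sum>i\<in>I. d i * g i) = (\<Sum>i\<in>I. b i * g i) - r * (\<Sum>i\<in>I. c i * g i)"
        by (simp add: d_def left_diff_distrib sum_subtractf sum_distrib_left mult.assoc)
      then have "a - (\<Sum>i\<in>I. d i * g i) = (a - (\<Sum>i\<in>I. b i * g i)) + r * (\<Sum>i\<in>I. c i * g i)" by simp
      also have "\<dots> \<in> p" using rF FA by (intro pD(4) b(2) p_mult(1) c(2)) auto
      finally have "a - (\<Sum>i\<in>I. d i * g i) \<in> p" .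
      moreover have "(\<Sum>i\<in>I. d i * g i) = (\<Sum>i\<in>?J. d i * g i)"
        using finI k ck by (simp add: sum.remove[of I k] d_def r_def)
      moreover have "\<forall>i\<in>?J. d i \<in> F" unfolding d_def using b(1) c(1) rF subringD(5,6)[OF sF] by simp
      ultimately show ?thesis by (intro exI[of _ d]) simp
    qed
    then have "sp ?J g" unfolding sp_def using finI gA by blast
    then have "card I \<le> card ?J" by (rule min)
    then show False using k finI by (metis card_Diff1_less linorder_not_le)
  qed
  show ?thesis
  proof (rule exI[of _ I], rule exI[of _ g], intro conjI allI impI ballI)
    show "finite I" by (rule finI)
    show "g i \<in> A" if "i \<in> I" for i by (rule gA[OF that])
    show "\<exists>c. (\<forall>i\<in>I. c i \<in> F) \<and> a - (\<Sum>i\<in>I. c i * g i) \<in> p" if "a \<in> A" for a by (rule span[OF that])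
    show "c i = 0" if "(\<forall>i\<in>I. c i \<in> F) \<and> (\<Sum>i\<in>I. c i * g i) \<in> p" "i \<in> I" for c i
      using that(1) by (elim conjE) (rule ind[OF _ _ that(2)])
  qed
qed

text \<open>Coordinates \<open>h i\<close> with respect to an \<open>F\<close>-basis
  \<open>g\<close> of \<open>A/p\<close> recover \<open>x\<close> as the sum of all
  \<open>g i \<otimes> h i x\<close>. Constants have absolute value at most 1, so each
  \<open>h i\<close> is bounded by the norm, and norm 0 makes every coordinate vanish.\<close>

lemma FT_definite:
  assumes "X \<in> carrier (tensor (ring_on F) KM VV)" "FT.tnorm X = 0"
  shows "X = \<one>\<^bsub>tensor (ring_on F) KM VV\<^esub>"
proof -
  obtain x where x: "Poly_Mapping.keys x \<subseteq> FT.pairs" "X = FT.cls x" using assms(1) by (rule FT.tensor_carrierE)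
  obtain I :: "('c + 'c) set" and g where I: "finite I" "\<forall>i\<in>I. g i \<in> A"
      "\<forall>a\<in>A. \<exists>c. (\<forall>i\<in>I. c i \<in> F) \<and> a - (\<Sum>i\<in>I. c i * g i) \<in> p"
      "\<forall>c. (\<forall>i\<in>I. c i \<in> F) \<and> (\<Sum>i\<in>I. c i * g i) \<in> p \<longrightarrow> (\<forall>i\<in>I. c i = 0)"
    by (insert span_minimal, elim exE conjE) (rule that)
  have "\<forall>a\<in>A. \<exists>c. (\<forall>i\<in>I. c i \<in> F) \<and> a - (\<Sum>i\<in>I. c i * g i) \<in> p" by (rule I(3))
  from bchoice[OF this] obtain co where
    co: "\<forall>a\<in>A. (\<forall>i\<in>I. co a i \<in> F) \<and> a - (\<Sum>i\<in>I. co a i * g i) \<in> p" ..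
  have coF: "co a i \<in> F" if "a \<in> A" "i \<in> I" for a i using co that by blast
  have cop: "a - (\<Sum>i\<in>I. co a i * g i) \<in> p" if "a \<in> A" for a using co that by blast
  have uniq: "co a i = d i" if a: "a \<in> A" and d: "\<And>i. i \<in> I \<Longrightarrow> d i \<in> F" "a - (\<Sum>i\<in>I. d i * g i) \<in> p" and i: "i \<in> I" for a d i
  proof -
    have "(\<Sum>i\<in>I. (co a i - d i) * g i) = (a - (\<Sum>i\<in>I. d i * g i)) - (a - (\<Sum>i\<in>I. co a i * g i))"
      by (simp add: left_diff_distrib sum_subtractf)
    then have "(\<Sum>i\<in>I. (co a i - d i) * g i) \<in> p" using pD(2)[OF d(2) cop[OF a]] by simp
    moreover have "\<forall>i\<in>I. co a i - d i \<in> F" using coF[OF a] d(1) subringD(5)[OF sF] by blast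
    ultimately have "\<forall>i\<in>I. co a i - d i = 0" using I(4)[THEN spec, of "\<lambda>i. co a i - d i"] by blast
    then show ?thesis using i by simp
  qed
  have co_add: "co (a + b) i = co a i + co b i" if ab: "a \<in> A" "b \<in> A" and i: "i \<in> I" for a b i
  proof (rule uniq[OF sA(4)[OF ab] _ _ i])
    show "co a i + co b i \<in> F" if "i \<in> I" for i using coF ab that subringD(4)[OF sF] by blast
    have "(a + b) - (\<Sum>i\<in>I. (co a i + co b i) * g i) = (a - (\<Sum>i\<in>I. co a i * g i)) + (b - (\<Sum>i\<in>I. co b i * g i))"
      by (simp add: distrib_right sum.distrib)
    then show "(a + b) - (\<Sum>i\<in>I. (co a i + co b i) * g i) \<in> p" using pD(4)[OF cop[OF ab(1)] cop[OF ab(2)]] by (simp only:)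
  qed
  have co_smult: "co (c * a) i = c * co a i" if a: "a \<in> A" and c: "c \<in> F" and i: "i \<in> I" for a c i
  proof (rule uniq[OF _ _ _ i])
    have cA: "c \<in> A" using c FA by blast
    show "c * a \<in> A" using cA a by (rule sA(6))
    show "c * co a i \<in> F" if "i \<in> I" for i using coF a c that subringD(6)[OF sF] by blast
    have "c * a - (\<Sum>i\<in>I. c * co a i * g i) = c * (a - (\<Sum>i\<in>I. co a i * g i))"
      by (simp add: right_diff_distrib sum_distrib_left mult.assoc)
    then show "c * a - (\<Sum>i\<in>I. c * co a i * g i) \<in> p" using p_mult(1)[OF cA cop[OF a]] by (simp only:)
  qed
  have co_p: "co a i = co b i" if ab: "a \<in> A" "b \<in> A" "a - b \<in> p" and i: "i \<in> I" for a b i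
  proof (rule uniq[OF ab(1) _ _ i])
    show "co b i \<in> F" if "i \<in> I" for i using coF ab that by blast
    show "a - (\<Sum>i\<in>I. co b i * g i) \<in> p" using pD(4)[OF ab(3) cop[OF ab(2)]] by simp
  qed
  \<comment> \<open>Formal sums carry residue classes, while \<open>co\<close> is defined on
    \<open>A\<close>; by \<open>co_p\<close> the chosen preimage does not matter.\<close>
  define rp where "rp t = (SOME a. a \<in> A \<and> chi a = t)" for t
  have rp: "rp (chi a) \<in> A \<and> chi (rp (chi a)) = chi a" if "a \<in> A" for a
    unfolding rp_def by (rule someI[of _ a]) (use that in simp)
  define h where "h i = fext (\<lambda>(t, v :: 'c^'d). co (rp t) i *s v)" for i
  have h_fr: "h i (fr a v) = co a i *s v" if "a \<in> A" "i \<in> I" for a i v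
  proof -
    have "co (rp (chi a)) i = co a i" using rp[OF that(1)] chi_eq that by (intro co_p) auto
    then show ?thesis by (simp add: h_def)
  qed
  have h_diff: "h i (s - t) = h i s - h i t" for i s t by (simp add: h_def fext_diff)
  have h_null: "h i s = 0" if i: "i \<in> I" and s: "s \<in> FT.null" for i s
  proof -
    have "h i s \<in> {0}"
    proof (rule FT.null_induct_balanced[OF h_diff diff_closed_zero _ _ _ s])
      fix m m' n assume "m \<in> carrier KM" "m' \<in> carrier KM"
      then obtain a b where "a \<in> A" "b \<in> A" "m = chi a" "m' = chi b" by auto
      then show "h i (frag_of (m \<oplus>\<^bsub>KM\<^esub> m', n)) - h i (frag_of (m, n)) - h i (frag_of (m', n)) \<in> {0}"
        using i sA(4) by (simp add: chi_add h_fr co_add vec.scale_left_distrib)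
    next
      fix m n n' assume "m \<in> carrier KM"
      then obtain a where "a \<in> A" "m = chi a" by auto
      then show "h i (frag_of (m, n \<oplus>\<^bsub>VV\<^esub> n')) - h i (frag_of (m, n)) - h i (frag_of (m, n')) \<in> {0}"
        using i by (simp add: h_fr vec.scale_right_distrib)
    next
      fix r m n assume r: "r \<in> carrier (ring_on F)" and "m \<in> carrier KM"
      then obtain a where a: "a \<in> A" "m = chi a" by auto
      have "r \<in> A" using r FA by auto
      then show "h i (frag_of (r \<odot>\<^bsub>KM\<^esub> m, n)) - h i (frag_of (m, r \<odot>\<^bsub>VV\<^esub> n)) \<in> {0}"
        using i r a sA(6)[of r a] by (simp add: chi_mult h_fr co_smult vector_smult_assoc mult.commute[of "co a i"])
    qed
    then show ?thesis by simp
  qed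
  have bound: "vsn (h i s) < e" if i: "i \<in> I" and s: "s \<in> FT.small e" and e: "e > 0" for i s e
  proof -
    have dc: "diff_closed {v :: 'c^'d. vsn v < e}"
      unfolding diff_closed_def
    proof (intro conjI ballI)
      show "0 \<in> {v :: 'c^'d. vsn v < e}" using e by simp
      fix v w :: "'c^'d" assume "v \<in> {v. vsn v < e}" "w \<in> {v. vsn v < e}"
      then show "v - w \<in> {v. vsn v < e}" using vsn_add[of v "- w"] by simp
    qed
    have "h i s \<in> {v. vsn v < e}"
    proof (rule FT.small_induct[OF h_diff dc _ _ s])
      show "h i x \<in> {v. vsn v < e}" if "x \<in> FT.null" for x using h_null[OF i that] e by simp
      fix m and v :: "'c^'d" assume "m \<in> carrier KM" and v: "vsn v < e"
      then obtain a where a: "a \<in> A" "m = chi a" by auto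
      have "vsn (co a i *s v) \<le> absval (co a i) * vsn v" by (rule vsn_smult)
      also have "\<dots> \<le> 1 * vsn v" using F1 coF a i by (intro mult_right_mono) auto
      finally show "h i (frag_of (m, v)) \<in> {v. vsn v < e}" using v a i by (simp add: h_fr)
    qed
    then show ?thesis by simp
  qed
  have h0: "h i x = 0" if i: "i \<in> I" for i
  proof (rule vsn_eq_0, rule order_antisym[OF dense_ge vsn_nonneg])
    fix e :: real assume "0 < e"
    then have "x \<in> FT.small e" using FT.tnorm_less_iff[OF x(1)] assms(2) x(2) by simp
    then show "vsn (h i x) \<le> e" using bound[OF i _ \<open>0 < e\<close>] by (simp add: less_imp_le)
  qed
  have combo: "fr (\<Sum>i\<in>J. c i * g i) v - (\<Sum>i\<in>J. fr (g i) (c i *s v)) \<in> FT.null"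
    if "finite J" "J \<subseteq> I" "\<And>i. i \<in> J \<Longrightarrow> c i \<in> F" for J c v
    using that
  proof (induction J rule: finite_induct)
    case empty
    show ?case using fr_p[OF pD(1)] by simp
  next
    case (insert i J)
    have gi: "g i \<in> A" "c i \<in> F" using insert I(2) by auto
    have gi': "c i * g i \<in> A" using gi FA by (intro sA(6)) auto
    have "(\<Sum>j\<in>J. c j * g j) \<in> A" using insert I(2) FA by (intro sA(8) sA(6)) auto
    then have "fr (c i * g i + (\<Sum>j\<in>J. c j * g j)) v - (fr (c i * g i) v + fr (\<Sum>j\<in>J. c j * g j) v) \<in> FT.null"
      by (rule fr_left[OF gi'])
    moreover have "fr (c i * g i) v + fr (\<Sum>j\<in>J. c j * g j) v - (fr (g i) (c i *s v) + (\<Sum>j\<in>J. fr (g j) (c j *s v))) \<in> FT.null"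
      using insert by (intro FT.null_add2 fr_smult gi) auto
    ultimately show ?case using insert(1,2) FT.null_trans by simp
  qed
  have "x - (\<Sum>i\<in>I. fr (g i) (h i x)) \<in> FT.null"
    using x(1)
  proof (rule free_Abelian_group_induct)
    show "0 - (\<Sum>i\<in>I. fr (g i) (h i 0)) \<in> FT.null"
    proof -
      have "(\<Sum>i\<in>I. fr (g i) (h i 0)) \<in> FT.null" using I(2) by (intro FT.null_sum) (simp add: h_def fr_0)
      then show ?thesis using FT.null_minus by simp
    qed
  next
    fix s t assume st: "s - (\<Sum>i\<in>I. fr (g i) (h i s)) \<in> FT.null" "t - (\<Sum>i\<in>I. fr (g i) (h i t)) \<in> FT.null"
    have "(\<Sum>i\<in>I. fr (g i) (h i s)) - (\<Sum>i\<in>I. fr (g i) (h i t)) - (\<Sum>i\<in>I. fr (g i) (h i (s - t))) \<in> FT.null"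
      unfolding h_diff sum_subtractf[symmetric]
    proof (rule FT.null_sum)
      fix i assume "i \<in> I"
      then show "fr (g i) (h i s) - fr (g i) (h i t) - fr (g i) (h i s - h i t) \<in> FT.null"
        using I(2) by (intro FT.null_sym[OF fr_diff]) simp
    qed
    with FT.null_diff2[OF st] show "s - t - (\<Sum>i\<in>I. fr (g i) (h i (s - t))) \<in> FT.null" by (rule FT.null_trans)
  next
    fix k assume "k \<in> FT.pairs"
    then obtain a v where a: "a \<in> A" "k = (chi a, v)" by auto
    have sA': "(\<Sum>i\<in>I. co a i * g i) \<in> A" using coF[OF a(1)] I(2) FA by (intro sA(8) sA(6)) auto
    have "chi a = chi (\<Sum>i\<in>I. co a i * g i)" using chi_eq[OF a(1) sA'] cop[OF a(1)] by simp
    moreover have "(\<Sum>i\<in>I. fr (g i) (h i (fr a v))) = (\<Sum>i\<in>I. fr (g i) (co a i *s v))"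
      by (rule sum.cong) (use h_fr a in auto)
    moreover have "fr (\<Sum>i\<in>I. co a i * g i) v - (\<Sum>i\<in>I. fr (g i) (co a i *s v)) \<in> FT.null"
      by (rule combo[OF I(1) order_refl]) (rule coF[OF a(1)])
    ultimately show "frag_of k - (\<Sum>i\<in>I. fr (g i) (h i (frag_of k))) \<in> FT.null"
      using a(2) by simp
  qed
  moreover have "(\<Sum>i\<in>I. fr (g i) (h i x)) \<in> FT.null"
    using h0 I(2) by (intro FT.null_sum) (simp add: fr_0)
  ultimately have "x - (\<Sum>i\<in>I. fr (g i) (h i x)) + (\<Sum>i\<in>I. fr (g i) (h i x)) \<in> FT.null" by (rule FT.null_add)
  then have "x \<in> FT.null" by simp
  then show ?thesis using x(2) FT.cls_eqI[of x 0] by (simp add: FT.tensor_one)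
qed

end

section \<open>Gauss--Thakur sums\<close>

context anderson_char
begin

definition Ui :: "'c^'d \<Rightarrow> 'c^'d" where "Ui v = matrix_inv (phi u 0) *v v"

lemma Ui_dd: "Ui (dd u v) = v" and dd_Ui: "dd u (Ui v) = v"
  using phi_invertible[OF uA u0] by (simp_all add: Ui_def matrix_vector_mul_assoc)

lemma Ui_add: "Ui (v + w) = Ui v + Ui w"
  by (simp add: Ui_def matrix_vector_right_distrib)

lemma Ui_smult: "Ui (c *s v) = c *s Ui v"
  by (simp add: Ui_def vector_scalar_commute)

lemma Ui_commute: "a \<in> A \<Longrightarrow> Ui (dd a v) = dd a (Ui v)"
  using dd_commute[OF _ uA, of a "Ui v"] Ui_dd[of "dd a (Ui v)"] by (simp add: dd_Ui)

definition ww :: 'c where "ww = u * z"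

lemma wwA: "ww \<in> A"
  using sA(4)[OF subsetD[OF pA uz] sA(2)] by (simp add: ww_def)

lemma ww1: "ww - 1 \<in> p"
  using uz by (simp add: ww_def)

text \<open>This is \<open>ex (\<partial>(c z) x)\<close>. As \<open>z\<close> lies only in
  \<open>K\<close>, the operator is spelled out as
  \<open>\<partial>u^(-1) \<partial>(c u z)\<close>, with \<open>u z\<close> in
  \<open>A\<close>.\<close>

definition ez :: "'c \<Rightarrow> 'c^'d \<Rightarrow> 'c^'d" where "ez c x = ex (Ui (dd (c * ww) x))"

lemma ez_lie: "c \<in> A \<Longrightarrow> ex (lie_action A phi (c * z) *v x) = ez c x"
proof -
  assume c: "c \<in> A"
  have "c * z = c * ww / u" using u0 by (simp add: ww_def)
  then have "lie_action A phi (c * z) = matrix_inv (phi u 0) ** phi (c * ww) 0"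
    using lie_action_eq[OF sA(6)[OF c wwA] uA u0] by simp
  then show ?thesis by (simp add: ez_def Ui_def matrix_vector_mul_assoc)
qed

lemma ez_add: "ez c (x + y) = ez c x + ez c y"
  by (simp add: ez_def dd_add Ui_add ex_add)

lemma ez_0: "ez c 0 = 0"
  using ez_add[of c 0 0] by simp

lemma ez_diff: "ez c (x - y) = ez c x - ez c y"
  using ez_add[of c "x - y" y] by simp

lemma ez_smult: "k \<in> F \<Longrightarrow> ez c (k *s x) = k *s ez c x"
  by (simp add: ez_def dd_smult Ui_smult ex_smult)

lemma ez_dd: "a \<in> A \<Longrightarrow> c \<in> A \<Longrightarrow> ez c (dd a x) = ez (c * a) x"
  using dd_mult[OF sA(6)[OF _ wwA] , of c a x] by (simp add: ez_def mult_ac)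

lemma ez_tw: "a \<in> A \<Longrightarrow> c \<in> A \<Longrightarrow> tw a (ez c x) = ez (c * a) x"
  using dd_mult[of a "c * ww" x] sA(6)[OF _ wwA, of c] Ui_commute[of a "dd (c * ww) x"]
  by (simp add: ez_def mult_ac flip: ex_dd)

lemma ez_left_diff: "c \<in> A \<Longrightarrow> d \<in> A \<Longrightarrow> ez (c - d) x = ez c x - ez d x"
proof -
  assume cd: "c \<in> A" "d \<in> A"
  have "dd (c * ww) x = dd ((c - d) * ww) x + dd (d * ww) x"
    using dd_add_left[OF sA(6)[OF sA(5)[OF cd] wwA] sA(6)[OF cd(2) wwA], of x] by (simp add: algebra_simps)
  then show ?thesis by (simp add: ez_def Ui_add ex_add)
qed

text \<open>Multiplication by \<open>z\<close> carries \<open>p\<close> into \<open>A\<close>, so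
  \<open>\<partial>(c z) x\<close> is again a period. Hence \<open>ez c x\<close> depends only on
  \<open>c\<close> modulo \<open>p\<close>.\<close>

lemma ez_p: "c \<in> p \<Longrightarrow> x \<in> Lam \<Longrightarrow> ez c x = 0"
proof -
  assume c: "c \<in> p" and x: "x \<in> Lam"
  have e: "c * ww = u * (z * c)" by (simp add: ww_def mult_ac)
  have "Ui (dd (c * ww) x) = dd (z * c) x" unfolding e dd_mult[OF uA zp[OF c]] by (rule Ui_dd)
  then show ?thesis using Lam_dd[OF zp[OF c] x] by (simp add: ez_def Lam_iff)
qed

lemma ez_cong: "c \<in> A \<Longrightarrow> d \<in> A \<Longrightarrow> c - d \<in> p \<Longrightarrow> x \<in> Lam \<Longrightarrow> ez c x = ez d x"
  using ez_left_diff[of c d x] ez_p[of "c - d" x] by simp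

text \<open>Representatives turn the sum over units of \<open>A/p\<close> into a sum over a finite
  subset of \<open>A\<close>, where \<open>phi\<close> and \<open>chi\<close> can be
  applied.\<close>

definition rep :: "'c set \<Rightarrow> 'c" where "rep X = (SOME a. a \<in> A \<and> kap a = X)"
definition CC :: "'c set" where "CC = rep ` Units kk"
definition iv :: "'c \<Rightarrow> 'c" where "iv c = (SOME b. b \<in> A \<and> c * b - 1 \<in> p)"

lemma rep_kap: "a \<in> A \<Longrightarrow> rep (kap a) \<in> A \<and> kap (rep (kap a)) = kap a"
  unfolding rep_def by (rule someI[of _ a]) simp

lemma CC_iff: "c \<in> CC \<longleftrightarrow> (\<exists>a\<in>A - p. c = rep (kap a))"
  by (simp add: CC_def Units_kk image_iff)

lemma CC_A: "c \<in> CC \<Longrightarrow> c \<in> A" "c \<in> CC \<Longrightarrow> c \<notin> p"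
proof -
  assume "c \<in> CC"
  then obtain a where a: "a \<in> A" "a \<notin> p" "c = rep (kap a)" by (auto simp: CC_iff)
  then show "c \<in> A" using rep_kap by simp
  have "c - a \<in> p" using rep_kap[OF a(1)] a(3) kap_eq by simp
  then show "c \<notin> p" using a(2) pD(2)[of c "c - a"] by auto
qed

lemma kap_bij: "bij_betw kap CC (Units kk)"
proof -
  have "kap (rep X) = X" if "X \<in> Units kk" for X
  proof -
    obtain a where "a \<in> A" "X = kap a" using \<open>X \<in> _\<close> unfolding Units_kk by blast
    then show ?thesis using rep_kap by simp
  qed
  then show ?thesis unfolding CC_def by (intro bij_betw_byWitness[of _ rep]) auto
qed

lemma finite_CC: "finite CC"
proof -
  have "Units kk \<subseteq> carrier kk" by (auto simp: Units_def)
  then show ?thesis unfolding CC_def using finite_kk finite_subset by blast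
qed

lemma card_CC: "Suc (card CC) = Q"
proof -
  interpret K: field kk by (rule kk_field)
  have "card CC = card (carrier kk - {\<zero>\<^bsub>kk\<^esub>})"
    using bij_betw_same_card[OF kap_bij] by (simp add: K.field_Units)
  moreover have "card (carrier kk) = Suc (card (carrier kk - {\<zero>\<^bsub>kk\<^esub>}))"
    by (rule card.remove[OF finite_kk K.zero_closed])
  ultimately show ?thesis unfolding Q_def by (simp only:)
qed

lemma iv_prop: assumes "c \<in> CC" shows "iv c \<in> A" "c * iv c - 1 \<in> p"
proof -
  obtain b where b: "b \<in> A \<and> c * b - 1 \<in> p" using inv_mod_p[OF CC_A(1)[OF assms] CC_A(2)[OF assms]] by blast
  have "iv c \<in> A \<and> c * iv c - 1 \<in> p" unfolding iv_def by (rule someI[of _ b]) (rule b)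
  then show "iv c \<in> A" "c * iv c - 1 \<in> p" by auto
qed

text \<open>For \<open>a\<close> outside \<open>p\<close> substitute \<open>c a\<close> for
  \<open>c\<close> in the unit group: the inverse of \<open>c a\<close> cancels \<open>a\<close> in
  the character. For \<open>a\<close> in \<open>p\<close> both sums vanish. This identity gives both
  the module property of Gauss sums and their appearance in \<open>main_gauss\<close>.\<close>

lemma gauss_shift:
  assumes a: "a \<in> A" and x: "x \<in> Lam"
  shows "(\<Sum>c\<in>CC. fr (iv c * a) (ez c x)) - (\<Sum>c\<in>CC. fr (iv c) (ez (c * a) x)) \<in> FT.null"
proof (cases "a \<in> p")
  case True
  have "fr (iv c * a) (ez c x) \<in> FT.null" if "c \<in> CC" for c
    using iv_prop[OF that] True by (intro fr_p p_mult(1))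
  moreover have "fr (iv c) (ez (c * a) x) \<in> FT.null" if "c \<in> CC" for c
    using ez_p[OF p_mult(1)[OF CC_A(1)[OF that] True] x] fr_0[OF iv_prop(1)[OF that]] by simp
  ultimately show ?thesis by (intro FT.null_diff FT.null_sum)
next
  case False
  define sg where "sg c = rep (kap (c * a))" for c
  have ca: "c * a \<in> A" "c * a \<notin> p" if "c \<in> CC" for c
    using CC_A[OF that] a False by (auto intro: sA(6) p_prime[THEN notE])
  have sgA: "sg c \<in> CC" if "c \<in> CC" for c unfolding sg_def CC_iff using ca[OF that] by blast
  have sgp: "sg c - c * a \<in> p" if "c \<in> CC" for c
    using rep_kap[OF ca(1)[OF that]] kap_eq by (simp add: sg_def)
  have "inj_on sg CC"
  proof (rule inj_onI)
    fix c d assume cd: "c \<in> CC" "d \<in> CC" "sg c = sg d"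
    have "(c - d) * a = (sg d - d * a) - (sg c - c * a)" using cd(3) by (simp add: algebra_simps)
    then have "(c - d) * a \<in> p" using pD(2)[OF sgp[OF cd(2)] sgp[OF cd(1)]] by simp
    then have "c - d \<in> p" using p_prime[of "c - d" a] CC_A(1) cd a False sA(5) by blast
    then have "kap c = kap d" by (simp add: kap_eq)
    then show "c = d" using kap_bij cd(1,2) by (auto simp: bij_betw_def inj_on_def)
  qed
  moreover have "sg ` CC = CC" using endo_inj_surj[OF finite_CC _ calculation] sgA by blast
  ultimately have bij: "bij_betw sg CC CC" by (simp add: bij_betw_def)
  have "fr (iv (sg c) * a) (ez (sg c) x) = fr (iv c) (ez (c * a) x)" if c: "c \<in> CC" for c
  proof -
    note ivc = iv_prop[OF c] and ivs = iv_prop[OF sgA[OF c]]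
    have "ez (sg c) x = ez (c * a) x" by (rule ez_cong[OF CC_A(1)[OF sgA[OF c]] ca(1)[OF c] sgp[OF c] x])
    moreover have "iv (sg c) * a - iv c \<in> p"
    proof (rule ccontr)
      assume n: "iv (sg c) * a - iv c \<notin> p"
      have dA: "iv (sg c) * a - iv c \<in> A" using ivc(1) ivs(1) a by (intro sA(5,6))
      have "c * (iv (sg c) * a - iv c) = (sg c * iv (sg c) - 1) - iv (sg c) * (sg c - c * a) - (c * iv c - 1)"
        by (simp add: algebra_simps)
      also have "\<dots> \<in> p" by (intro pD(2) p_mult(1) ivs ivc sgp[OF c])
      finally show False using p_prime[OF CC_A(1)[OF c] dA CC_A(2)[OF c] n] by blast
    qed
    then have "chi (iv (sg c) * a) = chi (iv c)" using chi_eq[OF sA(6)[OF ivs(1) a] ivc(1)] by simp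
    ultimately show ?thesis by simp
  qed
  then have "(\<Sum>c\<in>CC. fr (iv c) (ez (c * a) x)) = (\<Sum>c\<in>CC. fr (iv (sg c) * a) (ez (sg c) x))" by simp
  also have "\<dots> = (\<Sum>c\<in>CC. fr (iv c * a) (ez c x))" by (rule sum.reindex_bij_betw[OF bij])
  finally show ?thesis by simp
qed

definition gfrag :: "'c^'d \<Rightarrow> _" where "gfrag x = - (\<Sum>c\<in>CC. fr (iv c) (ez c x))"

lemma gfrag_keys: "Poly_Mapping.keys (gfrag x) \<subseteq> FT.pairs"
proof -
  have "(\<Sum>c\<in>CC. fr (iv c) (ez c x)) \<in> {s. Poly_Mapping.keys s \<subseteq> FT.pairs}"
    by (rule diff_closed_sum[OF diff_closed_keys]) (use iv_prop(1) in simp)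
  then show ?thesis by (simp add: gfrag_def)
qed

lemma gauss_map_eq:
  assumes x: "x \<in> Lam" shows "gauss_map F A p P phi ex z x = FT.cls (gfrag x)"
proof -
  let ?psi = "\<lambda>a. ex (lie_action A phi (a * z) *v x)"
  let ?f = "\<lambda>X. frag_of (inv\<^bsub>QQ\<^esub> the_elem (chi ` X), the_elem (?psi ` X))"
  have "?f (kap c) = fr (iv c) (ez c x)" if c: "c \<in> CC" for c
  proof -
    have cA: "c \<in> A" by (rule CC_A(1)[OF c])
    \<comment> \<open>\<open>the_elem\<close> requires both maps to be constant on the coset; for
      the second this uses that \<open>x\<close> is a period.\<close>
    have mem: "a \<in> A \<and> chi a = chi c \<and> ?psi a = ez c x" if "a \<in> kap c" for a
    proof -
      have ac: "a - c \<in> p" using that kap_mem by simp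
      then have aA: "a \<in> A" using sA(4)[OF subsetD[OF pA ac] cA] by simp
      then show ?thesis using ac cA chi_eq ez_lie ez_cong[OF aA cA ac x] by simp
    qed
    have cc: "c \<in> kap c" using pD(1) by (simp add: kap_mem)
    have "chi ` kap c = (\<lambda>a. chi c) ` kap c" by (rule image_cong[OF refl]) (simp only: mem)
    also have "\<dots> = {chi c}" by (rule image_constant[OF cc])
    finally have 1: "the_elem (chi ` kap c) = chi c" by (simp only: the_elem_eq)
    have "?psi ` kap c = (\<lambda>a. ez c x) ` kap c" by (rule image_cong[OF refl]) (simp only: mem)
    also have "\<dots> = {ez c x}" by (rule image_constant[OF cc])
    finally have 2: "the_elem (?psi ` kap c) = ez c x" by (simp only: the_elem_eq)
    show ?thesis unfolding 1 2 chi_inv[OF cA iv_prop[OF c]] ..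
  qed
  then have "(\<Sum>c\<in>CC. fr (iv c) (ez c x)) = (\<Sum>c\<in>CC. ?f (kap c))" by simp
  also have "\<dots> = (\<Sum>X\<in>Units kk. ?f X)" by (rule sum.reindex_bij_betw[OF kap_bij])
  finally show ?thesis unfolding gauss_map_def gauss_sum_def gfrag_def by simp
qed

lemma gfrag_add: "gfrag (x + y) - (gfrag x + gfrag y) \<in> FT.null"
proof -
  have "(\<Sum>c\<in>CC. fr (iv c) (ez c (x + y)) - (fr (iv c) (ez c x) + fr (iv c) (ez c y))) \<in> FT.null"
    unfolding ez_add by (intro FT.null_sum fr_right iv_prop)
  then have "- (\<Sum>c\<in>CC. fr (iv c) (ez c (x + y)) - (fr (iv c) (ez c x) + fr (iv c) (ez c y))) \<in> FT.null"
    by (rule FT.null_minus)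
  then show ?thesis by (simp add: gfrag_def sum_subtractf sum.distrib algebra_simps)
qed

lemma tw_null: "s \<in> FT.null \<Longrightarrow> fmap2 id (tw a) s \<in> FT.null"
proof (rule fmap2_null[OF FT.tensor_pair_axioms FT.tensor_pair_axioms])
  fix r m and n :: "'c^'d" assume "r \<in> carrier (ring_on F)" "m \<in> carrier KM"
  then show "frag_of (id (r \<odot>\<^bsub>KM\<^esub> m), tw a n) - frag_of (id m, tw a (r \<odot>\<^bsub>VV\<^esub> n)) \<in> FT.null"
    using FT.rel_smult[of r m "tw a n"] by (simp add: tw_smult)
qed (simp_all add: tw_add)

lemma chi_null: "a \<in> A \<Longrightarrow> s \<in> FT.null \<Longrightarrow> fmap2 (\<lambda>t. chi a \<otimes>\<^bsub>QQ\<^esub> t) id s \<in> FT.null"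
proof (rule fmap2_null[OF FT.tensor_pair_axioms FT.tensor_pair_axioms])
  assume a: "a \<in> A"
  show "chi a \<otimes>\<^bsub>QQ\<^esub> m \<in> carrier KM" if "m \<in> carrier KM" for m
    using that a sA(6) by (auto simp: chi_mult)
  show "chi a \<otimes>\<^bsub>QQ\<^esub> (m \<oplus>\<^bsub>KM\<^esub> m') = chi a \<otimes>\<^bsub>QQ\<^esub> m \<oplus>\<^bsub>KM\<^esub> chi a \<otimes>\<^bsub>QQ\<^esub> m'"
    if "m \<in> carrier KM" "m' \<in> carrier KM" for m m'
    using that a by (auto simp: chi_add chi_mult sA distrib_left)
  fix r m and n :: "'c^'d" assume r: "r \<in> carrier (ring_on F)" and "m \<in> carrier KM"
  then obtain b where b: "b \<in> A" "m = chi b" by auto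
  have rA: "r \<in> A" using r FA by auto
  show "frag_of (chi a \<otimes>\<^bsub>QQ\<^esub> (r \<odot>\<^bsub>KM\<^esub> m), id n) - frag_of (chi a \<otimes>\<^bsub>QQ\<^esub> m, id (r \<odot>\<^bsub>VV\<^esub> n)) \<in> FT.null"
    using fr_smult[OF sA(6)[OF a b(1)], of r n] r b a rA sA(6) by (simp add: chi_mult mult.left_commute)
qed simp_all

lemma gauss_map_tw:
  assumes a: "a \<in> A" and x: "x \<in> Lam"
  shows "gauss_map F A p P phi ex z (dd a x) = tensor_FV_map F A P id (tw a) (gauss_map F A p P phi ex z x)"
proof -
  have "fmap2 id (tw a) (gfrag x) = gfrag (dd a x)"
    using a by (simp add: gfrag_def fmap2_sum ez_tw ez_dd CC_A)
  then show ?thesis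
    using tensor_map_cls[OF FT.tensor_pair_axioms FT.tensor_pair_axioms gfrag_keys tw_null]
    by (simp add: gauss_map_eq[OF x] gauss_map_eq[OF Lam_dd[OF a x]] tensor_FV_map_def)
qed

text \<open>\<open>\<phi>_a\<close> acts on each \<open>ez c x\<close> by
  \<open>c \<mapsto> c a\<close>, and \<open>gauss_shift\<close> moves this factor to the character
  side.\<close>

lemma gauss_map_module:
  assumes x: "x \<in> Lam"
  shows "gauss_map F A p P phi ex z x \<in> gauss_module F A P phi"
proof -
  have "FT.cls (gfrag (dd a x)) = FT.cls (fmap2 (\<lambda>t. chi a \<otimes>\<^bsub>QQ\<^esub> t) id (gfrag x))" if a: "a \<in> A" for a
  proof (rule FT.cls_eqI)
    have "fmap2 (\<lambda>t. chi a \<otimes>\<^bsub>QQ\<^esub> t) id (gfrag x) = - (\<Sum>c\<in>CC. fr (iv c * a) (ez c x))"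
      unfolding gfrag_def fmap2_simps(5) fmap2_sum using a iv_prop(1) by (simp add: chi_mult mult.commute)
    moreover have "gfrag (dd a x) = - (\<Sum>c\<in>CC. fr (iv c) (ez (c * a) x))"
      using a by (simp add: gfrag_def ez_dd CC_A)
    ultimately show "gfrag (dd a x) - fmap2 (\<lambda>t. chi a \<otimes>\<^bsub>QQ\<^esub> t) id (gfrag x) \<in> FT.null"
      using gauss_shift[OF a x] by simp
  qed
  then show ?thesis
    unfolding gauss_module_def
    using gauss_map_tw[OF _ x, symmetric] gauss_map_eq[OF x] gauss_map_eq[OF Lam_dd[OF _ x]] FT.cls_carrier[OF gfrag_keys]
      tensor_map_cls[OF FT.tensor_pair_axioms FT.tensor_pair_axioms gfrag_keys chi_null]
    by (simp add: tensor_FV_def tensor_FV_map_def)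
qed

text \<open>The map \<open>m \<otimes> n \<mapsto> \<chi>(b m) \<otimes> G(n)\<close> is balanced
  over \<open>F[u]\<close> because both sides see only the constant term: \<open>\<chi>\<close>
  kills \<open>u\<close>, and \<open>G\<close> kills \<open>\<partial>u\<close> of a period.\<close>

lemma theta_null:
  assumes b: "b \<in> A" and G: "\<And>x y. G (x + y) = G x + G y" "\<And>k x. k \<in> F \<Longrightarrow> G (k *s x) = k *s G x"
      "\<And>x. x \<in> Lam \<Longrightarrow> G (dd u x) = 0" and s: "s \<in> LT.null"
  shows "fmap2 (\<lambda>a. chi (b * a)) G s \<in> FT.null"
  using s
proof (rule fmap2_null[OF LT.tensor_pair_axioms FT.tensor_pair_axioms, rotated -1])
  fix r m n assume "r \<in> carrier RR" "m \<in> carrier (alg_on A)" "n \<in> carrier LM"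
  then have rmn: "r \<in> adjoin_ring F u" "m \<in> A" "n \<in> Lam" by auto
  obtain c0 r' where r': "c0 \<in> F" "r' \<in> A" "r = c0 + u * r'" using adjoin_decomp[OF rmn(1)] by blast
  have c0A: "c0 \<in> A" using r' FA by blast
  have bm: "b * m \<in> A" using b rmn(2) by (rule sA(6))
  have rA: "r \<in> A" using rmn(1) Ru_A by blast
  have "b * (r * m) - c0 * (b * m) = (r' * (b * m)) * u" by (simp add: r'(3) algebra_simps)
  also have "\<dots> \<in> p" by (intro p_mult(1) up sA(6) r' bm)
  finally have "chi (b * (r * m)) = chi (c0 * (b * m))"
    using chi_eq[OF sA(6)[OF b sA(6)[OF rA rmn(2)]] sA(6)[OF c0A bm]] by simp
  moreover have "G (dd r n) = c0 *s G n"
  proof -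
    have "dd r n = c0 *s n + dd u (dd r' n)"
      using dd_add_left[OF c0A sA(6)[OF uA r'(2)], of n] dd_mult[OF uA r'(2), of n] dd_const[OF r'(1), of n] by (simp add: r'(3))
    then show ?thesis using G(3)[OF Lam_dd[OF r'(2) rmn(3)]] G(1,2) r'(1) by simp
  qed
  ultimately show "frag_of (chi (b * (r \<odot>\<^bsub>alg_on A\<^esub> m)), G n) - frag_of (chi (b * m), G (r \<odot>\<^bsub>LM\<^esub> n)) \<in> FT.null"
    using fr_smult[OF bm r'(1), of "G n"] by simp
qed (use b G(1) sA(6) in \<open>auto simp: distrib_left chi_add\<close>)

text \<open>Repeated addition can be moved to the vector, where it is multiplication by a number
  that is 0 in the field.\<close>

lemma card_multiple_null:
  assumes s: "Poly_Mapping.keys s \<subseteq> FT.pairs" and J: "finite J" "of_nat (card J) = (0 :: 'c)"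
  shows "(\<Sum>j\<in>J. s) \<in> FT.null"
  using s
proof (rule free_Abelian_group_induct)
  show "(\<Sum>j\<in>J. 0) \<in> FT.null" by simp
  show "(\<Sum>j\<in>J. x - y) \<in> FT.null" if "(\<Sum>j\<in>J. x) \<in> FT.null" "(\<Sum>j\<in>J. y) \<in> FT.null" for x y
    using FT.null_diff[OF that] by (simp only: sum_subtractf)
  fix k assume "k \<in> FT.pairs"
  then obtain a v where a: "a \<in> A" "k = (chi a, v)" by auto
  have "(\<Sum>j\<in>J. v) = of_nat (card J) *s v"
    by (simp add: vec_eq_iff of_nat_index)
  then have "(\<Sum>j\<in>J. v) = 0" using J(2) by simp
  then have "fr a 0 - (\<Sum>j\<in>J. fr a v) \<in> FT.null" using fr_sum[OF J(1) a(1), of "\<lambda>_. v"] by simp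
  then have "fr a 0 - (fr a 0 - (\<Sum>j\<in>J. fr a v)) \<in> FT.null" using fr_0[OF a(1)] FT.null_diff by blast
  then show "(\<Sum>j\<in>J. frag_of k) \<in> FT.null" using a(2) by simp
qed

text \<open>A diagonal tensor may be acted on by the same element of \<open>A\<close> from either
  factor. From the left this is felt by the character, from the right by the exponential.\<close>

lemma main_gauss:
  assumes y: "Poly_Mapping.keys y \<subseteq> A \<times> Lam" and diag: "\<And>a. a \<in> A \<Longrightarrow> Lop a y - Rop a y \<in> LT.null"
  shows "fmap2 chi (\<lambda>x. ex (Ui x)) y - gfrag (mu y) \<in> FT.null"
proof -
  define T where "T = fmap2 chi (ez 1) y"
  have Tkeys: "Poly_Mapping.keys T \<subseteq> FT.pairs" unfolding T_def by (rule keys_fmap2[OF y]) auto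
  \<comment> \<open>Acting with \<open>ww = u z\<close>: on the left nothing changes, as
    \<open>ww \<equiv> 1\<close>; on the right \<open>\<partial>u^(-1)\<close> becomes
    \<open>\<partial>z\<close>.\<close>
  have st1: "fmap2 chi (\<lambda>x. ex (Ui x)) y - T \<in> FT.null"
  proof -
    let ?G = "\<lambda>x. ex (Ui x)"
    have n: "fmap2 (\<lambda>a. chi (1 * a)) ?G s \<in> FT.null" if "s \<in> LT.null" for s
      using sA(2) _ _ _ that
      by (rule theta_null) (simp_all add: Ui_add ex_add Ui_smult ex_smult Ui_dd Lam_iff)
    have "fmap2 chi ?G (Lop ww y) - fmap2 chi ?G (Rop ww y) \<in> FT.null"
      using n[OF diag[OF wwA]] by simp
    moreover have "fmap2 chi ?G (Lop ww y) = fmap2 chi ?G y"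
      unfolding Lop_def fmap2_fmap2
    proof (rule fmap2_cong[OF y])
      fix a assume a: "a \<in> A"
      have "ww * a - a = a * (ww - 1)" by (simp add: algebra_simps)
      then show "chi (ww * a) = chi a" using chi_eq[OF sA(6)[OF wwA a] a] p_mult(1)[OF a ww1] by simp
    qed simp
    moreover have "fmap2 chi ?G (Rop ww y) = T"
      unfolding Rop_def fmap2_fmap2 T_def by (rule fmap2_cong[OF y]) (simp_all add: ez_def)
    ultimately show ?thesis by simp
  qed
  \<comment> \<open>The same with \<open>c\<close>, after scaling by the inverse of
    \<open>\<chi>(c)\<close>: the left action undoes the scaling, the right action turns
    \<open>ez 1\<close> into \<open>ez c\<close>.\<close>
  have st2: "T - fmap2 (\<lambda>a. chi (iv c * a)) (ez c) y \<in> FT.null" if c: "c \<in> CC" for c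
  proof -
    note ivc = iv_prop[OF c] and cA = CC_A(1)[OF c]
    have n: "fmap2 (\<lambda>a. chi (iv c * a)) (ez 1) s \<in> FT.null" if "s \<in> LT.null" for s
      using ivc(1) _ _ _ that
    proof (rule theta_null)
      show "ez 1 (dd u x) = 0" if "x \<in> Lam" for x
        using ez_dd[OF uA sA(2), of x] ez_p[OF up that] by simp
    qed (simp_all add: ez_add ez_smult)
    have "fmap2 (\<lambda>a. chi (iv c * a)) (ez 1) (Lop c y) - fmap2 (\<lambda>a. chi (iv c * a)) (ez 1) (Rop c y) \<in> FT.null"
      using n[OF diag[OF cA]] by simp
    moreover have "fmap2 (\<lambda>a. chi (iv c * a)) (ez 1) (Lop c y) = T"
      unfolding Lop_def fmap2_fmap2 T_def
    proof (rule fmap2_cong[OF y])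
      fix a assume a: "a \<in> A"
      have "iv c * (c * a) - a = a * (c * iv c - 1)" by (simp add: algebra_simps)
      then show "chi (iv c * (c * a)) = chi a"
        using chi_eq[OF sA(6)[OF ivc(1) sA(6)[OF cA a]] a] p_mult(1)[OF a ivc(2)] by simp
    qed simp
    moreover have "fmap2 (\<lambda>a. chi (iv c * a)) (ez 1) (Rop c y) = fmap2 (\<lambda>a. chi (iv c * a)) (ez c) y"
      unfolding Rop_def fmap2_fmap2 by (rule fmap2_cong[OF y]) (simp_all add: ez_dd[OF cA sA(2)])
    ultimately show ?thesis by simp
  qed
  \<comment> \<open>On \<open>a \<otimes> x\<close>, \<open>gauss_shift\<close> moves
    \<open>a\<close> next to \<open>c\<close>, and \<open>ez (c a) x = ez c (\<partial>a x)\<close>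
    produces \<open>mu\<close>.\<close>
  have st3: "(\<Sum>c\<in>CC. fmap2 (\<lambda>a. chi (iv c * a)) (ez c) y) - (\<Sum>c\<in>CC. fr (iv c) (ez c (mu y))) \<in> FT.null"
    using y
  proof (rule free_Abelian_group_induct)
    have "(\<Sum>c\<in>CC. fr (iv c) (ez c (mu 0))) \<in> FT.null"
      using iv_prop(1) by (intro FT.null_sum) (simp add: ez_0 fr_0)
    then show "(\<Sum>c\<in>CC. fmap2 (\<lambda>a. chi (iv c * a)) (ez c) 0) - (\<Sum>c\<in>CC. fr (iv c) (ez c (mu 0))) \<in> FT.null"
      using FT.null_minus by simp
  next
    fix s t :: "'c \<times> ('c^'d) \<Rightarrow>\<^sub>0 int"
    assume st: "(\<Sum>c\<in>CC. fmap2 (\<lambda>a. chi (iv c * a)) (ez c) s) - (\<Sum>c\<in>CC. fr (iv c) (ez c (mu s))) \<in> FT.null"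
      "(\<Sum>c\<in>CC. fmap2 (\<lambda>a. chi (iv c * a)) (ez c) t) - (\<Sum>c\<in>CC. fr (iv c) (ez c (mu t))) \<in> FT.null"
    have "(\<Sum>c\<in>CC. fr (iv c) (ez c (mu s))) - (\<Sum>c\<in>CC. fr (iv c) (ez c (mu t))) - (\<Sum>c\<in>CC. fr (iv c) (ez c (mu (s - t)))) \<in> FT.null"
      unfolding mu_diff ez_diff sum_subtractf[symmetric]
    proof (rule FT.null_sum)
      fix c assume "c \<in> CC"
      then show "fr (iv c) (ez c (mu s)) - fr (iv c) (ez c (mu t)) - fr (iv c) (ez c (mu s) - ez c (mu t)) \<in> FT.null"
        by (intro FT.null_sym[OF fr_diff] iv_prop)
    qed
    with FT.null_diff2[OF st]
    show "(\<Sum>c\<in>CC. fmap2 (\<lambda>a. chi (iv c * a)) (ez c) (s - t)) - (\<Sum>c\<in>CC. fr (iv c) (ez c (mu (s - t)))) \<in> FT.null"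
      unfolding fmap2_simps sum_subtractf by (rule FT.null_trans)
  next
    fix k assume "k \<in> A \<times> Lam"
    then obtain a x where k: "a \<in> A" "x \<in> Lam" "k = (a, x)" by auto
    have "(\<Sum>c\<in>CC. fr (iv c) (ez c (mu (frag_of k)))) = (\<Sum>c\<in>CC. fr (iv c) (ez (c * a) x))"
      using k CC_A by (simp add: ez_dd)
    then show "(\<Sum>c\<in>CC. fmap2 (\<lambda>a. chi (iv c * a)) (ez c) (frag_of k)) - (\<Sum>c\<in>CC. fr (iv c) (ez c (mu (frag_of k)))) \<in> FT.null"
      using gauss_shift[OF k(1,2)] k(3) by simp
  qed
  \<comment> \<open>The index 0 supplies one more copy of \<open>T\<close>, for a total of
    \<open>Q = 0\<close> in the field. So the sum of \<open>T\<close> over \<open>CC\<close> is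
    \<open>-T\<close>, which accounts for the sign in the Gauss sum.\<close>
  have "0 \<notin> CC" using CC_A(2) pD(1) by blast
  then have "T + (\<Sum>c\<in>CC. T) = (\<Sum>c\<in>insert 0 CC. T)" by (rule sum.insert[OF finite_CC, symmetric])
  also have "\<dots> \<in> FT.null"
    by (rule card_multiple_null[OF Tkeys]) (use finite_CC \<open>0 \<notin> CC\<close> card_CC Q_char in auto)
  finally have st4: "T + (\<Sum>c\<in>CC. T) \<in> FT.null" .
  have "(\<Sum>c\<in>CC. T) - (\<Sum>c\<in>CC. fmap2 (\<lambda>a. chi (iv c * a)) (ez c) y) \<in> FT.null"
    by (rule FT.null_sum2) (rule st2)
  from FT.null_trans[OF this st3]
  have "(\<Sum>c\<in>CC. T) + gfrag (mu y) \<in> FT.null" by (simp add: gfrag_def)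
  from FT.null_diff[OF st4 this] have "T - gfrag (mu y) \<in> FT.null" by simp
  with st1 show ?thesis by (rule FT.null_trans)
qed

end

section \<open>The isomorphism \<open>\<delta>\<^sub>u\<close>\<close>

context anderson_char
begin

abbreviation "TA \<equiv> tensor (ring_on F) (alg_on A) VV"
abbreviation "hcls \<equiv> \<lambda>x. null_rel TA AT.tnorm `` {\<lambda>n. AT.cls (x n)}"
abbreviation "hcauchy \<equiv> \<lambda>x. (\<lambda>n. AT.cls (x n)) \<in> cauchy_seqs TA AT.tnorm"

lemma hat_unfold: "tensor_AV F A = TA" "norm_AV A = AT.tnorm" "hat_AV F A = completion TA AT.tnorm"
  by (simp_all add: tensor_AV_def norm_AV_def hat_AV_def)

section \<open>Continuous linear maps on the completed tensor product\<close>

definition linmap :: "('c^'d \<Rightarrow> 'c^'d) \<Rightarrow> bool" where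
  "linmap g \<longleftrightarrow> (\<forall>x y. g (x + y) = g x + g y) \<and> (\<forall>c\<in>F. \<forall>x. g (c *s x) = c *s g x)"

definition contmap :: "('c^'d \<Rightarrow> 'c^'d) \<Rightarrow> bool" where
  "contmap g \<longleftrightarrow> (\<forall>e>0. \<exists>d>0. \<forall>v. vsn v < d \<longrightarrow> vsn (g v) < e)"

lemma AT_null:
  assumes b: "b \<in> A" and g: "linmap g" and s: "s \<in> AT.null"
  shows "fmap2 ((*) b) g s \<in> AT.null"
  using s
proof (rule fmap2_null[OF AT.tensor_pair_axioms AT.tensor_pair_axioms, rotated -1])
  fix r m and n :: "'c^'d" assume "r \<in> carrier (ring_on F)" "m \<in> carrier (alg_on A)"
  then show "frag_of (b * (r \<odot>\<^bsub>alg_on A\<^esub> m), g n) - frag_of (b * m, g (r \<odot>\<^bsub>VV\<^esub> n)) \<in> AT.null"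
    using AT.rel_smult[of r "b * m" "g n"] g sA(6)[OF b, of m] by (simp add: linmap_def mult.left_commute)
qed (use b g sA(6) in \<open>auto simp: linmap_def distrib_left\<close>)

text \<open>Reading the identity of the \<open>A\<close>-factor as multiplication by 1 lets
  \<open>hat_map_eq\<close> cover every \<open>hat_map\<close> that occurs.\<close>

lemma id_mult: "id = (*) (1 :: 'c)"
  by (simp add: fun_eq_iff)

lemma AT_keys: "Poly_Mapping.keys x \<subseteq> AT.pairs \<Longrightarrow> b \<in> A \<Longrightarrow> Poly_Mapping.keys (fmap2 ((*) b) g x) \<subseteq> AT.pairs"
  by (rule keys_fmap2[of x A UNIV]) (auto intro: sA(6))

lemma hat_map_eq:
  assumes b: "b \<in> A" and g: "linmap g" "contmap g"
    and x: "\<And>n. Poly_Mapping.keys (x n) \<subseteq> AT.pairs" "hcauchy x"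
  shows "hat_map F A ((*) b) g (hcls x) = hcls (\<lambda>n. fmap2 ((*) b) g (x n))"
    and "hcauchy (\<lambda>n. fmap2 ((*) b) g (x n))"
proof -
  let ?h = "tensor_map (ring_on F) (alg_on A) VV ((*) b) g"
  have hom: "?h \<in> hom TA TA"
    by (rule tensor_map_hom[OF AT.tensor_pair_axioms AT.tensor_pair_axioms])
       (use b sA(6) AT_null[OF b g(1)] in auto)
  have cont: "\<forall>e>0. \<exists>d>0. \<forall>X\<in>carrier TA. AT.tnorm X < d \<longrightarrow> AT.tnorm (?h X) < e"
    by (rule tensor_map_cont[OF AT.tensor_V_axioms AT.tensor_V_axioms])
       (use b sA(6) AT_null[OF b g(1)] g(2) in \<open>auto simp: contmap_def\<close>)
  have eq: "?h (AT.cls (x n)) = AT.cls (fmap2 ((*) b) g (x n))" for n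
    by (rule tensor_map_cls[OF AT.tensor_pair_axioms AT.tensor_pair_axioms x(1) AT_null[OF b g(1)]])
  show "hat_map F A ((*) b) g (hcls x) = hcls (\<lambda>n. fmap2 ((*) b) g (x n))"
    unfolding hat_map_def hat_unfold completion_map_seqcls[OF AT.ultra AT.ultra hom cont x(2)] eq ..
  show "hcauchy (\<lambda>n. fmap2 ((*) b) g (x n))"
    using ultra_uniform(1)[OF AT.ultra AT.ultra hom cont x(2)] unfolding eq .
qed

lemma linmap_id: "linmap id" "contmap id"
  by (auto simp: linmap_def contmap_def)

lemma contmap_bound: "C > 0 \<Longrightarrow> (\<And>v. vsn (g v) \<le> C * vsn v) \<Longrightarrow> contmap g"
  unfolding contmap_def
proof (intro allI impI)
  fix e :: real assume C: "C > 0" and b: "\<And>v. vsn (g v) \<le> C * vsn v" and e: "e > 0"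
  have "vsn (g v) < e" if "vsn v < e / C" for v
    using b[of v] that C by (simp add: field_simps)
  then show "\<exists>d>0. \<forall>v. vsn v < d \<longrightarrow> vsn (g v) < e" using C e by (intro exI[of _ "e / C"]) auto
qed

lemma linmap_dd: "linmap (\<lambda>x. dd a x)" "contmap (\<lambda>x. dd a x)"
proof -
  show "linmap (\<lambda>x. dd a x)" by (simp add: linmap_def dd_add dd_smult)
  obtain C where "C > 0" "\<And>x. vsn (dd a x) \<le> C * vsn x" using vsn_matrix_bound[of "phi a 0"] by blast
  then show "contmap (\<lambda>x. dd a x)" by (rule contmap_bound)
qed

lemma linmap_ex: "linmap ex" "contmap ex"
  by (auto simp: linmap_def contmap_def ex_add ex_smult intro: ex_continuous)

section \<open>The geometric series for the inverse of
  \<open>1 \<otimes> \<partial>u - u \<otimes> 1\<close>\<close>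

lemma Ui_pow_add: "(Ui ^^ k) (v + w) = (Ui ^^ k) v + (Ui ^^ k) w"
  by (induction k) (simp_all add: Ui_add)

lemma Ui_pow_smult: "(Ui ^^ k) (c *s v) = c *s (Ui ^^ k) v"
  by (induction k) (simp_all add: Ui_smult)

lemma linmap_Ui: "linmap (Ui ^^ k)"
  by (simp add: linmap_def Ui_pow_add Ui_pow_smult)

lemma dd_Ui_pow: "dd (u ^ k) ((Ui ^^ k) v) = v"
proof (induction k arbitrary: v)
  case (Suc k)
  have "dd (u ^ Suc k) ((Ui ^^ Suc k) v) = dd (u ^ k) (dd u (Ui ((Ui ^^ k) v)))"
    using dd_mult[OF sA(7)[OF uA] uA, of k "(Ui ^^ Suc k) v"] by (simp add: mult.commute)
  then show ?case using Suc by (simp add: dd_Ui)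
qed (simp add: dd_1)

text \<open>\<open>Ui\<close> itself may enlarge vectors, but for the \<open>N\<close> of
  \<open>power_scalar\<close> its \<open>N\<close>-th power is the scalar \<open>u^(-N)\<close>, of
  absolute value \<open>r < 1\<close>. The remaining fewer than \<open>N\<close> factors cost at
  most \<open>C ^ N\<close>.\<close>

lemma Ui_bound: "\<exists>C r N. C > 0 \<and> 0 < r \<and> r < 1 \<and> N > 0 \<and> (\<forall>k v. vsn ((Ui ^^ k) v) \<le> C * r ^ (k div N) * vsn v)"
proof -
  obtain N where N: "N > 0" "\<And>x. dd (u ^ N) x = u ^ N *s x" using power_scalar[OF uA] by blast
  have UN: "(Ui ^^ N) v = inverse (u ^ N) *s v" for v
  proof -
    have "u ^ N *s (Ui ^^ N) v = v" using dd_Ui_pow[of N v] N(2) by simp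
    then have "inverse (u ^ N) *s (u ^ N *s (Ui ^^ N) v) = inverse (u ^ N) *s v" by simp
    then show ?thesis using u0 by (simp add: vector_smult_assoc)
  qed
  obtain C1 where C1: "C1 > 0" "\<And>x. vsn (Ui x) \<le> C1 * vsn x"
    using vsn_matrix_bound[of "matrix_inv (phi u 0)"] unfolding Ui_def by blast
  define C where "C = max 1 C1"
  have C: "C \<ge> 1" "\<And>x. vsn (Ui x) \<le> C * vsn x"
  proof -
    show "C \<ge> 1" by (simp add: C_def)
    fix x :: "'c^'d" have "C1 * vsn x \<le> C * vsn x" by (intro mult_right_mono) (auto simp: C_def)
    then show "vsn (Ui x) \<le> C * vsn x" using C1(2)[of x] by linarith
  qed
  have small: "vsn ((Ui ^^ j) v) \<le> C ^ j * vsn v" for j v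
  proof (induction j)
    case (Suc j)
    have "vsn ((Ui ^^ Suc j) v) \<le> C * vsn ((Ui ^^ j) v)" using C(2) by simp
    also have "\<dots> \<le> C * (C ^ j * vsn v)" using C(1) Suc by (intro mult_left_mono) auto
    finally show ?case by (simp add: mult.assoc)
  qed simp
  define r where "r = absval (inverse (u ^ N))"
  have r: "0 < r" "r < 1"
  proof -
    have "1 < absval u ^ N" using u1 N(1) by (rule one_less_power)
    then show "0 < r" "r < 1" unfolding r_def absval_inverse absval_power by (simp_all add: inverse_less_1_iff)
  qed
  have mult: "vsn ((Ui ^^ (m * N)) v) \<le> r ^ m * vsn v" for m v
  proof (induction m)
    case (Suc m)
    have "(Ui ^^ (Suc m * N)) v = inverse (u ^ N) *s (Ui ^^ (m * N)) v"
      by (simp only: mult_Suc funpow_add o_def UN)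
    then have "vsn ((Ui ^^ (Suc m * N)) v) \<le> r * vsn ((Ui ^^ (m * N)) v)" using vsn_smult r_def by metis
    also have "\<dots> \<le> r * (r ^ m * vsn v)" using r Suc by (intro mult_left_mono) auto
    finally show ?case by (simp add: mult.assoc)
  qed simp
  have "vsn ((Ui ^^ k) v) \<le> C ^ N * r ^ (k div N) * vsn v" for k v
  proof -
    have "k = k mod N + k div N * N" by simp
    then have "(Ui ^^ k) v = (Ui ^^ (k mod N)) ((Ui ^^ (k div N * N)) v)" by (metis funpow_add o_apply)
    then have "vsn ((Ui ^^ k) v) \<le> C ^ (k mod N) * vsn ((Ui ^^ (k div N * N)) v)" using small by simp
    also have "\<dots> \<le> C ^ N * (r ^ (k div N) * vsn v)"
    proof (rule mult_mono)
      show "C ^ (k mod N) \<le> C ^ N" using C(1) N(1) by (intro power_increasing) (auto simp: less_imp_le)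
      show "0 \<le> C ^ N" using C(1) by auto
    qed (use mult in auto)
    finally show ?thesis by (simp add: mult.assoc)
  qed
  moreover have "C ^ N > 0" by (rule zero_less_power) (use C(1) in linarith)
  ultimately show ?thesis using r N(1) by (intro exI[of _ "C ^ N"] exI[of _ r] exI[of _ N]) blast
qed

text \<open>The \<open>k\<close>-th power of \<open>u \<otimes> \<partial>u^(-1)\<close>, the ratio
  of the geometric series.\<close>

definition tk :: "nat \<Rightarrow> ('c \<times> ('c^'d) \<Rightarrow>\<^sub>0 int) \<Rightarrow> ('c \<times> ('c^'d) \<Rightarrow>\<^sub>0 int)" where
  "tk k = fmap2 ((*) (u ^ k)) (Ui ^^ k)"

lemma tk_diff: "tk k (x - y) = tk k x - tk k y"
  by (simp add: tk_def)

lemma tk_0: "tk 0 x = x"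
proof -
  have "(*) (1 :: 'c) = (\<lambda>c. c)" "(Ui ^^ 0) = (\<lambda>v. v)" by (simp_all add: fun_eq_iff)
  then show ?thesis by (simp only: tk_def power_0 fmap2_id)
qed

lemma tk_tk: "tk j (tk k x) = tk (j + k) x"
proof -
  have "(*) (u ^ (j + k)) = (\<lambda>a. u ^ j * (u ^ k * a))" by (simp add: fun_eq_iff power_add)
  moreover have "Ui ^^ (j + k) = (\<lambda>v. (Ui ^^ j) ((Ui ^^ k) v))" by (simp add: funpow_add fun_eq_iff)
  ultimately show ?thesis by (simp add: tk_def fmap2_fmap2)
qed

lemma tk_small: "\<exists>C>0. \<forall>k x e. x \<in> AT.small e \<longrightarrow> tk k x \<in> AT.small (C * e)"
  and tk_tends: "x \<in> AT.small d \<Longrightarrow> e > 0 \<Longrightarrow> \<exists>N. \<forall>k\<ge>N. tk k x \<in> AT.small e"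
proof -
  obtain C r N where C: "C > 0" "0 < r" "r < 1" "N > 0" "\<And>k v. vsn ((Ui ^^ k) v) \<le> C * r ^ (k div N) * vsn v"
    using Ui_bound by blast
  have step: "tk k x \<in> AT.small e'" if "x \<in> AT.small e" "\<And>v. vsn v < e \<Longrightarrow> vsn ((Ui ^^ k) v) < e'" for k x e e'
    unfolding tk_def
    by (rule small_map[OF AT.tensor_V_axioms AT.tensor_V_axioms _ AT_null[OF sA(7)[OF uA] linmap_Ui] that(2) that(1)])
       (use sA(6)[OF sA(7)[OF uA]] in auto)
  have C1: "vsn ((Ui ^^ k) v) \<le> C * vsn v" for k v
  proof -
    have "C * r ^ (k div N) * vsn v \<le> C * 1 * vsn v"
      using C by (intro mult_right_mono mult_left_mono power_le_one) auto
    then show ?thesis using C(5)[of k v] by simp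
  qed
  show "\<exists>C>0. \<forall>k x e. x \<in> AT.small e \<longrightarrow> tk k x \<in> AT.small (C * e)"
  proof (intro exI[of _ C] conjI allI impI)
    fix k x e assume "x \<in> AT.small e"
    then show "tk k x \<in> AT.small (C * e)"
    proof (rule step)
      fix v :: "'c^'d" assume "vsn v < e"
      then have "C * vsn v < C * e" using C(1) by (rule mult_strict_left_mono)
      then show "vsn ((Ui ^^ k) v) < C * e" using C1[of k v] by linarith
    qed
  qed (rule C(1))
  assume x: "x \<in> AT.small d" and e: "e > 0"
  \<comment> \<open>Nothing says that \<open>d\<close> is positive, and the choice of
    \<open>M\<close> divides by the radius.\<close>
  define d' where "d' = max d 1"
  have x': "x \<in> AT.small d'" by (rule AT.small_mono[OF x]) (simp add: d'_def)
  have d': "d' > 0" by (simp add: d'_def)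
  have "\<exists>M. r ^ M < e / (C * d')" using C d' e by (intro real_arch_pow_inv) auto
  then obtain M where M: "r ^ M < e / (C * d')" by blast
  have "tk k x \<in> AT.small e" if k: "k \<ge> M * N" for k
    using x'
  proof (rule step)
    fix v :: "'c^'d" assume v: "vsn v < d'"
    have "k div N \<ge> M" using k C(4) by (metis div_le_mono nonzero_mult_div_cancel_right less_numeral_extra(3))
    then have "r ^ (k div N) \<le> r ^ M" using C by (intro power_decreasing) auto
    then have "C * r ^ (k div N) * vsn v \<le> C * r ^ M * d'"
      using C v by (intro mult_mono) auto
    also have "\<dots> < e" using M C d' by (simp add: field_simps)
    finally show "vsn ((Ui ^^ k) v) < e" using C(5)[of k v] by linarith
  qed
  then show "\<exists>N. \<forall>k\<ge>N. tk k x \<in> AT.small e" by blast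
qed

text \<open>Telescoping writes \<open>x\<close> as the sum of \<open>tk j (x - tk 1 x)\<close> for
  \<open>j < k\<close> plus \<open>tk k x\<close>. The sum lies in one ball, since balls are
  subgroups, and for large \<open>k\<close> so does the last term.\<close>

lemma small_of_contraction:
  assumes C: "\<And>k x e. x \<in> AT.small e \<Longrightarrow> tk k x \<in> AT.small (C * e)" "C > 0"
    and x: "Poly_Mapping.keys x \<subseteq> AT.pairs" and e: "e > 0" and d: "x - tk 1 x \<in> AT.small e"
  shows "x \<in> AT.small (C * e)"
proof -
  obtain dd where "x \<in> AT.small dd" using AT.small_exists[OF x] by blast
  then obtain k where k: "tk k x \<in> AT.small (C * e)" using tk_tends[of x dd "C * e"] C(2) e by fastforce
  have "x = (\<Sum>j<n. tk j (x - tk 1 x)) + tk n x" for n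
  proof (induction n)
    case (Suc n)
    have "tk n (x - tk 1 x) = tk n x - tk (Suc n) x" by (simp add: tk_diff tk_tk)
    then show ?case using Suc by simp
  qed (simp add: tk_0)
  moreover have "(\<Sum>j<k. tk j (x - tk 1 x)) \<in> AT.small (C * e)"
    by (rule diff_closed_sum[OF AT.small_diff_closed]) (rule C(1)[OF d])
  ultimately show ?thesis using diff_closedD(4)[OF AT.small_diff_closed _ k] by metis
qed

definition ud :: "('c \<times> ('c^'d) \<Rightarrow>\<^sub>0 int) \<Rightarrow> ('c \<times> ('c^'d) \<Rightarrow>\<^sub>0 int)" where
  "ud x = fmap2 ((*) 1) (\<lambda>v. dd u v) x - fmap2 ((*) u) id x"

lemma ud_diff: "ud (x - y) = ud x - ud y"
  by (simp add: ud_def)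

lemma ud_keys: "Poly_Mapping.keys x \<subseteq> AT.pairs \<Longrightarrow> Poly_Mapping.keys (ud x) \<subseteq> AT.pairs"
  unfolding ud_def by (intro keys_diff_subset AT_keys sA(2) uA)

lemma u_diff_eq:
  assumes x: "\<And>n. Poly_Mapping.keys (x n) \<subseteq> AT.pairs" "hcauchy x"
  shows "u_diff F A phi u (hcls x) = hcls (\<lambda>n. ud (x n))" "hcauchy (\<lambda>n. ud (x n))"
proof -
  interpret U: ultra_group TA AT.tnorm by (rule AT.ultra)
  note m1 = hat_map_eq[OF sA(2) linmap_dd(1)[of u] linmap_dd(2)[of u] x]
    and m2 = hat_map_eq[OF uA linmap_id x]
  have k1: "Poly_Mapping.keys (fmap2 ((*) 1) (\<lambda>v. dd u v) (x n)) \<subseteq> AT.pairs"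
    and k2: "Poly_Mapping.keys (fmap2 ((*) u) id (x n)) \<subseteq> AT.pairs" for n
    by (intro AT_keys x(1) sA(2) uA)+
  have "u_diff F A phi u (hcls x) = hcls (\<lambda>n. fmap2 ((*) 1) (\<lambda>v. dd u v) (x n)) \<otimes>\<^bsub>completion TA AT.tnorm\<^esub>
      inv\<^bsub>completion TA AT.tnorm\<^esub> hcls (\<lambda>n. fmap2 ((*) u) id (x n))"
    unfolding u_diff_def hat_unfold m2(1)[symmetric] m1(1)[symmetric] id_mult by simp
  also have "\<dots> = null_rel TA AT.tnorm `` {\<lambda>n. AT.cls (fmap2 ((*) 1) (\<lambda>v. dd u v) (x n)) \<otimes>\<^bsub>TA\<^esub> inv\<^bsub>TA\<^esub> AT.cls (fmap2 ((*) u) id (x n))}"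
    unfolding U.completion_inv[OF m2(2)] by (rule U.completion_mult[OF m1(2) U.cauchy_inv[OF m2(2)]])
  finally show "u_diff F A phi u (hcls x) = hcls (\<lambda>n. ud (x n))"
    unfolding AT.tensor_diff[OF k1 k2] ud_def .
  show "hcauchy (\<lambda>n. ud (x n))"
    using U.cauchy_diff[OF m1(2) m2(2)] unfolding AT.tensor_diff[OF k1 k2] ud_def .
qed

lemma hcls_eq_iff:
  assumes "\<And>n. Poly_Mapping.keys (x n) \<subseteq> AT.pairs" "\<And>n. Poly_Mapping.keys (y n) \<subseteq> AT.pairs" "hcauchy x" "hcauchy y"
  shows "hcls x = hcls y \<longleftrightarrow> (\<forall>e>0. \<exists>N. \<forall>n\<ge>N. x n - y n \<in> AT.small e)"
  unfolding ultra_group.seqcls_eq_iff[OF AT.ultra assms(3,4)] AT.tensor_diff[OF assms(1,2)]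
  by (rule AT.tnorm_tendsto_0) (intro keys_diff_subset assms)

text \<open>Composed with \<open>1 \<otimes> \<partial>u^(-1)\<close>, the operator
  \<open>ud\<close> becomes \<open>1 - tk 1\<close>, to which \<open>small_of_contraction\<close>
  applies. The definite description inside \<open>the_inv_into\<close> depends on this
  injectivity.\<close>

lemma u_diff_inj:
  assumes x: "\<And>n. Poly_Mapping.keys (x n) \<subseteq> AT.pairs" "hcauchy x"
    and y: "\<And>n. Poly_Mapping.keys (y n) \<subseteq> AT.pairs" "hcauchy y"
    and eq: "u_diff F A phi u (hcls x) = u_diff F A phi u (hcls y)"
  shows "hcls x = hcls y"
proof -
  obtain C where C: "C > 0" "\<And>k x e. x \<in> AT.small e \<Longrightarrow> tk k x \<in> AT.small (C * e)" using tk_small by blast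
  obtain C1 where C1: "C1 > 0" "\<And>x. vsn (Ui x) \<le> C1 * vsn x"
    using vsn_matrix_bound[of "matrix_inv (phi u 0)"] unfolding Ui_def by blast
  have "hcls (\<lambda>n. ud (x n)) = hcls (\<lambda>n. ud (y n))"
    using eq unfolding u_diff_eq(1)[OF x] u_diff_eq(1)[OF y] .
  then have lim: "\<forall>e>0. \<exists>N. \<forall>n\<ge>N. ud (x n) - ud (y n) \<in> AT.small e"
    using hcls_eq_iff[OF ud_keys[OF x(1)] ud_keys[OF y(1)] u_diff_eq(2)[OF x] u_diff_eq(2)[OF y]] by blast
  have "\<exists>N. \<forall>n\<ge>N. x n - y n \<in> AT.small e" if e: "e > 0" for e
  proof -
    \<comment> \<open>\<open>C1\<close> is lost in applying \<open>Ui\<close>, and \<open>C\<close>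
      in \<open>small_of_contraction\<close>.\<close>
    define e' where "e' = e / C / C1"
    have e': "e' > 0" using e C(1) C1(1) by (simp add: e'_def)
    obtain N where N: "\<forall>n\<ge>N. ud (x n) - ud (y n) \<in> AT.small e'" using lim e' by blast
    have "x n - y n \<in> AT.small e" if n: "n \<ge> N" for n
    proof -
      let ?d = "x n - y n"
      have kd: "Poly_Mapping.keys ?d \<subseteq> AT.pairs" by (intro keys_diff_subset x(1) y(1))
      have udd: "ud ?d \<in> AT.small e'" using N n by (simp add: ud_diff)
      have "fmap2 ((*) 1) (Ui ^^ 1) (ud ?d) \<in> AT.small (e / C)"
      proof (rule small_map[OF AT.tensor_V_axioms AT.tensor_V_axioms _ AT_null[OF sA(2) linmap_Ui] _ udd])
        fix v :: "'c^'d" assume "vsn v < e'"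
        then have "C1 * vsn v < C1 * e'" using C1(1) by (rule mult_strict_left_mono)
        then show "vsn ((Ui ^^ 1) v) < e / C" using C1(2)[of v] C1(1) by (simp add: e'_def)
      qed simp
      moreover have "fmap2 ((*) 1) (Ui ^^ 1) (ud ?d) = ?d - tk 1 ?d"
      proof -
        have "(\<lambda>a. 1 * (1 * a)) = (\<lambda>a :: 'c. a)" "(\<lambda>b. (Ui ^^ 1) (dd u b)) = (\<lambda>b. b)"
          "(\<lambda>a. 1 * (u * a)) = (*) (u ^ 1)" "(\<lambda>b. (Ui ^^ 1) (id b)) = (Ui ^^ 1)"
          by (simp_all add: fun_eq_iff Ui_dd)
        then show ?thesis unfolding ud_def fmap2_simps(4) fmap2_fmap2 tk_def by (simp only: fmap2_id)
      qed
      ultimately have "?d \<in> AT.small (C * (e / C))"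
        using e C(1) by (intro small_of_contraction[OF C(2,1) kd]) auto
      then show ?thesis using C(1) by simp
    qed
    then show ?thesis by blast
  qed
  then show ?thesis using hcls_eq_iff[OF x(1) y(1) x(2) y(2)] by blast
qed

text \<open>Partial sums of the expansion of
  \<open>(1 \<otimes> \<partial>u - u \<otimes> 1)^(-1)\<close> as the series of all
  \<open>u^k \<otimes> \<partial>u^(-k-1)\<close>.\<close>

definition ws :: "('c \<times> ('c^'d) \<Rightarrow>\<^sub>0 int) \<Rightarrow> nat \<Rightarrow> ('c \<times> ('c^'d) \<Rightarrow>\<^sub>0 int)" where
  "ws s n = (\<Sum>k<n. fmap2 ((*) (u ^ k)) (Ui ^^ Suc k) s)"

lemma ws_keys: assumes "Poly_Mapping.keys s \<subseteq> AT.pairs" shows "Poly_Mapping.keys (ws s n) \<subseteq> AT.pairs"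
proof -
  have "ws s n \<in> {x. Poly_Mapping.keys x \<subseteq> AT.pairs}" unfolding ws_def
    by (rule diff_closed_sum[OF diff_closed_keys]) (use AT_keys[OF assms sA(7)[OF uA]] in simp)
  then show ?thesis by simp
qed

lemma ws_ud: "ud (ws s n) = s - tk n s"
proof -
  have "ud (fmap2 ((*) (u ^ k)) (Ui ^^ Suc k) s) = tk k s - tk (Suc k) s" for k
  proof -
    have "(\<lambda>a. 1 * (u ^ k * a)) = (*) (u ^ k)" "(\<lambda>b. dd u ((Ui ^^ Suc k) b)) = Ui ^^ k"
      "(\<lambda>a. u * (u ^ k * a)) = (*) (u ^ Suc k)" "(\<lambda>b. id ((Ui ^^ Suc k) b)) = Ui ^^ Suc k"
      by (simp_all add: fun_eq_iff dd_Ui)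
    then show ?thesis unfolding ud_def fmap2_fmap2 tk_def by (simp only:)
  qed
  moreover have "ud (ws s n) = (\<Sum>k<n. ud (fmap2 ((*) (u ^ k)) (Ui ^^ Suc k) s))"
    by (simp add: ud_def ws_def fmap2_sum sum_subtractf)
  moreover have "(\<Sum>k<n. tk k s - tk (Suc k) s) = tk 0 s - tk n s" by (rule sum_lessThan_telescope')
  ultimately show ?thesis by (simp add: tk_0)
qed

text \<open>By \<open>ws_ud\<close> the operator sends the partial sums to
  \<open>s - tk n s\<close>, which tends to \<open>s\<close>.\<close>

lemma ws_inverse:
  assumes s: "Poly_Mapping.keys s \<subseteq> AT.pairs"
  shows "hcauchy (ws s)"
    and "the_inv_into (carrier (hat_AV F A)) (u_diff F A phi u)
           (to_completion (tensor_AV F A) (norm_AV A) (tensor_class (ring_on F) (alg_on A) coord_space s)) = hcls (ws s)"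
proof -
  interpret U: ultra_group TA AT.tnorm by (rule AT.ultra)
  obtain d where d: "s \<in> AT.small d" using AT.small_exists[OF s] by blast
  have Uis: "fmap2 ((*) 1) (Ui ^^ 1) x \<in> AT.small (C1 * e)"
    if "x \<in> AT.small e" "C1 > 0" "\<And>x. vsn (Ui x) \<le> C1 * vsn x" for x e C1
  proof (rule small_map[OF AT.tensor_V_axioms AT.tensor_V_axioms _ AT_null[OF sA(2) linmap_Ui] _ that(1)])
    fix v :: "'c^'d" assume "vsn v < e"
    then have "C1 * vsn v < C1 * e" using that(2) by (rule mult_strict_left_mono)
    then show "vsn ((Ui ^^ 1) v) < C1 * e" using that(3)[of v] by simp
  qed simp
  obtain C1 where C1: "C1 > 0" "\<And>x. vsn (Ui x) \<le> C1 * vsn x"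
    using vsn_matrix_bound[of "matrix_inv (phi u 0)"] unfolding Ui_def by blast
  have "\<exists>N. \<forall>m\<ge>N. \<forall>n\<ge>N. ws s m - ws s n \<in> AT.small e" if e: "e > 0" for e
  proof -
    obtain N where N: "\<And>k. k \<ge> N \<Longrightarrow> tk k s \<in> AT.small (e / C1)" using tk_tends[OF d, of "e / C1"] e C1(1) by auto
    have tm: "fmap2 ((*) (u ^ k)) (Ui ^^ Suc k) s \<in> AT.small e" if "k \<ge> N" for k
    proof -
      have "(\<lambda>a. 1 * (u ^ k * a)) = (*) (u ^ k)" "(\<lambda>b. (Ui ^^ 1) ((Ui ^^ k) b)) = Ui ^^ Suc k"
        by (simp_all add: fun_eq_iff)
      then have "fmap2 ((*) 1) (Ui ^^ 1) (tk k s) = fmap2 ((*) (u ^ k)) (Ui ^^ Suc k) s"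
        unfolding tk_def fmap2_fmap2 by (simp only:)
      then show ?thesis using Uis[OF N[OF that] C1] C1(1) by simp
    qed
    have le: "ws s m - ws s n \<in> AT.small e" if "n \<ge> N" "m \<ge> n" for m n
    proof -
      have "ws s m = ws s n + (\<Sum>k=n..<m. fmap2 ((*) (u ^ k)) (Ui ^^ Suc k) s)"
        unfolding ws_def atLeast0LessThan[symmetric]
        by (rule sum.atLeastLessThan_concat[OF zero_le that(2), symmetric])
      moreover have "(\<Sum>k=n..<m. fmap2 ((*) (u ^ k)) (Ui ^^ Suc k) s) \<in> AT.small e"
        by (rule diff_closed_sum[OF AT.small_diff_closed]) (use tm that in auto)
      ultimately show ?thesis by simp
    qed
    have "ws s m - ws s n \<in> AT.small e" if "m \<ge> N" "n \<ge> N" for m n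
    proof (cases "n \<le> m")
      case False
      then show ?thesis using diff_closedD(3)[OF AT.small_diff_closed le[of m n]] that by simp
    qed (use le that in auto)
    then show ?thesis by blast
  qed
  then show cw: "hcauchy (ws s)" using AT.cauchy_cls[of "ws s", OF ws_keys[OF s]] by blast
  have cs: "hcauchy (\<lambda>n. s)" by (rule U.cauchy_const[OF AT.cls_carrier[OF s]])
  have "hcls (\<lambda>n. ud (ws s n)) = hcls (\<lambda>n. s)"
  proof (subst hcls_eq_iff[of "\<lambda>n. ud (ws s n)" "\<lambda>n. s", OF ud_keys[OF ws_keys[OF s]] s u_diff_eq(2)[of "ws s", OF ws_keys[OF s] cw] cs], intro allI impI)
    fix e :: real assume "e > 0"
    then obtain N where "\<forall>k\<ge>N. tk k s \<in> AT.small e" using tk_tends[OF d] by blast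
    then have "\<forall>k\<ge>N. ud (ws s k) - s \<in> AT.small e"
      using diff_closedD(3)[OF AT.small_diff_closed] by (simp add: ws_ud)
    then show "\<exists>N. \<forall>n\<ge>N. ud (ws s n) - s \<in> AT.small e" by blast
  qed
  then have val: "u_diff F A phi u (hcls (ws s)) = hcls (\<lambda>n. s)" unfolding u_diff_eq(1)[of "ws s", OF ws_keys[OF s] cw] .
  have carr: "hcls (ws s) \<in> carrier (completion TA AT.tnorm)" unfolding U.completion_carrier using cw by blast
  have "(THE x. x \<in> carrier (completion TA AT.tnorm) \<and> u_diff F A phi u x = hcls (\<lambda>n. s)) = hcls (ws s)"
  proof (rule the_equality)
    show "hcls (ws s) \<in> carrier (completion TA AT.tnorm) \<and> u_diff F A phi u (hcls (ws s)) = hcls (\<lambda>n. s)"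
      using carr val by blast
    fix W assume W: "W \<in> carrier (completion TA AT.tnorm) \<and> u_diff F A phi u W = hcls (\<lambda>n. s)"
    then obtain X where X: "X \<in> cauchy_seqs TA AT.tnorm" "W = null_rel TA AT.tnorm `` {X}" unfolding U.completion_carrier by blast
    obtain x where x: "\<And>n. Poly_Mapping.keys (x n) \<subseteq> AT.pairs" "X = (\<lambda>n. AT.cls (x n))" using AT.cauchy_lift[OF X(1)] by metis
    have "hcls x = hcls (ws s)"
      by (rule u_diff_inj[of x "ws s", OF x(1) _ ws_keys[OF s] cw]) (use X x W val in simp_all)
    then show "W = hcls (ws s)" using X(2) x(2) by simp
  qed
  then show "the_inv_into (carrier (hat_AV F A)) (u_diff F A phi u)
           (to_completion (tensor_AV F A) (norm_AV A) (tensor_class (ring_on F) (alg_on A) coord_space s)) = hcls (ws s)"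
    unfolding the_inv_into_def hat_unfold to_completion_def .
qed

section \<open>Evaluation of the character on values of \<open>delta\<close>\<close>

lemma mult_map_cls: "mult_map phi (LT.cls y) = mu y"
proof -
  have c: "mu s = mu y" if "s \<in> LT.cls y" for s
    using mu_null[of "s - y"] mu_diff[of s y] that by (simp add: LT.cls_mem)
  have "mu ` LT.cls y = (\<lambda>_. mu y) ` LT.cls y" by (rule image_cong[OF refl c])
  also have "\<dots> = {mu y}" by (rule image_constant[OF LT.cls_self])
  finally have "the_elem (mu ` LT.cls y) = mu y" by (simp only: the_elem_eq)
  moreover have "mult_map phi (LT.cls y) = the_elem (mu ` LT.cls y)"
    by (simp add: mult_map_def mu_def fext_def case_prod_unfold)
  ultimately show ?thesis by simp
qed

lemma diagonal_mem:
  assumes y: "Poly_Mapping.keys y \<subseteq> A \<times> Lam" and diag: "\<And>a. a \<in> A \<Longrightarrow> Lop a y - Rop a y \<in> LT.null"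
  shows "LT.cls y \<in> diagonal_tensors F A phi ex u"
proof -
  have y': "Poly_Mapping.keys y \<subseteq> carrier (alg_on A) \<times> carrier LM" using y by simp
  have idf: "fmap2 ((*) a) id = Lop a" "fmap2 id (\<lambda>x. dd a x) = Rop a" for a
    by (simp_all add: Lop_def Rop_def id_def)
  have "tensor_map RR (alg_on A) LM ((*) a) id (LT.cls y) = tensor_map RR (alg_on A) LM id (\<lambda>x. dd a x) (LT.cls y)"
    if a: "a \<in> A" for a
  proof -
    have "tensor_map RR (alg_on A) LM ((*) a) id (LT.cls y) = LT.cls (Lop a y)"
      unfolding idf(1)[symmetric]
      by (rule tensor_map_cls[OF LT.tensor_pair_axioms LT.tensor_pair_axioms y']) (simp only: idf Lop_null[OF a])
    moreover have "tensor_map RR (alg_on A) LM id (\<lambda>x. dd a x) (LT.cls y) = LT.cls (Rop a y)"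
      unfolding idf(2)[symmetric]
      by (rule tensor_map_cls[OF LT.tensor_pair_axioms LT.tensor_pair_axioms y']) (simp only: idf Rop_null[OF a])
    ultimately show ?thesis using LT.cls_eqI[OF diag[OF a]] by simp
  qed
  then show ?thesis unfolding diagonal_tensors_def Let_def using LT.cls_carrier[OF y'] by simp
qed

lemma chi_AT_null: "s \<in> AT.null \<Longrightarrow> fmap2 chi id s \<in> FT.null"
proof (rule fmap2_null[OF AT.tensor_pair_axioms FT.tensor_pair_axioms])
  fix r m and n :: "'c^'d" assume "r \<in> carrier (ring_on F)" "m \<in> carrier (alg_on A)"
  then show "frag_of (chi (r \<odot>\<^bsub>alg_on A\<^esub> m), id n) - frag_of (chi m, id (r \<odot>\<^bsub>VV\<^esub> n)) \<in> FT.null"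
    using fr_smult[of m r n] by simp
qed (simp_all add: chi_add)

text \<open>The images of all partial sums but the empty one agree: \<open>n > 0\<close> ensures
  that the term \<open>k = 0\<close>, the only one without a factor \<open>u\<close>, is
  present.\<close>

lemma char_of_ws:
  assumes y: "Poly_Mapping.keys y \<subseteq> A \<times> Lam" and n: "n > 0"
  shows "fmap2 chi id (fmap2 ((*) 1) ex (ws y n)) - fmap2 chi (\<lambda>x. ex (Ui x)) y \<in> FT.null"
proof -
  obtain m where m: "n = Suc m" using n gr0_implies_Suc by blast
  let ?t = "\<lambda>k. fmap2 (\<lambda>a. chi (u ^ k * a)) (\<lambda>x. ex ((Ui ^^ Suc k) x)) y"
  have "fmap2 chi id (fmap2 ((*) 1) ex (ws y n)) = (\<Sum>k<n. ?t k)"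
    unfolding ws_def fmap2_sum fmap2_fmap2 by simp
  also have "\<dots> = ?t 0 + (\<Sum>k<m. ?t (Suc k))" unfolding m by (rule sum.lessThan_Suc_shift)
  finally have "fmap2 chi id (fmap2 ((*) 1) ex (ws y n)) - fmap2 chi (\<lambda>x. ex (Ui x)) y = (\<Sum>k<m. ?t (Suc k))" by simp
  also have "\<dots> \<in> FT.null"
  proof (rule FT.null_sum)
    fix k
    from y show "?t (Suc k) \<in> FT.null"
    proof (rule free_Abelian_group_induct)
      fix b assume "b \<in> A \<times> Lam"
      then obtain a x where b: "a \<in> A" "b = (a, x)" by auto
      have eq: "u ^ Suc k * a = (u ^ k * a) * u" by (simp add: mult_ac)
      have "u ^ Suc k * a \<in> p" unfolding eq by (rule p_mult(1)[OF sA(6)[OF sA(7)[OF uA] b(1)] up])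
      then show "fmap2 (\<lambda>a. chi (u ^ Suc k * a)) (\<lambda>x. ex ((Ui ^^ Suc (Suc k)) x)) (frag_of b) \<in> FT.null"
        unfolding b(2) fmap2_simps(2) by (rule fr_p)
    qed (simp_all add: FT.null_diff)
  qed
  finally show ?thesis .
qed

lemma gfrag_cong:
  assumes "s \<in> A" "s - 1 \<in> p" "x \<in> Lam" shows "gfrag (dd s x) = gfrag x"
proof -
  have "ez c (dd s x) = ez c x" if c: "c \<in> CC" for c
  proof -
    have "c * s - c = c * (s - 1)" by (simp add: algebra_simps)
    then have "c * s - c \<in> p" using p_mult(1)[OF CC_A(1)[OF c] assms(2)] by simp
    then show ?thesis using ez_dd[OF assms(1) CC_A(1)[OF c], of x] ez_cong[OF sA(6)[OF CC_A(1)[OF c] assms(1)] CC_A(1)[OF c] _ assms(3)] by simp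
  qed
  then show ?thesis by (simp add: gfrag_def)
qed

text \<open>The formula gives \<open>delta\<close> at \<open>\<partial>s x\<close> only, and
  linearity identifies that value with \<open>s\<close> times \<open>delta x\<close>. No explicit
  representative of \<open>delta x\<close> is found: since \<open>\<chi>(s) = 1\<close>, the
  character cannot tell an arbitrary one from its multiple by \<open>s\<close>.\<close>

lemma char_hat_delta:
  assumes delta: "is_delta F K A phi ex u delta"
    and x: "x \<in> Lam" "x \<in> ideal_times_lattice A phi (different F K A u) Lam"
  shows "char_hat F A P (delta x) = FT.cls (gfrag x)"
proof -
  interpret U: ultra_group TA AT.tnorm by (rule AT.ultra)
  let ?D = "ideal_times_lattice A phi (different F K A u) Lam"
  have iso: "delta \<in> iso (add_group_on ?D) ((hat_AV F A)\<lparr>carrier := special_functions F A phi\<rparr>)"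
    and lin: "\<And>a. a \<in> A \<Longrightarrow> delta (dd a x) = hat_map F A ((*) a) id (delta x)"
    and formula: "\<And>y s. y \<in> diagonal_tensors F A phi ex u \<Longrightarrow> s \<in> y \<Longrightarrow>
         delta (mult_map phi y) = hat_map F A id ex
             (the_inv_into (carrier (hat_AV F A)) (u_diff F A phi u)
               (to_completion (tensor_AV F A) (norm_AV A) (tensor_class (ring_on F) (alg_on A) coord_space s)))"
    using delta x(2) unfolding is_delta_def Let_def by blast+
  have "delta x \<in> special_functions F A phi"
    using iso x(2) by (auto simp: iso_def hom_def add_group_on_def)
  then have carr: "delta x \<in> carrier (completion TA AT.tnorm)" by (simp add: special_functions_def hat_unfold)
  obtain y s where y: "Poly_Mapping.keys y \<subseteq> A \<times> Lam" and s: "s \<in> A" "s - 1 \<in> p" and mu: "mu y = dd s x"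
    and diag: "\<And>a. a \<in> A \<Longrightarrow> Lop a y - Rop a y \<in> LT.null"
    using diagonal_exists[OF x(1)] by blast
  have ky: "Poly_Mapping.keys y \<subseteq> AT.pairs" using y by auto
  note wsk = ws_keys[OF ky] and wsc = ws_inverse(1)[OF ky]
  note exw = hat_map_eq[of 1 ex "ws y", OF sA(2) linmap_ex wsk wsc]
  \<comment> \<open>Among the lifts of the diagonal tensor the formal sum \<open>y\<close> itself is
    used, so \<open>ws y\<close> represents the inverse image.\<close>
  have d1: "delta (dd s x) = hcls (\<lambda>n. fmap2 ((*) 1) ex (ws y n))"
    using formula[OF diagonal_mem[OF y diag] LT.cls_self] exw(1)
    unfolding mult_map_cls mu ws_inverse(2)[OF ky] id_mult by simp
  show ?thesis
    unfolding char_hat_def tensor_FV_def tensor_FV_map_def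
  proof (rule completion_lift_eq[OF FT.ultra FT_definite])
    show "FT.cls (gfrag x) \<in> carrier (tensor (ring_on F) KM VV)" by (rule FT.cls_carrier[OF gfrag_keys])
    obtain X0 where "X0 \<in> cauchy_seqs TA AT.tnorm" "delta x = null_rel TA AT.tnorm `` {X0}"
      using carr unfolding U.completion_carrier by blast
    note X0 = this
    then show "delta x \<noteq> {}" using U.seqcls_self[OF X0(1)] by blast
    fix X assume "X \<in> delta x"
    then have "X \<in> null_rel TA AT.tnorm `` {X0}" using X0(2) by simp
    note X = U.seqcls_memD[OF this]
    obtain x' where x': "\<And>n. Poly_Mapping.keys (x' n) \<subseteq> AT.pairs" "X = (\<lambda>n. AT.cls (x' n))"
      using AT.cauchy_lift[OF X(2)] by metis
    have cx': "hcauchy x'" and dx: "delta x = hcls x'" using X X0(2) x'(2) by auto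
    have map: "tensor_map (ring_on F) KM VV chi id (X n) = FT.cls (fmap2 chi id (x' n))" for n
      unfolding x'(2) by (rule tensor_map_cls[OF AT.tensor_pair_axioms FT.tensor_pair_axioms x'(1) chi_AT_null])
    have kx: "Poly_Mapping.keys (fmap2 chi id (x' n)) \<subseteq> FT.pairs" for n
      by (rule keys_fmap2[OF x'(1)]) auto
    show "tensor_map (ring_on F) KM VV chi id (X n) \<in> carrier (tensor (ring_on F) KM VV)" for n
      unfolding map by (rule FT.cls_carrier[OF kx])
    note sx = hat_map_eq[of s id x', OF s(1) linmap_id x'(1) cx']
    \<comment> \<open>The arbitrary representative \<open>x'\<close> of \<open>delta x\<close>, once
      multiplied by \<open>s\<close>, is compared with the known partial sums.\<close>
    have "hcls (\<lambda>n. fmap2 ((*) s) id (x' n)) = hcls (\<lambda>n. fmap2 ((*) 1) ex (ws y n))"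
      using lin[OF s(1)] unfolding dx d1 sx(1) by simp
    then have lim: "\<forall>e>0. \<exists>N. \<forall>n\<ge>N. fmap2 ((*) s) id (x' n) - fmap2 ((*) 1) ex (ws y n) \<in> AT.small e"
      using hcls_eq_iff[of "\<lambda>n. fmap2 ((*) s) id (x' n)" "\<lambda>n. fmap2 ((*) 1) ex (ws y n)",
          OF AT_keys[OF x'(1) s(1)] AT_keys[OF wsk sA(2)] sx(2) exw(2)] by blast
    have same: "fmap2 chi id (fmap2 ((*) s) id (x' n)) = fmap2 chi id (x' n)" for n
      unfolding fmap2_fmap2
    proof (rule fmap2_cong[OF x'(1)])
      fix a assume "a \<in> carrier (alg_on A)"
      then have a: "a \<in> A" by simp
      have "s * a - a = a * (s - 1)" by (simp add: algebra_simps)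
      then show "chi (s * a) = chi a" using chi_eq[OF sA(6)[OF s(1) a] a] p_mult(1)[OF a s(2)] by simp
    qed simp
    have "\<forall>e>0. \<exists>N. \<forall>n\<ge>N. fmap2 chi id (x' n) - gfrag x \<in> FT.small e"
    proof (intro allI impI)
      fix e :: real assume "e > 0"
      then obtain N where N: "\<And>n. n \<ge> N \<Longrightarrow> fmap2 ((*) s) id (x' n) - fmap2 ((*) 1) ex (ws y n) \<in> AT.small e"
        using lim by blast
      \<comment> \<open>\<open>Suc N\<close> instead of \<open>N\<close>, because
        \<open>char_of_ws\<close> needs a positive index.\<close>
      have "fmap2 chi id (x' n) - gfrag x \<in> FT.small e" if n: "n \<ge> Suc N" for n
      proof -
        have "fmap2 chi id (fmap2 ((*) s) id (x' n) - fmap2 ((*) 1) ex (ws y n)) \<in> FT.small e"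
          by (rule small_map[OF AT.tensor_V_axioms FT.tensor_V_axioms _ chi_AT_null _ N]) (use n in auto)
        then have 1: "fmap2 chi id (x' n) - fmap2 chi id (fmap2 ((*) 1) ex (ws y n)) \<in> FT.small e"
          by (simp only: fmap2_simps(4) same)
        have "fmap2 chi id (fmap2 ((*) 1) ex (ws y n)) - gfrag (mu y) \<in> FT.null"
          by (rule FT.null_trans[OF char_of_ws[OF y] main_gauss[OF y diag]]) (use n in auto)
        then have 2: "fmap2 chi id (fmap2 ((*) 1) ex (ws y n)) - gfrag x \<in> FT.small e"
          unfolding mu gfrag_cong[OF s x(1)] by (rule FT.small_null)
        show ?thesis using diff_closedD(4)[OF FT.small_diff_closed 1 2] by simp
      qed
      then show "\<exists>N. \<forall>n\<ge>N. fmap2 chi id (x' n) - gfrag x \<in> FT.small e" by blast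
    qed
    then show "(\<lambda>n. FT.tnorm (tensor_map (ring_on F) KM VV chi id (X n) \<otimes>\<^bsub>tensor (ring_on F) KM VV\<^esub>
        inv\<^bsub>tensor (ring_on F) KM VV\<^esub> FT.cls (gfrag x))) \<longlonglongrightarrow> 0"
      unfolding map FT.tensor_diff[OF kx gfrag_keys]
      by (subst FT.tnorm_tendsto_0) (intro keys_diff_subset kx gfrag_keys)
  qed
qed

text \<open>The lattice is itself a submodule containing the generators, so it contains their hull.
  The Gauss sum lemmas apply to periods only.\<close>

lemma ideal_times_lattice_Lam:
  assumes "I \<subseteq> A" shows "ideal_times_lattice A phi I Lam \<subseteq> Lam"
  unfolding ideal_times_lattice_def
proof (rule hull_minimal)
  show "{dd a x |a x. a \<in> I \<and> x \<in> Lam} \<subseteq> Lam" using assms Lam_dd by auto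
  have gr: "group (add_group_on (UNIV :: ('c^'d) set))"
    by (rule groupI) (auto simp: add_group_on_def add.assoc intro: exI[of _ "- x" for x])
  have inv: "inv\<^bsub>add_group_on UNIV\<^esub> x = - x" for x :: "'c^'d"
    by (rule group.inv_equality[OF gr]) (simp_all add: add_group_on_def)
  have "subgroup Lam (add_group_on UNIV)"
  proof
    show "inv\<^bsub>add_group_on UNIV\<^esub> x \<in> Lam" if "x \<in> Lam" for x
      unfolding inv using diff_closedD(3)[OF Lam_diff_closed that] .
  qed (use diff_closedD[OF Lam_diff_closed] in \<open>auto simp: add_group_on_def\<close>)
  then show "subgroup Lam (add_group_on UNIV) \<and> (\<forall>a\<in>A. \<forall>x\<in>Lam. dd a x \<in> Lam)" using Lam_dd by blast
qed

end

theorem theorem5p2: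
  fixes F K Oinf A L p :: "'c::complete_ultrametric_field set"
    and phi :: "'c \<Rightarrow> ('c, 'd::finite) twisted"
    and ex :: "'c^'d \<Rightarrow> 'c^'d"
    and u z :: 'c
    and P :: "'c residue"
    and delta :: "'c^'d \<Rightarrow> ('c, 'd) hat_elem"
  assumes curve: "function_field F K" and infty: "is_place F K Oinf"
    and A_def: "A = regular_away F K Oinf"
    and C_infty: "completed_closure K Oinf"
    and L: "field (ring_on L)" "K \<subseteq> L"
    and E: "anderson_module F A L phi"
    and exp_E: "is_exponential F A phi ex"
    and p: "maximalideal p (ring_on A)"
    and u: "u \<in> A" "uniformizer A p u" "finite_separable (adjoin_field F u) K"
    and P: "max_ideal_above F A p P"
    and z: "z \<in> inverse_ideal K A p" "u * z - 1 \<in> p"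
    and delta: "is_delta F K A phi ex u delta"
    and D_def: "D = ideal_times_lattice A phi (different F K A u) (period_lattice ex)"
  shows "(\<forall>x\<in>D. char_hat F A P (delta x) = gauss_map F A p P phi ex z x) \<and>
    gauss_map F A p P phi ex z
      \<in> hom (add_group_on D) ((tensor_FV F A P)\<lparr>carrier := gauss_module F A P phi\<rparr>) \<and>
    (\<forall>a\<in>A. \<forall>x\<in>D. gauss_map F A p P phi ex z (phi a 0 *v x) =
      tensor_FV_map F A P id (twisted_app (card F) (phi a)) (gauss_map F A p P phi ex z x))"
proof -
  note FK = function_fieldD[OF curve]
  note A = regular_away_subring[OF FK(1,3,4) A_def]
  have inf: "{x\<in>K. absval x \<le> 1} = Oinf" using C_infty by (simp add: completed_closure_def)
  note gen = coordinate_ring_finite[OF curve A_def infty inf u(1,3)]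
  interpret anderson_char F A L phi ex p u P z
  proof (intro anderson_char.intro anderson_prime.intro anderson.intro anderson_prime_axioms.intro anderson_char_axioms.intro)
    show "absval c \<le> 1" if "c \<in> F" for c using that infty inf by (auto simp: is_place_def)
    show "z * x \<in> A" if "x \<in> p" for x using z(1) that by (simp add: inverse_ideal_def)
    show "\<exists>(I :: ('c + 'c) set) g. finite I \<and> (\<forall>i\<in>I. g i \<in> A) \<and>
      (\<forall>a\<in>A. \<exists>c. (\<forall>i\<in>I. c i \<in> adjoin_ring F u) \<and> a = (\<Sum>i\<in>I. c i * g i))" by (rule gen(2))
  qed (fact FK(1) FK(2) A(1) A(2) E exp_E p u(2) u(1) gen(1) P z(2))+
  \<comment> \<open>The different consists of elements of \<open>A\<close> by definition.\<close>
  have DL: "D \<subseteq> Lam" unfolding D_def by (rule ideal_times_lattice_Lam) (auto simp: different_def)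
  have "gauss_map F A p P phi ex z (x + y) = gauss_map F A p P phi ex z x \<otimes>\<^bsub>tensor_FV F A P\<^esub> gauss_map F A p P phi ex z y"
    if "x \<in> D" "y \<in> D" for x y
  proof -
    have xy: "x \<in> Lam" "y \<in> Lam" "x + y \<in> Lam"
      using that DL diff_closedD(4)[OF Lam_diff_closed, of x y] by auto
    show ?thesis
      unfolding gauss_map_eq[OF xy(1)] gauss_map_eq[OF xy(2)] gauss_map_eq[OF xy(3)] tensor_FV_def
        FT.tensor_mult[OF gfrag_keys gfrag_keys]
      by (rule FT.cls_eqI[OF gfrag_add])
  qed
  then have "gauss_map F A p P phi ex z
      \<in> hom (add_group_on D) ((tensor_FV F A P)\<lparr>carrier := gauss_module F A P phi\<rparr>)"
    using DL gauss_map_module by (intro homI) (auto simp: add_group_on_def)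
  moreover have "char_hat F A P (delta x) = gauss_map F A p P phi ex z x" if x: "x \<in> D" for x
    using char_hat_delta[OF delta subsetD[OF DL x] x[unfolded D_def]] gauss_map_eq[OF subsetD[OF DL x]] by simp
  moreover have "gauss_map F A p P phi ex z (phi a 0 *v x) =
      tensor_FV_map F A P id (twisted_app (card F) (phi a)) (gauss_map F A p P phi ex z x)" if "a \<in> A" "x \<in> D" for a x
    by (rule gauss_map_tw[OF that(1) subsetD[OF DL that(2)]])
  ultimately show ?thesis by blast
qed

end
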